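(* Assume $\frac{k_1}{\rho_1}=\frac{k_2}{\rho_2}$ and $k_1=k_3$. Then the semigroup $(e^{t\mathcal A})_{t\ge0}$ is exponentially stable: there exist constants $M\ge1$ and $\epsilon>0$ such that for all $U_0\in\mathcal H$ and $t\ge0$, $$\|e^{t\mathcal A}U_0\|_{\mathcal H}\le Me^{-\epsilon t}\|U_0\|_{\mathcal H}.$$ Equivalently, $i\mathbb R\subset\rho(\mathcal A)$ and $\sup_{\lambda\in\mathbb R}\|(i\lambda I-\mathcal A)^{-1}\|_{\mathcal L(\mathcal H)}<\infty$.
   Context: Let $\rho_1,\rho_2,k_1,k_2,k_3,l,L$ be positive real numbers, $0<\beta<L$, $a_0>0$, and $a(x)=a_0$ for $x\in(0,\beta)$, $a(x)=0$ for $x\in(\beta,L)$. Let $\mathcal H=(H^1_0(0,L)\times L^2(0,L))^3$ with inner product, for $U=(v^1,\dots,v^6)$, $\tilde U=(\tilde v^1,\dots,\tilde v^6)$, $$(U,\tilde U)_{\mathcal H}=\int_0^L\Big(k_1(v^1_x+v^3+lv^5)\overline{(\tilde v^1_x+\tilde v^3+l\tilde v^5)}+\rho_1v^2\overline{\tilde v^2}+k_2v^3_x\overline{\tilde v^3_x}+\rho_2v^4\overline{\tilde v^4}+k_3(v^5_x-lv^1)\overline{(\tilde v^5_x-l\tilde v^1)}+\rho_1v^6\overline{\tilde v^6}\Big)dx.$$ Let $D(\mathcal A)=[(H^2(0,L)\cap H^1_0(0,L))\times H^1_0(0,L)]^3$ and $$\mathcal A(v^1,\dots,v^6)^\top=\Big(v^2,\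 \tfrac{k_1}{\rho_1}(v^1_x+v^3+lv^5)_x+\tfrac{lk_3}{\rho_1}(v^5_x-lv^1),\ v^4,\ \tfrac{k_2}{\rho_2}v^3_{xx}-\tfrac{k_1}{\rho_2}(v^1_x+v^3+lv^5),\ v^6,\ \tfrac{k_3}{\rho_1}(v^5_x-lv^1)_x-\tfrac{lk_1}{\rho_1}(v^1_x+v^3+lv^5)-\tfrac{a(x)}{\rho_1}v^6\Big)^\top.$$ $\mathcal A$ generates a $C_0$-semigroup of contractions $e^{t\mathcal A}$ on $\mathcal H$ (solving the damped Bresse system with Dirichlet conditions, $U=(\varphi,\varphi_t,\psi,\psi_t,w,w_t)$). *)

theory Defs
  imports "HOL-Analysis.Analysis"
begin

text \<open>Concrete model of the spaces on the interval (0,L).  Elements of L2, H1 etc. are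
represented by functions real => complex (representatives); the inner-product norm on
the energy space is a seminorm on representatives, and all identities between states
are stated modulo that seminorm (i.e. almost everywhere).\<close>

definition L2 :: "real \<Rightarrow> (real \<Rightarrow> complex) \<Rightarrow> bool" where
  "L2 L f \<longleftrightarrow> set_borel_measurable lborel {0..L} f \<and>
     set_integrable lborel {0..L} (\<lambda>x. (cmod (f x))\<^sup>2)"

definition H1 :: "real \<Rightarrow> (real \<Rightarrow> complex) \<Rightarrow> bool" where
  "H1 L f \<longleftrightarrow> (\<exists>g. L2 L g \<and> (\<forall>x\<in>{0..L}. f x = f 0 + (LINT t:{0..x}|lborel. g t)))"

definition H10 :: "real \<Rightarrow> (real \<Rightarrow> complex) \<Rightarrow> bool" where
  "H10 L f \<longleftrightarrow> H1 L f \<and> f 0 = 0 \<and> f L = 0"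

definition H2 :: "real \<Rightarrow> (real \<Rightarrow> complex) \<Rightarrow> bool" where
  "H2 L f \<longleftrightarrow> (\<exists>g h. L2 L h \<and> (\<forall>x\<in>{0..L}. f x = f 0 + (LINT t:{0..x}|lborel. g t))
                     \<and> (\<forall>x\<in>{0..L}. g x = g 0 + (LINT t:{0..x}|lborel. h t)))"

text \<open>Weak first derivative (unique almost everywhere).\<close>
definition dx :: "real \<Rightarrow> (real \<Rightarrow> complex) \<Rightarrow> real \<Rightarrow> complex" where
  "dx L f = (SOME g. L2 L g \<and> (\<forall>x\<in>{0..L}. f x = f 0 + (LINT t:{0..x}|lborel. g t)))"

text \<open>Weak second derivative (unique almost everywhere).\<close>
definition dxx :: "real \<Rightarrow> (real \<Rightarrow> complex) \<Rightarrow> real \<Rightarrow> complex" where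
  "dxx L f = (SOME h. L2 L h \<and> (\<exists>g. (\<forall>x\<in>{0..L}. f x = f 0 + (LINT t:{0..x}|lborel. g t))
                     \<and> (\<forall>x\<in>{0..L}. g x = g 0 + (LINT t:{0..x}|lborel. h t))))"

text \<open>States U = (v1,...,v6) are indexed by 1..6.\<close>
type_synonym state = "nat \<Rightarrow> real \<Rightarrow> complex"

definition inH :: "real \<Rightarrow> state \<Rightarrow> bool" where
  "inH L U \<longleftrightarrow> H10 L (U 1) \<and> L2 L (U 2) \<and> H10 L (U 3) \<and> L2 L (U 4) \<and> H10 L (U 5) \<and> L2 L (U 6)
     \<and> (\<forall>i. i \<notin> {1..6} \<longrightarrow> U i = (\<lambda>_. 0))"

definition domA :: "real \<Rightarrow> state \<Rightarrow> bool" where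
  "domA L U \<longleftrightarrow> H2 L (U 1) \<and> H10 L (U 1) \<and> H10 L (U 2) \<and> H2 L (U 3) \<and> H10 L (U 3) \<and> H10 L (U 4)
     \<and> H2 L (U 5) \<and> H10 L (U 5) \<and> H10 L (U 6) \<and> (\<forall>i. i \<notin> {1..6} \<longrightarrow> U i = (\<lambda>_. 0))"

definition Hnorm :: "real \<Rightarrow> real \<Rightarrow> real \<Rightarrow> real \<Rightarrow> real \<Rightarrow> real \<Rightarrow> real \<Rightarrow> state \<Rightarrow> real" where
  "Hnorm \<rho>1 \<rho>2 k1 k2 k3 l L U = sqrt (LINT x:{0..L}|lborel.
      k1 * (cmod (dx L (U 1) x + U 3 x + of_real l * U 5 x))\<^sup>2 + \<rho>1 * (cmod (U 2 x))\<^sup>2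
    + k2 * (cmod (dx L (U 3) x))\<^sup>2 + \<rho>2 * (cmod (U 4 x))\<^sup>2
    + k3 * (cmod (dx L (U 5) x - of_real l * U 1 x))\<^sup>2 + \<rho>1 * (cmod (U 6 x))\<^sup>2)"

text \<open>Damping coefficient a(x) = a0 on (0,beta), 0 on (beta,L) (value at beta irrelevant).\<close>
definition damp :: "real \<Rightarrow> real \<Rightarrow> real \<Rightarrow> real" where
  "damp a0 \<beta> x = (if x < \<beta> then a0 else 0)"

text \<open>The operator A; (v1_x + v3 + l v5)_x is written out as v1_xx + v3_x + l v5_x, etc.\<close>
definition opA :: "real \<Rightarrow> real \<Rightarrow> real \<Rightarrow> real \<Rightarrow> real \<Rightarrow> real \<Rightarrow> real \<Rightarrow> real \<Rightarrow> real \<Rightarrow> state \<Rightarrow> state" where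
  "opA \<rho>1 \<rho>2 k1 k2 k3 l L a0 \<beta> U = (\<lambda>i.
     if i = 1 then U 2
     else if i = 2 then (\<lambda>x. of_real (k1/\<rho>1) * (dxx L (U 1) x + dx L (U 3) x + of_real l * dx L (U 5) x)
                          + of_real (l*k3/\<rho>1) * (dx L (U 5) x - of_real l * U 1 x))
     else if i = 3 then U 4
     else if i = 4 then (\<lambda>x. of_real (k2/\<rho>2) * dxx L (U 3) x
                          - of_real (k1/\<rho>2) * (dx L (U 1) x + U 3 x + of_real l * U 5 x))
     else if i = 5 then U 6
     else if i = 6 then (\<lambda>x. of_real (k3/\<rho>1) * (dxx L (U 5) x - of_real l * dx L (U 1) x)
                          - of_real (l*k1/\<rho>1) * (dx L (U 1) x + U 3 x + of_real l * U 5 x)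
                          - of_real (damp a0 \<beta> x / \<rho>1) * U 6 x)
     else (\<lambda>_. 0))"

definition sadd :: "state \<Rightarrow> state \<Rightarrow> state" where
  "sadd U V = (\<lambda>i x. U i x + V i x)"

definition sdiff :: "state \<Rightarrow> state \<Rightarrow> state" where
  "sdiff U V = (\<lambda>i x. U i x - V i x)"

definition sscale :: "complex \<Rightarrow> state \<Rightarrow> state" where
  "sscale c U = (\<lambda>i x. c * U i x)"

definition is_semigroup_of_A ::
  "real \<Rightarrow> real \<Rightarrow> real \<Rightarrow> real \<Rightarrow> real \<Rightarrow> real \<Rightarrow> real \<Rightarrow> real \<Rightarrow> real \<Rightarrow> (real \<Rightarrow> state \<Rightarrow> state) \<Rightarrow> bool" where
  "is_semigroup_of_A \<rho>1 \<rho>2 k1 k2 k3 l L a0 \<beta> T \<longleftrightarrow>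
    (let N = Hnorm \<rho>1 \<rho>2 k1 k2 k3 l L; A = opA \<rho>1 \<rho>2 k1 k2 k3 l L a0 \<beta> in
     (\<forall>t\<ge>0. \<forall>U. inH L U \<longrightarrow> inH L (T t U)) \<and>
     (\<forall>t\<ge>0. \<forall>U V c d. inH L U \<and> inH L V \<longrightarrow>
         N (sdiff (T t (sadd (sscale c U) (sscale d V))) (sadd (sscale c (T t U)) (sscale d (T t V)))) = 0) \<and>
     (\<forall>t\<ge>0. \<exists>C. \<forall>U. inH L U \<longrightarrow> N (T t U) \<le> C * N U) \<and>
     (\<forall>U. inH L U \<longrightarrow> N (sdiff (T 0 U) U) = 0) \<and>
     (\<forall>s t U. s \<ge> 0 \<and> t \<ge> 0 \<and> inH L U \<longrightarrow> N (sdiff (T (s + t) U) (T s (T t U))) = 0) \<and>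
     (\<forall>U. inH L U \<longrightarrow> ((\<lambda>t. N (sdiff (T t U) U)) \<longlongrightarrow> 0) (at_right 0)) \<and>
     (\<forall>U. domA L U \<longrightarrow>
         ((\<lambda>h. N (sdiff (sscale (of_real (1/h)) (sdiff (T h U) U)) (A U))) \<longlongrightarrow> 0) (at_right 0)) \<and>
     (\<forall>U V. inH L U \<and> inH L V \<and>
         ((\<lambda>h. N (sdiff (sscale (of_real (1/h)) (sdiff (T h U) U)) V)) \<longlongrightarrow> 0) (at_right 0) \<longrightarrow>
         (\<exists>U'. domA L U' \<and> N (sdiff U U') = 0 \<and> N (sdiff (A U') V) = 0)))"

end

theory Submission
  imports Defs
begin

text \<open>
For real \<open>\<lambda>\<close> the equation \<open>(i \<lambda> - A) U = F\<close> is a linear system of first-order equations in \<open>x\<close> for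
the displacements, their derivatives and the rescaled velocities.  Equal wave speeds make its leading
part \<open>i \<mu>\<close> times a swap of velocities and derivatives, so that a Gronwall estimate bounds \<open>U\<close>, uniformly
in \<open>\<lambda>\<close>, by the initial slopes at \<open>x = 0\<close> and by \<open>F\<close>.  On the damped interval near \<open>x = 0\<close> the dissipation
controls \<open>v\<^sup>6\<close>.  For large \<open>\<bar>\<mu>\<bar>\<close> the combination of velocity and strain that travels to one side is,
up to a phase and small errors, a polynomial in \<open>x\<close> whose coefficients encode the three slopes, and the
oscillation separates it from the other one; for bounded \<open>\<mu>\<close> away from \<open>0\<close> the Taylor polynomial
of \<open>v\<^sup>5\<close> plays this role.  In both cases the slopes are bounded by the damped component on a short interval.
For small \<open>\<lambda>\<close> coercivity of the elastic energy suffices.  This gives a resolvent bound \<open>M\<close> on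
the imaginary axis.

The passage to the semigroup replaces Plancherel's theorem by Parseval's identity for the discrete Fourier
transform.  An orbit sampled at step \<open>h\<close> and cut off by a tent function satisfies a periodic difference equation;
its Fourier modes satisfy \<open>(\<mu>\<^sub>k - A) W\<^sub>k = G\<^sub>k\<close> with \<open>Re \<mu>\<^sub>k \<ge> 0\<close>, and by dissipativity the bound on the
imaginary axis is valid there too.  As \<open>h\<close> tends to \<open>0\<close> this yields \<open>N (T \<tau> U) \<le> (6 M / \<tau>) N U\<close>, and
\<open>\<tau> = 12 M\<close> gives exponential decay.
\<close>

section \<open>Absolutely continuous functions\<close>

text \<open>Why one damped component sees all three slopes: through \<open>l\<close> the third
  equation feels the first at order \<open>x\<close>, and the first feels the second at order
  \<open>x^2\<close>, so the successive Taylor coefficients of the third component bring in one new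
  slope each. At high frequency this survives because all three waves share one phase; between
  different phases the coupling terms would oscillate and average out. The Taylor remainder has the
  size of the whole solution, which Gronwall bounds by slopes plus data, so it is absorbed by first
  fixing a short length \<open>r\<close> and then a large frequency. The hypothesis on
  \<open>T\<close> gives boundedness at each single time, continuity at time zero and the generator.
  Contractivity is derived: Baire's theorem on the time axis yields locally uniform bounds, hence
  continuous orbits, and dissipation makes the norm nonincreasing. The resolvent estimate serves as
  an a priori inequality on the domain; the Fourier modes of a sampled orbit are finite combinations
  of domain elements, so it applies to them directly. The tent vanishes at both ends of the sample,
  which keeps the difference equation valid across the wrap-around.\<close>

definition AC :: "real \<Rightarrow> (real \<Rightarrow> 'a::euclidean_space) \<Rightarrow> (real \<Rightarrow> 'a) \<Rightarrow> bool" where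
  "AC b f F \<longleftrightarrow> set_integrable lborel {0..b} F \<and> (\<forall>x\<in>{0..b}. f x = f 0 + (LINT t:{0..x}|lborel. F t))"

lemma AC_integrable: "AC b f F \<Longrightarrow> set_integrable lborel {0..b} F"
  unfolding AC_def by blast

lemma AC_I:
  assumes "set_integrable lborel {0..b} F"
    "\<And>x. 0 \<le> x \<Longrightarrow> x \<le> b \<Longrightarrow> f x = f 0 + (LINT t:{0..x}|lborel. F t)"
  shows "AC b f F"
  unfolding AC_def using assms by (meson atLeastAtMost_iff)

lemma set_integrable_sub:
  fixes f :: "real \<Rightarrow> 'a::euclidean_space"
  shows "set_integrable lborel {0..b} f \<Longrightarrow> x \<le> b \<Longrightarrow> set_integrable lborel {0..x} f"
  by (rule set_integrable_subset) auto

lemma AC_eq: "AC b f F \<Longrightarrow> 0 \<le> x \<Longrightarrow> x \<le> b \<Longrightarrow> f x = f 0 + (LINT t:{0..x}|lborel. F t)"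
  unfolding AC_def by (meson atLeastAtMost_iff)

lemma AC_int: "AC b f F \<Longrightarrow> x \<le> b \<Longrightarrow> set_integrable lborel {0..x} F"
  using AC_integrable set_integrable_sub by blast

lemma AC_subset: "AC b f F \<Longrightarrow> c \<le> b \<Longrightarrow> AC c f F"
  unfolding AC_def by (meson atLeastAtMost_iff order_trans set_integrable_sub)

lemma set_integrable_continuous:
  fixes f :: "real \<Rightarrow> 'a::euclidean_space"
  shows "continuous_on {a..b} f \<Longrightarrow> set_integrable lborel {a..b} f"
  by (rule borel_integrable_atLeastAtMost')

lemma AC_continuous:
  assumes "AC b f F" shows "continuous_on {0..b} f"
proof -
  have i: "F integrable_on {0..b}"
    using AC_integrable[OF assms] by (rule set_borel_integral_eq_integral)
  have e: "f x = f 0 + integral {0..x} F" if "x \<in> {0..b}" for x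
    using AC_eq[OF assms, of x] that set_borel_integral_eq_integral(2)[OF AC_int[OF assms, of x]] by simp
  have "continuous_on {0..b} (\<lambda>x. f 0 + integral {0..x} F)"
    by (intro continuous_intros indefinite_integral_continuous_1 i)
  then show ?thesis
    by (rule continuous_on_eq) (metis e)
qed

lemma AC_cong:
  assumes "AC b f F" "\<And>x. 0 \<le> x \<Longrightarrow> x \<le> b \<Longrightarrow> f x = g x" "\<And>x. 0 \<le> x \<Longrightarrow> x \<le> b \<Longrightarrow> F x = G x"
  shows "AC b g G"
proof -
  have "set_integrable lborel {0..b} G"
    using AC_integrable[OF assms(1)] assms(3) set_integrable_cong[of lborel lborel "{0..b}" "{0..b}" F G] by auto
  moreover have "g x = g 0 + (LINT t:{0..x}|lborel. G t)" if "x \<in> {0..b}" for x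
  proof -
    have "(LINT t:{0..x}|lborel. F t) = (LINT t:{0..x}|lborel. G t)"
      using that assms(3) by (intro set_lebesgue_integral_cong) auto
    then show ?thesis using AC_eq[OF assms(1), of x] assms(2)[of x] assms(2)[of 0] that by auto
  qed
  ultimately show ?thesis by (meson AC_I atLeastAtMost_iff)
qed

text \<open>The derivative in \<open>AC\<close> is a chosen representative, and \<open>dx\<close>,
  \<open>dxx\<close> are fixed only up to null sets, so \<open>F\<close> must be exchangeable almost
  everywhere. Integrability of \<open>G\<close> is a separate hypothesis because equality almost
  everywhere does not give Borel measurability.\<close>

lemma AC_cong_AE:
  assumes "AC b f F" "\<And>x. 0 \<le> x \<Longrightarrow> x \<le> b \<Longrightarrow> f x = g x"
    "AE x in lborel. 0 \<le> x \<and> x \<le> b \<longrightarrow> F x = G x" "set_integrable lborel {0..b} G"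
  shows "AC b g G"
proof -
  have "g x = g 0 + (LINT t:{0..x}|lborel. G t)" if "x \<in> {0..b}" for x
  proof -
    have "set_integrable lborel {0..x} F" "set_integrable lborel {0..x} G"
      using AC_int[OF assms(1)] that set_integrable_sub[OF assms(4)] by auto
    then have m: "set_borel_measurable lborel {0..x} F" "set_borel_measurable lborel {0..x} G"
      unfolding set_integrable_def set_borel_measurable_def by (auto dest: borel_measurable_integrable)
    have "(LINT t:{0..x}|lborel. F t) = (LINT t:{0..x}|lborel. G t)"
      using m assms(3) that unfolding set_lebesgue_integral_def set_borel_measurable_def
      by (intro integral_cong_AE) (auto elim!: eventually_mono split: split_indicator)
    then show ?thesis using AC_eq[OF assms(1), of x] assms(2)[of x] assms(2)[of 0] that by auto
  qed
  then show ?thesis using assms(4) by (meson AC_I atLeastAtMost_iff)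
qed

lemma AC_const: "AC b (\<lambda>_. c) (\<lambda>_. 0)"
  by (intro AC_I) (auto simp: set_integrable_def)

lemma AC_add:
  assumes "AC b f F" "AC b g G" shows "AC b (\<lambda>x. f x + g x) (\<lambda>x. F x + G x)"
proof (rule AC_I)
  show "set_integrable lborel {0..b} (\<lambda>x. F x + G x)"
    using AC_integrable[OF assms(1)] AC_integrable[OF assms(2)] by (rule set_integral_add)
  fix x assume x: "0 \<le> x" "x \<le> b"
  have "(LINT t:{0..x}|lborel. F t + G t) = (LINT t:{0..x}|lborel. F t) + (LINT t:{0..x}|lborel. G t)"
    using AC_int[OF assms(1) x(2)] AC_int[OF assms(2) x(2)] by (rule set_integral_add)
  then show "f x + g x = f 0 + g 0 + (LINT t:{0..x}|lborel. F t + G t)"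
    using AC_eq[OF assms(1) x] AC_eq[OF assms(2) x] by (simp only: add_ac)
qed

lemma AC_linear:
  assumes "bounded_linear T" "AC b f F" shows "AC b (\<lambda>x. T (f x)) (\<lambda>x. T (F x))"
proof -
  interpret bounded_linear T by fact
  have i: "integrable lborel (\<lambda>t. indicator {0..x} t *\<^sub>R F t)" if "x \<le> b" for x
    using AC_int[OF assms(2) that] by (simp add: set_integrable_def)
  have *: "set_integrable lborel {0..x} (\<lambda>t. T (F t))"
          "(LINT t:{0..x}|lborel. T (F t)) = T (LINT t:{0..x}|lborel. F t)" if "x \<le> b" for x
    using integrable_bounded_linear[OF assms(1) i[OF that]] integral_bounded_linear[OF assms(1) i[OF that]]
    by (simp_all add: set_integrable_def set_lebesgue_integral_def scaleR)
  show ?thesis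
  proof (rule AC_I)
    show "set_integrable lborel {0..b} (\<lambda>x. T (F x))" using * by simp
    fix x assume "0 \<le> x" "x \<le> b"
    then show "T (f x) = T (f 0) + (LINT t:{0..x}|lborel. T (F t))"
      using AC_eq[OF assms(2), of x] *(2)[of x] add by simp
  qed
qed

lemma AC_cmult:
  fixes f :: "real \<Rightarrow> complex"
  shows "AC b f F \<Longrightarrow> AC b (\<lambda>x. c * f x) (\<lambda>x. c * F x)"
  by (rule AC_linear[OF bounded_linear_mult_right])

lemma AC_cnj: "AC b f F \<Longrightarrow> AC b (\<lambda>x. cnj (f x)) (\<lambda>x. cnj (F x))"
  by (rule AC_linear[OF bounded_linear_cnj])

lemma AC_Re: "AC b f F \<Longrightarrow> AC b (\<lambda>x. Re (f x)) (\<lambda>x. Re (F x))"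
  by (rule AC_linear[OF bounded_linear_Re])

lemma AC_diff:
  fixes f :: "real \<Rightarrow> complex"
  shows "AC b f F \<Longrightarrow> AC b g G \<Longrightarrow> AC b (\<lambda>x. f x - g x) (\<lambda>x. F x - G x)"
  using AC_add[OF _ AC_cmult[of b g G "-1"]] by simp

lemma AC_C1:
  fixes f :: "real \<Rightarrow> 'a::euclidean_space"
  assumes "\<And>x. (f has_vector_derivative F x) (at x)" "continuous_on UNIV F"
  shows "AC b f F"
proof -
  have c: "continuous_on A F" for A using assms(2) continuous_on_subset by blast
  have i: "set_integrable lborel {0..x} F" for x by (intro set_integrable_continuous c)
  have "f x = f 0 + (LINT t:{0..x}|lborel. F t)" if "0 \<le> x" for x
  proof -
    have "(F has_integral f x - f 0) {0..x}"
      using assms(1) that by (intro fundamental_theorem_of_calculus) (auto intro: has_vector_derivative_at_within)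
    then show ?thesis using set_borel_integral_eq_integral(2)[OF i[of x]] by (simp add: integral_unique)
  qed
  then show ?thesis using i by (meson AC_I)
qed

lemma set_integrable_mult_continuous:
  fixes f g :: "real \<Rightarrow> complex"
  assumes "set_integrable lborel {0..b} F" "continuous_on {0..b} g"
  shows "set_integrable lborel {0..b} (\<lambda>x. F x * g x)"
proof -
  have "bounded (g ` {0..b})" by (intro compact_imp_bounded compact_continuous_image assms) auto
  then obtain B where B: "\<And>x. x \<in> {0..b} \<Longrightarrow> cmod (g x) \<le> B" unfolding bounded_iff by blast
  have m: "(\<lambda>x. indicat_real {0..b} x *\<^sub>R g x) \<in> borel_measurable lborel"
    using borel_measurable_integrable[OF set_integrable_continuous[OF assms(2), unfolded set_integrable_def]] .
  have i: "integrable lborel (\<lambda>x. indicat_real {0..b} x *\<^sub>R F x)" using assms(1) by (simp add: set_integrable_def)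
  have "integrable lborel (\<lambda>x. (indicat_real {0..b} x *\<^sub>R F x) * (indicat_real {0..b} x *\<^sub>R g x))"
  proof (rule Bochner_Integration.integrable_bound[of _ "\<lambda>x. B *\<^sub>R (indicat_real {0..b} x *\<^sub>R F x)"])
    show "integrable lborel (\<lambda>x. B *\<^sub>R (indicat_real {0..b} x *\<^sub>R F x))" using i by (rule integrable_scaleR_right)
    show "(\<lambda>x. (indicat_real {0..b} x *\<^sub>R F x) * (indicat_real {0..b} x *\<^sub>R g x)) \<in> borel_measurable lborel"
      using m i by measurable
    show "AE x in lborel. norm ((indicat_real {0..b} x *\<^sub>R F x) * (indicat_real {0..b} x *\<^sub>R g x))
      \<le> norm (B *\<^sub>R (indicat_real {0..b} x *\<^sub>R F x))"
    proof (rule AE_I2)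
      fix x show "norm ((indicat_real {0..b} x *\<^sub>R F x) * (indicat_real {0..b} x *\<^sub>R g x))
      \<le> norm (B *\<^sub>R (indicat_real {0..b} x *\<^sub>R F x))"
      proof (cases "x \<in> {0..b}")
        case True
        then have "cmod (g x) \<le> B" using B by auto
        then have "cmod (F x) * cmod (g x) \<le> \<bar>B\<bar> * cmod (F x)"
          by (subst mult.commute, intro mult_right_mono) auto
        then show ?thesis using True by (simp add: norm_mult)
      qed auto
    qed
  qed
  then show ?thesis unfolding set_integrable_def
    by (rule Bochner_Integration.integrable_cong[THEN iffD1, rotated -1]) (auto split: split_indicator)
qed

text \<open>Fubini on the triangle \<open>t \<le> s\<close> replaces differentiation almost everywhere.\<close>
lemma AC_mult:
  fixes f g :: "real \<Rightarrow> complex"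
  assumes f: "AC b f F" and g: "AC b g G"
  shows "AC b (\<lambda>x. f x * g x) (\<lambda>x. F x * g x + f x * G x)"
proof -
  have i1: "set_integrable lborel {0..b} (\<lambda>x. F x * g x)"
    using set_integrable_mult_continuous AC_integrable[OF f] AC_continuous[OF g] by blast
  have i2: "set_integrable lborel {0..b} (\<lambda>x. f x * G x)"
    using set_integrable_mult_continuous[OF AC_integrable[OF g] AC_continuous[OF f]] by (simp add: mult.commute)
  have "f x * g x = f 0 * g 0 + (LINT t:{0..x}|lborel. F t * g t + f t * G t)" if x: "x \<in> {0..b}" for x
  proof -
    let ?I = "indicat_real {0..x}"
    let ?F = "\<lambda>t. ?I t *\<^sub>R F t" and ?G = "\<lambda>t. ?I t *\<^sub>R G t"
    have iF: "integrable lborel ?F" and iG: "integrable lborel ?G"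
      using AC_int[OF f, of x] AC_int[OF g, of x] x by (auto simp: set_integrable_def)
    have mF[measurable]: "?F \<in> borel_measurable borel" and mG[measurable]: "?G \<in> borel_measurable borel"
      using iF iG by auto
    \<comment> \<open>The indicator of \<open>{..s}\<close> at \<open>t\<close> cuts out the
      triangle. Integrating in \<open>t\<close> first produces the increment
      \<open>g s - g 0\<close>, integrating in \<open>s\<close> first produces
      \<open>f x - f t\<close>; comparing the two is integration by parts.\<close>
    let ?H = "\<lambda>s t. (?F s * ?G t) * of_real (indicat_real {..s} t)"
    have iH: "integrable (lborel \<Otimes>\<^sub>M lborel) (\<lambda>(s,t). ?H s t)"
    proof (rule lborel_pair.Fubini_integrable)
      have "(\<lambda>p::real\<times>real. indicat_real {..fst p} (snd p)) = (\<lambda>p. if snd p \<le> fst p then 1 else 0)"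
        by (auto simp: indicator_def)
      then have [measurable]: "(\<lambda>p::real\<times>real. indicat_real {..fst p} (snd p)) \<in> borel_measurable (borel \<Otimes>\<^sub>M borel)"
        by simp
      show m: "(\<lambda>(s,t). ?H s t) \<in> borel_measurable (lborel \<Otimes>\<^sub>M lborel)"
      proof -
        have m1: "(\<lambda>p. ?F (fst p)) \<in> borel_measurable (lborel \<Otimes>\<^sub>M lborel)"
          by (rule measurable_compose[OF measurable_fst]) simp
        have m2: "(\<lambda>p. ?G (snd p)) \<in> borel_measurable (lborel \<Otimes>\<^sub>M lborel)"
          by (rule measurable_compose[OF measurable_snd]) simp
        have "(\<lambda>p::real\<times>real. of_real (if snd p \<le> fst p then 1 else 0) :: complex) \<in> borel_measurable (lborel \<Otimes>\<^sub>M lborel)"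
          by measurable
        then have q: "(\<lambda>p. (?F (fst p) * ?G (snd p)) * of_real (if snd p \<le> fst p then 1 else 0)) \<in> borel_measurable (lborel \<Otimes>\<^sub>M lborel)"
          by (intro borel_measurable_times m1 m2)
        have "?F (fst p) * ?G (snd p) * of_real (if snd p \<le> fst p then 1 else 0) = (case p of (s,t) \<Rightarrow> ?H s t)" for p
          unfolding case_prod_unfold by (cases "snd p \<le> fst p") (simp_all only: indicator_simps atMost_iff if_True if_False not_False_eq_True)
        then show ?thesis
          by (rule measurable_cong[THEN iffD1, OF _ q])
      qed
      have ii: "integrable lborel (\<lambda>t. ?H s t)" for s
      proof (rule Bochner_Integration.integrable_bound)
        show "integrable lborel (\<lambda>t. ?F s * ?G t)" using iG by (intro integrable_mult_right) simp
        have "(\<lambda>t. complex_of_real (indicat_real {..s} t)) \<in> borel_measurable lborel" by simp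
        then show "(\<lambda>t. ?H s t) \<in> borel_measurable lborel"
          using mG by (intro borel_measurable_times borel_measurable_const) auto
        show "AE t in lborel. norm (?H s t) \<le> norm (?F s * ?G t)"
          by (rule AE_I2) (simp only: norm_mult norm_of_real,
            auto split: split_indicator intro!: mult_left_le)
      qed
      show "AE s in lborel. integrable lborel (\<lambda>t. (\<lambda>(s,t). ?H s t) (s, t))"
        using ii by simp
      have "integrable lborel (\<lambda>s. \<integral>t. norm (?H s t) \<partial>lborel)"
      proof (rule Bochner_Integration.integrable_bound[of _ "\<lambda>s. norm (?F s) * (\<integral>t. norm (?G t) \<partial>lborel)"])
        show "integrable lborel (\<lambda>s. norm (?F s) * (\<integral>t. norm (?G t) \<partial>lborel))"
          by (intro integrable_mult_left integrable_norm iF)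
        show "(\<lambda>s. \<integral>t. norm (?H s t) \<partial>lborel) \<in> borel_measurable lborel"
          using measurable_compose[OF m borel_measurable_norm] by (intro lborel.borel_measurable_lebesgue_integral)
            (simp only: case_prod_unfold)
        show "AE s in lborel. norm (\<integral>t. norm (?H s t) \<partial>lborel) \<le> norm (norm (?F s) * (\<integral>t. norm (?G t) \<partial>lborel))"
        proof (rule AE_I2)
          fix s
          have "(\<integral>t. norm (?H s t) \<partial>lborel) \<le> (\<integral>t. norm (?F s) * norm (?G t) \<partial>lborel)"
          proof (rule integral_mono)
            show "integrable lborel (\<lambda>t. norm (?H s t))" by (rule integrable_norm[OF ii])
            show "integrable lborel (\<lambda>t. norm (?F s) * norm (?G t))"
              by (intro integrable_mult_right integrable_norm iG)
            show "norm (?H s t) \<le> norm (?F s) * norm (?G t)" for t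
              unfolding norm_mult norm_of_real by (intro mult_left_le) (auto split: split_indicator)
          qed
          also have "\<dots> = norm (?F s) * (\<integral>t. norm (?G t) \<partial>lborel)" by simp
          finally show "norm (\<integral>t. norm (?H s t) \<partial>lborel) \<le> norm (norm (?F s) * (\<integral>t. norm (?G t) \<partial>lborel))"
            by (simp add: abs_of_nonneg)
        qed
      qed
      then show "integrable lborel (\<lambda>s. \<integral>t. norm ((\<lambda>(s,t). ?H s t) (s, t)) \<partial>lborel)" by simp
    qed
    have fub: "(\<integral>t. (\<integral>s. ?H s t \<partial>lborel) \<partial>lborel) = (\<integral>s. (\<integral>t. ?H s t \<partial>lborel) \<partial>lborel)"
      using lborel_pair.Fubini_integral[OF iH] .
    have L: "(\<integral>t. ?H s t \<partial>lborel) = ?I s *\<^sub>R (F s * (g s - g 0))" for s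
    proof (cases "s \<in> {0..x}")
      case True
      have "?H s t = F s * (indicat_real {0..s} t *\<^sub>R G t)" for t
        using True by (auto split: split_indicator)
      then have "(\<integral>t. ?H s t \<partial>lborel) = F s * (LINT t:{0..s}|lborel. G t)"
        unfolding set_lebesgue_integral_def by (simp only: integral_mult_right_zero)
      then show ?thesis using AC_eq[OF g, of s] True x by simp
    qed auto
    have R: "(\<integral>s. ?H s t \<partial>lborel) = ?I t *\<^sub>R (G t * (f x - f t))" for t
    proof (cases "t \<in> {0..x}")
      case True
      have 1: "set_integrable lborel {0..x} F" using iF by (simp add: set_integrable_def)
      have "?H s t = G t * (indicat_real {t..x} s *\<^sub>R F s)" for s
        using True by (auto split: split_indicator)
      then have "(\<integral>s. ?H s t \<partial>lborel) = G t * (LINT s:{t..x}|lborel. F s)"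
        unfolding set_lebesgue_integral_def by (simp only: integral_mult_right_zero)
      also have "(LINT s:{t..x}|lborel. F s) = (LINT s:{0..x}|lborel. F s) - (LINT s:{0..t}|lborel. F s)"
      proof -
        have "(LINT s:{0..x}|lborel. F s) = (LINT s:{0..t}|lborel. F s) + (LINT s:{t..x}|lborel. F s)"
        proof -
          have "set_integrable lborel {0..t} F" "set_integrable lborel {t..x} F"
            using True by (auto intro: set_integrable_subset[OF 1])
          then show ?thesis
            using set_borel_integral_eq_integral(2)[OF 1] set_borel_integral_eq_integral(1)[OF 1]
              set_borel_integral_eq_integral(2)[of "{0..t}" F] set_borel_integral_eq_integral(2)[of "{t..x}" F]
              Henstock_Kurzweil_Integration.integral_combine[of 0 t x F] True by auto
        qed
        then show ?thesis by simp
      qed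
      also have "\<dots> = f x - f t" using AC_eq[OF f, of x] AC_eq[OF f, of t] True x by simp
      finally show ?thesis using True by simp
    qed auto
    have alg: "t = q * c + r * d" if "a = p - q * c" "a' = r * d - s" "t = p + s" "a = a'" for a p q c a' r d s t :: complex
      using that by (simp add: algebra_simps)
    have eq: "(LINT s:{0..x}|lborel. F s * (g s - g 0)) = (LINT t:{0..x}|lborel. G t * (f x - f t))"
      using fub unfolding L R set_lebesgue_integral_def by simp
    have i: "set_integrable lborel {0..x} (\<lambda>x. F x * g x)" "set_integrable lborel {0..x} (\<lambda>x. f x * G x)"
        "set_integrable lborel {0..x} F" "set_integrable lborel {0..x} G"
      using set_integrable_sub[OF i1] set_integrable_sub[OF i2] AC_int[OF f] AC_int[OF g] x by auto
    have "(LINT s:{0..x}|lborel. F s * (g s - g 0)) = (LINT s:{0..x}|lborel. F s * g s) - (LINT s:{0..x}|lborel. F s) * g 0"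
      using i by (simp add: right_diff_distrib set_integral_diff)
    moreover have "(LINT t:{0..x}|lborel. G t * (f x - f t)) = (LINT t:{0..x}|lborel. G t) * f x - (LINT t:{0..x}|lborel. f t * G t)"
      using i by (simp add: right_diff_distrib set_integral_diff mult.commute)
    moreover have "(LINT t:{0..x}|lborel. F t * g t + f t * G t) = (LINT s:{0..x}|lborel. F s * g s) + (LINT t:{0..x}|lborel. f t * G t)"
      using i by simp
    ultimately have "(LINT t:{0..x}|lborel. F t * g t + f t * G t) = (LINT s:{0..x}|lborel. F s) * g 0 + (LINT t:{0..x}|lborel. G t) * f x"
      using eq alg by blast
    also have "\<dots> = (f x - f 0) * g 0 + (g x - g 0) * f x"
      using AC_eq[OF f, of x] AC_eq[OF g, of x] x by simp
    finally show ?thesis by (simp add: algebra_simps)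
  qed
  then show ?thesis using set_integral_add(1)[OF i1 i2] by (meson AC_I atLeastAtMost_iff)
qed

lemma AC_norm2:
  assumes "AC b f F" shows "AC b (\<lambda>x. (cmod (f x))\<^sup>2) (\<lambda>x. 2 * Re (cnj (f x) * F x))"
proof -
  have "AC b (\<lambda>x. Re (cnj (f x) * f x)) (\<lambda>x. Re (cnj (F x) * f x + cnj (f x) * F x))"
    by (intro AC_Re AC_mult AC_cnj assms)
  then show ?thesis
    by (rule AC_cong) (simp_all only: cmod_power2 cnj.simps times_complex.simps plus_complex.simps, simp_all add: power2_eq_square algebra_simps)
qed

lemma AC_exp: "AC b (\<lambda>x. exp (\<i> * of_real (\<nu> * x))) (\<lambda>x. \<i> * of_real \<nu> * exp (\<i> * of_real (\<nu> * x)))"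
proof (rule AC_C1)
  fix x :: real
  have "((\<lambda>z. exp (\<i> * of_real \<nu> * z)) has_field_derivative \<i> * of_real \<nu> * exp (\<i> * of_real \<nu> * of_real x)) (at (of_real x))"
    by (auto intro!: derivative_eq_intros)
  from has_vector_derivative_real_field[OF this, of UNIV]
  show "((\<lambda>x. exp (\<i> * of_real (\<nu> * x))) has_vector_derivative \<i> * of_real \<nu> * exp (\<i> * of_real (\<nu> * x))) (at x)"
    by (simp add: mult.assoc)
qed (auto intro!: continuous_intros)

text \<open>Equal primitives force the integral of \<open>F - G\<close> to vanish on every
  subinterval. Vanishing integrals pass to complements and disjoint countable unions, hence to all
  Borel sets, and a function with vanishing integrals over all of them is zero almost
  everywhere.\<close>

lemma AC_derivative_unique:
  assumes "AC b f F" "AC b f G" "0 \<le> b"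
  shows "AE x in lborel. x \<in> {0..b} \<longrightarrow> F x = G x"
proof -
  let ?h = "\<lambda>x. indicat_real {0..b} x *\<^sub>R (F x - G x)"
  have ih: "set_integrable lborel {0..b} (\<lambda>x. F x - G x)" using AC_integrable[OF assms(1)] AC_integrable[OF assms(2)] by auto
  then have ih': "integrable lborel ?h" by (simp add: set_integrable_def)
  have z0: "(LINT t:{0..x}|lborel. F t - G t) = 0" if "0 \<le> x" "x \<le> b" for x
    using AC_eq[OF assms(1) that] AC_eq[OF assms(2) that] AC_int[OF assms(1) that(2)] AC_int[OF assms(2) that(2)]
    by (subst set_integral_diff) auto
  have z1: "(LINT t:{x..y}|lborel. F t - G t) = 0" if "0 \<le> x" "x \<le> y" "y \<le> b" for x y
  proof -
    have 1: "set_integrable lborel {0..y} (\<lambda>x. F x - G x)" "set_integrable lborel {0..x} (\<lambda>x. F x - G x)"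
       "set_integrable lborel {x..y} (\<lambda>x. F x - G x)"
      using that by (auto intro: set_integrable_subset[OF ih])
    show ?thesis using z0[of x] z0[of y] that 1[THEN set_borel_integral_eq_integral(2)]
        Henstock_Kurzweil_Integration.integral_combine[of 0 x y "\<lambda>x. F x - G x", OF _ _ 1(1)[THEN set_borel_integral_eq_integral(1)]] by auto
  qed
  \<comment> \<open>Extending \<open>F - G\<close> by zero makes the statement meaningful on all
    Borel sets of the line; the complement step uses that the total integral is zero.\<close>
  have "set_lebesgue_integral lborel A ?h = 0" if "A \<in> sets borel" for A
    using that
  proof (induct rule: borel_set_induct)
    case empty
    show ?case by (simp add: set_lebesgue_integral_def)
  next
    case (interval c d)
    show ?case
    proof (cases "max 0 c \<le> min b d")
      case True
      have "set_lebesgue_integral lborel {c..d} ?h = (LINT t:{max 0 c..min b d}|lborel. F t - G t)"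
        unfolding set_lebesgue_integral_def by (rule Bochner_Integration.integral_cong) (auto split: split_indicator)
      then show ?thesis using z1[of "max 0 c" "min b d"] True by auto
    next
      case False
      have "(\<lambda>x. indicat_real {c..d} x *\<^sub>R ?h x) = (\<lambda>x. 0)" using False by (auto split: split_indicator)
      then show ?thesis unfolding set_lebesgue_integral_def by (simp only: Bochner_Integration.integral_zero)
    qed
  next
    case (compl A)
    have "integrable lborel (\<lambda>x. indicat_real A x *\<^sub>R ?h x)"
      using compl by (intro integrable_mult_indicator[OF _ ih']) auto
    moreover have "indicat_real (UNIV - A) x *\<^sub>R ?h x = ?h x - indicat_real A x *\<^sub>R ?h x" for x
      by (auto split: split_indicator)
    moreover have "(\<integral>x. ?h x \<partial>lborel) = 0" using z0[of b] assms(3) by (simp add: set_lebesgue_integral_def)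
    ultimately show ?case using compl ih' unfolding set_lebesgue_integral_def
      by (simp add: Compl_eq_Diff_UNIV)
  next
    case (union A)
    have "set_integrable lborel (\<Union>i. A i) ?h"
      unfolding set_integrable_def using union by (intro integrable_mult_indicator[OF _ ih']) auto
    then have "set_lebesgue_integral lborel (\<Union>i. A i) ?h = (\<Sum>i. set_lebesgue_integral lborel (A i) ?h)"
      using union by (intro lebesgue_integral_countable_add) (auto simp: disjoint_family_on_def)
    then show ?case using union by simp
  qed
  then have "AE x in lborel. ?h x = 0"
    by (intro sigma_finite_measure.density_zero[OF lborel.sigma_finite_measure_axioms] ih') auto
  then show ?thesis by eventually_elim auto
qed

section \<open>Integral inequalities: Cauchy-Schwarz, Gronwall, Taylor remainders,
  oscillation\<close>

lemma cauchy_schwarz_interval: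
  fixes f :: "real \<Rightarrow> real"
  assumes "set_integrable lborel {0..b} f" "set_integrable lborel {0..b} (\<lambda>x. (f x)\<^sup>2)" "0 < b"
  shows "(LINT x:{0..b}|lborel. f x)\<^sup>2 \<le> b * (LINT x:{0..b}|lborel. (f x)\<^sup>2)"
proof -
  \<comment> \<open>The mean value of \<open>f\<close>: the inequality is the nonnegativity of its
    variance.\<close>
  define m where "m = (LINT x:{0..b}|lborel. f x) / b"
  have c: "set_integrable lborel {0..b} (\<lambda>_. c::real)" for c by (intro set_integrable_continuous continuous_intros)
  have "0 \<le> (LINT x:{0..b}|lborel. (f x - m)\<^sup>2)"
    unfolding set_lebesgue_integral_def by (rule Bochner_Integration.integral_nonneg) auto
  also have "\<dots> = (LINT x:{0..b}|lborel. ((f x)\<^sup>2 - 2 * m * f x) + m\<^sup>2)"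
    by (rule set_lebesgue_integral_cong) (auto simp: power2_eq_square algebra_simps)
  also have "\<dots> = (LINT x:{0..b}|lborel. (f x)\<^sup>2) - 2 * m * (LINT x:{0..b}|lborel. f x) + m\<^sup>2 * b"
    using assms c by (subst set_integral_add, auto simp: set_integral_const)+
  also have "\<dots> = (LINT x:{0..b}|lborel. (f x)\<^sup>2) - (LINT x:{0..b}|lborel. f x)\<^sup>2 / b"
    using assms(3) by (simp add: m_def power2_eq_square field_simps)
  finally show ?thesis using assms(3) by (simp add: field_simps)
qed

text \<open>The derivative \<open>e'\<close> exists only as an integrable function, so the
  differential inequality is integrated first. The resulting right side has a continuous integrand
  and is differentiable in the interior, which lets the classical argument run.\<close>

lemma gronwall_AC:
  fixes e e' \<gamma> :: "real \<Rightarrow> real"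
  assumes e: "AC b e e'" and le: "\<And>x. 0 \<le> x \<Longrightarrow> x \<le> b \<Longrightarrow> e' x \<le> C * e x + \<gamma> x"
    and \<gamma>: "set_integrable lborel {0..b} \<gamma>" "\<And>x. 0 \<le> \<gamma> x" and C: "0 \<le> C" and x: "0 \<le> x" "x \<le> b"
    and e0: "0 \<le> e 0"
  shows "e x \<le> (e 0 + (LINT t:{0..b}|lborel. \<gamma> t)) * exp (C * b)"
proof -
  define A where "A = e 0 + (LINT t:{0..b}|lborel. \<gamma> t)"
  have ce: "continuous_on {0..b} e" using AC_continuous[OF e] .
  have \<gamma>0: "0 \<le> (LINT t:{0..b}|lborel. \<gamma> t)"
    unfolding set_lebesgue_integral_def using \<gamma>(2) by (intro Bochner_Integration.integral_nonneg) auto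
  have ub: "e y \<le> A + C * integral {0..y} e" if y: "0 \<le> y" "y \<le> b" for y
  proof -
    have ie: "set_integrable lborel {0..y} e"
      by (intro set_integrable_continuous continuous_on_subset[OF ce]) (use y in auto)
    have i\<gamma>: "set_integrable lborel {0..y} \<gamma>" using \<gamma> y set_integrable_sub by auto
    have "e y = e 0 + (LINT t:{0..y}|lborel. e' t)" by (rule AC_eq[OF e y])
    also have "(LINT t:{0..y}|lborel. e' t) \<le> (LINT t:{0..y}|lborel. C * e t + \<gamma> t)"
      using le y ie i\<gamma> AC_int[OF e] by (intro set_integral_mono) auto
    also have "\<dots> = C * (LINT t:{0..y}|lborel. e t) + (LINT t:{0..y}|lborel. \<gamma> t)"
      using ie i\<gamma> by simp
    also have "(LINT t:{0..y}|lborel. \<gamma> t) \<le> (LINT t:{0..b}|lborel. \<gamma> t)"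
      using \<gamma> i\<gamma> y unfolding set_lebesgue_integral_def set_integrable_def
      by (intro integral_mono) (auto split: split_indicator)
    finally show ?thesis using set_borel_integral_eq_integral(2)[OF ie] by (simp add: A_def)
  qed
  \<comment> \<open>The bound \<open>ub\<close> says exactly that this exponentially weighted right
    side has a nonpositive derivative.\<close>
  define H where "H y = exp (- C * y) * (A + C * integral {0..y} e)" for y
  have "H x \<le> H 0"
  proof (rule DERIV_nonpos_imp_decreasing_open[OF x(1)])
    fix y assume y: "0 < y" "y < x"
    have "((\<lambda>u. integral {0..u} e) has_vector_derivative e y) (at y within {0..b})"
      using ce y x by (intro integral_has_vector_derivative) auto
    then have "((\<lambda>u. integral {0..u} e) has_real_derivative e y) (at y)"
      using y x by (simp add: has_real_derivative_iff_has_vector_derivative at_within_Icc_at)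
    then have "(H has_real_derivative exp (- C * y) * (C * e y - C * (A + C * integral {0..y} e))) (at y)"
      unfolding H_def by (auto intro!: derivative_eq_intros simp: algebra_simps)
    moreover have "exp (- C * y) * (C * e y - C * (A + C * integral {0..y} e)) \<le> 0"
      using ub[of y] y x C by (simp add: mult_le_0_iff mult_left_mono)
    ultimately show "\<exists>z. (H has_real_derivative z) (at y) \<and> z \<le> 0" by blast
  next
    have "e integrable_on {0..x}"
      by (intro integrable_continuous_interval continuous_on_subset[OF ce]) (use x in auto)
    then show "continuous_on {0..x} H" unfolding H_def
      by (intro continuous_intros indefinite_integral_continuous_1)
  qed
  then have "exp (- C * x) * (A + C * integral {0..x} e) \<le> A" by (simp add: H_def)
  then have "A + C * integral {0..x} e \<le> A * exp (C * x)"
    by (simp add: exp_minus field_simps)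
  also have "\<dots> \<le> A * exp (C * b)"
    using e0 \<gamma>0 C x by (intro mult_left_mono) (auto simp: A_def mult_left_mono)
  finally show ?thesis using ub[OF x] by (simp add: A_def)
qed

text \<open>One integration raises the power of \<open>x\<close> in a remainder bound by one. The
  factor \<open>1 / Suc n\<close> is discarded so that the form of the bound is stable under
  repeated use, and the rough part \<gamma> enters only through its total integral.\<close>

lemma AC_le:
  assumes f: "AC b f F" and F: "\<And>x. 0 \<le> x \<Longrightarrow> x \<le> b \<Longrightarrow> norm (F x) \<le> A + B * x ^ n + \<gamma> x"
    and \<gamma>: "set_integrable lborel {0..b} \<gamma>" "\<And>x. 0 \<le> \<gamma> x" and "0 \<le> B" and x: "0 \<le> x" "x \<le> b"
  shows "norm (f x - f 0) \<le> A * x + B * x ^ Suc n + (LINT t:{0..b}|lborel. \<gamma> t)"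
proof -
  have iF: "set_integrable lborel {0..x} F" using AC_int[OF f x(2)] .
  have i\<gamma>: "set_integrable lborel {0..x} \<gamma>" using set_integrable_sub[OF \<gamma>(1) x(2)] .
  have ic: "set_integrable lborel {0..x} (\<lambda>t. c::real)" for c by (intro set_integrable_continuous continuous_intros)
  have "norm (f x - f 0) = norm (LINT t:{0..x}|lborel. F t)" using AC_eq[OF f x] by simp
  also have "\<dots> \<le> (LINT t:{0..x}|lborel. norm (F t))"
    using iF unfolding set_lebesgue_integral_def set_integrable_def
    by (intro order_trans[OF integral_norm_bound]) (simp add: abs_of_nonneg)
  also have "\<dots> \<le> (LINT t:{0..x}|lborel. (A + B * x ^ n) + \<gamma> t)"
  proof (intro set_integral_mono)
    show "set_integrable lborel {0..x} (\<lambda>t. norm (F t))"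
      using iF unfolding set_integrable_def by (drule_tac integrable_norm) simp
    show "set_integrable lborel {0..x} (\<lambda>t. (A + B * x ^ n) + \<gamma> t)" using ic i\<gamma> by (intro set_integral_add)
    fix t assume t: "t \<in> {0..x}"
    then have "B * t ^ n \<le> B * x ^ n" using assms by (intro mult_left_mono power_mono) auto
    then show "norm (F t) \<le> (A + B * x ^ n) + \<gamma> t" using F[of t] t x by auto
  qed
  also have "\<dots> = (A + B * x ^ n) * x + (LINT t:{0..x}|lborel. \<gamma> t)"
    using ic i\<gamma> x by (subst set_integral_add) (auto simp: set_integral_const algebra_simps)
  also have "(LINT t:{0..x}|lborel. \<gamma> t) \<le> (LINT t:{0..b}|lborel. \<gamma> t)"
    using \<gamma> i\<gamma> x unfolding set_lebesgue_integral_def set_integrable_def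
    by (intro integral_mono) (auto split: split_indicator)
  finally show ?thesis by (simp add: algebra_simps)
qed

text \<open>Integration by parts against the exponential gains the factor
  \<open>1 / \<bar>\<nu>\<bar>\<close>. The derivative may have a merely integrable part \<gamma>,
  since the data of the resolvent equation are only square integrable.\<close>

lemma oscillatory_integral:
  assumes f: "AC b f F" and A: "\<And>x. 0 \<le> x \<Longrightarrow> x \<le> b \<Longrightarrow> cmod (f x) \<le> A"
    and F: "\<And>x. 0 \<le> x \<Longrightarrow> x \<le> b \<Longrightarrow> cmod (F x) \<le> B + \<gamma> x"
    and \<gamma>: "set_integrable lborel {0..b} \<gamma>" "\<And>x. 0 \<le> \<gamma> x" and \<nu>: "\<nu> \<noteq> 0" and x: "0 \<le> x" "x \<le> b"
  shows "cmod (LINT t:{0..x}|lborel. exp (\<i> * of_real (\<nu> * t)) * f t)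
     \<le> (2 * A + B * x + (LINT t:{0..b}|lborel. \<gamma> t)) / \<bar>\<nu>\<bar>"
proof -
  let ?E = "\<lambda>t. exp (\<i> * of_real (\<nu> * t))"
  have cE: "continuous_on {0..c} ?E" for c by (intro continuous_intros)
  have nE: "cmod (?E t) = 1" for t by (rule norm_exp_i_times)
  have fx: "AC x f F" using AC_subset[OF f x(2)] .
  have i1: "set_integrable lborel {0..x} (\<lambda>t. F t * ?E t)"
    by (rule set_integrable_mult_continuous[OF AC_integrable[OF fx] cE])
  have i2: "set_integrable lborel {0..x} (\<lambda>t. ?E t * f t)"
    by (intro set_integrable_continuous continuous_intros AC_continuous[OF fx])
  have "f x * ?E x = f 0 * ?E 0 + (LINT t:{0..x}|lborel. F t * ?E t + f t * (\<i> * of_real \<nu> * ?E t))"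
    using AC_eq[OF AC_mult[OF fx AC_exp] x(1)] by blast
  also have "(LINT t:{0..x}|lborel. F t * ?E t + f t * (\<i> * of_real \<nu> * ?E t))
     = (LINT t:{0..x}|lborel. F t * ?E t + (\<i> * of_real \<nu>) * (?E t * f t))"
    by (rule set_lebesgue_integral_cong) (auto simp: algebra_simps)
  also have "\<dots> = (LINT t:{0..x}|lborel. F t * ?E t) + (\<i> * of_real \<nu>) * (LINT t:{0..x}|lborel. ?E t * f t)"
    using i1 i2 by (subst set_integral_add(2)) auto
  finally have eq: "(\<i> * of_real \<nu>) * (LINT t:{0..x}|lborel. ?E t * f t) = f x * ?E x - f 0 * ?E 0 - (LINT t:{0..x}|lborel. F t * ?E t)"
    by (simp add: algebra_simps)
  have "cmod (LINT t:{0..x}|lborel. F t * ?E t) \<le> B * x + (LINT t:{0..b}|lborel. \<gamma> t)"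
  proof -
    have ac: "AC x (\<lambda>y. LINT t:{0..y}|lborel. F t * ?E t) (\<lambda>t. F t * ?E t)"
    proof (rule AC_I[OF i1])
      have "(LINT t:{0..0}|lborel. F t * ?E t) = 0"
        unfolding set_lebesgue_integral_def
        by (rule integral_eq_zero_AE, rule AE_mp[OF AE_lborel_singleton[of 0]]) (auto intro!: AE_I2 split: split_indicator)
      then show "(LINT t:{0..y}|lborel. F t * ?E t) = (LINT t:{0..0}|lborel. F t * ?E t) + (LINT t:{0..y}|lborel. F t * ?E t)" for y
        by simp
    qed
    have z: "(LINT t:{0..0}|lborel. F t * ?E t) = 0"
        unfolding set_lebesgue_integral_def
        by (rule integral_eq_zero_AE, rule AE_mp[OF AE_lborel_singleton[of 0]]) (auto intro!: AE_I2 split: split_indicator)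
    have "norm ((LINT t:{0..x}|lborel. F t * ?E t) - (LINT t:{0..0}|lborel. F t * ?E t)) \<le> B * x + 0 * x ^ Suc 0 + (LINT t:{0..x}|lborel. \<gamma> t)"
      using F x \<gamma> set_integrable_sub[OF \<gamma>(1) x(2)] by (intro AC_le[OF ac]) (auto simp: norm_mult nE)
    moreover have "(LINT t:{0..x}|lborel. \<gamma> t) \<le> (LINT t:{0..b}|lborel. \<gamma> t)"
      using \<gamma> set_integrable_sub[OF \<gamma>(1) x(2)] x unfolding set_lebesgue_integral_def set_integrable_def
      by (intro integral_mono) (auto split: split_indicator)
    ultimately show ?thesis using z by simp
  qed
  moreover have "cmod (f x * ?E x) \<le> A" "cmod (f 0 * ?E 0) \<le> A" using A[of x] A[of 0] x by (auto simp: norm_mult nE)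
  ultimately have "cmod ((\<i> * of_real \<nu>) * (LINT t:{0..x}|lborel. ?E t * f t)) \<le> 2 * A + (B * x + (LINT t:{0..b}|lborel. \<gamma> t))"
    unfolding eq by (smt (verit) norm_triangle_ineq4)
  then have "\<bar>\<nu>\<bar> * cmod (LINT t:{0..x}|lborel. ?E t * f t) \<le> 2 * A + (B * x + (LINT t:{0..b}|lborel. \<gamma> t))"
    by (simp add: norm_mult)
  then show ?thesis using \<nu> by (simp add: field_simps)
qed

section \<open>The resolvent equation as a first-order system\<close>

lemma AC_sum:
  assumes "finite I" "\<And>i. i \<in> I \<Longrightarrow> AC b (f i) (F i)"
  shows "AC b (\<lambda>x. \<Sum>i\<in>I. f i x) (\<lambda>x. \<Sum>i\<in>I. F i x)"
  using assms
proof (induct I rule: finite_induct)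
  case empty
  then show ?case using AC_const[of b 0] by simp
next
  case (insert j I)
  then show ?case using AC_add[of b "f j" "F j"] by simp
qed

text \<open>The terms free of \<mu> when the three second-order equations are solved for the highest
  derivatives; \<kappa> stands for \<open>k1/k2\<close>. Each coefficient \<open>2*l\<close> adds
  two contributions of size \<open>l\<close>, one from each strain, which have equal weight because
  \<open>k1 = k3\<close>.\<close>

definition lower_order :: "real \<Rightarrow> real \<Rightarrow> (nat \<Rightarrow> real \<Rightarrow> complex) \<Rightarrow> (nat \<Rightarrow> real \<Rightarrow> complex) \<Rightarrow> nat \<Rightarrow> real \<Rightarrow> complex" where
  "lower_order l \<kappa> u z i x =
    (if i = 1 then - z 2 x - of_real (2*l) * z 3 x + of_real (l\<^sup>2) * u 1 x
     else if i = 2 then of_real \<kappa> * (z 1 x + u 2 x + of_real l * u 3 x)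
     else of_real (2*l) * z 1 x + of_real l * u 2 x + of_real (l\<^sup>2) * u 3 x)"

text \<open>In the application \<open>u\<close> is the triple \<open>(v\<^sup>1, v\<^sup>3, v\<^sup>5)\<close>, \<open>z\<close> its derivative, \<open>Y\<close> the velocities \<open>(v\<^sup>2, v\<^sup>4, v\<^sup>6)\<close> scaled
  by the common \<open>sqrt (\<rho>1 / k1)\<close>, and \<open>D\<close> bounds the damping.\<close>
locale bresse_ode =
  fixes b l \<kappa> \<mu> D :: real and u Y z g h :: "nat \<Rightarrow> real \<Rightarrow> complex" and \<gamma> :: "real \<Rightarrow> real"
  assumes pos: "0 < b" "0 < l" "0 < \<kappa>" "0 \<le> D"
    and AC_u: "\<And>i. i \<in> {1,2,3} \<Longrightarrow> AC b (u i) (z i)"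
    and AC_Y: "\<And>i. i \<in> {1,2,3} \<Longrightarrow> AC b (Y i) (\<lambda>x. \<i> * of_real \<mu> * z i x + g i x)"
    and AC_z: "\<And>i. i \<in> {1,2,3} \<Longrightarrow> AC b (z i) (\<lambda>x. \<i> * of_real \<mu> * Y i x + (lower_order l \<kappa> u z i x + h i x))"
    and u0: "\<And>i. i \<in> {1,2,3} \<Longrightarrow> u i 0 = 0"
    and Y0: "\<And>i. i \<in> {1,2,3} \<Longrightarrow> Y i 0 = 0"
    and g_le: "\<And>i x. i \<in> {1,2,3} \<Longrightarrow> 0 \<le> x \<Longrightarrow> x \<le> b \<Longrightarrow> cmod (g i x) \<le> \<gamma> x"
    and h_le: "\<And>i x. i \<in> {1,2,3} \<Longrightarrow> 0 \<le> x \<Longrightarrow> x \<le> b \<Longrightarrow> cmod (h i x) \<le> D * cmod (Y i x) + \<gamma> x"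
    and \<gamma>_nonneg: "\<And>x. 0 \<le> \<gamma> x"
    and \<gamma>_int: "set_integrable lborel {0..b} \<gamma>" "set_integrable lborel {0..b} (\<lambda>x. (\<gamma> x)\<^sup>2)"
begin

definition "\<delta> = sqrt (LINT x:{0..b}|lborel. (\<gamma> x)\<^sup>2)"
definition "pn = cmod (z 1 0) + cmod (z 2 0) + cmod (z 3 0)"
definition "energy x = (\<Sum>i\<in>{1,2,3}. (cmod (u i x))\<^sup>2 + (cmod (Y i x))\<^sup>2 + (cmod (z i x))\<^sup>2)"

lemma \<delta>_nonneg: "0 \<le> \<delta>"
  unfolding \<delta>_def set_lebesgue_integral_def by (simp add: Bochner_Integration.integral_nonneg)

lemma \<delta>_square: "\<delta>\<^sup>2 = (LINT x:{0..b}|lborel. (\<gamma> x)\<^sup>2)"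
  unfolding \<delta>_def set_lebesgue_integral_def by (simp add: Bochner_Integration.integral_nonneg)

lemma pn_nonneg: "0 \<le> pn" by (simp add: pn_def)

lemma \<gamma>_L1: "(LINT x:{0..b}|lborel. \<gamma> x) \<le> sqrt b * \<delta>"
proof -
  have "(LINT x:{0..b}|lborel. \<gamma> x)\<^sup>2 \<le> b * \<delta>\<^sup>2"
    unfolding \<delta>_square using cauchy_schwarz_interval[OF \<gamma>_int pos(1)] .
  then have "\<bar>LINT x:{0..b}|lborel. \<gamma> x\<bar> \<le> sqrt (b * \<delta>\<^sup>2)" by (metis real_sqrt_abs real_sqrt_le_mono)
  then show ?thesis using \<delta>_nonneg by (simp add: real_sqrt_mult)
qed

lemma energy_ge:
  assumes "i \<in> {1,2,3}"
  shows "(cmod (u i x))\<^sup>2 + (cmod (Y i x))\<^sup>2 + (cmod (z i x))\<^sup>2 \<le> energy x"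
  unfolding energy_def by (rule member_le_sum) (use assms in auto)

lemma energy_nonneg: "0 \<le> energy x"
  unfolding energy_def by (intro sum_nonneg) auto

lemma energy_components:
  assumes "i \<in> {1,2,3}"
  shows "cmod (u i x) \<le> sqrt (energy x)" "cmod (Y i x) \<le> sqrt (energy x)" "cmod (z i x) \<le> sqrt (energy x)"
  by (intro real_le_rsqrt; use energy_ge[OF assms, of x] in \<open>smt (verit) zero_le_power2\<close>)+

lemma lower_order_le:
  assumes "\<And>i. i \<in> {1,2,3} \<Longrightarrow> cmod (u i x) \<le> s" "\<And>i. i \<in> {1,2,3} \<Longrightarrow> cmod (z i x) \<le> s"
  shows "cmod (lower_order l \<kappa> u z i x) \<le> (1 + 3*l + l\<^sup>2 + \<kappa>*(2 + l)) * s"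
proof -
  have b: "cmod (u 1 x) \<le> s" "cmod (u 2 x) \<le> s" "cmod (u 3 x) \<le> s"
     "cmod (z 1 x) \<le> s" "cmod (z 2 x) \<le> s" "cmod (z 3 x) \<le> s"
    using assms by auto
  have s: "0 \<le> s" using b(1) norm_ge_zero order_trans by blast
  have m: "cmod (of_real c * w) \<le> c * s" if "cmod w \<le> s" "0 \<le> c" for c w
    using that by (simp add: norm_mult mult_left_mono)
  have 1: "cmod (- z 2 x - of_real (2*l) * z 3 x + of_real (l\<^sup>2) * u 1 x) \<le> s + 2*l * s + l\<^sup>2 * s"
    by (rule order_trans[OF norm_triangle_ineq] add_mono order_trans[OF norm_triangle_ineq4])+
       (use b m[of "z 3 x" "2*l"] m[of "u 1 x" "l\<^sup>2"] pos in auto)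
  have 2: "cmod (of_real \<kappa> * (z 1 x + u 2 x + of_real l * u 3 x)) \<le> \<kappa> * (s + s + l * s)"
  proof -
    have "cmod (z 1 x + u 2 x + of_real l * u 3 x) \<le> s + s + l * s"
      using b m[of "u 3 x" l] pos by (intro norm_triangle_mono) auto
    then show ?thesis using pos by (simp add: norm_mult)
  qed
  have 3: "cmod (of_real (2*l) * z 1 x + of_real l * u 2 x + of_real (l\<^sup>2) * u 3 x) \<le> 2*l * s + l * s + l\<^sup>2 * s"
    using b m[of "z 1 x" "2*l"] m[of "u 2 x" l] m[of "u 3 x" "l\<^sup>2"] pos
    by (smt (verit) norm_triangle_ineq zero_le_power2)
  have "0 \<le> l * s" "0 \<le> l\<^sup>2 * s" "0 \<le> \<kappa> * s" "0 \<le> \<kappa> * (l * s)" using s pos by auto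
  moreover have "(1 + 3*l + l\<^sup>2 + \<kappa>*(2 + l)) * s = (s + 2 * l * s + l\<^sup>2 * s) + (l * s + \<kappa> * (s + s + l * s))"
    "(1 + 3*l + l\<^sup>2 + \<kappa>*(2 + l)) * s = \<kappa> * (s + s + l * s) + (s + 2 * (l * s) + l * s + l\<^sup>2 * s)"
    "(1 + 3*l + l\<^sup>2 + \<kappa>*(2 + l)) * s = (2 * l * s + l * s + l\<^sup>2 * s) + (s + \<kappa> * (s + s + l * s))"
    by (simp_all add: algebra_simps)
  moreover have "0 \<le> \<kappa> * (s + s + l * s)" using s pos by simp
  ultimately show ?thesis using 1 2 3 s unfolding lower_order_def
    by (smt (verit))
qed

definition "K = 1 + 3*l + l\<^sup>2 + \<kappa>*(2 + l)"

lemma K_ge_1: "1 \<le> K" using pos by (simp add: K_def)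

text \<open>The terms containing \<open>\<mu>\<close> cancel in the derivative of the energy, so that the bound is uniform in \<open>\<mu>\<close>.\<close>
lemma energy_bound:
  assumes "0 \<le> x" "x \<le> b"
  shows "energy x \<le> (pn\<^sup>2 + (3 + 12) * \<delta>\<^sup>2) * exp ((3 + 12 * (K + D)\<^sup>2) * b)"
proof -
  define e' where "e' x = (\<Sum>i\<in>{1,2,3}. 2 * Re (cnj (u i x) * z i x)
     + 2 * Re (cnj (Y i x) * (\<i> * of_real \<mu> * z i x + g i x))
     + 2 * Re (cnj (z i x) * (\<i> * of_real \<mu> * Y i x + (lower_order l \<kappa> u z i x + h i x))))" for x
  have ac: "AC b energy e'"
  proof -
    have i: "AC b (\<lambda>x. (cmod (u i x))\<^sup>2 + (cmod (Y i x))\<^sup>2 + (cmod (z i x))\<^sup>2) (\<lambda>x. 2 * Re (cnj (u i x) * z i x)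
     + 2 * Re (cnj (Y i x) * (\<i> * of_real \<mu> * z i x + g i x))
     + 2 * Re (cnj (z i x) * (\<i> * of_real \<mu> * Y i x + (lower_order l \<kappa> u z i x + h i x))))" if "i \<in> {1,2,3}" for i
      by (intro AC_add AC_norm2 AC_u AC_Y AC_z that)
    show ?thesis unfolding energy_def[abs_def] e'_def[abs_def] by (rule AC_sum[OF _ i]) auto
  qed
  have le: "e' x \<le> (3 + 12 * (K + D)\<^sup>2) * energy x + 15 * (\<gamma> x)\<^sup>2" if x: "0 \<le> x" "x \<le> b" for x
  proof -
    let ?s = "sqrt (energy x)"
    have t: "2 * Re (cnj (u i x) * z i x) + 2 * Re (cnj (Y i x) * (\<i> * of_real \<mu> * z i x + g i x))
     + 2 * Re (cnj (z i x) * (\<i> * of_real \<mu> * Y i x + (lower_order l \<kappa> u z i x + h i x)))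
      \<le> 2 * ((cmod (u i x))\<^sup>2 + (cmod (Y i x))\<^sup>2 + (cmod (z i x))\<^sup>2) + (\<gamma> x)\<^sup>2 + 2 * ((K + D)\<^sup>2 * energy x) + 2 * (\<gamma> x)\<^sup>2"
      if i: "i \<in> {1,2,3}" for i
    proof -
      have r: "2 * Re (cnj w * v) \<le> (cmod w)\<^sup>2 + (cmod v)\<^sup>2" for w v
      proof -
        have "0 \<le> (cmod (w - v))\<^sup>2" by simp
        then show ?thesis unfolding cmod_power2 by (simp add: power2_eq_square algebra_simps)
      qed
      \<comment> \<open>The two terms containing \<mu> add up to \<i> times a real number.\<close>
      have c: "2 * Re (cnj (Y i x) * (\<i> * of_real \<mu> * z i x + g i x))
     + 2 * Re (cnj (z i x) * (\<i> * of_real \<mu> * Y i x + (lower_order l \<kappa> u z i x + h i x)))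
       = 2 * Re (cnj (Y i x) * g i x) + 2 * Re (cnj (z i x) * (lower_order l \<kappa> u z i x + h i x))"
        by (simp add: algebra_simps)
      have "cmod (lower_order l \<kappa> u z i x + h i x) \<le> (K + D) * ?s + \<gamma> x"
      proof -
        have "cmod (lower_order l \<kappa> u z i x) \<le> K * ?s"
          unfolding K_def by (rule lower_order_le) (auto intro: energy_components)
        moreover have "cmod (h i x) \<le> D * ?s + \<gamma> x"
          using h_le[OF i x] energy_components(2)[OF i, of x] pos(4) by (smt (verit) mult_left_mono)
        ultimately show ?thesis by (smt (verit) norm_triangle_ineq distrib_right)
      qed
      then have "(cmod (lower_order l \<kappa> u z i x + h i x))\<^sup>2 \<le> ((K + D) * ?s + \<gamma> x)\<^sup>2"
        by (intro power_mono) auto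
      also have "\<dots> \<le> 2 * ((K + D) * ?s)\<^sup>2 + 2 * (\<gamma> x)\<^sup>2"
        using sum_squares_ge_zero[of "(K + D) * ?s - \<gamma> x" 0] by (simp add: power2_eq_square algebra_simps)
      also have "((K + D) * ?s)\<^sup>2 = (K + D)\<^sup>2 * energy x" using energy_nonneg by (simp add: power_mult_distrib)
      finally have R: "(cmod (lower_order l \<kappa> u z i x + h i x))\<^sup>2 \<le> 2 * ((K + D)\<^sup>2 * energy x) + 2 * (\<gamma> x)\<^sup>2" .
      have G: "(cmod (g i x))\<^sup>2 \<le> (\<gamma> x)\<^sup>2" using g_le[OF i x] by (intro power_mono) auto
      show ?thesis
        using c R G r[of "u i x" "z i x"] r[of "Y i x" "g i x"] r[of "z i x" "lower_order l \<kappa> u z i x + h i x"]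
        by (smt (verit) zero_le_power2)
    qed
    have "e' x \<le> (\<Sum>i\<in>{1,2,3::nat}. 2 * ((cmod (u i x))\<^sup>2 + (cmod (Y i x))\<^sup>2 + (cmod (z i x))\<^sup>2) + (\<gamma> x)\<^sup>2 + 2 * ((K + D)\<^sup>2 * energy x) + 2 * (\<gamma> x)\<^sup>2)"
      unfolding e'_def by (rule sum_mono) (rule t)
    also have "\<dots> = 2 * energy x + 3 * ((\<gamma> x)\<^sup>2 + 2 * ((K + D)\<^sup>2 * energy x) + 2 * (\<gamma> x)\<^sup>2)"
      unfolding energy_def by (simp add: algebra_simps)
    finally have "e' x \<le> 2 * energy x + 3 * ((\<gamma> x)\<^sup>2 + 2 * ((K + D)\<^sup>2 * energy x) + 2 * (\<gamma> x)\<^sup>2)" .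
    moreover have "0 \<le> (\<gamma> x)\<^sup>2" "0 \<le> (K + D)\<^sup>2 * energy x" using energy_nonneg by auto
    moreover have "E \<le> 3 * e + 12 * w + 15 * q" if "E \<le> 2 * e + 3 * (q + 2 * w + 2 * q)" "0 \<le> q" "0 \<le> w" "0 \<le> e" for E e w q :: real
    proof -
      have "2 * e + 3 * (q + 2 * w + 2 * q) = 2 * e + 6 * w + 9 * q" by simp
      then show ?thesis using that by linarith
    qed
    ultimately have "e' x \<le> 3 * energy x + 12 * ((K + D)\<^sup>2 * energy x) + 15 * (\<gamma> x)\<^sup>2"
      using energy_nonneg[of x] by blast
    then show ?thesis by (simp only: distrib_right mult.assoc)
  qed
  have "energy x \<le> (energy 0 + (LINT t:{0..b}|lborel. 15 * (\<gamma> t)\<^sup>2)) * exp ((3 + 12 * (K + D)\<^sup>2) * b)"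
    by (rule gronwall_AC[OF ac le]) (use assms energy_nonneg \<gamma>_int in auto)
  also have "(LINT t:{0..b}|lborel. 15 * (\<gamma> t)\<^sup>2) = 15 * \<delta>\<^sup>2" by (simp add: \<delta>_square)
  also have "(energy 0 + 15 * \<delta>\<^sup>2) * exp ((3 + 12 * (K + D)\<^sup>2) * b) \<le> (pn\<^sup>2 + 15 * \<delta>\<^sup>2) * exp ((3 + 12 * (K + D)\<^sup>2) * b)"
  proof -
    have "energy 0 \<le> pn\<^sup>2" by (simp add: energy_def pn_def u0 Y0 power2_eq_square algebra_simps)
    then show ?thesis by simp
  qed
  finally show ?thesis by simp
qed

text \<open>The factor 4 exceeds the square root of the 15 in \<open>energy_bound\<close>, and the
  exponential, being at least 1, dominates its own square root. \<open>S\<close> is thus a bound for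
  every component in terms of slopes and data.\<close>

definition "K0 = 4 * exp ((3 + 12 * (K + D)\<^sup>2) * b)"
definition "S = K0 * (pn + \<delta>)"

lemma K0_ge_1: "1 \<le> K0"
proof -
  have "1 \<le> exp ((3 + 12 * (K + D)\<^sup>2) * b)" using pos by simp
  then show ?thesis unfolding K0_def by linarith
qed

lemma S_nonneg: "0 \<le> S" using K0_ge_1 pn_nonneg \<delta>_nonneg by (simp add: S_def)

lemma sqrt_energy_le_S:
  assumes "0 \<le> x" "x \<le> b" shows "sqrt (energy x) \<le> S"
proof (rule real_le_lsqrt)
  let ?E = "exp ((3 + 12 * (K + D)\<^sup>2) * b)"
  have E: "1 \<le> ?E" using pos by simp
  have "energy x \<le> (pn\<^sup>2 + 15 * \<delta>\<^sup>2) * ?E" using energy_bound[OF assms] by simp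
  also have "\<dots> \<le> (16 * (pn + \<delta>)\<^sup>2) * (?E * ?E)"
  proof (rule mult_mono)
    show "pn\<^sup>2 + 15 * \<delta>\<^sup>2 \<le> 16 * (pn + \<delta>)\<^sup>2" using pn_nonneg \<delta>_nonneg by (simp add: power2_eq_square algebra_simps)
    show "?E \<le> ?E * ?E" using E by simp
  qed auto
  finally show "energy x \<le> S\<^sup>2" by (simp add: S_def K0_def power_mult_distrib power2_eq_square algebra_simps)
qed (rule S_nonneg)

lemma bounds:
  assumes "0 \<le> x" "x \<le> b" "i \<in> {1,2,3}"
  shows "cmod (u i x) \<le> S" "cmod (Y i x) \<le> S" "cmod (z i x) \<le> S"
  using energy_components[OF assms(3), of x] sqrt_energy_le_S[OF assms(1,2)] by linarith+

end

section \<open>Observability from the damped end\<close>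

lemma set_integral_point [simp]:
  fixes F :: "real \<Rightarrow> 'a::euclidean_space"
  shows "(LINT t:{c}|lborel. F t) = 0"
  unfolding set_lebesgue_integral_def
  by (rule integral_eq_zero_AE, rule AE_mp[OF AE_lborel_singleton[of c]]) (auto intro!: AE_I2 split: split_indicator)

lemma AC_integral:
  fixes F :: "real \<Rightarrow> 'a::euclidean_space"
  assumes "set_integrable lborel {0..b} F"
  shows "AC b (\<lambda>x. LINT t:{0..x}|lborel. F t) F"
  by (rule AC_I[OF assms]) (simp add: set_integral_point)

lemma norm_integral_le:
  fixes F :: "real \<Rightarrow> 'a::euclidean_space"
  assumes "set_integrable lborel {0..b} F" "\<And>x. 0 \<le> x \<Longrightarrow> x \<le> b \<Longrightarrow> norm (F x) \<le> \<gamma> x"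
    "set_integrable lborel {0..b} \<gamma>" "\<And>x. 0 \<le> \<gamma> x" "0 \<le> x" "x \<le> b"
  shows "norm (LINT t:{0..x}|lborel. F t) \<le> (LINT t:{0..b}|lborel. \<gamma> t)"
  using AC_le[OF AC_integral[OF assms(1)], of 0 0 0 \<gamma> x] assms by (simp add: set_integral_point)

lemma AC_monomial:
  "AC b (\<lambda>x. c * of_real x ^ Suc n) (\<lambda>x. of_nat (Suc n) * c * of_real x ^ n :: complex)"
proof (rule AC_C1)
  fix x :: real
  have "((\<lambda>z. c * z ^ Suc n) has_field_derivative of_nat (Suc n) * c * of_real x ^ n) (at (of_real x))"
    using DERIV_cmult[OF DERIV_power[OF DERIV_ident, of "Suc n" "of_real x" UNIV], of c] by (simp add: algebra_simps)
  from has_vector_derivative_real_field[OF this, of UNIV]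
  show "((\<lambda>x. c * of_real x ^ Suc n) has_vector_derivative of_nat (Suc n) * c * of_real x ^ n) (at x)" by simp
qed (intro continuous_intros)

text \<open>The hypotheses concern the values at 1, 2, 3 of a cubic without constant term. The
  Vandermonde system is inverted explicitly, and the absolute sums of the rows of the inverse stay
  below 20.\<close>

lemma cubic_coefficients_le:
  fixes a b c :: complex
  assumes "cmod (a + b + c) \<le> m" "cmod (2 * a + 4 * b + 8 * c) \<le> m" "cmod (3 * a + 9 * b + 27 * c) \<le> m"
  shows "cmod a \<le> 20 * m" "cmod b \<le> 20 * m" "cmod c \<le> 20 * m"
proof -
  define p q r where "p = a + b + c" and "q = 2 * a + 4 * b + 8 * c" and "r = 3 * a + 9 * b + 27 * c"
  have pqr: "cmod p \<le> m" "cmod q \<le> m" "cmod r \<le> m" using assms by (auto simp: p_def q_def r_def)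
  have n: "cmod (of_real s * w) \<le> \<bar>s\<bar> * m" if "cmod w \<le> m" for s w
    using that by (simp add: norm_mult mult_left_mono)
  have lin: "cmod (of_real s * p + of_real t * q + of_real v * r) \<le> \<bar>s\<bar> * m + \<bar>t\<bar> * m + \<bar>v\<bar> * m" for s t v
    by (intro norm_triangle_mono n pqr)
  have "a = of_real 3 * p + of_real (-3/2) * q + of_real (1/3) * r"
       "b = of_real (-5/2) * p + of_real 2 * q + of_real (-1/2) * r"
       "c = of_real (1/2) * p + of_real (-1/2) * q + of_real (1/6) * r"
    by (simp_all add: p_def q_def r_def field_simps)
  moreover have "0 \<le> m" using assms(1) norm_ge_zero order_trans by blast
  ultimately show "cmod a \<le> 20 * m" "cmod b \<le> 20 * m" "cmod c \<le> 20 * m"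
    using lin[of 3 "-3/2" "1/3"] lin[of "-5/2" 2 "-1/2"] lin[of "1/2" "-1/2" "1/6"] by simp_all
qed

text \<open>Dividing the equation at the sample point \<open>n\<close> by \<open>n\<close> reduces
  the degrees 2, 3, 4 to 1, 2, 3 and only improves the bound.\<close>

lemma quartic_coefficients_le:
  fixes a b c :: complex
  assumes "cmod (a + b + c) \<le> m" "cmod (4 * a + 8 * b + 16 * c) \<le> m" "cmod (9 * a + 27 * b + 81 * c) \<le> m"
  shows "cmod a \<le> 20 * m" "cmod b \<le> 20 * m" "cmod c \<le> 20 * m"
proof -
  have "cmod (2 * a + 4 * b + 8 * c) \<le> m"
  proof -
    have "4 * a + 8 * b + 16 * c = 2 * (2 * a + 4 * b + 8 * c)" by (simp add: algebra_simps)
    then have "2 * cmod (2 * a + 4 * b + 8 * c) \<le> m" using assms(2) by (simp only: norm_mult norm_numeral)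
    then show ?thesis by (smt (verit) norm_ge_zero)
  qed
  moreover have "cmod (3 * a + 9 * b + 27 * c) \<le> m"
  proof -
    have "9 * a + 27 * b + 81 * c = 3 * (3 * a + 9 * b + 27 * c)" by (simp add: algebra_simps)
    then have "3 * cmod (3 * a + 9 * b + 27 * c) \<le> m" using assms(3) by (simp only: norm_mult norm_numeral)
    then show ?thesis by (smt (verit) norm_ge_zero)
  qed
  ultimately show "cmod a \<le> 20 * m" "cmod b \<le> 20 * m" "cmod c \<le> 20 * m"
    using cubic_coefficients_le[OF assms(1)] by auto
qed

lemma cmod_of_real_mult_le: "cmod w \<le> s \<Longrightarrow> 0 \<le> c \<Longrightarrow> cmod (of_real c * w) \<le> c * s"
  by (simp add: norm_mult mult_left_mono)

text \<open>On the damped interval the damping counts as data rather than as a coefficient: it is a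
  multiple of the observed velocity and goes into \<gamma>, so the growth constant \<open>D\<close>
  is 0.\<close>

locale bresse_ode0 = bresse_ode b l \<kappa> \<mu> 0 u Y z g h \<gamma>
  for b l \<kappa> \<mu> :: real and u Y z g h :: "nat \<Rightarrow> real \<Rightarrow> complex" and \<gamma> :: "real \<Rightarrow> real"
begin

definition "\<theta> = sqrt b * \<delta>"

lemma \<theta>_nonneg: "0 \<le> \<theta>" using pos \<delta>_nonneg by (simp add: \<theta>_def)

lemma \<gamma>_int_le: "(LINT x:{0..b}|lborel. \<gamma> x) \<le> \<theta>" unfolding \<theta>_def by (rule \<gamma>_L1)

lemma h_bound: "i \<in> {1,2,3} \<Longrightarrow> 0 \<le> x \<Longrightarrow> x \<le> b \<Longrightarrow> cmod (h i x) \<le> \<gamma> x" using h_le[of i x] by simp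

lemma lower_order_bound:
  assumes "0 \<le> x" "x \<le> b" shows "cmod (lower_order l \<kappa> u z i x) \<le> K * S"
  unfolding K_def by (rule lower_order_le) (use bounds[OF assms] in auto)

lemma cont:
  assumes "i \<in> {1,2,3}"
  shows "continuous_on {0..b} (u i)" "continuous_on {0..b} (Y i)" "continuous_on {0..b} (z i)"
  using AC_continuous AC_u[OF assms] AC_Y[OF assms] AC_z[OF assms] by blast+

lemma lower_order_cont: "continuous_on {0..b} (lower_order l \<kappa> u z i)"
proof -
  have "lower_order l \<kappa> u z i = (if i = 1 then (\<lambda>x. - z 2 x - of_real (2*l) * z 3 x + of_real (l\<^sup>2) * u 1 x)
     else if i = 2 then (\<lambda>x. of_real \<kappa> * (z 1 x + u 2 x + of_real l * u 3 x))
     else (\<lambda>x. of_real (2*l) * z 1 x + of_real l * u 2 x + of_real (l\<^sup>2) * u 3 x))"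
    by (auto simp: lower_order_def fun_eq_iff)
  then show ?thesis
    using cont[of 1] cont[of 2] cont[of 3] by (auto intro!: continuous_intros)
qed

lemma g_int: assumes "i \<in> {1,2,3}" shows "set_integrable lborel {0..b} (g i)"
proof -
  have "set_integrable lborel {0..b} (\<lambda>x. (\<i> * of_real \<mu> * z i x + g i x) - \<i> * of_real \<mu> * z i x)"
    by (intro set_integral_diff(1) AC_integrable[OF AC_Y] assms set_integrable_continuous continuous_intros cont)
  then show ?thesis by simp
qed

lemma h_int: assumes "i \<in> {1,2,3}" shows "set_integrable lborel {0..b} (h i)"
proof -
  have "set_integrable lborel {0..b} (\<lambda>x. (\<i> * of_real \<mu> * Y i x + (lower_order l \<kappa> u z i x + h i x))
      - (\<i> * of_real \<mu> * Y i x + lower_order l \<kappa> u z i x))"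
    by (intro set_integral_diff(1) AC_integrable[OF AC_z] assms set_integrable_continuous continuous_intros cont lower_order_cont)
  then show ?thesis by simp
qed

section \<open>Characteristic variables and the averaged system\<close>

definition "ph \<nu> x = exp (\<i> * of_real (\<nu> * x))"

lemma norm_ph [simp]: "cmod (ph \<nu> x) = 1" unfolding ph_def by (rule norm_exp_i_times)

lemma ph_add: "ph \<nu> x * ph \<nu>' x = ph (\<nu> + \<nu>') x"
  unfolding ph_def exp_add[symmetric] by (simp add: algebra_simps)

lemma ph_0 [simp]: "ph 0 x = 1" "ph \<nu> 0 = 1" by (simp_all add: ph_def)

lemma ph_cont: "continuous_on A (ph \<nu>)" unfolding ph_def[abs_def] by (intro continuous_intros)

lemma AC_ph: "AC b (ph \<nu>) (\<lambda>x. \<i> * of_real \<nu> * ph \<nu> x)"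
  unfolding ph_def[abs_def] by (rule AC_exp)

text \<open>The waves travelling in the two directions, with their phases removed: outside the
  phases, no factor \<mu> remains in the derivatives of \<open>P\<close> and \<open>Q\<close>, so
  both vary slowly uniformly in the frequency.\<close>

definition "P i x = ph (- \<mu>) x * (z i x + Y i x)"
definition "Q i x = ph \<mu> x * (z i x - Y i x)"

lemma AC_P:
  assumes i: "i \<in> {1,2,3}"
  shows "AC b (P i) (\<lambda>x. ph (- \<mu>) x * (lower_order l \<kappa> u z i x + (h i x + g i x)))"
  unfolding P_def[abs_def]
  by (rule AC_cong[OF AC_mult[OF AC_ph[of "- \<mu>"] AC_add[OF AC_z[OF i] AC_Y[OF i]]]]) (simp_all add: algebra_simps)

lemma AC_Q:
  assumes i: "i \<in> {1,2,3}"
  shows "AC b (Q i) (\<lambda>x. ph \<mu> x * (lower_order l \<kappa> u z i x + (h i x - g i x)))"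
  unfolding Q_def[abs_def]
  by (rule AC_cong[OF AC_mult[OF AC_ph[of \<mu>] AC_diff[OF AC_z[OF i] AC_Y[OF i]]]]) (simp_all add: algebra_simps)

lemma P_le: "0 \<le> x \<Longrightarrow> x \<le> b \<Longrightarrow> i \<in> {1,2,3} \<Longrightarrow> cmod (P i x) \<le> 2 * S"
  using norm_triangle_mono[OF bounds(3) bounds(2)] by (simp add: P_def norm_mult)

lemma Q_le: "0 \<le> x \<Longrightarrow> x \<le> b \<Longrightarrow> i \<in> {1,2,3} \<Longrightarrow> cmod (Q i x) \<le> 2 * S"
  using norm_triangle_ineq4[of "z i x" "Y i x"] bounds[of x i] by (simp add: Q_def norm_mult)

text \<open>Seen in the phase of \<open>P\<close>, the opposite wave carries the rapid phase
  \<open>ph (- 2 * \<mu>)\<close>. Its integral is small because \<open>Q\<close> varies slowly, so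
  on average only half of \<open>P\<close> is left of the strain.\<close>

lemma ph_z: "ph (- \<mu>) x * z i x = P i x / 2 + ph (- 2 * \<mu>) x * Q i x / 2"
proof -
  have "ph (- 2 * \<mu>) x * ph \<mu> x = ph (- \<mu>) x" by (simp add: ph_add)
  then have e: "ph (- 2 * \<mu>) x * Q i x = ph (- \<mu>) x * (z i x - Y i x)"
    by (simp add: Q_def mult.assoc[symmetric])
  show ?thesis unfolding e P_def by (simp add: field_simps)
qed

lemma ph_Y: "ph (- \<mu>) x * Y i x = P i x / 2 - ph (- 2 * \<mu>) x * Q i x / 2"
proof -
  have "ph (- 2 * \<mu>) x * ph \<mu> x = ph (- \<mu>) x" by (simp add: ph_add)
  then have e: "ph (- 2 * \<mu>) x * Q i x = ph (- \<mu>) x * (z i x - Y i x)"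
    by (simp add: Q_def mult.assoc[symmetric])
  show ?thesis unfolding e P_def by (simp add: field_simps)
qed

definition "OQ i x = (LINT t:{0..x}|lborel. ph (- 2 * \<mu>) t * Q i t)"
definition "OU i x = (LINT t:{0..x}|lborel. ph (- \<mu>) t * u i t)"
definition "OH i x = (LINT t:{0..x}|lborel. ph (- \<mu>) t * (h i t + g i t))"
text \<open>A common bound for the oscillatory integrals of \<open>Q\<close> and of
  \<open>u\<close>: \<open>4 * S\<close> comes from the boundary terms of \<open>Q\<close>,
  \<open>(K + 1) * b * S\<close> from the slow derivatives, \<open>2 * \<theta>\<close> from the
  data.\<close>

definition "W = ((4 + (K + 1) * b) * S + 2 * \<theta>) / \<bar>\<mu>\<bar>"
definition "\<eta> = K * W + 2 * \<theta>"

lemma AC_OQ: "i \<in> {1,2,3} \<Longrightarrow> AC b (OQ i) (\<lambda>x. ph (- 2 * \<mu>) x * Q i x)"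
  unfolding OQ_def[abs_def]
  by (intro AC_integral set_integrable_continuous continuous_intros ph_cont AC_continuous[OF AC_Q])

lemma AC_OU: "i \<in> {1,2,3} \<Longrightarrow> AC b (OU i) (\<lambda>x. ph (- \<mu>) x * u i x)"
  unfolding OU_def[abs_def]
  by (intro AC_integral set_integrable_continuous continuous_intros ph_cont cont)

lemma AC_OH: "i \<in> {1,2,3} \<Longrightarrow> AC b (OH i) (\<lambda>x. ph (- \<mu>) x * (h i x + g i x))"
  unfolding OH_def[abs_def]
  using set_integrable_mult_continuous[OF set_integral_add(1)[OF h_int g_int] ph_cont]
  by (intro AC_integral) (simp add: mult.commute)

lemma twice_\<gamma>: "set_integrable lborel {0..b} (\<lambda>x. 2 * \<gamma> x)" "(LINT x:{0..b}|lborel. 2 * \<gamma> x) \<le> 2 * \<theta>"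
  using \<gamma>_int \<gamma>_int_le by auto

lemma OQ_le:
  assumes "\<mu> \<noteq> 0" "0 \<le> x" "x \<le> b" "i \<in> {1,2,3}" shows "cmod (OQ i x) \<le> W"
proof -
  have "cmod (LINT t:{0..x}|lborel. exp (\<i> * of_real ((- 2 * \<mu>) * t)) * Q i t)
     \<le> (2 * (2 * S) + (K * S) * x + (LINT t:{0..b}|lborel. 2 * \<gamma> t)) / \<bar>- 2 * \<mu>\<bar>"
  proof (rule oscillatory_integral[OF AC_Q[OF assms(4)] Q_le])
    fix x assume x: "0 \<le> x" "x \<le> b"
    have "cmod (lower_order l \<kappa> u z i x + (h i x - g i x)) \<le> K * S + (\<gamma> x + \<gamma> x)"
      using norm_triangle_ineq4[of "h i x" "g i x"] h_bound[OF assms(4) x] g_le[OF assms(4) x]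
      by (intro norm_triangle_mono lower_order_bound x) linarith
    then show "cmod (ph \<mu> x * (lower_order l \<kappa> u z i x + (h i x - g i x))) \<le> K * S + 2 * \<gamma> x"
      by (simp add: norm_mult)
  qed (use assms twice_\<gamma> \<gamma>_nonneg in auto)
  also have "\<dots> \<le> (2 * (2 * S) + (K * S) * b + 2 * \<theta>) / \<bar>- 2 * \<mu>\<bar>"
    using assms twice_\<gamma> S_nonneg K_ge_1 by (intro divide_right_mono add_mono mult_left_mono) auto
  also have "\<dots> \<le> W"
    unfolding W_def abs_mult using S_nonneg \<theta>_nonneg pos K_ge_1 assms(1)
    by (intro frac_le) (auto simp: algebra_simps)
  finally show ?thesis by (simp add: OQ_def ph_def)
qed

lemma OU_le:
  assumes "\<mu> \<noteq> 0" "0 \<le> x" "x \<le> b" "i \<in> {1,2,3}" shows "cmod (OU i x) \<le> W"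
proof -
  have "cmod (LINT t:{0..x}|lborel. exp (\<i> * of_real ((- \<mu>) * t)) * u i t)
     \<le> (2 * S + S * x + (LINT t:{0..b}|lborel. 0)) / \<bar>- \<mu>\<bar>"
    by (rule oscillatory_integral[OF AC_u[OF assms(4)]]) (use assms bounds set_integrable_continuous[OF continuous_on_const] in auto)
  also have "\<dots> \<le> (2 * S + S * b + 0) / \<bar>- \<mu>\<bar>"
    using assms S_nonneg by (intro divide_right_mono add_mono mult_left_mono) auto
  also have "\<dots> \<le> W"
    unfolding W_def using S_nonneg \<theta>_nonneg pos K_ge_1 assms(1)
    by (intro frac_le) (auto simp: algebra_simps)
  finally show ?thesis by (simp add: OU_def ph_def)
qed

lemma OH_le:
  assumes "0 \<le> x" "x \<le> b" "i \<in> {1,2,3}" shows "cmod (OH i x) \<le> 2 * \<theta>"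
proof -
  have "cmod (OH i x) \<le> (LINT t:{0..b}|lborel. 2 * \<gamma> t)"
    unfolding OH_def
  proof (rule norm_integral_le[OF AC_integrable[OF AC_OH[OF assms(3)]]])
    fix x assume x: "0 \<le> x" "x \<le> b"
    show "cmod (ph (- \<mu>) x * (h i x + g i x)) \<le> 2 * \<gamma> x"
      using norm_triangle_mono[OF h_bound[OF assms(3) x] g_le[OF assms(3) x]] by (simp add: norm_mult)
  qed (use assms twice_\<gamma> \<gamma>_nonneg in auto)
  then show ?thesis using twice_\<gamma> by linarith
qed

text \<open>The contribution of opposite waves, displacements and data to \<open>P i\<close>,
  already integrated. Smallness appears only after integration, hence this part is subtracted from
  \<open>P i\<close> instead of being estimated inside its derivative.\<close>

definition "eps (i::nat) x = (if i = 1 then - (OQ 2 x / 2) - of_real l * OQ 3 x + of_real (l\<^sup>2) * OU 1 x + OH 1 x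
  else if i = 2 then of_real (\<kappa>/2) * OQ 1 x + of_real \<kappa> * OU 2 x + of_real (\<kappa>*l) * OU 3 x + OH 2 x
  else of_real l * OQ 1 x + of_real l * OU 2 x + of_real (l\<^sup>2) * OU 3 x + OH 3 x)"

lemma eps_0: "eps i 0 = 0"
  by (simp add: eps_def OQ_def OU_def OH_def set_integral_point)

lemma W_nonneg: "0 \<le> W" using S_nonneg \<theta>_nonneg pos K_ge_1 by (simp add: W_def)

lemma eps_le:
  assumes "\<mu> \<noteq> 0" "0 \<le> x" "x \<le> b" shows "cmod (eps i x) \<le> \<eta>"
proof -
  note [simp] = OQ_le[OF assms] OU_le[OF assms] OH_le[OF assms(2,3)]
  have K: "1/2 * W + l * W + l\<^sup>2 * W \<le> K * W" "\<kappa>/2 * W + \<kappa> * W + (\<kappa>*l) * W \<le> K * W" "l * W + l * W + l\<^sup>2 * W \<le> K * W"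
    using pos unfolding distrib_right[symmetric] K_def by (intro mult_right_mono W_nonneg; simp add: algebra_simps)+
  have 1: "cmod (- (OQ 2 x / 2) - of_real l * OQ 3 x + of_real (l\<^sup>2) * OU 1 x + OH 1 x) \<le> 1/2 * W + l * W + l\<^sup>2 * W + 2 * \<theta>"
  proof -
    have e: "- (OQ 2 x / 2) - of_real l * OQ 3 x + of_real (l\<^sup>2) * OU 1 x + OH 1 x
       = of_real (1/2) * (- OQ 2 x) + of_real l * (- OQ 3 x) + of_real (l\<^sup>2) * OU 1 x + OH 1 x" by simp
    show ?thesis unfolding e using pos by (intro norm_triangle_mono cmod_of_real_mult_le) auto
  qed
  have 2: "cmod (of_real (\<kappa>/2) * OQ 1 x + of_real \<kappa> * OU 2 x + of_real (\<kappa>*l) * OU 3 x + OH 2 x) \<le> \<kappa>/2 * W + \<kappa> * W + (\<kappa>*l) * W + 2 * \<theta>"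
    using pos by (intro norm_triangle_mono cmod_of_real_mult_le) auto
  have 3: "cmod (of_real l * OQ 1 x + of_real l * OU 2 x + of_real (l\<^sup>2) * OU 3 x + OH 3 x) \<le> l * W + l * W + l\<^sup>2 * W + 2 * \<theta>"
    using pos by (intro norm_triangle_mono cmod_of_real_mult_le) auto
  show ?thesis using 1 2 3 K unfolding eps_def \<eta>_def by (smt (verit))
qed

definition "M (i::nat) x = (if i = 1 then - (P 2 x / 2) - of_real l * P 3 x else if i = 2 then of_real (\<kappa>/2) * P 1 x else of_real l * P 1 x)"

text \<open>In the phase of \<open>P\<close>, each \<open>z\<close> is \<open>P / 2\<close> plus an
  oscillating term. The first parts form the closed system \<open>M\<close> with constant
  coefficients; all remaining terms make up the derivative of \<open>eps\<close>.\<close>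

lemma AC_P_eps:
  assumes "i \<in> {1,2,3}" shows "AC b (\<lambda>x. P i x - eps i x) (M i)"
proof -
  have ac: "AC b (\<lambda>x. P 1 x - (- (OQ 2 x / 2) - of_real l * OQ 3 x + of_real (l\<^sup>2) * OU 1 x + OH 1 x)) (M 1)"
  proof (rule AC_cong)
    show "AC b (\<lambda>x. P 1 x - (of_real (-1/2) * OQ 2 x - of_real l * OQ 3 x + of_real (l\<^sup>2) * OU 1 x + OH 1 x))
      (\<lambda>x. ph (- \<mu>) x * (lower_order l \<kappa> u z 1 x + (h 1 x + g 1 x)) - (of_real (-1/2) * (ph (- 2 * \<mu>) x * Q 2 x)
         - of_real l * (ph (- 2 * \<mu>) x * Q 3 x) + of_real (l\<^sup>2) * (ph (- \<mu>) x * u 1 x) + ph (- \<mu>) x * (h 1 x + g 1 x)))"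
      by (intro AC_diff AC_add AC_cmult AC_P AC_OQ AC_OU AC_OH) auto
  next
    fix x
    have "ph (- \<mu>) x * lower_order l \<kappa> u z 1 x = - (ph (- \<mu>) x * z 2 x) - of_real (2*l) * (ph (- \<mu>) x * z 3 x) + of_real (l\<^sup>2) * (ph (- \<mu>) x * u 1 x)"
      by (simp add: lower_order_def algebra_simps)
    then show "ph (- \<mu>) x * (lower_order l \<kappa> u z 1 x + (h 1 x + g 1 x)) - (of_real (-1/2) * (ph (- 2 * \<mu>) x * Q 2 x)
         - of_real l * (ph (- 2 * \<mu>) x * Q 3 x) + of_real (l\<^sup>2) * (ph (- \<mu>) x * u 1 x) + ph (- \<mu>) x * (h 1 x + g 1 x)) = M 1 x"
      unfolding distrib_left[of "ph (- \<mu>) x" "lower_order l \<kappa> u z 1 x"] ph_z M_def by (simp add: algebra_simps)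
  qed simp
  have ac2: "AC b (\<lambda>x. P 2 x - (of_real (\<kappa>/2) * OQ 1 x + of_real \<kappa> * OU 2 x + of_real (\<kappa>*l) * OU 3 x + OH 2 x)) (M 2)"
  proof (rule AC_cong)
    show "AC b (\<lambda>x. P 2 x - (of_real (\<kappa>/2) * OQ 1 x + of_real \<kappa> * OU 2 x + of_real (\<kappa>*l) * OU 3 x + OH 2 x))
      (\<lambda>x. ph (- \<mu>) x * (lower_order l \<kappa> u z 2 x + (h 2 x + g 2 x)) - (of_real (\<kappa>/2) * (ph (- 2 * \<mu>) x * Q 1 x)
         + of_real \<kappa> * (ph (- \<mu>) x * u 2 x) + of_real (\<kappa>*l) * (ph (- \<mu>) x * u 3 x) + ph (- \<mu>) x * (h 2 x + g 2 x)))"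
      by (intro AC_diff AC_add AC_cmult AC_P AC_OQ AC_OU AC_OH) auto
  next
    fix x
    have "ph (- \<mu>) x * lower_order l \<kappa> u z 2 x = of_real \<kappa> * (ph (- \<mu>) x * z 1 x) + of_real \<kappa> * (ph (- \<mu>) x * u 2 x) + of_real (\<kappa>*l) * (ph (- \<mu>) x * u 3 x)"
      by (simp add: lower_order_def algebra_simps)
    then show "ph (- \<mu>) x * (lower_order l \<kappa> u z 2 x + (h 2 x + g 2 x)) - (of_real (\<kappa>/2) * (ph (- 2 * \<mu>) x * Q 1 x)
         + of_real \<kappa> * (ph (- \<mu>) x * u 2 x) + of_real (\<kappa>*l) * (ph (- \<mu>) x * u 3 x) + ph (- \<mu>) x * (h 2 x + g 2 x)) = M 2 x"
      unfolding distrib_left[of "ph (- \<mu>) x" "lower_order l \<kappa> u z 2 x"] ph_z M_def by (simp add: algebra_simps)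
  qed simp
  have ac3: "AC b (\<lambda>x. P 3 x - (of_real l * OQ 1 x + of_real l * OU 2 x + of_real (l\<^sup>2) * OU 3 x + OH 3 x)) (M 3)"
  proof (rule AC_cong)
    show "AC b (\<lambda>x. P 3 x - (of_real l * OQ 1 x + of_real l * OU 2 x + of_real (l\<^sup>2) * OU 3 x + OH 3 x))
      (\<lambda>x. ph (- \<mu>) x * (lower_order l \<kappa> u z 3 x + (h 3 x + g 3 x)) - (of_real l * (ph (- 2 * \<mu>) x * Q 1 x)
         + of_real l * (ph (- \<mu>) x * u 2 x) + of_real (l\<^sup>2) * (ph (- \<mu>) x * u 3 x) + ph (- \<mu>) x * (h 3 x + g 3 x)))"
      by (intro AC_diff AC_add AC_cmult AC_P AC_OQ AC_OU AC_OH) auto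
  next
    fix x
    have "ph (- \<mu>) x * lower_order l \<kappa> u z 3 x = of_real (2*l) * (ph (- \<mu>) x * z 1 x) + of_real l * (ph (- \<mu>) x * u 2 x) + of_real (l\<^sup>2) * (ph (- \<mu>) x * u 3 x)"
      by (simp add: lower_order_def algebra_simps)
    then show "ph (- \<mu>) x * (lower_order l \<kappa> u z 3 x + (h 3 x + g 3 x)) - (of_real l * (ph (- 2 * \<mu>) x * Q 1 x)
         + of_real l * (ph (- \<mu>) x * u 2 x) + of_real (l\<^sup>2) * (ph (- \<mu>) x * u 3 x) + ph (- \<mu>) x * (h 3 x + g 3 x)) = M 3 x"
      unfolding distrib_left[of "ph (- \<mu>) x" "lower_order l \<kappa> u z 3 x"] ph_z M_def by (simp add: algebra_simps)
  qed simp
  show ?thesis using assms ac ac2 ac3 by (auto simp: eps_def)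
qed

end

lemma AC_le0:
  assumes f: "AC b f F" and F: "\<And>x. 0 \<le> x \<Longrightarrow> x \<le> b \<Longrightarrow> norm (F x) \<le> A + B * x ^ n"
    and "0 \<le> B" and x: "0 \<le> x" "x \<le> b"
  shows "norm (f x - f 0) \<le> A * x + B * x ^ Suc n"
proof -
  have "set_integrable lborel {0..b} (\<lambda>_. 0::real)" by (intro set_integrable_continuous continuous_intros)
  then have "norm (f x - f 0) \<le> A * x + B * x ^ Suc n + (LINT t:{0..b}|lborel. 0)"
    using F by (intro AC_le[OF f _ _ _ assms(3) x]) auto
  then show ?thesis by simp
qed

section \<open>High frequency: recovering the slopes from the averaged system\<close>

context bresse_ode0
begin

definition "p i = z i 0"

text \<open>Second Taylor polynomial at 0 of the third component of the averaged system
  \<open>M\<close>: its derivative is \<open>l\<close> times the first component, whose derivative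
  is minus one half of \<open>p 2 + 2 l p 3\<close>. Each coefficient contains a slope that the
  preceding ones do not.\<close>

definition "q x = p 3 + of_real l * p 1 * of_real x - of_real (l/4) * (p 2 + of_real (2*l) * p 3) * (of_real x)\<^sup>2"

text \<open>Zeroth order of a Picard iteration. Inserted into the derivative of \<open>P 1\<close>
  it gives the first order, and that one, inserted into the derivative of \<open>P 3\<close>, gives
  the second.\<close>

lemma P_near_p:
  assumes "\<mu> \<noteq> 0" "0 \<le> x" "x \<le> b" "i \<in> {1,2,3}"
  shows "cmod (P i x - p i) \<le> \<eta> + 2 * K * S * x"
proof -
  have M: "cmod (M i y) \<le> 2 * K * S + 0 * y ^ 0" if y: "0 \<le> y" "y \<le> b" for y
  proof -
    have P[simp]: "cmod (P 1 y) \<le> 2 * S" "cmod (P 2 y) \<le> 2 * S" "cmod (P 3 y) \<le> 2 * S" using P_le[OF y] by auto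
    have 1: "cmod (of_real (1/2) * (- P 2 y) + of_real l * (- P 3 y)) \<le> 1/2 * (2 * S) + l * (2 * S)"
      using pos by (intro norm_triangle_mono cmod_of_real_mult_le) auto
    have 2: "cmod (of_real (\<kappa>/2) * P 1 y) \<le> \<kappa>/2 * (2 * S)" "cmod (of_real l * P 1 y) \<le> l * (2 * S)"
      by (intro cmod_of_real_mult_le P; use pos in simp)+
    have "(1/2 + l) * (2 * S) \<le> K * (2 * S)" "\<kappa>/2 * (2 * S) \<le> K * (2 * S)" "l * (2 * S) \<le> K * (2 * S)"
      using pos S_nonneg unfolding K_def by (intro mult_right_mono; simp add: algebra_simps add_nonneg_nonneg)+
    moreover have "(1/2 + l) * (2 * S) = 1/2 * (2 * S) + l * (2 * S)" by (simp only: distrib_right)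
    moreover have "- (P 2 y / 2) - of_real l * P 3 y = of_real (1/2) * (- P 2 y) + of_real l * (- P 3 y)" by simp
    moreover have "2 * K * S + 0 * y ^ 0 = K * (2 * S)" by simp
    ultimately show ?thesis using 1 2 unfolding M_def by (smt (verit))
  qed
  have "cmod ((P i x - eps i x) - (P i 0 - eps i 0)) \<le> 2 * K * S * x + 0 * x ^ Suc 0"
    by (rule AC_le0[OF AC_P_eps[OF assms(4)] M]) (use assms in auto)
  moreover have "P i 0 - eps i 0 = p i" using assms(4) by (simp add: eps_0 P_def p_def Y0)
  ultimately have 1: "cmod ((P i x - eps i x) - p i) \<le> 2 * K * S * x" by simp
  have "P i x - p i = eps i x + ((P i x - eps i x) - p i)" by simp
  then show ?thesis using norm_triangle_mono[OF eps_le[OF assms(1-3), of i] 1] by metis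
qed

lemma P1_expansion:
  assumes "\<mu> \<noteq> 0" "0 \<le> x" "x \<le> b"
  shows "cmod (P 1 x - (p 1 - of_real (1/2) * (p 2 + of_real (2*l) * p 3) * of_real x)) \<le> \<eta> + K * \<eta> * x + 2 * K\<^sup>2 * S * x\<^sup>2"
proof -
  let ?v = "of_real (1/2) * (p 2 + of_real (2*l) * p 3)"
  have ac: "AC b (\<lambda>x. (P 1 x - eps 1 x) + ?v * of_real x ^ Suc 0) (\<lambda>x. M 1 x + of_nat (Suc 0) * ?v * of_real x ^ 0)"
    by (intro AC_add AC_P_eps AC_monomial) auto
  have \<eta>: "0 \<le> \<eta>" using W_nonneg \<theta>_nonneg K_ge_1 by (simp add: \<eta>_def)
  have b: "cmod (M 1 y + of_nat (Suc 0) * ?v * of_real y ^ 0) \<le> K * \<eta> + (2 * K\<^sup>2 * S) * y ^ 1" if y: "0 \<le> y" "y \<le> b" for y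
  proof -
    have e: "M 1 y + of_nat (Suc 0) * ?v * of_real y ^ 0 = of_real (1/2) * (- (P 2 y - p 2)) + of_real l * (- (P 3 y - p 3))"
      by (simp add: M_def algebra_simps)
    have "cmod (M 1 y + of_nat (Suc 0) * ?v * of_real y ^ 0) \<le> 1/2 * (\<eta> + 2 * K * S * y) + l * (\<eta> + 2 * K * S * y)"
      unfolding e using pos P_near_p[OF assms(1) y, of 2] P_near_p[OF assms(1) y, of 3]
      by (intro norm_triangle_mono cmod_of_real_mult_le; simp only: norm_minus_cancel; simp)
    also have "\<dots> = (1/2 + l) * (\<eta> + 2 * K * S * y)" by (simp add: algebra_simps)
    also have "\<dots> \<le> K * (\<eta> + 2 * K * S * y)"
      using pos S_nonneg \<eta> K_ge_1 y by (intro mult_right_mono) (auto simp: K_def add_nonneg_nonneg)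
    finally show ?thesis by (simp add: algebra_simps power2_eq_square)
  qed
  have "cmod (((P 1 x - eps 1 x) + ?v * of_real x ^ Suc 0) - ((P 1 0 - eps 1 0) + ?v * of_real 0 ^ Suc 0)) \<le> K * \<eta> * x + (2 * K\<^sup>2 * S) * x ^ Suc 1"
    by (rule AC_le0[OF ac b]) (use assms S_nonneg in auto)
  moreover have "P 1 0 - eps 1 0 = p 1" by (simp add: eps_0 P_def p_def Y0)
  ultimately have 1: "cmod ((P 1 x - eps 1 x) + ?v * of_real x - p 1) \<le> K * \<eta> * x + 2 * K\<^sup>2 * S * x\<^sup>2" by (simp add: power2_eq_square)
  have "P 1 x - (p 1 - ?v * of_real x) = eps 1 x + ((P 1 x - eps 1 x) + ?v * of_real x - p 1)" by simp
  then show ?thesis using norm_triangle_mono[OF eps_le[OF assms, of 1] 1] by (smt (verit))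
qed

lemma \<eta>_nonneg: "0 \<le> \<eta>" using W_nonneg \<theta>_nonneg K_ge_1 by (simp add: \<eta>_def)

lemma P3_expansion:
  assumes "\<mu> \<noteq> 0" "0 \<le> x" "x \<le> b"
  shows "cmod (P 3 x - q x) \<le> (1 + K * (1 + K * b) * b) * \<eta> + 2 * K ^ 3 * S * x ^ 3"
proof -
  let ?v = "of_real (1/2) * (p 2 + of_real (2*l) * p 3)"
  have ac: "AC b (\<lambda>x. (P 3 x - eps 3 x) + (- (of_real l * p 1)) * of_real x ^ Suc 0 + (of_real (l/2) * ?v) * of_real x ^ Suc 1)
    (\<lambda>x. M 3 x + of_nat (Suc 0) * (- (of_real l * p 1)) * of_real x ^ 0 + of_nat (Suc 1) * (of_real (l/2) * ?v) * of_real x ^ 1)"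
    by (intro AC_add AC_P_eps AC_monomial) auto
  have b: "cmod (M 3 y + of_nat (Suc 0) * (- (of_real l * p 1)) * of_real y ^ 0 + of_nat (Suc 1) * (of_real (l/2) * ?v) * of_real y ^ 1)
     \<le> K * (1 + K * b) * \<eta> + (2 * K ^ 3 * S) * y ^ 2" if y: "0 \<le> y" "y \<le> b" for y
  proof -
    have e: "M 3 y + of_nat (Suc 0) * (- (of_real l * p 1)) * of_real y ^ 0 + of_nat (Suc 1) * (of_real (l/2) * ?v) * of_real y ^ 1
       = of_real l * (P 1 y - (p 1 - ?v * of_real y))"
      by (simp add: M_def algebra_simps)
    have "cmod (of_real l * (P 1 y - (p 1 - ?v * of_real y))) \<le> l * (\<eta> + K * \<eta> * y + 2 * K\<^sup>2 * S * y\<^sup>2)"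
      using P1_expansion[OF assms(1) y] pos by (intro cmod_of_real_mult_le) auto
    also have "\<dots> \<le> K * (\<eta> + K * \<eta> * b + 2 * K\<^sup>2 * S * y\<^sup>2)"
      using pos S_nonneg \<eta>_nonneg K_ge_1 y by (intro mult_mono add_mono mult_left_mono) (auto simp: K_def add_nonneg_nonneg)
    finally show ?thesis unfolding e by (simp add: algebra_simps power2_eq_square power3_eq_cube)
  qed
  have "cmod (((P 3 x - eps 3 x) + (- (of_real l * p 1)) * of_real x ^ Suc 0 + (of_real (l/2) * ?v) * of_real x ^ Suc 1)
     - ((P 3 0 - eps 3 0) + (- (of_real l * p 1)) * of_real 0 ^ Suc 0 + (of_real (l/2) * ?v) * of_real 0 ^ Suc 1))
     \<le> K * (1 + K * b) * \<eta> * x + (2 * K ^ 3 * S) * x ^ Suc 2"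
    by (rule AC_le0[OF ac b]) (use assms S_nonneg K_ge_1 in auto)
  also have "K * (1 + K * b) * \<eta> * x \<le> K * (1 + K * b) * \<eta> * b"
    using assms \<eta>_nonneg K_ge_1 pos by (intro mult_left_mono) auto
  finally have "cmod (((P 3 x - eps 3 x) + (- (of_real l * p 1)) * of_real x ^ Suc 0 + (of_real (l/2) * ?v) * of_real x ^ Suc 1)
     - ((P 3 0 - eps 3 0) + (- (of_real l * p 1)) * of_real 0 ^ Suc 0 + (of_real (l/2) * ?v) * of_real 0 ^ Suc 1))
     \<le> K * (1 + K * b) * \<eta> * b + 2 * K ^ 3 * S * x ^ 3" by (simp add: power3_eq_cube algebra_simps)
  moreover have "((P 3 x - eps 3 x) + (- (of_real l * p 1)) * of_real x ^ Suc 0 + (of_real (l/2) * ?v) * of_real x ^ Suc 1)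
     - ((P 3 0 - eps 3 0) + (- (of_real l * p 1)) * of_real 0 ^ Suc 0 + (of_real (l/2) * ?v) * of_real 0 ^ Suc 1)
     = P 3 x - eps 3 x - q x"
    by (simp add: eps_0 P_def p_def Y0 q_def power2_eq_square algebra_simps)
  ultimately have 1: "cmod (P 3 x - eps 3 x - q x) \<le> K * (1 + K * b) * \<eta> * b + 2 * K ^ 3 * S * x ^ 3" by metis
  have "P 3 x - q x = eps 3 x + (P 3 x - eps 3 x - q x)" by simp
  then have "cmod (P 3 x - q x) \<le> \<eta> + (K * (1 + K * b) * \<eta> * b + 2 * K ^ 3 * S * x ^ 3)"
    using norm_triangle_mono[OF eps_le[OF assms, of 3] 1] by metis
  then show ?thesis by (simp add: algebra_simps)
qed

text \<open>By \<open>ph_Y\<close>, \<open>P 3\<close> is the observed velocity plus the oscillating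
  part of \<open>Q 3\<close>. The latter is small only after integration, and \<gamma> is controlled
  only in the mean; therefore the estimate concerns the primitive of \<open>q\<close>, a cubic
  without constant term.\<close>

lemma cubic_small:
  assumes "\<mu> \<noteq> 0" "0 \<le> x" "x \<le> b" and Y3: "\<And>x. 0 \<le> x \<Longrightarrow> x \<le> b \<Longrightarrow> cmod (Y 3 x) \<le> \<gamma> x"
  shows "cmod (p 3 * of_real x + of_real (l/2) * p 1 * of_real x ^ 2 - of_real (l/12) * (p 2 + of_real (2*l) * p 3) * of_real x ^ 3)
    \<le> 2 * \<theta> + W + (1 + K * (1 + K * b) * b) * \<eta> * b + 2 * K ^ 3 * S * x ^ 4" (is "cmod (?I x) \<le> _")
proof -
  define OP where "OP x = (LINT t:{0..x}|lborel. P 3 t)" for x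
  define OY where "OY x = (LINT t:{0..x}|lborel. ph (- \<mu>) t * Y 3 t)" for x
  have iY: "set_integrable lborel {0..b} (\<lambda>t. ph (- \<mu>) t * Y 3 t)"
    by (intro set_integrable_continuous continuous_intros ph_cont cont) auto
  have ac: "AC b OP (P 3)"
    unfolding OP_def[abs_def] by (intro AC_integral set_integrable_continuous AC_continuous[OF AC_P]) auto
  have ac2: "AC b (\<lambda>x. 2 * OY x + OQ 3 x) (P 3)"
  proof (rule AC_cong)
    show "AC b (\<lambda>x. 2 * OY x + OQ 3 x) (\<lambda>x. 2 * (ph (- \<mu>) x * Y 3 x) + ph (- 2 * \<mu>) x * Q 3 x)"
      unfolding OY_def[abs_def] by (intro AC_add AC_cmult AC_integral iY AC_OQ) auto
    show "2 * (ph (- \<mu>) x * Y 3 x) + ph (- 2 * \<mu>) x * Q 3 x = P 3 x" for x unfolding ph_Y by simp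
  qed simp
  have "OP x = 2 * OY x + OQ 3 x"
    using AC_eq[OF ac assms(2,3)] AC_eq[OF ac2 assms(2,3)] by (simp add: OP_def OY_def OQ_def)
  moreover have "cmod (OY x) \<le> \<theta>"
    unfolding OY_def using Y3 by (intro order_trans[OF norm_integral_le[OF iY _ \<gamma>_int(1) \<gamma>_nonneg assms(2,3)] \<gamma>_int_le]) (simp add: norm_mult)
  ultimately have 1: "cmod (OP x) \<le> 2 * \<theta> + W"
    using norm_triangle_mono[of "2 * OY x" "2 * \<theta>" "OQ 3 x" W] OQ_le[OF assms(1-3), of 3] by (simp add: norm_mult)
  have acI: "AC b (\<lambda>x. OP x + (- p 3) * of_real x ^ Suc 0 + (- (of_real (l/2) * p 1)) * of_real x ^ Suc 1
       + (of_real (l/12) * (p 2 + of_real (2*l) * p 3)) * of_real x ^ Suc 2)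
    (\<lambda>x. P 3 x + of_nat (Suc 0) * (- p 3) * of_real x ^ 0 + of_nat (Suc 1) * (- (of_real (l/2) * p 1)) * of_real x ^ 1
       + of_nat (Suc 2) * (of_real (l/12) * (p 2 + of_real (2*l) * p 3)) * of_real x ^ 2)"
    by (intro AC_add ac AC_monomial)
  have "cmod ((OP x + (- p 3) * of_real x ^ Suc 0 + (- (of_real (l/2) * p 1)) * of_real x ^ Suc 1
       + (of_real (l/12) * (p 2 + of_real (2*l) * p 3)) * of_real x ^ Suc 2)
       - (OP 0 + (- p 3) * of_real 0 ^ Suc 0 + (- (of_real (l/2) * p 1)) * of_real 0 ^ Suc 1
       + (of_real (l/12) * (p 2 + of_real (2*l) * p 3)) * of_real 0 ^ Suc 2))
     \<le> (1 + K * (1 + K * b) * b) * \<eta> * x + (2 * K ^ 3 * S) * x ^ Suc 3"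
  proof (rule AC_le0[OF acI])
    fix y assume y: "0 \<le> y" "y \<le> b"
    have "P 3 y + of_nat (Suc 0) * (- p 3) * of_real y ^ 0 + of_nat (Suc 1) * (- (of_real (l/2) * p 1)) * of_real y ^ 1
       + of_nat (Suc 2) * (of_real (l/12) * (p 2 + of_real (2*l) * p 3)) * of_real y ^ 2 = P 3 y - q y"
      by (simp add: q_def field_simps power2_eq_square)
    then show "cmod (P 3 y + of_nat (Suc 0) * (- p 3) * of_real y ^ 0 + of_nat (Suc 1) * (- (of_real (l/2) * p 1)) * of_real y ^ 1
       + of_nat (Suc 2) * (of_real (l/12) * (p 2 + of_real (2*l) * p 3)) * of_real y ^ 2)
        \<le> (1 + K * (1 + K * b) * b) * \<eta> + 2 * K ^ 3 * S * y ^ 3"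
      using P3_expansion[OF assms(1) y] by metis
  qed (use assms S_nonneg K_ge_1 in auto)
  also have "(1 + K * (1 + K * b) * b) * \<eta> * x \<le> (1 + K * (1 + K * b) * b) * \<eta> * b"
    using assms \<eta>_nonneg K_ge_1 pos by (intro mult_left_mono) auto
  also have "2 * K ^ 3 * S * x ^ Suc 3 = 2 * K ^ 3 * S * x ^ 4" by (simp add: numeral_eq_Suc)
  also have "(OP x + (- p 3) * of_real x ^ Suc 0 + (- (of_real (l/2) * p 1)) * of_real x ^ Suc 1
       + (of_real (l/12) * (p 2 + of_real (2*l) * p 3)) * of_real x ^ Suc 2)
       - (OP 0 + (- p 3) * of_real 0 ^ Suc 0 + (- (of_real (l/2) * p 1)) * of_real 0 ^ Suc 1
       + (of_real (l/12) * (p 2 + of_real (2*l) * p 3)) * of_real 0 ^ Suc 2) = OP x - ?I x"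
    by (simp add: OP_def numeral_eq_Suc algebra_simps)
  finally have 2: "cmod (OP x - ?I x) \<le> (1 + K * (1 + K * b) * b) * \<eta> * b + 2 * K ^ 3 * S * x ^ 4" by simp
  have "?I x = OP x - (OP x - ?I x)" by simp
  then have "cmod (?I x) \<le> cmod (OP x) + cmod (OP x - ?I x)" by (metis norm_triangle_ineq4)
  then show ?thesis using 1 2 by linarith
qed

lemma pn_eq: "pn = cmod (p 1) + cmod (p 2) + cmod (p 3)" by (simp add: pn_def p_def)

text \<open>Sampling the cubic at \<open>r\<close>, \<open>2*r\<close> and \<open>3*r\<close>
  isolates the slopes. The remainder carries \<open>r ^ 4\<close> against \<open>r ^ 3\<close> on
  the left; this gain of one power later absorbs the slopes hidden in \<open>S\<close>.\<close>

lemma pn_le_high: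
  assumes "\<mu> \<noteq> 0" and Y3: "\<And>x. 0 \<le> x \<Longrightarrow> x \<le> b \<Longrightarrow> cmod (Y 3 x) \<le> \<gamma> x" and r: "0 < r" "r \<le> 1" "3 * r \<le> b"
  shows "pn * r ^ 3 \<le> (20 + 40/l + 240/l + 40*l) * (2 * \<theta> + W + (1 + K * (1 + K * b) * b) * \<eta> * b + 162 * K ^ 3 * S * r ^ 4)"
proof -
  \<comment> \<open>162 is \<open>2 * 3 ^ 4\<close>, the Taylor remainder at the farthest sample
    \<open>3*r\<close>.\<close>
  define m where "m = 2 * \<theta> + W + (1 + K * (1 + K * b) * b) * \<eta> * b + 162 * K ^ 3 * S * r ^ 4"
  define A B C where "A = p 3 * of_real r" and "B = of_real (l/2) * p 1 * of_real r ^ 2"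
     and "C = - (of_real (l/12) * (p 2 + of_real (2*l) * p 3) * of_real r ^ 3)"
  have le: "2 * K ^ 3 * S * (n * r) ^ 4 \<le> 162 * K ^ 3 * S * r ^ 4" if "0 \<le> n" "n \<le> 3" for n
  proof -
    have "n ^ 4 \<le> 3 ^ 4" using that by (intro power_mono) auto
    then have "n ^ 4 * (2 * K ^ 3 * S * r ^ 4) \<le> 81 * (2 * K ^ 3 * S * r ^ 4)"
      using K_ge_1 S_nonneg r by (intro mult_right_mono) auto
    then show ?thesis by (simp add: power_mult_distrib algebra_simps)
  qed
  have i: "cmod (of_real n * A + of_real (n^2) * B + of_real (n^3) * C) \<le> m" if n: "0 \<le> n" "n \<le> 3" for n
  proof -
    have "n * r \<le> 3 * r" using n r by (intro mult_right_mono) auto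
    then have nr: "n * r \<le> b" using r by linarith
    then have "cmod (p 3 * of_real (n*r) + of_real (l/2) * p 1 * of_real (n*r) ^ 2 - of_real (l/12) * (p 2 + of_real (2*l) * p 3) * of_real (n*r) ^ 3)
      \<le> 2 * \<theta> + W + (1 + K * (1 + K * b) * b) * \<eta> * b + 2 * K ^ 3 * S * (n*r) ^ 4"
      using n r nr by (intro cubic_small assms) auto
    moreover have "p 3 * of_real (n*r) + of_real (l/2) * p 1 * of_real (n*r) ^ 2 - of_real (l/12) * (p 2 + of_real (2*l) * p 3) * of_real (n*r) ^ 3
      = of_real n * A + of_real (n^2) * B + of_real (n^3) * C"
      by (simp add: A_def B_def C_def power_mult_distrib algebra_simps)
    ultimately show ?thesis using le[OF n] unfolding m_def by (smt (verit))
  qed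
  have abc: "cmod A \<le> 20 * m" "cmod B \<le> 20 * m" "cmod C \<le> 20 * m"
    using cubic_coefficients_le[of A B C m] i[of 1] i[of 2] i[of 3] by simp_all
  have m0: "0 \<le> m" using norm_ge_zero[of A] abc(1) by linarith
  have r3: "r ^ 3 \<le> r" "r ^ 3 \<le> r ^ 2" using r power_decreasing[of 1 3 r] power_decreasing[of 2 3 r] by auto
  have p3: "cmod (p 3) * r ^ 3 \<le> 20 * m"
  proof -
    have "cmod (p 3) * r \<le> 20 * m" using abc(1) r by (simp add: A_def norm_mult)
    moreover have "cmod (p 3) * r ^ 3 \<le> cmod (p 3) * r" using r3 by (intro mult_left_mono) auto
    ultimately show ?thesis by linarith
  qed
  have p1: "cmod (p 1) * r ^ 3 \<le> 40 / l * m"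
  proof -
    have "l / 2 * (cmod (p 1) * r ^ 2) \<le> 20 * m" using abc(2) r pos by (simp add: B_def norm_mult norm_power)
    then have "cmod (p 1) * r ^ 2 \<le> 40 / l * m" using pos by (simp add: field_simps)
    moreover have "cmod (p 1) * r ^ 3 \<le> cmod (p 1) * r ^ 2" using r3 by (intro mult_left_mono) auto
    ultimately show ?thesis by linarith
  qed
  have p2: "cmod (p 2) * r ^ 3 \<le> 240 / l * m + 2 * l * (20 * m)"
  proof -
    have "l / 12 * (cmod (p 2 + of_real (2*l) * p 3) * r ^ 3) \<le> 20 * m" using abc(3) r pos by (simp add: C_def norm_mult norm_power)
    then have 1: "cmod (p 2 + of_real (2*l) * p 3) * r ^ 3 \<le> 240 / l * m" using pos by (simp add: field_simps)
    have "cmod (p 2) \<le> cmod (p 2 + of_real (2*l) * p 3) + 2 * l * cmod (p 3)"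
      using norm_triangle_ineq4[of "p 2 + of_real (2*l) * p 3" "of_real (2*l) * p 3"] pos by (simp add: norm_mult)
    then have "cmod (p 2) * r ^ 3 \<le> (cmod (p 2 + of_real (2*l) * p 3) + 2 * l * cmod (p 3)) * r ^ 3"
      using r by (intro mult_right_mono) auto
    also have "\<dots> = cmod (p 2 + of_real (2*l) * p 3) * r ^ 3 + 2 * l * (cmod (p 3) * r ^ 3)" by (simp add: algebra_simps)
    also have "\<dots> \<le> 240 / l * m + 2 * l * (20 * m)" using 1 p3 pos by (intro add_mono mult_left_mono) auto
    finally show ?thesis .
  qed
  have "pn * r ^ 3 = cmod (p 1) * r ^ 3 + cmod (p 2) * r ^ 3 + cmod (p 3) * r ^ 3" by (simp add: pn_eq algebra_simps)
  also have "\<dots> \<le> 40 / l * m + (240 / l * m + 2 * l * (20 * m)) + 20 * m" using p1 p2 p3 by linarith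
  also have "\<dots> = (20 + 40/l + 240/l + 40*l) * m" by (simp add: algebra_simps)
  finally show ?thesis by (simp add: m_def)
qed

end

lemma observability_high:
  fixes b l \<kappa> :: real
  assumes pos: "0 < b" "0 < l" "0 < \<kappa>"
  shows "\<exists>C \<Lambda>. 0 < C \<and> 0 < \<Lambda> \<and> (\<forall>\<mu> u Y z g h \<gamma>. bresse_ode0 b l \<kappa> \<mu> u Y z g h \<gamma> \<longrightarrow> \<Lambda> \<le> \<bar>\<mu>\<bar> \<longrightarrow>
    (\<forall>x\<in>{0..b}. cmod (Y 3 x) \<le> \<gamma> x) \<longrightarrow> bresse_ode.pn z \<le> C * bresse_ode.\<delta> b \<gamma>)"
proof -
  define K where "K = 1 + 3*l + l\<^sup>2 + \<kappa>*(2 + l)"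
  define K0 where "K0 = 4 * exp ((3 + 12 * (K + 0)\<^sup>2) * b)"
  define C7 where "C7 = 20 + 40/l + 240/l + 40*l"
  define e1 where "e1 = (1 + K * (1 + K * b) * b) * b"
  define w where "w = 4 + (K + 1) * b"
  define a1 where "a1 = 2 * (1 + e1) + 2 * (1 + e1 * K)"
  define a2 where "a2 = (1 + e1 * K) * w"
  \<comment> \<open>The order of choices matters. \<open>r\<close> depends on the coefficients only
    and makes the Taylor remainder at most \<open>r ^ 3 / 4\<close> times slopes plus data; then
    \<Lambda> does the same for the terms of size \<open>1 / \<bar>\<mu>\<bar>\<close>. Half of the
    left side survives.\<close>
  define r where "r = min 1 (min (b/3) (1 / (4 * C7 * 162 * K ^ 3 * K0)))"
  define \<Lambda> where "\<Lambda> = max 1 (4 * C7 * a2 * K0 / r ^ 3)"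
  define C where "C = 2 * C7 * a1 * sqrt b / r ^ 3 + 1"
  have K1: "1 \<le> K" using pos by (simp add: K_def)
  have K0: "0 < K0" by (simp add: K0_def)
  have C7: "0 < C7" using pos by (simp add: C7_def add_pos_pos)
  have e1: "0 \<le> e1" using pos K1 by (simp add: e1_def)
  have w: "0 < w" using pos K1 by (simp add: w_def add_pos_pos)
  have a1: "0 < a1" "0 \<le> a2" using e1 K1 w by (auto simp: a1_def a2_def intro!: add_pos_nonneg)
  have r: "0 < r" "r \<le> 1" "3 * r \<le> b" using pos C7 K1 K0 by (auto simp: r_def)
  have r2: "C7 * 162 * K ^ 3 * K0 * r \<le> 1/4"
  proof -
    have "r \<le> 1 / (4 * C7 * 162 * K ^ 3 * K0)" by (simp add: r_def)
    moreover have "0 < C7 * 162 * K ^ 3 * K0" using C7 K1 K0 by simp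
    ultimately show ?thesis by (simp add: field_simps)
  qed
  have C0: "0 < C" using C7 a1 pos r by (simp add: C_def add_nonneg_pos)
  have "bresse_ode.pn z \<le> C * bresse_ode.\<delta> b \<gamma>"
    if ode: "bresse_ode0 b l \<kappa> \<mu> u Y z g h \<gamma>" and \<mu>: "\<Lambda> \<le> \<bar>\<mu>\<bar>" and Y3: "\<forall>x\<in>{0..b}. cmod (Y 3 x) \<le> \<gamma> x"
    for \<mu> u Y z g h \<gamma>
  proof -
    interpret o: bresse_ode0 b l \<kappa> \<mu> u Y z g h \<gamma> by fact
    have K: "o.K = K" by (simp add: o.K_def K_def)
    have S: "o.S = K0 * (o.pn + o.\<delta>)" by (simp add: o.S_def o.K0_def K K0_def)
    have \<theta>: "o.\<theta> = sqrt b * o.\<delta>" by (rule o.\<theta>_def)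
    have \<mu>1: "1 \<le> \<bar>\<mu>\<bar>" "4 * C7 * a2 * K0 / r ^ 3 \<le> \<bar>\<mu>\<bar>" using \<mu> by (auto simp: \<Lambda>_def)
    have "2 * o.\<theta> / \<bar>\<mu>\<bar> \<le> 2 * o.\<theta> / 1" using \<mu>1 o.\<theta>_nonneg by (intro divide_left_mono) auto
    then have W: "o.W \<le> w * o.S / \<bar>\<mu>\<bar> + 2 * o.\<theta>"
      unfolding o.W_def K w_def add_divide_distrib by simp
    have "o.pn * r ^ 3 \<le> C7 * (2 * o.\<theta> + o.W + (1 + K * (1 + K * b) * b) * o.\<eta> * b + 162 * K ^ 3 * o.S * r ^ 4)"
      using o.pn_le_high[of r] \<mu>1 Y3 r unfolding K C7_def by auto
    also have "2 * o.\<theta> + o.W + (1 + K * (1 + K * b) * b) * o.\<eta> * b = 2 * (1 + e1) * o.\<theta> + (1 + e1 * K) * o.W"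
      by (simp add: e1_def o.\<eta>_def K algebra_simps)
    also have "\<dots> \<le> 2 * (1 + e1) * o.\<theta> + (1 + e1 * K) * (w * o.S / \<bar>\<mu>\<bar> + 2 * o.\<theta>)"
      using W e1 K1 by (intro add_left_mono mult_left_mono) auto
    also have "\<dots> = a1 * o.\<theta> + a2 * o.S / \<bar>\<mu>\<bar>" by (simp add: a1_def a2_def algebra_simps)
    finally have "o.pn * r ^ 3 \<le> C7 * (a1 * o.\<theta> + a2 * o.S / \<bar>\<mu>\<bar> + 162 * K ^ 3 * o.S * r ^ 4)"
      using C7 by simp
    also have "\<dots> = C7 * a1 * sqrt b * o.\<delta> + (C7 * a2 * K0 / \<bar>\<mu>\<bar>) * (o.pn + o.\<delta>) + (C7 * 162 * K ^ 3 * K0 * r) * r ^ 3 * (o.pn + o.\<delta>)"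
      by (simp add: S \<theta> algebra_simps power3_eq_cube power4_eq_xxxx)
    also have "\<dots> \<le> C7 * a1 * sqrt b * o.\<delta> + (r ^ 3 / 4) * (o.pn + o.\<delta>) + 1/4 * r ^ 3 * (o.pn + o.\<delta>)"
    proof (intro add_mono mult_right_mono r2)
      show "C7 * a2 * K0 / \<bar>\<mu>\<bar> \<le> r ^ 3 / 4" using \<mu>1 r by (simp add: field_simps)
    qed (use r a1 C7 pos o.pn_nonneg o.\<delta>_nonneg in auto)
    also have "\<dots> = C7 * a1 * sqrt b * o.\<delta> + r ^ 3 / 2 * (o.pn + o.\<delta>)" by (simp add: algebra_simps)
    finally have "o.pn * r ^ 3 \<le> C7 * a1 * sqrt b * o.\<delta> + r ^ 3 / 2 * (o.pn + o.\<delta>)" .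
    then have "r ^ 3 * o.pn \<le> 2 * C7 * a1 * sqrt b * o.\<delta> + r ^ 3 * o.\<delta>" by (simp add: field_simps)
    also have "\<dots> = r ^ 3 * (C * o.\<delta>)" using r by (simp add: C_def field_simps)
    finally show ?thesis using r by simp
  qed
  then show ?thesis using C0 by (intro exI[of _ C] exI[of _ \<Lambda>]) (auto simp: \<Lambda>_def)
qed

section \<open>Bounded frequency: ordinary Taylor expansion\<close>

context bresse_ode0
begin

text \<open>For bounded \<mu> the terms containing \<mu> are of lower order too, so the ordinary
  Taylor expansion at 0 applies with \<open>\<Lambda> + K\<close> in place of \<open>K\<close>. The
  displacement is observed here instead of the velocity, which degenerates as \<mu> tends to
  0.\<close>

lemma pn_le_low:
  fixes \<Lambda> :: real
  defines "N \<equiv> \<Lambda> + K"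
  defines "C1 \<equiv> \<Lambda> + (\<Lambda>\<^sup>2 + l + l\<^sup>2) * b + 2 * l * (1 + N * b)" and "C2 \<equiv> (\<Lambda>\<^sup>2 + l + l\<^sup>2) * N + 6 * l * N\<^sup>2"
  assumes \<mu>: "\<bar>\<mu>\<bar> \<le> \<Lambda>" and u3: "\<And>x. 0 \<le> x \<Longrightarrow> x \<le> b \<Longrightarrow> cmod (u 3 x) \<le> \<gamma> x" and r: "0 < r" "r \<le> 1" "3 * r \<le> b"
  shows "pn * r ^ 4 \<le> (40 + 60/l + (480 + 40 * (3 * l\<^sup>2 + \<Lambda>\<^sup>2))/l) * (\<theta> * (1 + (C1 * b + 1) * b * b) + 243 * C2 * S * r ^ 5)"
proof -
  have \<Lambda>0: "0 \<le> \<Lambda>" using \<mu> by linarith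
  have N: "1 \<le> N" "0 \<le> N" using \<Lambda>0 K_ge_1 by (auto simp: N_def)
  have C: "0 \<le> C1" "0 \<le> C2" using \<Lambda>0 N pos by (auto simp: C1_def C2_def)
  have Y_le: "cmod (Y i x) \<le> \<theta> + \<Lambda> * S * x" if x: "0 \<le> x" "x \<le> b" and i: "i \<in> {1,2,3}" for i x
  proof -
    have "cmod (Y i x - Y i 0) \<le> (\<Lambda> * S) * x + 0 * x ^ Suc 0 + (LINT t:{0..b}|lborel. \<gamma> t)"
    proof (rule AC_le[OF AC_Y[OF i] _ \<gamma>_int(1) \<gamma>_nonneg])
      fix y assume y: "0 \<le> y" "y \<le> b"
      have "\<bar>\<mu>\<bar> * cmod (z i y) \<le> \<Lambda> * S" using \<mu> bounds(3)[OF y i] \<Lambda>0 by (intro mult_mono) auto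
      then show "cmod (\<i> * of_real \<mu> * z i y + g i y) \<le> \<Lambda> * S + 0 * y ^ 0 + \<gamma> y"
        using norm_triangle_mono[of "\<i> * of_real \<mu> * z i y" "\<Lambda> * S"] g_le[OF i y] by (simp add: norm_mult)
    qed (use x in auto)
    then show ?thesis using \<gamma>_int_le Y0[OF i] by simp
  qed
  have Y3_le: "cmod (Y 3 x - \<i> * of_real \<mu> * u 3 x) \<le> \<theta>" if x: "0 \<le> x" "x \<le> b" for x
  proof -
    \<comment> \<open>In this combination the terms with \<open>z 3\<close> cancel and the
      derivative is \<open>g 3\<close> alone. Hence \<open>\<i> \<mu> Y 3\<close> may be replaced by
      \<open>- \<mu>^2 u 3\<close> up to data.\<close>
    have ac: "AC b (\<lambda>x. Y 3 x - \<i> * of_real \<mu> * u 3 x) (\<lambda>x. (\<i> * of_real \<mu> * z 3 x + g 3 x) - \<i> * of_real \<mu> * z 3 x)"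
      by (intro AC_diff AC_cmult AC_Y AC_u) auto
    have "cmod ((Y 3 x - \<i> * of_real \<mu> * u 3 x) - (Y 3 0 - \<i> * of_real \<mu> * u 3 0)) \<le> 0 * x + 0 * x ^ Suc 0 + (LINT t:{0..b}|lborel. \<gamma> t)"
      using g_le[of 3] by (intro AC_le[OF ac _ \<gamma>_int(1) \<gamma>_nonneg]) (use x in auto)
    then show ?thesis using \<gamma>_int_le Y0[of 3] u0[of 3] by simp
  qed
  have z_le: "cmod (z i x - p i) \<le> \<theta> + N * S * x" if x: "0 \<le> x" "x \<le> b" and i: "i \<in> {1,2,3}" for i x
  proof -
    have "cmod (z i x - z i 0) \<le> (N * S) * x + 0 * x ^ Suc 0 + (LINT t:{0..b}|lborel. \<gamma> t)"
    proof (rule AC_le[OF AC_z[OF i] _ \<gamma>_int(1) \<gamma>_nonneg])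
      fix y assume y: "0 \<le> y" "y \<le> b"
      have "\<bar>\<mu>\<bar> * cmod (Y i y) \<le> \<Lambda> * S" using \<mu> bounds(2)[OF y i] \<Lambda>0 by (intro mult_mono) auto
      then have "cmod (\<i> * of_real \<mu> * Y i y) \<le> \<Lambda> * S" by (simp add: norm_mult)
      then have "cmod (\<i> * of_real \<mu> * Y i y + (lower_order l \<kappa> u z i y + h i y)) \<le> \<Lambda> * S + (K * S + \<gamma> y)"
        using lower_order_bound[OF y, of i] h_bound[OF i y] by (intro norm_triangle_mono)
      then show "cmod (\<i> * of_real \<mu> * Y i y + (lower_order l \<kappa> u z i y + h i y)) \<le> N * S + 0 * y ^ 0 + \<gamma> y"
        by (simp add: N_def algebra_simps)
    qed (use x in auto)
    then show ?thesis using \<gamma>_int_le by (simp add: p_def)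
  qed
  have u_le: "cmod (u i x - p i * of_real x) \<le> \<theta> * x + N * S * x ^ 2" if x: "0 \<le> x" "x \<le> b" and i: "i \<in> {1,2,3}" for i x
  proof -
    have ac: "AC b (\<lambda>x. u i x + (- p i) * of_real x ^ Suc 0) (\<lambda>x. z i x + of_nat (Suc 0) * (- p i) * of_real x ^ 0)"
      by (intro AC_add AC_u AC_monomial i)
    have "cmod ((u i x + (- p i) * of_real x ^ Suc 0) - (u i 0 + (- p i) * of_real 0 ^ Suc 0)) \<le> \<theta> * x + (N * S) * x ^ Suc 1"
      using z_le i N S_nonneg by (intro AC_le0[OF ac]) (use x in auto)
    then show ?thesis by (simp add: u0[OF i] power2_eq_square)
  qed
  have u_S: "cmod (u i x) \<le> S * x" if x: "0 \<le> x" "x \<le> b" and i: "i \<in> {1,2,3}" for i x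
  proof -
    have "cmod (u i x - u i 0) \<le> S * x + 0 * x ^ Suc 0"
      using bounds(3)[OF _ _ i] by (intro AC_le0[OF AC_u[OF i]]) (use x in auto)
    then show ?thesis by (simp add: u0[OF i])
  qed
  define v where "v = p 2 + of_real (2*l) * p 3"
  have l_le: "1 + 2 * l \<le> K" "l\<^sup>2 \<le> K" using pos by (auto simp: K_def add_nonneg_nonneg algebra_simps)
  have z1_le: "cmod (z 1 x - (p 1 - v * of_real x)) \<le> \<theta> * (1 + N * b) + 3 * N\<^sup>2 * S * x\<^sup>2" if x: "0 \<le> x" "x \<le> b" for x
  proof -
    have ac: "AC b (\<lambda>x. z 1 x + v * of_real x ^ Suc 0) (\<lambda>x. (\<i> * of_real \<mu> * Y 1 x + (lower_order l \<kappa> u z 1 x + h 1 x)) + of_nat (Suc 0) * v * of_real x ^ 0)"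
      by (intro AC_add AC_z AC_monomial) auto
    have "cmod ((z 1 x + v * of_real x ^ Suc 0) - (z 1 0 + v * of_real 0 ^ Suc 0)) \<le> (N * \<theta>) * x + (3 * N\<^sup>2 * S) * x ^ Suc 1 + (LINT t:{0..b}|lborel. \<gamma> t)"
    proof (rule AC_le[OF ac _ \<gamma>_int(1) \<gamma>_nonneg])
      fix y assume y: "0 \<le> y" "y \<le> b"
      have e: "(\<i> * of_real \<mu> * Y 1 y + (lower_order l \<kappa> u z 1 y + h 1 y)) + of_nat (Suc 0) * v * of_real y ^ 0
        = \<i> * of_real \<mu> * Y 1 y + of_real 1 * (- (z 2 y - p 2)) + of_real (2*l) * (- (z 3 y - p 3)) + of_real (l\<^sup>2) * u 1 y + h 1 y"
        by (simp add: v_def lower_order_def algebra_simps)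
      have "\<bar>\<mu>\<bar> * cmod (Y 1 y) \<le> \<Lambda> * (\<theta> + \<Lambda> * S * y)" using \<mu> Y_le[OF y, of 1] \<Lambda>0 by (intro mult_mono) auto
      then have "cmod (\<i> * of_real \<mu> * Y 1 y) \<le> \<Lambda> * (\<theta> + \<Lambda> * S * y)" by (simp add: norm_mult)
      then have "cmod (\<i> * of_real \<mu> * Y 1 y + of_real 1 * (- (z 2 y - p 2)) + of_real (2*l) * (- (z 3 y - p 3)) + of_real (l\<^sup>2) * u 1 y + h 1 y)
        \<le> \<Lambda> * (\<theta> + \<Lambda> * S * y) + 1 * (\<theta> + N * S * y) + 2 * l * (\<theta> + N * S * y) + l\<^sup>2 * (S * y) + \<gamma> y"
        using z_le[OF y, of 2] z_le[OF y, of 3] u_S[OF y, of 1] h_bound[OF _ y, of 1] pos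
        by (intro norm_triangle_mono cmod_of_real_mult_le; simp only: norm_minus_cancel; simp)
      also have "\<dots> = (\<Lambda> + (1 + 2 * l)) * \<theta> + (\<Lambda> * \<Lambda> + (1 + 2 * l) * N + l\<^sup>2 * 1) * (S * y) + \<gamma> y"
        by (simp add: algebra_simps)
      also have "\<dots> \<le> N * \<theta> + (N * N + N * N + N * N) * (S * y) + \<gamma> y"
        using \<Lambda>0 N l_le \<theta>_nonneg S_nonneg y pos K_ge_1
        by (intro add_mono mult_right_mono mult_mono) (auto simp: N_def)
      finally show "cmod ((\<i> * of_real \<mu> * Y 1 y + (lower_order l \<kappa> u z 1 y + h 1 y)) + of_nat (Suc 0) * v * of_real y ^ 0)
        \<le> N * \<theta> + 3 * N\<^sup>2 * S * y ^ 1 + \<gamma> y" unfolding e by (simp add: power2_eq_square algebra_simps)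
    qed (use x N S_nonneg in auto)
    also have "(N * \<theta>) * x \<le> (N * \<theta>) * b" using x N \<theta>_nonneg by (intro mult_left_mono) auto
    also have "(LINT t:{0..b}|lborel. \<gamma> t) \<le> \<theta>" by (rule \<gamma>_int_le)
    finally have "cmod ((z 1 x + v * of_real x ^ Suc 0) - (z 1 0 + v * of_real 0 ^ Suc 0)) \<le> N * \<theta> * b + 3 * N\<^sup>2 * S * x ^ Suc 1 + \<theta>" by simp
    moreover have "(z 1 x + v * of_real x ^ Suc 0) - (z 1 0 + v * of_real 0 ^ Suc 0) = z 1 x - (p 1 - v * of_real x)"
      by (simp add: p_def)
    ultimately show ?thesis by (simp add: power2_eq_square algebra_simps)
  qed
  \<comment> \<open>Coefficient of \<open>x\<close> in the derivative of \<open>z 3\<close>: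
    \<open>- \<mu>^2 p 3\<close> from the velocity, \<open>- 2 l (p 2 + 2 l p 3)\<close> from
    \<open>z 1\<close>, \<open>l p 2\<close> from \<open>u 2\<close> and \<open>l^2 p 3\<close> from
    \<open>u 3\<close>.\<close>
  define c where "c = - (of_real l * p 2) - of_real (3 * l\<^sup>2 + \<mu>\<^sup>2) * p 3"
  have z3_le: "cmod (z 3 x - (p 3 + of_real (2*l) * p 1 * of_real x + c / 2 * of_real x ^ 2)) \<le> \<theta> * (C1 * b + 1) + C2 * S * x ^ 3" if x: "0 \<le> x" "x \<le> b" for x
  proof -
    have ac: "AC b (\<lambda>x. z 3 x + (- (of_real (2*l) * p 1)) * of_real x ^ Suc 0 + (- (c / 2)) * of_real x ^ Suc 1)
       (\<lambda>x. (\<i> * of_real \<mu> * Y 3 x + (lower_order l \<kappa> u z 3 x + h 3 x)) + of_nat (Suc 0) * (- (of_real (2*l) * p 1)) * of_real x ^ 0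
          + of_nat (Suc 1) * (- (c / 2)) * of_real x ^ 1)"
      by (intro AC_add AC_z AC_monomial) auto
    have "cmod ((z 3 x + (- (of_real (2*l) * p 1)) * of_real x ^ Suc 0 + (- (c / 2)) * of_real x ^ Suc 1)
       - (z 3 0 + (- (of_real (2*l) * p 1)) * of_real 0 ^ Suc 0 + (- (c / 2)) * of_real 0 ^ Suc 1)) \<le> (C1 * \<theta>) * x + (C2 * S) * x ^ Suc 2 + (LINT t:{0..b}|lborel. \<gamma> t)"
    proof (rule AC_le[OF ac _ \<gamma>_int(1) \<gamma>_nonneg])
      fix y assume y: "0 \<le> y" "y \<le> b"
      have e: "(\<i> * of_real \<mu> * Y 3 y + (lower_order l \<kappa> u z 3 y + h 3 y)) + of_nat (Suc 0) * (- (of_real (2*l) * p 1)) * of_real y ^ 0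
          + of_nat (Suc 1) * (- (c / 2)) * of_real y ^ 1
        = \<i> * of_real \<mu> * (Y 3 y - \<i> * of_real \<mu> * u 3 y) + of_real (\<mu>\<^sup>2) * (- (u 3 y - p 3 * of_real y))
          + of_real (2*l) * (z 1 y - (p 1 - v * of_real y)) + of_real l * (u 2 y - p 2 * of_real y) + of_real (l\<^sup>2) * (u 3 y - p 3 * of_real y) + h 3 y"
      proof -
        have "of_nat (Suc 1) * (- (c / 2)) * of_real y ^ 1 = - (c * of_real y)" by simp
        then show ?thesis
          by (simp only:) (simp add: v_def c_def lower_order_def algebra_simps power2_eq_square)
      qed
      have "\<bar>\<mu>\<bar> * cmod (Y 3 y - \<i> * of_real \<mu> * u 3 y) \<le> \<Lambda> * \<theta>" using \<mu> Y3_le[OF y] \<Lambda>0 by (intro mult_mono) auto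
      then have "cmod (\<i> * of_real \<mu> * (Y 3 y - \<i> * of_real \<mu> * u 3 y)) \<le> \<Lambda> * \<theta>" by (simp add: norm_mult)
      then have "cmod (\<i> * of_real \<mu> * (Y 3 y - \<i> * of_real \<mu> * u 3 y) + of_real (\<mu>\<^sup>2) * (- (u 3 y - p 3 * of_real y))
          + of_real (2*l) * (z 1 y - (p 1 - v * of_real y)) + of_real l * (u 2 y - p 2 * of_real y) + of_real (l\<^sup>2) * (u 3 y - p 3 * of_real y) + h 3 y)
        \<le> \<Lambda> * \<theta> + \<mu>\<^sup>2 * (\<theta> * y + N * S * y ^ 2) + 2 * l * (\<theta> * (1 + N * b) + 3 * N\<^sup>2 * S * y\<^sup>2)
          + l * (\<theta> * y + N * S * y ^ 2) + l\<^sup>2 * (\<theta> * y + N * S * y ^ 2) + \<gamma> y"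
        using u_le[OF y, of 2] u_le[OF y, of 3] z1_le[OF y] h_bound[OF _ y, of 3] pos
        by (intro norm_triangle_mono cmod_of_real_mult_le; simp only: norm_minus_cancel; simp)
      also have "\<dots> = \<Lambda> * \<theta> + (\<mu>\<^sup>2 + l + l\<^sup>2) * (\<theta> * y + N * S * y ^ 2) + 2 * l * (\<theta> * (1 + N * b) + 3 * N\<^sup>2 * S * y\<^sup>2) + \<gamma> y"
        by (simp add: algebra_simps)
      also have "\<dots> \<le> \<Lambda> * \<theta> + (\<Lambda>\<^sup>2 + l + l\<^sup>2) * (\<theta> * b + N * S * y ^ 2) + 2 * l * (\<theta> * (1 + N * b) + 3 * N\<^sup>2 * S * y\<^sup>2) + \<gamma> y"
      proof -
        have "\<mu>\<^sup>2 \<le> \<Lambda>\<^sup>2" using power_mono[OF \<mu>, of 2] by simp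
        then show ?thesis using \<theta>_nonneg S_nonneg N y pos by (intro add_mono mult_mono mult_left_mono order_refl) auto
      qed
      also have "\<dots> = C1 * \<theta> + C2 * S * y ^ 2 + \<gamma> y" by (simp add: C1_def C2_def algebra_simps)
      finally show "cmod ((\<i> * of_real \<mu> * Y 3 y + (lower_order l \<kappa> u z 3 y + h 3 y)) + of_nat (Suc 0) * (- (of_real (2*l) * p 1)) * of_real y ^ 0
          + of_nat (Suc 1) * (- (c / 2)) * of_real y ^ 1) \<le> C1 * \<theta> + C2 * S * y ^ 2 + \<gamma> y" unfolding e .
    qed (use x C S_nonneg in auto)
    also have "(C1 * \<theta>) * x \<le> (C1 * \<theta>) * b" using x C \<theta>_nonneg by (intro mult_left_mono) auto
    also have "(LINT t:{0..b}|lborel. \<gamma> t) \<le> \<theta>" by (rule \<gamma>_int_le)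
    also have "(z 3 x + (- (of_real (2*l) * p 1)) * of_real x ^ Suc 0 + (- (c / 2)) * of_real x ^ Suc 1)
       - (z 3 0 + (- (of_real (2*l) * p 1)) * of_real 0 ^ Suc 0 + (- (c / 2)) * of_real 0 ^ Suc 1)
       = z 3 x - (p 3 + of_real (2*l) * p 1 * of_real x + c / 2 * of_real x ^ 2)"
      by (simp add: p_def power2_eq_square)
    finally show ?thesis by (simp add: power3_eq_cube power2_eq_square algebra_simps)
  qed
  have u3_le: "cmod (u 3 x - (p 3 * of_real x + of_real l * p 1 * of_real x ^ 2 + c / 6 * of_real x ^ 3)) \<le> \<theta> * (C1 * b + 1) * b + C2 * S * x ^ 4" if x: "0 \<le> x" "x \<le> b" for x
  proof -
    have ac: "AC b (\<lambda>x. u 3 x + (- p 3) * of_real x ^ Suc 0 + (- (of_real l * p 1)) * of_real x ^ Suc 1 + (- (c / 6)) * of_real x ^ Suc 2)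
       (\<lambda>x. z 3 x + of_nat (Suc 0) * (- p 3) * of_real x ^ 0 + of_nat (Suc 1) * (- (of_real l * p 1)) * of_real x ^ 1 + of_nat (Suc 2) * (- (c / 6)) * of_real x ^ 2)"
      by (intro AC_add AC_u AC_monomial) auto
    have "cmod ((u 3 x + (- p 3) * of_real x ^ Suc 0 + (- (of_real l * p 1)) * of_real x ^ Suc 1 + (- (c / 6)) * of_real x ^ Suc 2)
       - (u 3 0 + (- p 3) * of_real 0 ^ Suc 0 + (- (of_real l * p 1)) * of_real 0 ^ Suc 1 + (- (c / 6)) * of_real 0 ^ Suc 2))
       \<le> (\<theta> * (C1 * b + 1)) * x + (C2 * S) * x ^ Suc 3"
    proof (rule AC_le0[OF ac])
      fix y assume y: "0 \<le> y" "y \<le> b"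
      have "z 3 y + of_nat (Suc 0) * (- p 3) * of_real y ^ 0 + of_nat (Suc 1) * (- (of_real l * p 1)) * of_real y ^ 1 + of_nat (Suc 2) * (- (c / 6)) * of_real y ^ 2
         = z 3 y - (p 3 + of_real (2*l) * p 1 * of_real y + c / 2 * of_real y ^ 2)"
        by (simp add: algebra_simps)
      then show "cmod (z 3 y + of_nat (Suc 0) * (- p 3) * of_real y ^ 0 + of_nat (Suc 1) * (- (of_real l * p 1)) * of_real y ^ 1 + of_nat (Suc 2) * (- (c / 6)) * of_real y ^ 2)
         \<le> \<theta> * (C1 * b + 1) + C2 * S * y ^ 3"
        using z3_le[OF y] by metis
    qed (use x C S_nonneg in auto)
    also have "(\<theta> * (C1 * b + 1)) * x \<le> (\<theta> * (C1 * b + 1)) * b" using x C pos \<theta>_nonneg by (intro mult_left_mono) auto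
    also have "(u 3 x + (- p 3) * of_real x ^ Suc 0 + (- (of_real l * p 1)) * of_real x ^ Suc 1 + (- (c / 6)) * of_real x ^ Suc 2)
       - (u 3 0 + (- p 3) * of_real 0 ^ Suc 0 + (- (of_real l * p 1)) * of_real 0 ^ Suc 1 + (- (c / 6)) * of_real 0 ^ Suc 2)
       = u 3 x - (p 3 * of_real x + of_real l * p 1 * of_real x ^ 2 + c / 6 * of_real x ^ 3)"
      by (simp add: u0 numeral_eq_Suc algebra_simps)
    finally show ?thesis by (simp add: numeral_eq_Suc algebra_simps)
  qed
  define m where "m = \<theta> * (1 + (C1 * b + 1) * b * b) + 243 * C2 * S * r ^ 5"
  have I_le: "cmod (p 3 / 2 * of_real x ^ 2 + of_real (l/3) * p 1 * of_real x ^ 3 + c / 24 * of_real x ^ 4) \<le> \<theta> * (1 + (C1 * b + 1) * b * b) + C2 * S * x ^ 5"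
     (is "cmod (?I x) \<le> _") if x: "0 \<le> x" "x \<le> b" for x
  proof -
    \<comment> \<open>\<open>u 3\<close> is bounded by \<gamma>, of which only the mean is
      controlled; hence one more integration, and monomials of degree 2, 3 and 4.\<close>
    define OU where "OU x = (LINT t:{0..x}|lborel. u 3 t)" for x
    have iu: "set_integrable lborel {0..b} (u 3)" by (intro set_integrable_continuous cont) auto
    have ac: "AC b (\<lambda>x. OU x + (- (p 3 / 2)) * of_real x ^ Suc 1 + (- (of_real (l/3) * p 1)) * of_real x ^ Suc 2 + (- (c / 24)) * of_real x ^ Suc 3)
       (\<lambda>x. u 3 x + of_nat (Suc 1) * (- (p 3 / 2)) * of_real x ^ 1 + of_nat (Suc 2) * (- (of_real (l/3) * p 1)) * of_real x ^ 2 + of_nat (Suc 3) * (- (c / 24)) * of_real x ^ 3)"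
      unfolding OU_def[abs_def] by (intro AC_add AC_integral iu AC_monomial)
    have "cmod ((OU x + (- (p 3 / 2)) * of_real x ^ Suc 1 + (- (of_real (l/3) * p 1)) * of_real x ^ Suc 2 + (- (c / 24)) * of_real x ^ Suc 3)
       - (OU 0 + (- (p 3 / 2)) * of_real 0 ^ Suc 1 + (- (of_real (l/3) * p 1)) * of_real 0 ^ Suc 2 + (- (c / 24)) * of_real 0 ^ Suc 3))
       \<le> (\<theta> * (C1 * b + 1) * b) * x + (C2 * S) * x ^ Suc 4"
    proof (rule AC_le0[OF ac])
      fix y assume y: "0 \<le> y" "y \<le> b"
      have "u 3 y + of_nat (Suc 1) * (- (p 3 / 2)) * of_real y ^ 1 + of_nat (Suc 2) * (- (of_real (l/3) * p 1)) * of_real y ^ 2 + of_nat (Suc 3) * (- (c / 24)) * of_real y ^ 3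
         = u 3 y - (p 3 * of_real y + of_real l * p 1 * of_real y ^ 2 + c / 6 * of_real y ^ 3)"
        by (simp add: algebra_simps)
      then show "cmod (u 3 y + of_nat (Suc 1) * (- (p 3 / 2)) * of_real y ^ 1 + of_nat (Suc 2) * (- (of_real (l/3) * p 1)) * of_real y ^ 2 + of_nat (Suc 3) * (- (c / 24)) * of_real y ^ 3)
         \<le> \<theta> * (C1 * b + 1) * b + C2 * S * y ^ 4"
        using u3_le[OF y] by metis
    qed (use x C S_nonneg in auto)
    also have "(\<theta> * (C1 * b + 1) * b) * x \<le> (\<theta> * (C1 * b + 1) * b) * b" using x C pos \<theta>_nonneg by (intro mult_left_mono) auto
    also have "(OU x + (- (p 3 / 2)) * of_real x ^ Suc 1 + (- (of_real (l/3) * p 1)) * of_real x ^ Suc 2 + (- (c / 24)) * of_real x ^ Suc 3)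
       - (OU 0 + (- (p 3 / 2)) * of_real 0 ^ Suc 1 + (- (of_real (l/3) * p 1)) * of_real 0 ^ Suc 2 + (- (c / 24)) * of_real 0 ^ Suc 3) = OU x - ?I x"
      by (simp add: OU_def numeral_eq_Suc algebra_simps)
    finally have 2: "cmod (OU x - ?I x) \<le> \<theta> * (C1 * b + 1) * b * b + C2 * S * x ^ 5" by (simp add: numeral_eq_Suc algebra_simps)
    have 1: "cmod (OU x) \<le> \<theta>"
      unfolding OU_def using u3 by (intro order_trans[OF norm_integral_le[OF iu _ \<gamma>_int(1) \<gamma>_nonneg x] \<gamma>_int_le])
    have "?I x = OU x - (OU x - ?I x)" by simp
    then have "cmod (?I x) \<le> cmod (OU x) + cmod (OU x - ?I x)" by (metis norm_triangle_ineq4)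
    then have "cmod (?I x) \<le> \<theta> + (\<theta> * (C1 * b + 1) * b * b + C2 * S * x ^ 5)" using 1 2 by linarith
    then show ?thesis by (simp add: algebra_simps)
  qed
  define A B D where "A = p 3 / 2 * of_real r ^ 2" and "B = of_real (l/3) * p 1 * of_real r ^ 3" and "D = c / 24 * of_real r ^ 4"
  have i: "cmod (of_real (n^2) * A + of_real (n^3) * B + of_real (n^4) * D) \<le> m" if n: "0 \<le> n" "n \<le> 3" for n
  proof -
    have "n * r \<le> 3 * r" using n r by (intro mult_right_mono) auto
    then have nr: "n * r \<le> b" using r by linarith
    have "n ^ 5 \<le> 3 ^ 5" using n by (intro power_mono) auto
    then have "n ^ 5 * (C2 * S * r ^ 5) \<le> 243 * (C2 * S * r ^ 5)"
      using C S_nonneg r by (intro mult_right_mono) auto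
    then have le: "C2 * S * (n * r) ^ 5 \<le> 243 * C2 * S * r ^ 5" by (simp add: power_mult_distrib algebra_simps)
    have "cmod (p 3 / 2 * of_real (n*r) ^ 2 + of_real (l/3) * p 1 * of_real (n*r) ^ 3 + c / 24 * of_real (n*r) ^ 4) \<le> \<theta> * (1 + (C1 * b + 1) * b * b) + C2 * S * (n*r) ^ 5"
      using n r nr by (intro I_le) auto
    moreover have "p 3 / 2 * of_real (n*r) ^ 2 + of_real (l/3) * p 1 * of_real (n*r) ^ 3 + c / 24 * of_real (n*r) ^ 4
      = of_real (n^2) * A + of_real (n^3) * B + of_real (n^4) * D"
      by (simp add: A_def B_def D_def power_mult_distrib algebra_simps)
    ultimately show ?thesis using le unfolding m_def by (smt (verit))
  qed
  have abc: "cmod A \<le> 20 * m" "cmod B \<le> 20 * m" "cmod D \<le> 20 * m"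
    using quartic_coefficients_le[of A B D m] i[of 1] i[of 2] i[of 3] by simp_all
  have m0: "0 \<le> m" using norm_ge_zero[of A] abc(1) by linarith
  have r4: "r ^ 4 \<le> r ^ 2" "r ^ 4 \<le> r ^ 3" using r power_decreasing[of 2 4 r] power_decreasing[of 3 4 r] by auto
  have p3: "cmod (p 3) * r ^ 4 \<le> 40 * m"
  proof -
    have "cmod (p 3) * r ^ 2 \<le> 40 * m" using abc(1) r by (simp add: A_def norm_mult norm_power norm_divide)
    moreover have "cmod (p 3) * r ^ 4 \<le> cmod (p 3) * r ^ 2" using r4 by (intro mult_left_mono) auto
    ultimately show ?thesis by linarith
  qed
  have p1: "cmod (p 1) * r ^ 4 \<le> 60 / l * m"
  proof -
    have "l / 3 * (cmod (p 1) * r ^ 3) \<le> 20 * m" using abc(2) r pos by (simp add: B_def norm_mult norm_power)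
    then have "cmod (p 1) * r ^ 3 \<le> 60 / l * m" using pos by (simp add: field_simps)
    moreover have "cmod (p 1) * r ^ 4 \<le> cmod (p 1) * r ^ 3" using r4 by (intro mult_left_mono) auto
    ultimately show ?thesis by linarith
  qed
  have p2: "cmod (p 2) * r ^ 4 \<le> (480 + 40 * (3 * l\<^sup>2 + \<Lambda>\<^sup>2)) / l * m"
  proof -
    have 1: "cmod c * r ^ 4 \<le> 480 * m" using abc(3) r by (simp add: D_def norm_mult norm_power norm_divide)
    \<comment> \<open>The slope \<open>p 2\<close> is seen through \<open>c\<close> alone and is
      recovered with the help of the bound already found for \<open>p 3\<close>.\<close>
    have "of_real l * p 2 = - c - of_real (3 * l\<^sup>2 + \<mu>\<^sup>2) * p 3" by (simp add: c_def)
    then have "cmod (of_real l * p 2) \<le> cmod c + cmod (of_real (3 * l\<^sup>2 + \<mu>\<^sup>2) * p 3)"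
      using norm_triangle_ineq4[of "- c" "of_real (3 * l\<^sup>2 + \<mu>\<^sup>2) * p 3"] by simp
    moreover have "cmod (of_real (3 * l\<^sup>2 + \<mu>\<^sup>2) * p 3) \<le> (3 * l\<^sup>2 + \<Lambda>\<^sup>2) * cmod (p 3)"
      using power_mono[OF \<mu>, of 2] by (simp only: norm_mult norm_of_real) (intro mult_right_mono, auto)
    ultimately have "l * cmod (p 2) \<le> cmod c + (3 * l\<^sup>2 + \<Lambda>\<^sup>2) * cmod (p 3)" using pos by (simp add: norm_mult)
    then have "l * cmod (p 2) * r ^ 4 \<le> (cmod c + (3 * l\<^sup>2 + \<Lambda>\<^sup>2) * cmod (p 3)) * r ^ 4"
      using r by (intro mult_right_mono) auto
    also have "\<dots> = cmod c * r ^ 4 + (3 * l\<^sup>2 + \<Lambda>\<^sup>2) * (cmod (p 3) * r ^ 4)" by (simp add: algebra_simps)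
    also have "\<dots> \<le> 480 * m + (3 * l\<^sup>2 + \<Lambda>\<^sup>2) * (40 * m)" using 1 p3 by (intro add_mono mult_left_mono) auto
    also have "\<dots> = (480 + 40 * (3 * l\<^sup>2 + \<Lambda>\<^sup>2)) * m" by (simp add: algebra_simps)
    finally show ?thesis using pos by (simp add: field_simps)
  qed
  have "pn * r ^ 4 = cmod (p 1) * r ^ 4 + cmod (p 2) * r ^ 4 + cmod (p 3) * r ^ 4" by (simp add: pn_eq algebra_simps)
  also have "\<dots> \<le> 60 / l * m + (480 + 40 * (3 * l\<^sup>2 + \<Lambda>\<^sup>2)) / l * m + 40 * m" using p1 p2 p3 by linarith
  also have "\<dots> = (40 + 60/l + (480 + 40 * (3 * l\<^sup>2 + \<Lambda>\<^sup>2))/l) * m" by (simp add: algebra_simps)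
  finally show ?thesis by (simp add: m_def)
qed

end

lemma observability_low:
  fixes b l \<kappa> \<Lambda> :: real
  assumes pos: "0 < b" "0 < l" "0 < \<kappa>" "0 \<le> \<Lambda>"
  shows "\<exists>C. 0 < C \<and> (\<forall>\<mu> u Y z g h \<gamma>. bresse_ode0 b l \<kappa> \<mu> u Y z g h \<gamma> \<longrightarrow> \<bar>\<mu>\<bar> \<le> \<Lambda> \<longrightarrow>
    (\<forall>x\<in>{0..b}. cmod (u 3 x) \<le> \<gamma> x) \<longrightarrow> bresse_ode.pn z \<le> C * bresse_ode.\<delta> b \<gamma>)"
proof -
  define K where "K = 1 + 3*l + l\<^sup>2 + \<kappa>*(2 + l)"
  define K0 where "K0 = 4 * exp ((3 + 12 * (K + 0)\<^sup>2) * b)"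
  define N where "N = \<Lambda> + K"
  define C1 where "C1 = \<Lambda> + (\<Lambda>\<^sup>2 + l + l\<^sup>2) * b + 2 * l * (1 + N * b)"
  define C2 where "C2 = (\<Lambda>\<^sup>2 + l + l\<^sup>2) * N + 6 * l * N\<^sup>2"
  define C7 where "C7 = 40 + 60/l + (480 + 40 * (3 * l\<^sup>2 + \<Lambda>\<^sup>2))/l"
  define a1 where "a1 = 1 + (C1 * b + 1) * b * b"
  \<comment> \<open>Makes the remainder at most half of \<open>r ^ 4\<close> times slopes plus data.
    The choice depends on \<Lambda>, not on \<mu>, so the final constant is uniform over the bounded
    range.\<close>
  define r where "r = min 1 (min (b/3) (1 / (2 * C7 * 243 * C2 * K0)))"
  define C where "C = 2 * C7 * a1 * sqrt b / r ^ 4 + 1"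
  have K1: "1 \<le> K" using pos by (simp add: K_def)
  have N1: "1 \<le> N" using pos K1 by (simp add: N_def)
  have K0: "0 < K0" by (simp add: K0_def)
  have "0 \<le> (480 + 40 * (3 * l\<^sup>2 + \<Lambda>\<^sup>2))/l" "0 \<le> 60 / l" using pos by auto
  then have C7: "0 < C7" unfolding C7_def by linarith
  have C1: "0 \<le> C1" using pos N1 by (simp add: C1_def)
  have C2: "0 < C2" using pos N1 unfolding C2_def by (intro add_nonneg_pos) auto
  have a1: "0 < a1" using C1 pos unfolding a1_def by (intro add_pos_nonneg) auto
  have r: "0 < r" "r \<le> 1" "3 * r \<le> b" using pos C7 C2 K0 by (auto simp: r_def)
  have r2: "C7 * 243 * C2 * K0 * r \<le> 1/2"
  proof -
    have "r \<le> 1 / (2 * C7 * 243 * C2 * K0)" by (simp add: r_def)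
    moreover have "0 < C7 * 243 * C2 * K0" using C7 C2 K0 by simp
    ultimately show ?thesis by (simp add: field_simps)
  qed
  have C0: "0 < C" using C7 a1 pos r by (simp add: C_def add_nonneg_pos)
  have "bresse_ode.pn z \<le> C * bresse_ode.\<delta> b \<gamma>"
    if ode: "bresse_ode0 b l \<kappa> \<mu> u Y z g h \<gamma>" and \<mu>: "\<bar>\<mu>\<bar> \<le> \<Lambda>" and u3: "\<forall>x\<in>{0..b}. cmod (u 3 x) \<le> \<gamma> x"
    for \<mu> u Y z g h \<gamma>
  proof -
    interpret o: bresse_ode0 b l \<kappa> \<mu> u Y z g h \<gamma> by fact
    have K: "o.K = K" by (simp add: o.K_def K_def)
    have S: "o.S = K0 * (o.pn + o.\<delta>)" by (simp add: o.S_def o.K0_def K K0_def)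
    have \<theta>: "o.\<theta> = sqrt b * o.\<delta>" by (rule o.\<theta>_def)
    have "o.pn * r ^ 4 \<le> C7 * (o.\<theta> * a1 + 243 * C2 * o.S * r ^ 5)"
      using o.pn_le_low[OF \<mu> _ r] u3 unfolding K N_def[symmetric] C1_def[symmetric] C2_def[symmetric] C7_def a1_def by auto
    also have "\<dots> = C7 * a1 * sqrt b * o.\<delta> + (C7 * 243 * C2 * K0 * r) * r ^ 4 * (o.pn + o.\<delta>)"
      by (simp add: S \<theta> algebra_simps numeral_eq_Suc)
    also have "\<dots> \<le> C7 * a1 * sqrt b * o.\<delta> + 1/2 * r ^ 4 * (o.pn + o.\<delta>)"
      using r a1 C7 pos o.pn_nonneg o.\<delta>_nonneg by (intro add_mono mult_right_mono r2) auto
    finally have "r ^ 4 * o.pn \<le> 2 * C7 * a1 * sqrt b * o.\<delta> + r ^ 4 * o.\<delta>" by (simp add: field_simps)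
    also have "\<dots> = r ^ 4 * (C * o.\<delta>)" using r by (simp add: C_def field_simps)
    finally show ?thesis using r by simp
  qed
  then show ?thesis using C0 by (intro exI[of _ C]) auto
qed

section \<open>Square-integrable states\<close>

lemma set_integrable_I_bound:
  fixes f :: "real \<Rightarrow> 'a::euclidean_space" and g :: "real \<Rightarrow> real"
  assumes "set_integrable lborel S g" "set_borel_measurable lborel S f" "\<And>x. x \<in> S \<Longrightarrow> norm (f x) \<le> g x"
  shows "set_integrable lborel S f"
  unfolding set_integrable_def
proof (rule Bochner_Integration.integrable_bound)
  show "integrable lborel (\<lambda>x. indicat_real S x *\<^sub>R g x)" using assms(1) by (simp add: set_integrable_def)
  show "(\<lambda>x. indicat_real S x *\<^sub>R f x) \<in> borel_measurable lborel" using assms(2) by (simp add: set_borel_measurable_def)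
  show "AE x in lborel. norm (indicat_real S x *\<^sub>R f x) \<le> norm (indicat_real S x *\<^sub>R g x)"
    using assms(3) by (intro AE_I2) (force split: split_indicator)
qed

lemma set_integrable_measurable:
  fixes f :: "real \<Rightarrow> 'a::euclidean_space"
  shows "set_integrable lborel S f \<Longrightarrow> set_borel_measurable lborel S f"
  by (auto simp: set_integrable_def set_borel_measurable_def)

text \<open>Measurability on \<open>S\<close> refers to the function cut off outside
  \<open>S\<close>. As \<open>G\<close> may be nonzero at 0, the composition has to be cut off once
  more.\<close>

lemma sbm_compose:
  fixes f :: "real \<Rightarrow> 'a::euclidean_space" and G :: "'a \<Rightarrow> 'b::euclidean_space"
  assumes "set_borel_measurable lborel S f" "continuous_on UNIV G" "S \<in> sets borel"
  shows "set_borel_measurable lborel S (\<lambda>x. G (f x))"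
proof -
  have "(\<lambda>x. indicat_real S x *\<^sub>R G (indicat_real S x *\<^sub>R f x)) \<in> borel_measurable lborel"
  proof (rule borel_measurable_scaleR)
    show "(\<lambda>x. G (indicat_real S x *\<^sub>R f x)) \<in> borel_measurable lborel"
      using measurable_compose[OF assms(1)[unfolded set_borel_measurable_def] borel_measurable_continuous_onI[OF assms(2)]] .
    show "indicat_real S \<in> borel_measurable lborel" using assms(3) by simp
  qed
  moreover have "(\<lambda>x. indicat_real S x *\<^sub>R G (indicat_real S x *\<^sub>R f x)) = (\<lambda>x. indicat_real S x *\<^sub>R G (f x))"
    by (auto simp: fun_eq_iff split: split_indicator)
  ultimately show ?thesis by (simp add: set_borel_measurable_def)
qed

lemma sbm_mult:
  fixes f g :: "real \<Rightarrow> complex"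
  assumes "set_borel_measurable lborel S f" "set_borel_measurable lborel S g"
  shows "set_borel_measurable lborel S (\<lambda>x. f x * g x)"
proof -
  have "(\<lambda>x. (indicat_real S x *\<^sub>R f x) * (indicat_real S x *\<^sub>R g x)) \<in> borel_measurable lborel"
    using assms unfolding set_borel_measurable_def by (rule borel_measurable_times)
  moreover have "(\<lambda>x. (indicat_real S x *\<^sub>R f x) * (indicat_real S x *\<^sub>R g x)) = (\<lambda>x. indicat_real S x *\<^sub>R (f x * g x))"
    by (auto simp: fun_eq_iff split: split_indicator)
  ultimately show ?thesis by (simp add: set_borel_measurable_def)
qed

lemma sbm_add:
  fixes f g :: "real \<Rightarrow> complex"
  assumes "set_borel_measurable lborel S f" "set_borel_measurable lborel S g"
  shows "set_borel_measurable lborel S (\<lambda>x. f x + g x)"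
proof -
  have "(\<lambda>x. (indicat_real S x *\<^sub>R f x) + (indicat_real S x *\<^sub>R g x)) \<in> borel_measurable lborel"
    using assms unfolding set_borel_measurable_def by (rule borel_measurable_add)
  then show ?thesis by (simp add: set_borel_measurable_def scaleR_add_right)
qed

lemma L2_measurable: "L2 L f \<Longrightarrow> set_borel_measurable lborel {0..L} f"
  by (simp add: L2_def)

lemma L2_square: "L2 L f \<Longrightarrow> set_integrable lborel {0..L} (\<lambda>x. (cmod (f x))\<^sup>2)"
  by (simp add: L2_def)

lemma set_integrable_one: "set_integrable lborel {0..L::real} (\<lambda>_. c :: real)"
  by (intro set_integrable_continuous continuous_intros)

lemma L2_integrable:
  assumes "L2 L f" shows "set_integrable lborel {0..L} f"
proof (rule set_integrable_I_bound)
  show "set_integrable lborel {0..L} (\<lambda>x. 1 + (cmod (f x))\<^sup>2)"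
    using set_integrable_one L2_square[OF assms] by (intro set_integral_add(1))
  have "t \<le> 1 + t\<^sup>2" for t :: real using zero_le_power2[of "t - 1/2"] by (simp add: power2_eq_square algebra_simps)
  then show "norm (f x) \<le> 1 + (cmod (f x))\<^sup>2" for x by blast
qed (rule L2_measurable[OF assms])

lemma L2_mult_integrable:
  assumes "L2 L f" "L2 L g" shows "set_integrable lborel {0..L} (\<lambda>x. f x * g x)"
proof (rule set_integrable_I_bound)
  show "set_integrable lborel {0..L} (\<lambda>x. (cmod (f x))\<^sup>2 + (cmod (g x))\<^sup>2)"
    using assms by (intro set_integral_add(1) L2_square)
  show "norm (f x * g x) \<le> (cmod (f x))\<^sup>2 + (cmod (g x))\<^sup>2" for x
    using sum_squares_bound[of "cmod (f x)" "cmod (g x)"] mult_nonneg_nonneg[OF norm_ge_zero norm_ge_zero, of "f x" "g x"]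
    unfolding norm_mult by linarith
qed (intro sbm_mult L2_measurable assms)

lemma L2_add:
  assumes "L2 L f" "L2 L g" shows "L2 L (\<lambda>x. f x + g x)"
  unfolding L2_def
proof
  show m: "set_borel_measurable lborel {0..L} (\<lambda>x. f x + g x)" by (intro sbm_add L2_measurable assms)
  show "set_integrable lborel {0..L} (\<lambda>x. (cmod (f x + g x))\<^sup>2)"
  proof (rule set_integrable_I_bound)
    show "set_integrable lborel {0..L} (\<lambda>x. 2 * (cmod (f x))\<^sup>2 + 2 * (cmod (g x))\<^sup>2)"
      using assms by (intro set_integral_add(1) set_integrable_mult_right impI L2_square)
    show "norm ((cmod (f x + g x))\<^sup>2) \<le> 2 * (cmod (f x))\<^sup>2 + 2 * (cmod (g x))\<^sup>2" for x
    proof -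
      have "(cmod (f x + g x))\<^sup>2 \<le> (cmod (f x) + cmod (g x))\<^sup>2" by (intro power_mono norm_triangle_ineq) auto
      also have "\<dots> \<le> 2 * (cmod (f x))\<^sup>2 + 2 * (cmod (g x))\<^sup>2"
        using sum_squares_bound[of "cmod (f x)" "cmod (g x)"] by (simp add: power2_sum)
      finally show ?thesis by simp
    qed
    show "set_borel_measurable lborel {0..L} (\<lambda>x. (cmod (f x + g x))\<^sup>2)"
      by (rule sbm_compose[OF m, of "\<lambda>w. (cmod w)\<^sup>2"]) (auto intro!: continuous_intros)
  qed
qed

lemma L2_cmult: assumes "L2 L f" shows "L2 L (\<lambda>x. c * f x)"
  using assms sbm_compose[OF L2_measurable[OF assms], of "\<lambda>w. c * w"]
  by (auto simp: L2_def norm_mult power_mult_distrib intro!: continuous_intros)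

lemma L2_diff: "L2 L f \<Longrightarrow> L2 L g \<Longrightarrow> L2 L (\<lambda>x. f x - g x)"
  using L2_add[of L f "\<lambda>x. -1 * g x"] L2_cmult[of L g "-1"] by simp

lemma L2_continuous: assumes "continuous_on {0..L} f" shows "L2 L f"
  unfolding L2_def
  by (intro conjI set_integrable_measurable set_integrable_continuous continuous_intros assms)

lemma L2_cnj: assumes "L2 L f" shows "L2 L (\<lambda>x. cnj (f x))"
  using assms sbm_compose[OF L2_measurable[OF assms], of cnj] by (auto simp: L2_def intro!: continuous_intros)

lemma L2_AC: "AC L f F \<Longrightarrow> L2 L f"
  using AC_continuous L2_continuous by blast

lemma L2_damp: assumes "L2 L f" "0 \<le> a0" shows "L2 L (\<lambda>x. of_real (damp a0 \<beta> x) * f x)"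
  unfolding L2_def
proof
  have d: "damp a0 \<beta> \<in> borel_measurable borel" unfolding damp_def[abs_def] by measurable
  then have "set_borel_measurable lborel {0..L} (\<lambda>x. complex_of_real (damp a0 \<beta> x))"
    unfolding set_borel_measurable_def by measurable
  then show m: "set_borel_measurable lborel {0..L} (\<lambda>x. of_real (damp a0 \<beta> x) * f x)"
    by (rule sbm_mult) (rule L2_measurable[OF assms(1)])
  show "set_integrable lborel {0..L} (\<lambda>x. (cmod (of_real (damp a0 \<beta> x) * f x))\<^sup>2)"
  proof (rule set_integrable_I_bound)
    show "set_integrable lborel {0..L} (\<lambda>x. a0\<^sup>2 * (cmod (f x))\<^sup>2)"
      using assms by (intro set_integrable_mult_right impI L2_square)
    show "norm ((cmod (of_real (damp a0 \<beta> x) * f x))\<^sup>2) \<le> a0\<^sup>2 * (cmod (f x))\<^sup>2" for x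
      by (auto simp: damp_def norm_mult power_mult_distrib)
    show "set_borel_measurable lborel {0..L} (\<lambda>x. (cmod (of_real (damp a0 \<beta> x) * f x))\<^sup>2)"
      by (rule sbm_compose[OF m, of "\<lambda>w. (cmod w)\<^sup>2"]) (auto intro!: continuous_intros)
  qed
qed

section \<open>The norm on six square-integrable components\<close>

definition L2_6 :: "real \<Rightarrow> (nat \<Rightarrow> real \<Rightarrow> complex) \<Rightarrow> bool" where
  "L2_6 L F \<longleftrightarrow> (\<forall>i\<in>{1..6}. L2 L (F i))"

definition norm6 :: "real \<Rightarrow> (nat \<Rightarrow> real \<Rightarrow> complex) \<Rightarrow> real" where
  "norm6 L F = sqrt (LINT x:{0..L}|lborel. \<Sum>i\<in>{1..6}. (cmod (F i x))\<^sup>2)"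

lemma L2_6_int: "L2_6 L F \<Longrightarrow> set_integrable lborel {0..L} (\<lambda>x. \<Sum>i\<in>{1..6}. (cmod (F i x))\<^sup>2)"
  unfolding L2_6_def set_integrable_def scaleR_sum_right
  by (intro Bochner_Integration.integrable_sum) (use L2_square in \<open>auto simp: set_integrable_def\<close>)

lemma norm6_square: "(norm6 L F)\<^sup>2 = (LINT x:{0..L}|lborel. \<Sum>i\<in>{1..6}. (cmod (F i x))\<^sup>2)"
  unfolding norm6_def set_lebesgue_integral_def
  by (intro real_sqrt_pow2 Bochner_Integration.integral_nonneg scaleR_nonneg_nonneg sum_nonneg) auto

lemma norm6_nonneg: "0 \<le> norm6 L F"
  unfolding norm6_def set_lebesgue_integral_def
  by (intro real_sqrt_ge_zero Bochner_Integration.integral_nonneg scaleR_nonneg_nonneg sum_nonneg) auto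

lemma norm6_component:
  assumes "L2_6 L F" "i \<in> {1..6}"
  shows "(LINT x:{0..L}|lborel. (cmod (F i x))\<^sup>2) \<le> (norm6 L F)\<^sup>2"
  unfolding norm6_square
proof (rule set_integral_mono)
  show "(cmod (F i x))\<^sup>2 \<le> (\<Sum>i\<in>{1..6}. (cmod (F i x))\<^sup>2)" for x
    by (rule member_le_sum) (use assms in auto)
qed (use assms L2_square L2_6_int in \<open>auto simp: L2_6_def\<close>)

lemma norm6_cong_AE:
  assumes "L2_6 L F" "L2_6 L G" "\<And>i. i \<in> {1..6} \<Longrightarrow> AE x in lborel. x \<in> {0..L} \<longrightarrow> F i x = G i x"
  shows "norm6 L F = norm6 L G"
proof -
  have "AE x in lborel. \<forall>i\<in>{1..6}. x \<in> {0..L} \<longrightarrow> F i x = G i x"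
    by (rule AE_finite_allI) (use assms(3) in auto)
  then have "AE x in lborel. indicat_real {0..L} x *\<^sub>R (\<Sum>i\<in>{1..6}. (cmod (F i x))\<^sup>2) = indicat_real {0..L} x *\<^sub>R (\<Sum>i\<in>{1..6}. (cmod (G i x))\<^sup>2)"
    by eventually_elim (auto split: split_indicator)
  then have "(LINT x:{0..L}|lborel. \<Sum>i\<in>{1..6}. (cmod (F i x))\<^sup>2) = (LINT x:{0..L}|lborel. \<Sum>i\<in>{1..6}. (cmod (G i x))\<^sup>2)"
    unfolding set_lebesgue_integral_def using L2_6_int[OF assms(1)] L2_6_int[OF assms(2)]
    by (intro integral_cong_AE) (auto simp: set_integrable_def)
  then show ?thesis by (simp add: norm6_def)
qed

lemma L2_6_lin: "L2_6 L F \<Longrightarrow> L2_6 L G \<Longrightarrow> L2_6 L (\<lambda>i x. c * F i x + d * G i x)"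
  by (auto simp: L2_6_def intro!: L2_add L2_cmult)

lemma norm6_cmult: "norm6 L (\<lambda>i x. c * F i x) = cmod c * norm6 L F"
proof -
  have "(LINT x:{0..L}|lborel. \<Sum>i\<in>{1..6}. (cmod (c * F i x))\<^sup>2) = (cmod c)\<^sup>2 * (LINT x:{0..L}|lborel. \<Sum>i\<in>{1..6}. (cmod (F i x))\<^sup>2)"
    by (simp add: norm_mult power_mult_distrib sum_distrib_left[symmetric])
  then show ?thesis by (simp add: norm6_def real_sqrt_mult)
qed

text \<open>Minkowski's inequality from the weighted bound
  \<open>(f + g)^2 \<le> (1 + e) f^2 + (1 + 1/e) g^2\<close>, which holds pointwise and integrates
  directly; choosing the weight afterwards yields the sum of the norms.\<close>

lemma norm6_triangle:
  assumes "L2_6 L F" "L2_6 L G"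
  shows "norm6 L (\<lambda>i x. F i x + G i x) \<le> norm6 L F + norm6 L G"
proof -
  let ?a = "norm6 L F" and ?b = "norm6 L G" and ?n = "norm6 L (\<lambda>i x. F i x + G i x)"
  have FG: "L2_6 L (\<lambda>i x. F i x + G i x)" using L2_6_lin[OF assms, of 1 1] by simp
  have weighted: "?n\<^sup>2 \<le> (1 + e) * ?a\<^sup>2 + (1 + 1/e) * ?b\<^sup>2" if e: "0 < e" for e
  proof -
    have "?n\<^sup>2 \<le> (LINT x:{0..L}|lborel. (1 + e) * (\<Sum>i\<in>{1..6}. (cmod (F i x))\<^sup>2) + (1 + 1/e) * (\<Sum>i\<in>{1..6}. (cmod (G i x))\<^sup>2))"
      unfolding norm6_square
    proof (rule set_integral_mono)
      fix x
      have "(cmod (F i x + G i x))\<^sup>2 \<le> (1 + e) * (cmod (F i x))\<^sup>2 + (1 + 1/e) * (cmod (G i x))\<^sup>2" for i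
      proof -
        let ?f = "cmod (F i x)" and ?g = "cmod (G i x)"
        have "(cmod (F i x + G i x))\<^sup>2 \<le> (?f + ?g)\<^sup>2" by (intro power_mono norm_triangle_ineq) auto
        moreover have "0 \<le> (sqrt e * ?f - ?g / sqrt e)\<^sup>2" by simp
        then have "2 * ?f * ?g \<le> e * ?f\<^sup>2 + ?g\<^sup>2 / e"
          using e by (simp add: power2_diff power_mult_distrib power_divide)
        ultimately show ?thesis by (simp add: power2_sum algebra_simps)
      qed
      then show "(\<Sum>i\<in>{1..6}. (cmod (F i x + G i x))\<^sup>2) \<le> (1 + e) * (\<Sum>i\<in>{1..6}. (cmod (F i x))\<^sup>2) + (1 + 1/e) * (\<Sum>i\<in>{1..6}. (cmod (G i x))\<^sup>2)"
        unfolding sum_distrib_left sum.distrib[symmetric] by (intro sum_mono)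
    qed (intro L2_6_int FG set_integral_add(1) set_integrable_mult_right impI assms)+
    also have "\<dots> = (1 + e) * ?a\<^sup>2 + (1 + 1/e) * ?b\<^sup>2"
      unfolding norm6_square using L2_6_int[OF assms(1)] L2_6_int[OF assms(2)] by (subst set_integral_add) auto
    finally show ?thesis .
  qed
  have a: "0 \<le> ?a" and b: "0 \<le> ?b" using norm6_nonneg by auto
  have "?n \<le> ?a + ?b + r" if r: "0 < r" for r
  proof -
    \<comment> \<open>The optimal weight would be \<open>?b / ?a\<close>; the shift by
      \<open>r/2\<close> keeps numerator and denominator positive when a norm vanishes.\<close>
    let ?e = "(?b + r/2) / (?a + r/2)"
    have p: "0 < ?a + r/2" "0 < ?b + r/2" using a b r by auto
    have "?n\<^sup>2 \<le> (1 + ?e) * ?a\<^sup>2 + (1 + 1/?e) * ?b\<^sup>2" using weighted[of ?e] p by simp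
    also have "\<dots> \<le> (1 + ?e) * (?a + r/2)\<^sup>2 + (1 + 1/?e) * (?b + r/2)\<^sup>2"
      using p a b r by (intro add_mono mult_left_mono power_mono) auto
    also have "\<dots> = ((?a + r/2) + (?b + r/2))\<^sup>2"
    proof -
      have "(1 + q / p) * p\<^sup>2 + (1 + 1 / (q / p)) * q\<^sup>2 = (p + q)\<^sup>2" if "0 < p" "0 < q" for p q :: real
        using that by (simp add: power2_eq_square field_simps)
      then show ?thesis using p by blast
    qed
    finally have "?n \<le> (?a + r/2) + (?b + r/2)" by (rule power2_le_imp_le) (use p in linarith)
    then show ?thesis by simp
  qed
  then show ?thesis by (rule field_le_epsilon)
qed

section \<open>Weak derivatives and their representatives\<close>

lemma H10_AC: assumes "H10 L f" shows "AC L f (dx L f)" "L2 L (dx L f)"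
proof -
  have "\<exists>g. L2 L g \<and> (\<forall>x\<in>{0..L}. f x = f 0 + (LINT t:{0..x}|lborel. g t))"
    using assms by (auto simp only: H10_def H1_def)
  from someI_ex[OF this] have *: "L2 L (dx L f) \<and> (\<forall>x\<in>{0..L}. f x = f 0 + (LINT t:{0..x}|lborel. dx L f t))"
    unfolding dx_def .
  then show "L2 L (dx L f)" by blast
  show "AC L f (dx L f)" unfolding AC_def using * L2_integrable by blast
qed

lemma H10_ends: "H10 L f \<Longrightarrow> f 0 = 0" "H10 L f \<Longrightarrow> f L = 0"
  unfolding H10_def by blast+

lemma H10_I: "AC L f F \<Longrightarrow> L2 L F \<Longrightarrow> f 0 = 0 \<Longrightarrow> f L = 0 \<Longrightarrow> H10 L f"
  unfolding H10_def H1_def AC_def by blast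

lemma H10_L2: "H10 L f \<Longrightarrow> L2 L f" using H10_AC(1) L2_AC by blast

lemma H10_lin: assumes "H10 L f" "H10 L g" shows "H10 L (\<lambda>x. c * f x + d * g x)"
  by (rule H10_I[OF AC_add[OF AC_cmult AC_cmult, OF H10_AC(1) H10_AC(1), OF assms]])
     (simp_all add: H10_ends[OF assms(1)] H10_ends[OF assms(2)] L2_add L2_cmult H10_AC(2) assms)

lemma dx_unique:
  assumes "H10 L f" "AC L f F" "0 \<le> L" shows "AE x in lborel. x \<in> {0..L} \<longrightarrow> dx L f x = F x"
  by (rule AC_derivative_unique[OF H10_AC(1)[OF assms(1)] assms(2,3)])

lemma dx_lin:
  assumes "H10 L f" "H10 L g" "0 \<le> L"
  shows "AE x in lborel. x \<in> {0..L} \<longrightarrow> dx L (\<lambda>x. c * f x + d * g x) x = c * dx L f x + d * dx L g x"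
  by (rule dx_unique[OF H10_lin[OF assms(1,2)] _ assms(3)]) (intro AC_add AC_cmult H10_AC assms)

text \<open>\<open>g\<close> is the continuous representative of the first derivative.
  \<open>dx L f\<close> is chosen independently and can be compared with it almost everywhere
  only.\<close>

lemma H2_AC:
  assumes "H2 L f"
  obtains g where "AC L f g" "AC L g (dxx L f)" "L2 L (dxx L f)"
proof -
  have "\<exists>h. L2 L h \<and> (\<exists>g. (\<forall>x\<in>{0..L}. f x = f 0 + (LINT t:{0..x}|lborel. g t))
                     \<and> (\<forall>x\<in>{0..L}. g x = g 0 + (LINT t:{0..x}|lborel. h t)))"
    using assms unfolding H2_def by blast
  from someI_ex[OF this] have *: "L2 L (dxx L f) \<and> (\<exists>g. (\<forall>x\<in>{0..L}. f x = f 0 + (LINT t:{0..x}|lborel. g t))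
                     \<and> (\<forall>x\<in>{0..L}. g x = g 0 + (LINT t:{0..x}|lborel. dxx L f t)))"
    unfolding dxx_def .
  then obtain g where g: "\<forall>x\<in>{0..L}. f x = f 0 + (LINT t:{0..x}|lborel. g t)"
     "\<forall>x\<in>{0..L}. g x = g 0 + (LINT t:{0..x}|lborel. dxx L f t)" by blast
  have 1: "AC L g (dxx L f)" unfolding AC_def using * g(2) L2_integrable by blast
  have 2: "AC L f g" unfolding AC_def using g(1) set_integrable_continuous[OF AC_continuous[OF 1]] by blast
  show ?thesis using that[OF 2 1] * by blast
qed

lemma H2_I: "AC L f g \<Longrightarrow> AC L g h \<Longrightarrow> L2 L h \<Longrightarrow> H2 L f"
  unfolding H2_def AC_def by blast

lemma H2_lin: assumes "H2 L f" "H2 L g" shows "H2 L (\<lambda>x. c * f x + d * g x)"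
proof -
  obtain f' where f: "AC L f f'" "AC L f' (dxx L f)" "L2 L (dxx L f)" using H2_AC[OF assms(1)] .
  obtain g' where g: "AC L g g'" "AC L g' (dxx L g)" "L2 L (dxx L g)" using H2_AC[OF assms(2)] .
  show ?thesis
    by (rule H2_I[OF AC_add[OF AC_cmult[OF f(1)] AC_cmult[OF g(1)]] AC_add[OF AC_cmult[OF f(2)] AC_cmult[OF g(2)]]])
       (intro L2_add L2_cmult f g)
qed

text \<open>The intermediate derivatives agree almost everywhere and are continuous, hence agree on
  the whole interval; after that their own derivatives can be compared. For \<open>L = 0\<close> the
  interval is a null set.\<close>

lemma dxx_unique:
  assumes "AC L f g" "AC L g h" "L2 L h" "0 \<le> L"
  shows "AE x in lborel. x \<in> {0..L} \<longrightarrow> dxx L f x = h x"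
proof -
  obtain f' where f: "AC L f f'" "AC L f' (dxx L f)" using H2_AC[OF H2_I[OF assms(1-3)]] .
  have ae: "AE x in lborel. x \<in> {0..L} \<longrightarrow> f' x = g x" by (rule AC_derivative_unique[OF f(1) assms(1,4)])
  show ?thesis
  proof (cases "L = 0")
    case True
    show ?thesis by (rule AE_mp[OF AE_lborel_singleton[of 0]]) (auto simp: True)
  next
    case False
    have c: "continuous_on {0..L} f'" "continuous_on {0..L} g" using AC_continuous f(2) assms(2) by blast+
    have "f' x = g x" if x: "x \<in> {0..L}" for x
    proof (rule ccontr)
      assume ne: "f' x \<noteq> g x"
      define d where "d y = cmod (f' y - g y)" for y
      have ac: "AC L (\<lambda>x. LINT t:{0..x}|lborel. d t) d"
        unfolding d_def by (intro AC_integral set_integrable_continuous continuous_intros c)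
      \<comment> \<open>A continuous nonnegative function with vanishing integral is zero
        everywhere; this upgrades the equality of \<open>f'\<close> and \<open>g\<close> from almost
        all points to all points.\<close>
      have "(LINT t:{0..L}|lborel. d t) = 0"
        unfolding set_lebesgue_integral_def
      proof (rule integral_eq_zero_AE)
        show "AE x in lborel. indicat_real {0..L} x *\<^sub>R d x = 0"
          using ae by eventually_elim (auto simp: d_def split: split_indicator)
      qed
      moreover have "(LINT t:{0..L}|lborel. d t) = integral {0..L} d"
        by (intro set_borel_integral_eq_integral) (unfold d_def, intro set_integrable_continuous continuous_intros c)
      ultimately have "integral {0..L} d = 0" by simp
      then have "d x = 0"
      proof -
        have "continuous_on {0..L} d" unfolding d_def by (intro continuous_intros c)
        moreover have "0 < L" using False assms(4) by simp
        moreover have "0 \<le> d y" for y by (simp add: d_def)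
        ultimately show ?thesis using integral_eq_0_iff[of 0 L d] x \<open>integral {0..L} d = 0\<close> by blast
      qed
      then show False using ne by (simp add: d_def)
    qed
    then have "AC L g (dxx L f)" using f(2) by (intro AC_cong[OF f(2)]) auto
    then show ?thesis by (intro AC_derivative_unique[OF _ assms(2,4)])
  qed
qed

lemma dxx_lin:
  assumes "H2 L f" "H2 L g" "0 \<le> L"
  shows "AE x in lborel. x \<in> {0..L} \<longrightarrow> dxx L (\<lambda>x. c * f x + d * g x) x = c * dxx L f x + d * dxx L g x"
proof -
  obtain f' where f: "AC L f f'" "AC L f' (dxx L f)" "L2 L (dxx L f)" using H2_AC[OF assms(1)] .
  obtain g' where g: "AC L g g'" "AC L g' (dxx L g)" "L2 L (dxx L g)" using H2_AC[OF assms(2)] .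
  show ?thesis
    by (rule dxx_unique[OF AC_add[OF AC_cmult[OF f(1)] AC_cmult[OF g(1)]] AC_add[OF AC_cmult[OF f(2)] AC_cmult[OF g(2)]] _ assms(3)])
       (intro L2_add L2_cmult f g)
qed

section \<open>Energy space and generator\<close>

lemma sum_1_6: "(\<Sum>i\<in>{1..6::nat}. f i) = f 1 + f 2 + f 3 + f 4 + f 5 + (f 6 :: 'a::comm_monoid_add)"
proof -
  have "{1..6::nat} = {1,2,3,4,5,6}" by auto
  then show ?thesis by (simp add: add.assoc)
qed

lemma AC_integral_ends: "AC b f F \<Longrightarrow> 0 \<le> b \<Longrightarrow> (LINT x:{0..b}|lborel. F x) = f b - f 0"
  using AC_eq[of b f F b] by simp

lemma set_integral_Re:
  assumes "set_integrable lborel S f"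
  shows "set_integrable lborel S (\<lambda>x. Re (f x))" "(LINT x:S|lborel. Re (f x)) = Re (LINT x:S|lborel. f x)"
proof -
  have i: "integrable lborel (\<lambda>x. indicat_real S x *\<^sub>R f x)" using assms by (simp add: set_integrable_def)
  show "set_integrable lborel S (\<lambda>x. Re (f x))"
    using integrable_bounded_linear[OF bounded_linear_Re i] by (simp add: set_integrable_def)
  show "(LINT x:S|lborel. Re (f x)) = Re (LINT x:S|lborel. f x)"
    using integral_bounded_linear[OF bounded_linear_Re i] by (simp add: set_lebesgue_integral_def)
qed

lemma set_integral_cong_AE':
  fixes f g :: "real \<Rightarrow> 'a::euclidean_space"
  assumes "set_integrable lborel S f" "set_integrable lborel S g" "AE x in lborel. x \<in> S \<longrightarrow> f x = g x"
  shows "(LINT x:S|lborel. f x) = (LINT x:S|lborel. g x)"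
  unfolding set_lebesgue_integral_def
proof (rule integral_cong_AE)
  show "AE x in lborel. indicat_real S x *\<^sub>R f x = indicat_real S x *\<^sub>R g x"
    using assms(3) by eventually_elim (auto split: split_indicator)
qed (use assms in \<open>auto simp: set_integrable_def\<close>)

lemma set_integral_mono_AE':
  fixes f g :: "real \<Rightarrow> real"
  assumes "set_integrable lborel S f" "set_integrable lborel S g" "AE x in lborel. x \<in> S \<longrightarrow> f x \<le> g x"
  shows "(LINT x:S|lborel. f x) \<le> (LINT x:S|lborel. g x)"
  unfolding set_lebesgue_integral_def
proof (rule integral_mono_AE)
  show "AE x in lborel. indicat_real S x *\<^sub>R f x \<le> indicat_real S x *\<^sub>R g x"
    using assms(3) by eventually_elim (auto split: split_indicator)
qed (use assms in \<open>auto simp: set_integrable_def\<close>)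

text \<open>The hypothesis \<open>k1 = k3\<close> is built in by writing \<open>k1\<close> for both
  constants.\<close>

locale bresse =
  fixes \<rho>1 \<rho>2 k1 k2 l L a0 \<beta> :: real
  assumes par: "0 < \<rho>1" "0 < \<rho>2" "0 < k1" "0 < k2" "0 < l" "0 < L" "0 < \<beta>" "\<beta> < L" "0 < a0"
    and equal_speeds: "k1 / \<rho>1 = k2 / \<rho>2"
begin

definition "N = Hnorm \<rho>1 \<rho>2 k1 k2 k1 l L"
definition "A = opA \<rho>1 \<rho>2 k1 k2 k1 l L a0 \<beta>"

text \<open>An isometry of the energy space into six square-integrable functions: strains and
  velocities, each weighted by the square root of its coefficient. Pairing two values of
  \<open>J\<close> gives the energy inner product, so the form of the energy has to be unfolded
  rarely.\<close>

definition J :: "state \<Rightarrow> nat \<Rightarrow> real \<Rightarrow> complex" where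
  "J U i x = (if i = 1 then of_real (sqrt k1) * (dx L (U 1) x + U 3 x + of_real l * U 5 x)
    else if i = 2 then of_real (sqrt \<rho>1) * U 2 x
    else if i = 3 then of_real (sqrt k2) * dx L (U 3) x
    else if i = 4 then of_real (sqrt \<rho>2) * U 4 x
    else if i = 5 then of_real (sqrt k1) * (dx L (U 5) x - of_real l * U 1 x)
    else of_real (sqrt \<rho>1) * U 6 x)"

lemma J_simps:
  "J U 1 x = of_real (sqrt k1) * (dx L (U 1) x + U 3 x + of_real l * U 5 x)"
  "J U 2 x = of_real (sqrt \<rho>1) * U 2 x"
  "J U 3 x = of_real (sqrt k2) * dx L (U 3) x"
  "J U 4 x = of_real (sqrt \<rho>2) * U 4 x"
  "J U 5 x = of_real (sqrt k1) * (dx L (U 5) x - of_real l * U 1 x)"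
  "J U 6 x = of_real (sqrt \<rho>1) * U 6 x"
  by (simp_all add: J_def)

lemma J_norms: "(\<Sum>i\<in>{1..6}. (cmod (J U i x))\<^sup>2) = k1 * (cmod (dx L (U 1) x + U 3 x + of_real l * U 5 x))\<^sup>2 + \<rho>1 * (cmod (U 2 x))\<^sup>2
    + k2 * (cmod (dx L (U 3) x))\<^sup>2 + \<rho>2 * (cmod (U 4 x))\<^sup>2
    + k1 * (cmod (dx L (U 5) x - of_real l * U 1 x))\<^sup>2 + \<rho>1 * (cmod (U 6 x))\<^sup>2"
  unfolding sum_1_6 J_simps using par by (simp add: norm_mult power_mult_distrib)

lemma N_eq: "N U = norm6 L (J U)"
  unfolding N_def Hnorm_def norm6_def J_norms ..

lemma inH_H10: "inH L U \<Longrightarrow> i \<in> {1,3,5} \<Longrightarrow> H10 L (U i)" by (auto simp: inH_def)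
lemma inH_L2: "inH L U \<Longrightarrow> i \<in> {1..6} \<Longrightarrow> L2 L (U i)"
proof -
  assume a: "inH L U" "i \<in> {1..6}"
  then have "i \<in> {1,2,3,4,5,6}" by auto
  then show ?thesis using a(1) by (auto simp: inH_def H10_L2)
qed

lemma J_L2: assumes "inH L U" shows "L2_6 L (J U)"
  unfolding L2_6_def
proof
  fix i :: nat assume "i \<in> {1..6}"
  then have "i \<in> {1,2,3,4,5,6}" by auto
  then show "L2 L (J U i)"
    unfolding J_def[abs_def] using inH_L2[OF assms] inH_H10[OF assms]
    by (auto intro!: L2_cmult L2_add L2_diff H10_AC(2))
qed

lemma inH_lin: assumes "inH L U" "inH L V" shows "inH L (sadd (sscale c U) (sscale d V))"
  unfolding inH_def sadd_def sscale_def using assms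
  by (auto simp: inH_def intro!: H10_lin L2_add L2_cmult)

text \<open>Linearity holds only almost everywhere: \<open>dx\<close> of a combination is a new
  choice and need not be the combination of the chosen derivatives.\<close>

lemma J_lin:
  assumes "inH L U" "inH L V"
  shows "AE x in lborel. x \<in> {0..L} \<longrightarrow> J (sadd (sscale c U) (sscale d V)) i x = c * J U i x + d * J V i x"
proof -
  have *: "AE x in lborel. x \<in> {0..L} \<longrightarrow> dx L (\<lambda>x. c * U j x + d * V j x) x = c * dx L (U j) x + d * dx L (V j) x" if "j \<in> {1,3,5}" for j
    using inH_H10[OF assms(1) that] inH_H10[OF assms(2) that] par by (intro dx_lin) auto
  have "1 \<in> {1,3,5::nat}" "3 \<in> {1,3,5::nat}" "5 \<in> {1,3,5::nat}" by auto
  from this[THEN *] show ?thesis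
    by eventually_elim (auto simp: J_def sadd_def sscale_def algebra_simps)
qed

lemma N_lin:
  assumes "inH L U" "inH L V"
  shows "N (sadd (sscale c U) (sscale d V)) = norm6 L (\<lambda>i x. c * J U i x + d * J V i x)"
  unfolding N_eq by (rule norm6_cong_AE[OF J_L2[OF inH_lin[OF assms]] L2_6_lin[OF J_L2 J_L2, OF assms] J_lin[OF assms]])

lemma sdiff_eq: "sdiff U V = sadd (sscale 1 U) (sscale (-1) V)" by (simp add: sdiff_def sadd_def sscale_def)

lemma inH_sdiff: "inH L U \<Longrightarrow> inH L V \<Longrightarrow> inH L (sdiff U V)" unfolding sdiff_eq by (rule inH_lin)

lemma sscale_eq: "sscale c U = sadd (sscale c U) (sscale 0 U)" by (simp add: sadd_def sscale_def)

lemma inH_sscale: "inH L U \<Longrightarrow> inH L (sscale c U)" by (subst sscale_eq) (rule inH_lin)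

lemma N_sscale: "inH L U \<Longrightarrow> N (sscale c U) = cmod c * N U"
  by (subst sscale_eq, subst N_lin) (simp_all add: norm6_cmult N_eq)

lemma N_nonneg: "0 \<le> N U" by (simp add: N_eq norm6_nonneg)

lemma N_lin_le:
  assumes "inH L U" "inH L V"
  shows "N (sadd (sscale c U) (sscale d V)) \<le> cmod c * N U + cmod d * N V"
proof -
  have "norm6 L (\<lambda>i x. c * J U i x + d * J V i x) \<le> norm6 L (\<lambda>i x. c * J U i x) + norm6 L (\<lambda>i x. d * J V i x)"
    using L2_6_lin[OF J_L2 J_L2, OF assms(1,1), of c 0] L2_6_lin[OF J_L2 J_L2, OF assms(2,2), of d 0]
    by (intro norm6_triangle) simp_all
  then show ?thesis unfolding N_lin[OF assms] by (simp add: norm6_cmult N_eq)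
qed

lemma N_sdiff_triangle:
  assumes "inH L U" "inH L V" "inH L W" shows "N (sdiff U W) \<le> N (sdiff U V) + N (sdiff V W)"
proof -
  have "sdiff U W = sadd (sscale 1 (sdiff U V)) (sscale 1 (sdiff V W))" by (simp add: sdiff_def sadd_def sscale_def)
  then show ?thesis using N_lin_le[OF inH_sdiff inH_sdiff, of U V V W 1 1] assms by simp
qed

lemma N_sdiff_commute: assumes "inH L U" "inH L V" shows "N (sdiff U V) = N (sdiff V U)"
proof -
  have "sdiff U V = sscale (-1) (sdiff V U)" by (simp add: sdiff_def sscale_def)
  then show ?thesis using N_sscale[OF inH_sdiff, of V U "-1"] assms by simp
qed

lemma N_le_sdiff: assumes "inH L U" "inH L V" shows "N U \<le> N (sdiff U V) + N V"
proof -
  have "U = sadd (sscale 1 (sdiff U V)) (sscale 1 V)" by (simp add: sdiff_def sadd_def sscale_def)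
  then show ?thesis using N_lin_le[OF inH_sdiff assms(2), of U V 1 1] assms by simp
qed

lemma N_diff_le: assumes "inH L U" "inH L V" shows "\<bar>N U - N V\<bar> \<le> N (sdiff U V)"
  using N_le_sdiff[OF assms] N_le_sdiff[OF assms(2,1)] N_sdiff_commute[OF assms] by linarith

lemma N_eq_0: assumes "inH L U" "inH L V" "N (sdiff U V) = 0" shows "N U = N V"
  using N_diff_le[OF assms(1,2)] assms(3) by simp

lemma domA_H2: "domA L U \<Longrightarrow> i \<in> {1,3,5} \<Longrightarrow> H2 L (U i)" by (auto simp: domA_def)
lemma domA_H10: "domA L U \<Longrightarrow> i \<in> {1..6} \<Longrightarrow> H10 L (U i)"
proof -
  assume a: "domA L U" "i \<in> {1..6}"
  then have "i \<in> {1,2,3,4,5,6}" by auto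
  then show ?thesis using a(1) by (auto simp: domA_def)
qed

lemma domA_inH: assumes "domA L U" shows "inH L U"
  using assms by (auto simp: inH_def domA_def intro: H10_L2)

lemma domA_lin: assumes "domA L U" "domA L V" shows "domA L (sadd (sscale c U) (sscale d V))"
  unfolding domA_def sadd_def sscale_def using assms
  by (auto simp: domA_def intro!: H10_lin H2_lin)

lemma domA_rep:
  assumes "domA L U"
  shows "\<exists>g. (\<forall>i\<in>{1,3,5}. AC L (U i) (g i) \<and> AC L (g i) (dxx L (U i)) \<and> L2 L (dxx L (U i)))
    \<and> (AE x in lborel. x \<in> {0..L} \<longrightarrow> (\<forall>i\<in>{1,3,5}. dx L (U i) x = g i x))"
proof -
  have "\<forall>i\<in>{1,3,5}. \<exists>g. AC L (U i) g \<and> AC L g (dxx L (U i)) \<and> L2 L (dxx L (U i)) \<and> (AE x in lborel. x \<in> {0..L} \<longrightarrow> dx L (U i) x = g x)"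
  proof
    fix i :: nat assume i: "i \<in> {1,3,5}"
    then have i6: "i \<in> {1..6}" by auto
    obtain g where g: "AC L (U i) g" "AC L g (dxx L (U i))" "L2 L (dxx L (U i))" using H2_AC[OF domA_H2[OF assms i]] .
    then show "\<exists>g. AC L (U i) g \<and> AC L g (dxx L (U i)) \<and> L2 L (dxx L (U i)) \<and> (AE x in lborel. x \<in> {0..L} \<longrightarrow> dx L (U i) x = g x)"
      using dx_unique[OF domA_H10[OF assms i6] g(1)] par by auto
  qed
  from bchoice[OF this] obtain g where g: "\<forall>i\<in>{1,3,5}. AC L (U i) (g i) \<and> AC L (g i) (dxx L (U i)) \<and> L2 L (dxx L (U i)) \<and> (AE x in lborel. x \<in> {0..L} \<longrightarrow> dx L (U i) x = g i x)" ..
  then have "AE x in lborel. \<forall>i\<in>{1,3,5}. x \<in> {0..L} \<longrightarrow> dx L (U i) x = g i x"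
    by (intro AE_finite_allI) auto
  then have "AE x in lborel. x \<in> {0..L} \<longrightarrow> (\<forall>i\<in>{1,3,5}. dx L (U i) x = g i x)" by eventually_elim auto
  then show ?thesis using g by blast
qed

lemma inH_A: assumes "domA L U" shows "inH L (A U)"
proof -
  have dxx: "L2 L (dxx L (U i))" if "i \<in> {1,3,5}" for i using domA_rep[OF assms] that by blast
  have dx: "L2 L (dx L (U i))" "L2 L (U i)" if "i \<in> {1..6}" for i using domA_H10[OF assms that] H10_AC(2) H10_L2 by blast+
  have d: "L2 L (\<lambda>x. of_real (damp a0 \<beta> x / \<rho>1) * U 6 x)"
  proof -
    have "L2 L (\<lambda>x. of_real (1 / \<rho>1) * (of_real (damp a0 \<beta> x) * U 6 x))" using dx(2)[of 6] par by (intro L2_cmult L2_damp) auto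
    then show ?thesis by (simp add: mult.assoc[symmetric])
  qed
  have A: "A U 1 = U 2" "A U 3 = U 4" "A U 5 = U 6"
    "A U 2 = (\<lambda>x. of_real (k1/\<rho>1) * (dxx L (U 1) x + dx L (U 3) x + of_real l * dx L (U 5) x) + of_real (l*k1/\<rho>1) * (dx L (U 5) x - of_real l * U 1 x))"
    "A U 4 = (\<lambda>x. of_real (k2/\<rho>2) * dxx L (U 3) x - of_real (k1/\<rho>2) * (dx L (U 1) x + U 3 x + of_real l * U 5 x))"
    "A U 6 = (\<lambda>x. of_real (k1/\<rho>1) * (dxx L (U 5) x - of_real l * dx L (U 1) x)
       - of_real (l*k1/\<rho>1) * (dx L (U 1) x + U 3 x + of_real l * U 5 x) - of_real (damp a0 \<beta> x / \<rho>1) * U 6 x)"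
    "\<And>i. i \<notin> {1..6} \<Longrightarrow> A U i = (\<lambda>_. 0)"
    by (auto simp: A_def opA_def)
  have "L2 L (A U 2)" unfolding A by (intro L2_add L2_diff L2_cmult dx dxx) auto
  moreover have "L2 L (A U 4)" unfolding A by (intro L2_add L2_diff L2_cmult dx dxx) auto
  moreover have "L2 L (A U 6)" unfolding A by (intro L2_add L2_diff L2_cmult dx dxx d) auto
  ultimately show ?thesis
    unfolding inH_def using domA_H10[OF assms, of 2] domA_H10[OF assms, of 4] domA_H10[OF assms, of 6] A(1-3,7) by auto
qed

lemma sqrt_mult_of_real: "0 \<le> c \<Longrightarrow> (complex_of_real (sqrt c) * w) * cnj (of_real (sqrt c) * v) = of_real c * (w * cnj v)"
proof -
  assume "0 \<le> c"
  then have "complex_of_real (sqrt c) * of_real (sqrt c) = of_real c" by (simp flip: of_real_mult)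
  moreover have "(complex_of_real (sqrt c) * w) * cnj (of_real (sqrt c) * v) = (complex_of_real (sqrt c) * of_real (sqrt c)) * (w * cnj v)"
    by (simp only: complex_cnj_mult complex_cnj_complex_of_real mult_ac)
  ultimately show ?thesis by simp
qed

lemma J_pair: "(\<Sum>i\<in>{1..6}. J V i x * cnj (J U i x)) =
   of_real k1 * ((dx L (V 1) x + V 3 x + of_real l * V 5 x) * cnj (dx L (U 1) x + U 3 x + of_real l * U 5 x))
 + of_real \<rho>1 * (V 2 x * cnj (U 2 x)) + of_real k2 * (dx L (V 3) x * cnj (dx L (U 3) x)) + of_real \<rho>2 * (V 4 x * cnj (U 4 x))
 + of_real k1 * ((dx L (V 5) x - of_real l * V 1 x) * cnj (dx L (U 5) x - of_real l * U 1 x)) + of_real \<rho>1 * (V 6 x * cnj (U 6 x))"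
  unfolding sum_1_6 J_simps sqrt_mult_of_real[OF less_imp_le[OF par(1)]] sqrt_mult_of_real[OF less_imp_le[OF par(2)]]
    sqrt_mult_of_real[OF less_imp_le[OF par(3)]] sqrt_mult_of_real[OF less_imp_le[OF par(4)]] by (rule refl)

lemma A_components:
  "of_real \<rho>1 * A U 2 x = of_real k1 * (dxx L (U 1) x + dx L (U 3) x + of_real l * dx L (U 5) x) + of_real (l * k1) * (dx L (U 5) x - of_real l * U 1 x)"
  "of_real \<rho>2 * A U 4 x = of_real k2 * dxx L (U 3) x - of_real k1 * (dx L (U 1) x + U 3 x + of_real l * U 5 x)"
  "of_real \<rho>1 * A U 6 x = of_real k1 * (dxx L (U 5) x - of_real l * dx L (U 1) x) - of_real (l * k1) * (dx L (U 1) x + U 3 x + of_real l * U 5 x) - of_real (damp a0 \<beta> x) * U 6 x"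
  "A U 1 = U 2" "A U 3 = U 4" "A U 5 = U 6"
  using par by (simp_all add: A_def opA_def field_simps)

text \<open>Up to the damping density, the real part of the pairing of \<open>A U\<close> with
  \<open>U\<close> is the derivative of a sum of stresses times velocities. Its integral vanishes
  because the velocities vanish at both ends.\<close>

lemma dissipation:
  assumes "domA L U"
  shows "(LINT x:{0..L}|lborel. Re (\<Sum>i\<in>{1..6}. J (A U) i x * cnj (J U i x))) = - (LINT x:{0..L}|lborel. damp a0 \<beta> x * (cmod (U 6 x))\<^sup>2)"
    "set_integrable lborel {0..L} (\<lambda>x. damp a0 \<beta> x * (cmod (U 6 x))\<^sup>2)"
    "set_integrable lborel {0..L} (\<lambda>x. Re (\<Sum>i\<in>{1..6}. J (A U) i x * cnj (J U i x)))"
proof -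
  obtain g where g: "\<And>i. i \<in> {1,3,5} \<Longrightarrow> AC L (U i) (g i)" "\<And>i. i \<in> {1,3,5} \<Longrightarrow> AC L (g i) (dxx L (U i))"
    and ae: "AE x in lborel. x \<in> {0..L} \<longrightarrow> (\<forall>i\<in>{1,3,5}. dx L (U i) x = g i x)"
    using domA_rep[OF assms] by blast
  define S where "S x = g 1 x + U 3 x + of_real l * U 5 x" for x
  define S' where "S' x = dxx L (U 1) x + g 3 x + of_real l * g 5 x" for x
  define R where "R x = g 5 x - of_real l * U 1 x" for x
  define R' where "R' x = dxx L (U 5) x - of_real l * g 1 x" for x
  have acS: "AC L S S'" unfolding S_def[abs_def] S'_def[abs_def] by (intro AC_add AC_cmult g) auto
  have acR: "AC L R R'" unfolding R_def[abs_def] R'_def[abs_def] by (intro AC_diff AC_cmult g) auto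
  have acU: "AC L (U i) (dx L (U i))" if "i \<in> {1..6}" for i using H10_AC(1)[OF domA_H10[OF assms that]] .
  have ends: "U i 0 = 0" "U i L = 0" if "i \<in> {1..6}" for i using H10_ends domA_H10[OF assms that] by blast+
  define D where "D x = of_real k1 * (cnj (S' x) * U 2 x + cnj (S x) * dx L (U 2) x) + of_real k2 * (cnj (dxx L (U 3) x) * U 4 x + cnj (g 3 x) * dx L (U 4) x)
    + of_real k1 * (cnj (R' x) * U 6 x + cnj (R x) * dx L (U 6) x)" for x
  have acD: "AC L (\<lambda>x. of_real k1 * (cnj (S x) * U 2 x) + of_real k2 * (cnj (g 3 x) * U 4 x) + of_real k1 * (cnj (R x) * U 6 x)) D"
    unfolding D_def[abs_def] by (intro AC_add AC_cmult AC_mult AC_cnj acS acR acU g) auto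
  have D0: "(LINT x:{0..L}|lborel. D x) = 0" using AC_integral_ends[OF acD] par ends by simp
  have iD: "set_integrable lborel {0..L} D" using AC_integrable[OF acD] .
  show d: "set_integrable lborel {0..L} (\<lambda>x. damp a0 \<beta> x * (cmod (U 6 x))\<^sup>2)"
  proof -
    have "set_integrable lborel {0..L} (\<lambda>x. (of_real (damp a0 \<beta> x) * U 6 x) * cnj (U 6 x))"
      using par domA_H10[OF assms, of 6] by (intro L2_mult_integrable L2_damp L2_cnj H10_L2) auto
    from set_integral_Re(1)[OF this] show ?thesis unfolding cmod_power2
      by (rule set_integrable_cong[THEN iffD1, rotated -1]) (auto simp: power2_eq_square algebra_simps)
  qed
  show i: "set_integrable lborel {0..L} (\<lambda>x. Re (\<Sum>i\<in>{1..6}. J (A U) i x * cnj (J U i x)))"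
  proof (rule set_integral_Re)
    have "set_integrable lborel {0..L} (\<lambda>x. J (A U) i x * cnj (J U i x))" if "i \<in> {1..6}" for i
      using J_L2[OF inH_A[OF assms]] J_L2[OF domA_inH[OF assms]] that by (intro L2_mult_integrable L2_cnj) (auto simp: L2_6_def)
    then show "set_integrable lborel {0..L} (\<lambda>x. \<Sum>i\<in>{1..6}. J (A U) i x * cnj (J U i x))"
      unfolding sum_1_6 by (intro set_integral_add(1)) auto
  qed
  have alg: "Re (of_real k1 * ((dy1 + y2 + of_real l * y3) * cnj s) + (of_real k1 * s' + of_real (l * k1) * r) * cnj y1
     + of_real k2 * (dy2 * cnj z) + (of_real k2 * z' - of_real k1 * s) * cnj y2
     + of_real k1 * ((dy3 - of_real l * y1) * cnj r) + (of_real k1 * r' - of_real (l * k1) * s - of_real a * y3) * cnj y3)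
    = Re (of_real k1 * (cnj s' * y1 + cnj s * dy1) + of_real k2 * (cnj z' * y2 + cnj z * dy2) + of_real k1 * (cnj r' * y3 + cnj r * dy3)) - a * (cmod y3)\<^sup>2"
    for y1 y2 y3 dy1 dy2 dy3 s s' r r' z z' :: complex and a :: real
    unfolding cmod_power2 by (simp add: power2_eq_square) (simp add: algebra_simps)
  have "(LINT x:{0..L}|lborel. Re (\<Sum>i\<in>{1..6}. J (A U) i x * cnj (J U i x))) = (LINT x:{0..L}|lborel. Re (D x) - damp a0 \<beta> x * (cmod (U 6 x))\<^sup>2)"
  proof (rule set_integral_cong_AE'[OF i set_integral_diff(1)[OF set_integral_Re(1)[OF iD] d]])
    show "AE x in lborel. x \<in> {0..L} \<longrightarrow> Re (\<Sum>i\<in>{1..6}. J (A U) i x * cnj (J U i x)) = Re (D x) - damp a0 \<beta> x * (cmod (U 6 x))\<^sup>2"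
      using ae
    proof eventually_elim
      case (elim x)
      show ?case
      proof
        assume "x \<in> {0..L}"
        then have e: "dx L (U 1) x = g 1 x" "dx L (U 3) x = g 3 x" "dx L (U 5) x = g 5 x" using elim by auto
        have "(\<Sum>i\<in>{1..6}. J (A U) i x * cnj (J U i x)) = of_real k1 * ((dx L (U 2) x + U 4 x + of_real l * U 6 x) * cnj (S x)) + (of_real k1 * S' x + of_real (l * k1) * R x) * cnj (U 2 x)
     + of_real k2 * (dx L (U 4) x * cnj (g 3 x)) + (of_real k2 * dxx L (U 3) x - of_real k1 * S x) * cnj (U 4 x)
     + of_real k1 * ((dx L (U 6) x - of_real l * U 2 x) * cnj (R x)) + (of_real k1 * R' x - of_real (l * k1) * S x - of_real (damp a0 \<beta> x) * U 6 x) * cnj (U 6 x)"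
          unfolding J_pair mult.assoc[symmetric, of "of_real \<rho>1"] mult.assoc[symmetric, of "of_real \<rho>2"] A_components e S_def S'_def R_def R'_def by (rule refl)
        then show "Re (\<Sum>i\<in>{1..6}. J (A U) i x * cnj (J U i x)) = Re (D x) - damp a0 \<beta> x * (cmod (U 6 x))\<^sup>2"
          unfolding D_def by (simp only: alg)
      qed
    qed
  qed
  also have "\<dots> = Re (LINT x:{0..L}|lborel. D x) - (LINT x:{0..L}|lborel. damp a0 \<beta> x * (cmod (U 6 x))\<^sup>2)"
    by (subst set_integral_diff(2)[OF set_integral_Re(1)[OF iD] d]) (simp add: set_integral_Re(2)[OF iD])
  finally show "(LINT x:{0..L}|lborel. Re (\<Sum>i\<in>{1..6}. J (A U) i x * cnj (J U i x))) = - (LINT x:{0..L}|lborel. damp a0 \<beta> x * (cmod (U 6 x))\<^sup>2)"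
    using D0 by simp
qed

section \<open>The elastic energy\<close>

definition "strain U x = k1 * (cmod (dx L (U 1) x + U 3 x + of_real l * U 5 x))\<^sup>2 + k2 * (cmod (dx L (U 3) x))\<^sup>2
    + k1 * (cmod (dx L (U 5) x - of_real l * U 1 x))\<^sup>2"

lemma square_integrable_J: "inH L U \<Longrightarrow> i \<in> {1..6} \<Longrightarrow> set_integrable lborel {0..L} (\<lambda>x. (cmod (J U i x))\<^sup>2)"
  using J_L2 L2_square by (auto simp: L2_6_def)

lemma strain_eq: "strain U x = (cmod (J U 1 x))\<^sup>2 + (cmod (J U 3 x))\<^sup>2 + (cmod (J U 5 x))\<^sup>2"
  unfolding strain_def J_simps using par by (simp add: norm_mult power_mult_distrib)

lemma strain_int: "inH L U \<Longrightarrow> set_integrable lborel {0..L} (strain U)"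
  unfolding strain_eq[abs_def] by (intro set_integral_add(1) square_integrable_J) auto

lemma strain_nonneg: "0 \<le> strain U x" using par by (simp add: strain_def)

definition "Strain U = (LINT x:{0..L}|lborel. strain U x)"

lemma Strain_nonneg: "0 \<le> Strain U"
  unfolding Strain_def set_lebesgue_integral_def
  by (intro Bochner_Integration.integral_nonneg) (simp add: strain_nonneg)

lemma N_square:
  assumes "inH L U"
  shows "(N U)\<^sup>2 = Strain U + (LINT x:{0..L}|lborel. \<rho>1 * (cmod (U 2 x))\<^sup>2 + \<rho>2 * (cmod (U 4 x))\<^sup>2 + \<rho>1 * (cmod (U 6 x))\<^sup>2)"
proof -
  have i: "set_integrable lborel {0..L} (\<lambda>x. \<rho>1 * (cmod (U 2 x))\<^sup>2 + \<rho>2 * (cmod (U 4 x))\<^sup>2 + \<rho>1 * (cmod (U 6 x))\<^sup>2)"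
    using inH_L2[OF assms] by (intro set_integral_add(1) set_integrable_mult_right impI L2_square) auto
  have "(N U)\<^sup>2 = (LINT x:{0..L}|lborel. strain U x + (\<rho>1 * (cmod (U 2 x))\<^sup>2 + \<rho>2 * (cmod (U 4 x))\<^sup>2 + \<rho>1 * (cmod (U 6 x))\<^sup>2))"
    unfolding N_eq norm6_square J_norms strain_def by (rule set_lebesgue_integral_cong) auto
  then show ?thesis unfolding Strain_def using strain_int[OF assms] i by simp
qed

lemma velocity_le:
  assumes "inH L U"
  shows "(LINT x:{0..L}|lborel. (cmod (U 2 x))\<^sup>2) \<le> (N U)\<^sup>2 / \<rho>1" "(LINT x:{0..L}|lborel. (cmod (U 4 x))\<^sup>2) \<le> (N U)\<^sup>2 / \<rho>2"
    "(LINT x:{0..L}|lborel. (cmod (U 6 x))\<^sup>2) \<le> (N U)\<^sup>2 / \<rho>1"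
proof -
  have c: "(LINT x:{0..L}|lborel. (cmod (J U i x))\<^sup>2) \<le> (N U)\<^sup>2" if "i \<in> {1..6}" for i
    unfolding N_eq using norm6_component[OF J_L2[OF assms] that] .
  have e: "(cmod (of_real (sqrt r) * w))\<^sup>2 = r * (cmod w)\<^sup>2" if "0 < r" for r w
    using that by (simp add: norm_mult power_mult_distrib)
  show "(LINT x:{0..L}|lborel. (cmod (U 2 x))\<^sup>2) \<le> (N U)\<^sup>2 / \<rho>1" "(LINT x:{0..L}|lborel. (cmod (U 4 x))\<^sup>2) \<le> (N U)\<^sup>2 / \<rho>2"
    "(LINT x:{0..L}|lborel. (cmod (U 6 x))\<^sup>2) \<le> (N U)\<^sup>2 / \<rho>1"
    using c[of 2] c[of 4] c[of 6] par unfolding J_simps e[OF par(1)] e[OF par(2)] by (simp_all add: field_simps)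
qed

lemma Strain_le_N: "inH L U \<Longrightarrow> Strain U \<le> (N U)\<^sup>2"
proof -
  assume U: "inH L U"
  have "0 \<le> (LINT x:{0..L}|lborel. \<rho>1 * (cmod (U 2 x))\<^sup>2 + \<rho>2 * (cmod (U 4 x))\<^sup>2 + \<rho>1 * (cmod (U 6 x))\<^sup>2)"
    unfolding set_lebesgue_integral_def using par by (intro Bochner_Integration.integral_nonneg) auto
  then show ?thesis using N_square[OF U] by simp
qed

text \<open>Gronwall from the end point \<open>x = 0\<close> replaces a Korn-type inequality.\<close>
lemma coercivity:
  "\<exists>C>0. \<forall>U. inH L U \<longrightarrow> (\<forall>i\<in>{1,3,5}. (\<forall>x\<in>{0..L}. (cmod (U i x))\<^sup>2 \<le> C * Strain U) \<and>
      (LINT x:{0..L}|lborel. (cmod (dx L (U i) x))\<^sup>2) \<le> C * Strain U)"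
proof -
  define B where "B = 1/k1 + 1/k2"
  define E where "E = 2 + 2 * l"
  define C1 where "C1 = B * exp (E * L)"
  \<comment> \<open>The sum of the constant of the pointwise bound and of the two parts of the
    derivative bound, so that one \<open>C\<close> serves both claims.\<close>
  define C where "C = 3 * (1 + 2 * l\<^sup>2) * L * C1 + C1 + 3 * B"
  have B: "0 < B" using par by (simp add: B_def add_pos_pos)
  have C1: "0 < C1" using B by (simp add: C1_def)
  have C0: "0 < C" unfolding C_def using C1 B par by (intro add_pos_pos mult_pos_pos) (auto intro: add_pos_nonneg)
  have main: "(\<forall>x\<in>{0..L}. (cmod (U i x))\<^sup>2 \<le> C * Strain U) \<and> (LINT x:{0..L}|lborel. (cmod (dx L (U i) x))\<^sup>2) \<le> C * Strain U"
    if U: "inH L U" and i: "i \<in> {1,3,5}" for U i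
  proof -
    define s1 where "s1 x = dx L (U 1) x + U 3 x + of_real l * U 5 x" for x
    define s2 where "s2 x = dx L (U 3) x" for x
    define s3 where "s3 x = dx L (U 5) x - of_real l * U 1 x" for x
    have st: "strain U x = k1 * (cmod (s1 x))\<^sup>2 + k2 * (cmod (s2 x))\<^sup>2 + k1 * (cmod (s3 x))\<^sup>2" for x
      by (simp add: strain_def s1_def s2_def s3_def)
    have sB: "(cmod (s1 x))\<^sup>2 + (cmod (s2 x))\<^sup>2 + (cmod (s3 x))\<^sup>2 \<le> B * strain U x" for x
    proof -
      have p: "0 \<le> (cmod (s1 x))\<^sup>2" "0 \<le> (cmod (s2 x))\<^sup>2" "0 \<le> (cmod (s3 x))\<^sup>2" by auto
      have "B * strain U x = (cmod (s1 x))\<^sup>2 + (cmod (s2 x))\<^sup>2 + (cmod (s3 x))\<^sup>2 + (k1/k2 * (cmod (s1 x))\<^sup>2 + k2/k1 * (cmod (s2 x))\<^sup>2 + k1/k2 * (cmod (s3 x))\<^sup>2)"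
        unfolding st B_def using par by (simp add: field_simps)
      moreover have "0 \<le> k1/k2 * (cmod (s1 x))\<^sup>2 + k2/k1 * (cmod (s2 x))\<^sup>2 + k1/k2 * (cmod (s3 x))\<^sup>2"
        using par p by simp
      ultimately show ?thesis by linarith
    qed
    define e where "e x = (cmod (U 1 x))\<^sup>2 + (cmod (U 3 x))\<^sup>2 + (cmod (U 5 x))\<^sup>2" for x
    define e' where "e' x = 2 * Re (cnj (U 1 x) * dx L (U 1) x) + 2 * Re (cnj (U 3 x) * dx L (U 3) x) + 2 * Re (cnj (U 5 x) * dx L (U 5) x)" for x
    have ac: "AC L e e'" unfolding e_def[abs_def] e'_def[abs_def] using inH_H10[OF U]
      by (intro AC_add AC_norm2 H10_AC(1)) auto
    have r: "2 * Re (cnj w * v) \<le> (cmod w)\<^sup>2 + (cmod v)\<^sup>2" for w v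
    proof -
      have "0 \<le> (cmod (w - v))\<^sup>2" by simp
      then show ?thesis unfolding cmod_power2 by (simp add: power2_eq_square algebra_simps)
    qed
    have le: "e' x \<le> E * e x + B * strain U x" for x
    proof -
      \<comment> \<open>Displacement derivatives expressed by the strains. The coupling of
        \<open>U 1\<close> and \<open>U 5\<close> through \<open>l\<close> is skew and cancels in
        the real part, as \<open>c\<close> shows; what remains is the strains and the coupling with
        \<open>U 3\<close>.\<close>
      have d: "dx L (U 1) x = s1 x - U 3 x - of_real l * U 5 x" "dx L (U 3) x = s2 x" "dx L (U 5) x = s3 x + of_real l * U 1 x"
        by (simp_all add: s1_def s2_def s3_def)
      have c: "Re (cnj (U 5 x) * (of_real l * U 1 x)) = Re (cnj (U 1 x) * (of_real l * U 5 x))" by (simp add: algebra_simps)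
      have "e' x = 2 * Re (cnj (U 1 x) * s1 x) + 2 * Re (cnj (U 1 x) * (- U 3 x)) + 2 * Re (cnj (U 3 x) * s2 x) + 2 * Re (cnj (U 5 x) * s3 x)"
        unfolding e'_def d using c by (simp add: algebra_simps)
      also have "\<dots> \<le> ((cmod (U 1 x))\<^sup>2 + (cmod (s1 x))\<^sup>2) + ((cmod (U 1 x))\<^sup>2 + (cmod (- U 3 x))\<^sup>2) + ((cmod (U 3 x))\<^sup>2 + (cmod (s2 x))\<^sup>2) + ((cmod (U 5 x))\<^sup>2 + (cmod (s3 x))\<^sup>2)"
        by (intro add_mono r)
      also have "\<dots> \<le> 2 * e x + B * strain U x" using sB[of x] zero_le_power2[of "cmod (U 5 x)"] unfolding e_def norm_minus_cancel by (smt (verit))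
      also have "2 * e x \<le> E * e x" using par by (intro mult_right_mono) (auto simp: E_def e_def)
      finally show ?thesis by simp
    qed
    have eb: "e x \<le> C1 * Strain U" if "x \<in> {0..L}" for x
    proof -
      have "e x \<le> (e 0 + (LINT t:{0..L}|lborel. B * strain U t)) * exp (E * L)"
        by (rule gronwall_AC[OF ac le]) (use that strain_int[OF U] mult_nonneg_nonneg[OF less_imp_le[OF B] strain_nonneg] par in \<open>auto simp: E_def e_def\<close>)
      moreover have "e 0 = 0" using H10_ends(1)[OF inH_H10[OF U, of 1]] H10_ends(1)[OF inH_H10[OF U, of 3]] H10_ends(1)[OF inH_H10[OF U, of 5]] by (simp add: e_def)
      ultimately show ?thesis by (simp add: C1_def Strain_def mult.assoc mult.commute mult.left_commute)
    qed
    have ui: "(cmod (U j x))\<^sup>2 \<le> C1 * Strain U" if "x \<in> {0..L}" "j \<in> {1,3,5}" for j x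
      using eb[OF that(1)] that(2) zero_le_power2[of "cmod (U 1 x)"] zero_le_power2[of "cmod (U 3 x)"] zero_le_power2[of "cmod (U 5 x)"]
      unfolding e_def by (auto simp: e_def intro: order_trans[rotated])
    have C1C: "C1 * Strain U \<le> C * Strain U"
      using C1 B par by (intro mult_right_mono Strain_nonneg) (simp add: C_def)
    have dd: "(cmod (dx L (U i) x))\<^sup>2 \<le> 3 * (1 + 2 * l\<^sup>2) * (C1 * Strain U) + 3 * (B * strain U x)" if x: "x \<in> {0..L}" for x
    proof -
      have q: "(cmod (a + b + c))\<^sup>2 \<le> 3 * ((cmod a)\<^sup>2 + (cmod b)\<^sup>2 + (cmod c)\<^sup>2)" for a b c
      proof -
        have "(cmod (a + b + c))\<^sup>2 \<le> (cmod a + cmod b + cmod c)\<^sup>2"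
          by (intro power_mono norm_triangle_mono) auto
        also have "\<dots> \<le> 3 * ((cmod a)\<^sup>2 + (cmod b)\<^sup>2 + (cmod c)\<^sup>2)"
          using sum_squares_bound[of "cmod a" "cmod b"] sum_squares_bound[of "cmod a" "cmod c"] sum_squares_bound[of "cmod b" "cmod c"]
          by (simp add: power2_eq_square algebra_simps)
        finally show ?thesis .
      qed
      have s: "(cmod (s1 x))\<^sup>2 \<le> B * strain U x" "(cmod (s2 x))\<^sup>2 \<le> B * strain U x" "(cmod (s3 x))\<^sup>2 \<le> B * strain U x"
        using sB[of x] zero_le_power2[of "cmod (s1 x)"] zero_le_power2[of "cmod (s2 x)"] zero_le_power2[of "cmod (s3 x)"] by linarith+
      have u: "(cmod (U 1 x))\<^sup>2 \<le> C1 * Strain U" "(cmod (U 3 x))\<^sup>2 \<le> C1 * Strain U" "(cmod (U 5 x))\<^sup>2 \<le> C1 * Strain U"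
        using ui[OF x] by auto
      have lu: "l\<^sup>2 * (cmod (U 1 x))\<^sup>2 \<le> l\<^sup>2 * (C1 * Strain U)" "l\<^sup>2 * (cmod (U 5 x))\<^sup>2 \<le> l\<^sup>2 * (C1 * Strain U)"
        using u by (auto intro: mult_left_mono)
      have nn: "0 \<le> C1 * Strain U" "0 \<le> l\<^sup>2 * (C1 * Strain U)" "0 \<le> B * strain U x" using C1 B Strain_nonneg[of U] strain_nonneg[of U x] by simp_all
      have 1: "(cmod (dx L (U 1) x))\<^sup>2 \<le> 3 * (1 + 2 * l\<^sup>2) * (C1 * Strain U) + 3 * (B * strain U x)"
      proof -
        have "dx L (U 1) x = s1 x + (- U 3 x) + (- of_real l * U 5 x)" by (simp add: s1_def)
        then have "(cmod (dx L (U 1) x))\<^sup>2 \<le> 3 * ((cmod (s1 x))\<^sup>2 + (cmod (U 3 x))\<^sup>2 + l\<^sup>2 * (cmod (U 5 x))\<^sup>2)"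
          using q[of "s1 x" "- U 3 x" "- of_real l * U 5 x"] by (simp add: norm_mult power_mult_distrib)
        then have "(cmod (dx L (U 1) x))\<^sup>2 \<le> 3 * (B * strain U x + C1 * Strain U + 2 * (l\<^sup>2 * (C1 * Strain U)))" using s u lu nn by (smt (verit))
        then show ?thesis by (simp add: algebra_simps)
      qed
      have 2: "(cmod (dx L (U 3) x))\<^sup>2 \<le> 3 * (1 + 2 * l\<^sup>2) * (C1 * Strain U) + 3 * (B * strain U x)"
      proof -
        have "(cmod (dx L (U 3) x))\<^sup>2 \<le> 3 * (B * strain U x + C1 * Strain U + 2 * (l\<^sup>2 * (C1 * Strain U)))" using s nn unfolding s2_def by (smt (verit))
        then show ?thesis by (simp add: algebra_simps)
      qed
      have 3: "(cmod (dx L (U 5) x))\<^sup>2 \<le> 3 * (1 + 2 * l\<^sup>2) * (C1 * Strain U) + 3 * (B * strain U x)"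
      proof -
        have "dx L (U 5) x = s3 x + of_real l * U 1 x + 0" by (simp add: s3_def)
        then have "(cmod (dx L (U 5) x))\<^sup>2 \<le> 3 * ((cmod (s3 x))\<^sup>2 + l\<^sup>2 * (cmod (U 1 x))\<^sup>2)"
          using q[of "s3 x" "of_real l * U 1 x" 0] by (simp add: norm_mult power_mult_distrib)
        then have "(cmod (dx L (U 5) x))\<^sup>2 \<le> 3 * (B * strain U x + C1 * Strain U + 2 * (l\<^sup>2 * (C1 * Strain U)))" using s u lu nn by (smt (verit))
        then show ?thesis by (simp add: algebra_simps)
      qed
      show ?thesis using 1 2 3 i by auto
    qed
    have "(LINT x:{0..L}|lborel. (cmod (dx L (U i) x))\<^sup>2) \<le> (LINT x:{0..L}|lborel. 3 * (1 + 2 * l\<^sup>2) * (C1 * Strain U) + 3 * (B * strain U x))"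
    proof (rule set_integral_mono)
      show "set_integrable lborel {0..L} (\<lambda>x. (cmod (dx L (U i) x))\<^sup>2)" using H10_AC(2)[OF inH_H10[OF U i]] by (rule L2_square)
      show "set_integrable lborel {0..L} (\<lambda>x. 3 * (1 + 2 * l\<^sup>2) * (C1 * Strain U) + 3 * (B * strain U x))"
        using strain_int[OF U] by (intro set_integral_add(1) set_integrable_one set_integrable_mult_right impI)
    qed (rule dd)
    also have "\<dots> = 3 * (1 + 2 * l\<^sup>2) * (C1 * Strain U) * L + 3 * (B * Strain U)"
    proof -
      have c: "(LINT x:{0..L}|lborel. q) = q * L" for q :: real using par by (simp add: set_integral_const)
      have i: "set_integrable lborel {0..L} (\<lambda>x. 3 * (B * strain U x))"
        using strain_int[OF U] by (intro set_integrable_mult_right)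
      show ?thesis unfolding set_integral_add(2)[OF set_integrable_one i] c set_integral_mult_right Strain_def by (simp only: mult.assoc)
    qed
    also have "\<dots> \<le> C * Strain U"
    proof -
      have "0 \<le> C1 * Strain U" using C1 Strain_nonneg[of U] by simp
      then show ?thesis by (simp add: C_def algebra_simps)
    qed
    finally show ?thesis using ui[OF _ i] C1C by (meson order_trans)
  qed
  show ?thesis using main C0 by (intro exI[of _ C]) blast
qed

text \<open>The equations tested with the displacements instead of the velocities. This produces the
  elastic energy itself and is the source of the bound at small frequency.\<close>

lemma weak_identity:
  assumes "domA L U"
  shows "(LINT x:{0..L}|lborel. Re (of_real \<rho>1 * (A U 2 x * cnj (U 1 x)) + of_real \<rho>2 * (A U 4 x * cnj (U 3 x)) + of_real \<rho>1 * (A U 6 x * cnj (U 5 x))))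
    = - Strain U - (LINT x:{0..L}|lborel. damp a0 \<beta> x * Re (U 6 x * cnj (U 5 x)))"
    "set_integrable lborel {0..L} (\<lambda>x. damp a0 \<beta> x * Re (U 6 x * cnj (U 5 x)))"
proof -
  obtain g where g: "\<And>i. i \<in> {1,3,5} \<Longrightarrow> AC L (U i) (g i)" "\<And>i. i \<in> {1,3,5} \<Longrightarrow> AC L (g i) (dxx L (U i))"
    and ae: "AE x in lborel. x \<in> {0..L} \<longrightarrow> (\<forall>i\<in>{1,3,5}. dx L (U i) x = g i x)"
    using domA_rep[OF assms] by blast
  define S where "S x = g 1 x + U 3 x + of_real l * U 5 x" for x
  define S' where "S' x = dxx L (U 1) x + g 3 x + of_real l * g 5 x" for x
  define R where "R x = g 5 x - of_real l * U 1 x" for x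
  define R' where "R' x = dxx L (U 5) x - of_real l * g 1 x" for x
  have acS: "AC L S S'" unfolding S_def[abs_def] S'_def[abs_def] by (intro AC_add AC_cmult g) auto
  have acR: "AC L R R'" unfolding R_def[abs_def] R'_def[abs_def] by (intro AC_diff AC_cmult g) auto
  have ends: "U i 0 = 0" "U i L = 0" if "i \<in> {1..6}" for i using H10_ends domA_H10[OF assms that] by blast+
  define D where "D x = of_real k1 * (S' x * cnj (U 1 x) + S x * cnj (g 1 x)) + of_real k2 * (dxx L (U 3) x * cnj (U 3 x) + g 3 x * cnj (g 3 x))
    + of_real k1 * (R' x * cnj (U 5 x) + R x * cnj (g 5 x))" for x
  have acD: "AC L (\<lambda>x. of_real k1 * (S x * cnj (U 1 x)) + of_real k2 * (g 3 x * cnj (U 3 x)) + of_real k1 * (R x * cnj (U 5 x))) D"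
    unfolding D_def[abs_def] by (intro AC_add AC_cmult AC_mult AC_cnj acS acR g) auto
  have D0: "(LINT x:{0..L}|lborel. D x) = 0" using AC_integral_ends[OF acD] par ends by simp
  have iD: "set_integrable lborel {0..L} D" using AC_integrable[OF acD] .
  have U: "inH L U" using domA_inH[OF assms] .
  show d: "set_integrable lborel {0..L} (\<lambda>x. damp a0 \<beta> x * Re (U 6 x * cnj (U 5 x)))"
  proof -
    have "set_integrable lborel {0..L} (\<lambda>x. (of_real (damp a0 \<beta> x) * U 6 x) * cnj (U 5 x))"
      using par inH_L2[OF U] by (intro L2_mult_integrable L2_damp L2_cnj) auto
    from set_integral_Re(1)[OF this] show ?thesis
      by (rule set_integrable_cong[THEN iffD1, rotated -1]) (auto simp: algebra_simps)
  qed
  have i: "set_integrable lborel {0..L} (\<lambda>x. Re (of_real \<rho>1 * (A U 2 x * cnj (U 1 x)) + of_real \<rho>2 * (A U 4 x * cnj (U 3 x)) + of_real \<rho>1 * (A U 6 x * cnj (U 5 x))))"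
    using inH_L2[OF U] inH_L2[OF inH_A[OF assms]]
    by (intro set_integral_Re set_integral_add(1) set_integrable_mult_right impI L2_mult_integrable L2_cnj) auto
  have alg: "Re ((of_real k1 * s' + of_real (l * k1) * r) * cnj u1 + (of_real k2 * z' - of_real k1 * s) * cnj u2
     + (of_real k1 * r' - of_real (l * k1) * s - of_real a * y3) * cnj u3)
    = Re (of_real k1 * (s' * cnj u1 + s * cnj g1) + of_real k2 * (z' * cnj u2 + z * cnj z) + of_real k1 * (r' * cnj u3 + r * cnj g5))
     - (k1 * (cmod s)\<^sup>2 + k2 * (cmod z)\<^sup>2 + k1 * (cmod r)\<^sup>2) - a * Re (y3 * cnj u3)"
    if "s = g1 + u2 + of_real l * u3" "r = g5 - of_real l * u1"
    for u1 u2 u3 g1 g5 y3 s s' r r' z z' :: complex and a :: real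
    unfolding cmod_power2 that by (simp add: power2_eq_square) (simp add: algebra_simps)
  have "(LINT x:{0..L}|lborel. Re (of_real \<rho>1 * (A U 2 x * cnj (U 1 x)) + of_real \<rho>2 * (A U 4 x * cnj (U 3 x)) + of_real \<rho>1 * (A U 6 x * cnj (U 5 x))))
    = (LINT x:{0..L}|lborel. Re (D x) - strain U x - damp a0 \<beta> x * Re (U 6 x * cnj (U 5 x)))"
  proof (rule set_integral_cong_AE'[OF i set_integral_diff(1)[OF set_integral_diff(1)[OF set_integral_Re(1)[OF iD] strain_int[OF U]] d]])
    show "AE x in lborel. x \<in> {0..L} \<longrightarrow> Re (of_real \<rho>1 * (A U 2 x * cnj (U 1 x)) + of_real \<rho>2 * (A U 4 x * cnj (U 3 x)) + of_real \<rho>1 * (A U 6 x * cnj (U 5 x)))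
        = Re (D x) - strain U x - damp a0 \<beta> x * Re (U 6 x * cnj (U 5 x))"
      using ae
    proof eventually_elim
      case (elim x)
      show ?case
      proof
        assume "x \<in> {0..L}"
        then have e: "dx L (U 1) x = g 1 x" "dx L (U 3) x = g 3 x" "dx L (U 5) x = g 5 x" using elim by auto
        have 1: "of_real \<rho>1 * (A U 2 x * cnj (U 1 x)) + of_real \<rho>2 * (A U 4 x * cnj (U 3 x)) + of_real \<rho>1 * (A U 6 x * cnj (U 5 x))
          = (of_real k1 * S' x + of_real (l * k1) * R x) * cnj (U 1 x) + (of_real k2 * dxx L (U 3) x - of_real k1 * S x) * cnj (U 3 x)
             + (of_real k1 * R' x - of_real (l * k1) * S x - of_real (damp a0 \<beta> x) * U 6 x) * cnj (U 5 x)"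
          unfolding mult.assoc[symmetric, of "of_real \<rho>1"] mult.assoc[symmetric, of "of_real \<rho>2"] A_components e S_def S'_def R_def R'_def by (rule refl)
        show "Re (of_real \<rho>1 * (A U 2 x * cnj (U 1 x)) + of_real \<rho>2 * (A U 4 x * cnj (U 3 x)) + of_real \<rho>1 * (A U 6 x * cnj (U 5 x)))
        = Re (D x) - strain U x - damp a0 \<beta> x * Re (U 6 x * cnj (U 5 x))"
          unfolding 1 D_def strain_def e S_def[symmetric] R_def[symmetric] by (rule alg) (simp_all add: S_def R_def)
      qed
    qed
  qed
  also have "\<dots> = Re (LINT x:{0..L}|lborel. D x) - Strain U - (LINT x:{0..L}|lborel. damp a0 \<beta> x * Re (U 6 x * cnj (U 5 x)))"
    unfolding Strain_def using set_integral_Re[OF iD] strain_int[OF U] d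
    by (simp add: set_integral_diff)
  finally show "(LINT x:{0..L}|lborel. Re (of_real \<rho>1 * (A U 2 x * cnj (U 1 x)) + of_real \<rho>2 * (A U 4 x * cnj (U 3 x)) + of_real \<rho>1 * (A U 6 x * cnj (U 5 x))))
    = - Strain U - (LINT x:{0..L}|lborel. damp a0 \<beta> x * Re (U 6 x * cnj (U 5 x)))"
    using D0 by simp
qed

end

section \<open>The resolvent estimate\<close>

text \<open>All data are collected into a single majorant by adding absolute values; the factor
  \<open>card I\<close> is the cost of squaring the sum.\<close>

lemma sum_cmod_L2:
  fixes Q :: "nat \<Rightarrow> real \<Rightarrow> complex"
  assumes "finite I" "\<And>i. i \<in> I \<Longrightarrow> set_integrable lborel {0..b} (Q i)"
     "\<And>i. i \<in> I \<Longrightarrow> set_integrable lborel {0..b} (\<lambda>x. (cmod (Q i x))\<^sup>2)"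
  shows "set_integrable lborel {0..b} (\<lambda>x. \<Sum>i\<in>I. cmod (Q i x))"
    "set_integrable lborel {0..b} (\<lambda>x. (\<Sum>i\<in>I. cmod (Q i x))\<^sup>2)"
    "(LINT x:{0..b}|lborel. (\<Sum>i\<in>I. cmod (Q i x))\<^sup>2) \<le> card I * (\<Sum>i\<in>I. LINT x:{0..b}|lborel. (cmod (Q i x))\<^sup>2)"
proof -
  have n: "set_integrable lborel {0..b} (\<lambda>x. cmod (Q i x))" if "i \<in> I" for i
    using integrable_norm[OF assms(2)[OF that, unfolded set_integrable_def]] by (simp add: set_integrable_def)
  have sums: "set_integrable lborel {0..b} (\<lambda>x. \<Sum>i\<in>I. f i x)" if "\<And>i. i \<in> I \<Longrightarrow> set_integrable lborel {0..b} (f i)" for f :: "nat \<Rightarrow> real \<Rightarrow> real"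
    unfolding set_integrable_def scaleR_sum_right using that
    by (intro Bochner_Integration.integrable_sum) (auto simp: set_integrable_def)
  show 1: "set_integrable lborel {0..b} (\<lambda>x. \<Sum>i\<in>I. cmod (Q i x))" by (rule sums[OF n])
  have le: "(\<Sum>i\<in>I. cmod (Q i x))\<^sup>2 \<le> card I * (\<Sum>i\<in>I. (cmod (Q i x))\<^sup>2)" for x
    using sum_squared_le_sum_of_squares[of "\<lambda>i. cmod (Q i x)" I] by (simp add: mult.commute)
  have i2: "set_integrable lborel {0..b} (\<lambda>x. card I * (\<Sum>i\<in>I. (cmod (Q i x))\<^sup>2))"
    by (intro set_integrable_mult_right impI sums assms)
  show 2: "set_integrable lborel {0..b} (\<lambda>x. (\<Sum>i\<in>I. cmod (Q i x))\<^sup>2)"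
  proof (rule set_integrable_I_bound[OF i2])
    show "set_borel_measurable lborel {0..b} (\<lambda>x. (\<Sum>i\<in>I. cmod (Q i x))\<^sup>2)"
      by (rule sbm_compose[OF set_integrable_measurable[OF 1], of "\<lambda>t. t\<^sup>2"]) (auto intro!: continuous_intros)
    show "norm ((\<Sum>i\<in>I. cmod (Q i x))\<^sup>2) \<le> card I * (\<Sum>i\<in>I. (cmod (Q i x))\<^sup>2)" for x using le[of x] by simp
  qed
  have "(LINT x:{0..b}|lborel. (\<Sum>i\<in>I. cmod (Q i x))\<^sup>2) \<le> (LINT x:{0..b}|lborel. card I * (\<Sum>i\<in>I. (cmod (Q i x))\<^sup>2))"
    by (rule set_integral_mono[OF 2 i2 le])
  also have "\<dots> = card I * (\<Sum>i\<in>I. LINT x:{0..b}|lborel. (cmod (Q i x))\<^sup>2)"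
  proof -
    have "(LINT x:{0..b}|lborel. (\<Sum>i\<in>I. (cmod (Q i x))\<^sup>2)) = (\<Sum>i\<in>I. LINT x:{0..b}|lborel. (cmod (Q i x))\<^sup>2)"
      using assms(3) unfolding set_lebesgue_integral_def set_integrable_def scaleR_sum_right
      by (rule Bochner_Integration.integral_sum)
    then show ?thesis by simp
  qed
  finally show "(LINT x:{0..b}|lborel. (\<Sum>i\<in>I. cmod (Q i x))\<^sup>2) \<le> card I * (\<Sum>i\<in>I. LINT x:{0..b}|lborel. (cmod (Q i x))\<^sup>2)" .
qed

lemma set_integral_subset_le:
  fixes f :: "real \<Rightarrow> real"
  assumes "set_integrable lborel {0..b} f" "\<And>x. 0 \<le> f x" "c \<le> b"
  shows "(LINT x:{0..c}|lborel. f x) \<le> (LINT x:{0..b}|lborel. f x)"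
  using set_integrable_sub[OF assms(1,3)] assms unfolding set_lebesgue_integral_def set_integrable_def
  by (intro integral_mono) (auto split: split_indicator)

context bresse
begin

definition "res lam U = sdiff (sscale (\<i> * of_real lam) U) (A U)"

lemma res_inH: "domA L U \<Longrightarrow> inH L (res lam U)"
  unfolding res_def by (intro inH_sdiff inH_sscale inH_A domA_inH)

lemma res_eq: "res lam U i x = \<i> * of_real lam * U i x - A U i x"
  by (simp add: res_def sdiff_def sscale_def)

lemma J_res:
  assumes "domA L U"
  shows "AE x in lborel. x \<in> {0..L} \<longrightarrow> J (res lam U) i x = \<i> * of_real lam * J U i x - J (A U) i x"
proof -
  have e: "res lam U = sadd (sscale (\<i> * of_real lam) U) (sscale (-1) (A U))"
    by (simp add: res_def sdiff_def sadd_def sscale_def)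
  show ?thesis unfolding e using J_lin[OF domA_inH[OF assms] inH_A[OF assms], of "\<i> * of_real lam" "-1" i] by simp
qed

definition "I6 U = (LINT x:{0..\<beta>}|lborel. (cmod (U 6 x))\<^sup>2)"

lemma I6_damp:
  assumes "inH L U"
  shows "(LINT x:{0..L}|lborel. damp a0 \<beta> x * (cmod (U 6 x))\<^sup>2) = a0 * I6 U"
proof -
  have "(LINT x:{0..L}|lborel. damp a0 \<beta> x * (cmod (U 6 x))\<^sup>2) = (LINT x:{0..\<beta>}|lborel. a0 * (cmod (U 6 x))\<^sup>2)"
    unfolding set_lebesgue_integral_def
  proof (rule integral_cong_AE)
    have "set_integrable lborel {0..\<beta>} (\<lambda>x. (cmod (U 6 x))\<^sup>2)"
      by (rule set_integrable_sub[OF L2_square[OF inH_L2[OF assms]]]) (use par in auto)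
    then have "set_integrable lborel {0..\<beta>} (\<lambda>x. a0 * (cmod (U 6 x))\<^sup>2)" by simp
    then show m: "(\<lambda>x. indicat_real {0..\<beta>} x *\<^sub>R (a0 * (cmod (U 6 x))\<^sup>2)) \<in> borel_measurable lborel"
      unfolding set_integrable_def by (rule borel_measurable_integrable)
    \<comment> \<open>The two integrands can differ only at \<beta>, which the closed interval
      includes while \<open>damp\<close> is already 0 there.\<close>
    show "AE x in lborel. indicat_real {0..L} x *\<^sub>R (damp a0 \<beta> x * (cmod (U 6 x))\<^sup>2) = indicat_real {0..\<beta>} x *\<^sub>R (a0 * (cmod (U 6 x))\<^sup>2)"
      using AE_lborel_singleton[of \<beta>] by eventually_elim (use par in \<open>auto simp: damp_def split: split_indicator\<close>)
    have "indicat_real {..<\<beta>} \<in> borel_measurable lborel" by simp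
    then have "(\<lambda>x. indicat_real {..<\<beta>} x *\<^sub>R (indicat_real {0..\<beta>} x *\<^sub>R (a0 * (cmod (U 6 x))\<^sup>2))) \<in> borel_measurable lborel"
      using m by (rule borel_measurable_scaleR)
    moreover have "(\<lambda>x. indicat_real {..<\<beta>} x *\<^sub>R (indicat_real {0..\<beta>} x *\<^sub>R (a0 * (cmod (U 6 x))\<^sup>2))) = (\<lambda>x. indicat_real {0..L} x *\<^sub>R (damp a0 \<beta> x * (cmod (U 6 x))\<^sup>2))"
      using par by (auto simp: fun_eq_iff damp_def split: split_indicator)
    ultimately show "(\<lambda>x. indicat_real {0..L} x *\<^sub>R (damp a0 \<beta> x * (cmod (U 6 x))\<^sup>2)) \<in> borel_measurable lborel" by simp
  qed
  then show ?thesis by (simp add: I6_def)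
qed

text \<open>The term with \<open>\<i> * of_real lam\<close> has no real part, so the dissipation
  equals the real part of the pairing of \<open>res lam U\<close> with \<open>U\<close>. The weight
  \<open>e\<close> stays free, to be chosen so small that \<open>(N U)^2\<close> can be
  absorbed.\<close>

lemma dissipation_res_le:
  assumes U: "domA L U" and e: "0 < e"
  shows "a0 * I6 U \<le> e * (N U)\<^sup>2 + (N (res lam U))\<^sup>2 / (4 * e)"
proof -
  let ?F = "res lam U"
  note i = dissipation(3)[OF U]
  have ii: "set_integrable lborel {0..L} (\<lambda>x. e * (\<Sum>i\<in>{1..6}. (cmod (J U i x))\<^sup>2) + 1 / (4*e) * (\<Sum>i\<in>{1..6}. (cmod (J ?F i x))\<^sup>2))"
    by (intro set_integral_add(1) set_integrable_mult_right impI L2_6_int J_L2 res_inH domA_inH U)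
  have "a0 * I6 U = (LINT x:{0..L}|lborel. - Re (\<Sum>i\<in>{1..6}. J (A U) i x * cnj (J U i x)))"
    using dissipation(1)[OF U] I6_damp[OF domA_inH[OF U]] i by (simp add: set_integral_uminus del: Re_sum)
  also have "\<dots> \<le> (LINT x:{0..L}|lborel. e * (\<Sum>i\<in>{1..6}. (cmod (J U i x))\<^sup>2) + 1 / (4*e) * (\<Sum>i\<in>{1..6}. (cmod (J ?F i x))\<^sup>2))"
  proof (rule set_integral_mono_AE'[OF _ ii])
    show "set_integrable lborel {0..L} (\<lambda>x. - Re (\<Sum>i\<in>{1..6}. J (A U) i x * cnj (J U i x)))"
      using set_integrable_mult_right[of "-1" lborel "{0..L}" "\<lambda>x. Re (\<Sum>i\<in>{1..6}. J (A U) i x * cnj (J U i x))"] i by simp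
    have "AE x in lborel. \<forall>i\<in>{1..6}. x \<in> {0..L} \<longrightarrow> J ?F i x = \<i> * of_real lam * J U i x - J (A U) i x"
      using J_res[OF U] by (intro AE_finite_allI) auto
    then show "AE x in lborel. x \<in> {0..L} \<longrightarrow> - Re (\<Sum>i\<in>{1..6}. J (A U) i x * cnj (J U i x)) \<le> e * (\<Sum>i\<in>{1..6}. (cmod (J U i x))\<^sup>2) + 1 / (4*e) * (\<Sum>i\<in>{1..6}. (cmod (J ?F i x))\<^sup>2)"
    proof eventually_elim
      case (elim x)
      show ?case
      proof
        assume x: "x \<in> {0..L}"
        have "- Re (J (A U) i x * cnj (J U i x)) \<le> e * (cmod (J U i x))\<^sup>2 + 1 / (4*e) * (cmod (J ?F i x))\<^sup>2" if i: "i \<in> {1..6}" for i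
        proof -
          have F: "J (A U) i x = \<i> * of_real lam * J U i x - J ?F i x" using elim i x by simp
          have "Re (\<i> * of_real lam * J U i x * cnj (J U i x)) = 0" by (simp add: algebra_simps)
          then have "- Re (J (A U) i x * cnj (J U i x)) = Re (J ?F i x * cnj (J U i x))"
            unfolding F by (simp add: algebra_simps)
          also have "\<dots> \<le> cmod (J ?F i x) * cmod (J U i x)"
            using complex_Re_le_cmod[of "J ?F i x * cnj (J U i x)"] by (simp add: norm_mult)
          also have "\<dots> \<le> e * (cmod (J U i x))\<^sup>2 + 1 / (4*e) * (cmod (J ?F i x))\<^sup>2"
          proof -
            have "p * q \<le> e * q\<^sup>2 + 1 / (4*e) * p\<^sup>2" for p q :: real
            proof -
              have "0 \<le> (2 * e * q - p)\<^sup>2" by simp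
              then have "4 * e * (p * q) \<le> 4 * e * (e * q\<^sup>2) + p\<^sup>2" by (simp add: power2_eq_square algebra_simps)
              then show ?thesis using e by (simp add: field_simps)
            qed
            then show ?thesis .
          qed
          finally show ?thesis .
        qed
        then have "(\<Sum>i\<in>{1..6}. - Re (J (A U) i x * cnj (J U i x))) \<le> (\<Sum>i\<in>{1..6}. e * (cmod (J U i x))\<^sup>2 + 1 / (4*e) * (cmod (J ?F i x))\<^sup>2)"
          by (intro sum_mono)
        then show "- Re (\<Sum>i\<in>{1..6}. J (A U) i x * cnj (J U i x)) \<le> e * (\<Sum>i\<in>{1..6}. (cmod (J U i x))\<^sup>2) + 1 / (4*e) * (\<Sum>i\<in>{1..6}. (cmod (J ?F i x))\<^sup>2)"
          by (simp only: Re_sum sum_negf sum.distrib sum_distrib_left)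
      qed
    qed
  qed
  also have "\<dots> = e * (N U)\<^sup>2 + (N ?F)\<^sup>2 / (4 * e)"
    unfolding N_eq norm6_square using L2_6_int[OF J_L2[OF domA_inH[OF U]]] L2_6_int[OF J_L2[OF res_inH[OF U]]]
    by (subst set_integral_add(2)) auto
  finally show ?thesis .
qed

text \<open>Expanding the square of \<open>res lam U + \<sigma> U\<close> gives, besides the
  nonnegative term with \<open>\<sigma>^2\<close>, the cross term \<open>- 2 \<sigma>\<close> times
  the real part of the pairing of \<open>A U\<close> with \<open>U\<close>, nonnegative by
  dissipation.\<close>

lemma res_right_half_plane:
  assumes U: "domA L U" and s: "0 \<le> \<sigma>"
  shows "N (res lam U) \<le> N (sdiff (sscale (of_real \<sigma> + \<i> * of_real lam) U) (A U))"
proof -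
  let ?F = "res lam U" and ?G = "sdiff (sscale (of_real \<sigma> + \<i> * of_real lam) U) (A U)"
  have G: "inH L ?G" by (intro inH_sdiff inH_sscale inH_A domA_inH U)
  have e: "?G = sadd (sscale 1 ?F) (sscale (of_real \<sigma>) U)"
    by (simp add: res_def sdiff_def sadd_def sscale_def algebra_simps)
  have ae: "AE x in lborel. \<forall>i\<in>{1..6}. x \<in> {0..L} \<longrightarrow> J ?G i x = J ?F i x + of_real \<sigma> * J U i x \<and> J ?F i x = \<i> * of_real lam * J U i x - J (A U) i x"
  proof (intro AE_finite_allI)
    fix i
    show "AE x in lborel. x \<in> {0..L} \<longrightarrow> J ?G i x = J ?F i x + of_real \<sigma> * J U i x \<and> J ?F i x = \<i> * of_real lam * J U i x - J (A U) i x"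
      unfolding e using J_res[OF U, of lam i] J_lin[OF res_inH[OF U] domA_inH[OF U], of 1 lam "of_real \<sigma>" i] by eventually_elim simp
  qed simp
  note i = dissipation(3)[OF U]
  have "(N ?F)\<^sup>2 \<le> (LINT x:{0..L}|lborel. (\<Sum>i\<in>{1..6}. (cmod (J ?G i x))\<^sup>2) + 2 * \<sigma> * Re (\<Sum>i\<in>{1..6}. J (A U) i x * cnj (J U i x)))"
    unfolding N_eq norm6_square
  proof (rule set_integral_mono_AE')
    show "AE x in lborel. x \<in> {0..L} \<longrightarrow> (\<Sum>i\<in>{1..6}. (cmod (J ?F i x))\<^sup>2) \<le> (\<Sum>i\<in>{1..6}. (cmod (J ?G i x))\<^sup>2) + 2 * \<sigma> * Re (\<Sum>i\<in>{1..6}. J (A U) i x * cnj (J U i x))"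
      using ae
    proof eventually_elim
      case (elim x)
      show ?case
      proof
        assume x: "x \<in> {0..L}"
        have "(cmod (J ?F i x))\<^sup>2 \<le> (cmod (J ?G i x))\<^sup>2 + 2 * \<sigma> * Re (J (A U) i x * cnj (J U i x))" if i: "i \<in> {1..6}" for i
        proof -
          have F: "J ?G i x = J ?F i x + of_real \<sigma> * J U i x" "J ?F i x = \<i> * of_real lam * J U i x - J (A U) i x" using elim i x by auto
          have "(cmod (f + of_real \<sigma> * u))\<^sup>2 + 2 * \<sigma> * Re (a * cnj u) = (cmod f)\<^sup>2 + \<sigma>\<^sup>2 * (cmod u)\<^sup>2"
            if "f = \<i> * of_real lam * u - a" for f u a
            unfolding that cmod_power2 by (simp add: power2_eq_square algebra_simps)
          from this[OF F(2)] show ?thesis unfolding F(1) by (smt (verit) mult_nonneg_nonneg zero_le_power2)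
        qed
        then have "(\<Sum>i\<in>{1..6}. (cmod (J ?F i x))\<^sup>2) \<le> (\<Sum>i\<in>{1..6}. (cmod (J ?G i x))\<^sup>2 + 2 * \<sigma> * Re (J (A U) i x * cnj (J U i x)))"
          by (intro sum_mono)
        then show "(\<Sum>i\<in>{1..6}. (cmod (J ?F i x))\<^sup>2) \<le> (\<Sum>i\<in>{1..6}. (cmod (J ?G i x))\<^sup>2) + 2 * \<sigma> * Re (\<Sum>i\<in>{1..6}. J (A U) i x * cnj (J U i x))"
          by (simp only: Re_sum sum.distrib sum_distrib_left)
      qed
    qed
  qed (intro set_integral_add(1) set_integrable_mult_right impI i L2_6_int J_L2 res_inH U G)+
  also have "\<dots> = (N ?G)\<^sup>2 - 2 * \<sigma> * (a0 * I6 U)"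
    unfolding N_eq norm6_square using i L2_6_int[OF J_L2[OF G]] dissipation(1)[OF U] I6_damp[OF domA_inH[OF U]]
    by (subst set_integral_add(2)) (auto simp del: Re_sum)
  also have "\<dots> \<le> (N ?G)\<^sup>2"
  proof -
    have "0 \<le> I6 U" unfolding I6_def set_lebesgue_integral_def by (intro Bochner_Integration.integral_nonneg) auto
    then show ?thesis using s par by simp
  qed
  finally show ?thesis by (rule power2_le_imp_le) (rule N_nonneg)
qed

section \<open>From the resolvent equation to the first-order system\<close>

definition "slow = sqrt (\<rho>1 / k1)"

text \<open>Equal wave speeds make a single factor, the reciprocal speed, serve all three
  equations.\<close>

lemma slow: "0 < slow" "slow\<^sup>2 = \<rho>1 / k1" "slow\<^sup>2 = \<rho>2 / k2"
  using par equal_speeds by (auto simp: slow_def real_sqrt_pow2 field_simps)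

text \<open>The right sides of the system. The velocity is \<open>\<i> lam\<close> times the
  displacement minus its datum, so differentiating it leaves the derivative of the displacement
  datum in \<open>gg\<close>; in \<open>hh\<close>, multiplication by
  \<open>slow\<^sup>2 = \<rho>1 / k1\<close> turns the damping coefficient
  \<open>a / \<rho>1\<close> into \<open>a / k1\<close>.\<close>

definition "gg F i x = - of_real slow * dx L (F (2*i-1)) x"
definition "hh F U i x = - of_real (slow\<^sup>2) * F (2*i) x + (if i = 3 then of_real (damp a0 \<beta> x / k1) * U 6 x else 0)"

text \<open>Displacements sit at the indices \<open>2*i-1\<close>, velocities at \<open>2*i\<close>.
  The continuous functions \<open>g\<close> take the place of \<open>dx\<close>, so that the system
  has initial values at 0.\<close>

lemma ode_of_resolvent:
  fixes lam :: real
  assumes U: "domA L U"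
    and g: "\<And>i. i \<in> {1,3,5} \<Longrightarrow> AC L (U i) (g i)" "\<And>i. i \<in> {1,3,5} \<Longrightarrow> AC L (g i) (dxx L (U i))"
    and ae: "AE x in lborel. x \<in> {0..L} \<longrightarrow> (\<forall>i\<in>{1,3,5}. dx L (U i) x = g i x)"
    and i: "i \<in> {1,2,3}"
  defines "F \<equiv> res lam U"
  defines "u \<equiv> \<lambda>i. U (2*i-1)" and "z \<equiv> \<lambda>i. g (2*i-1)" and "Y \<equiv> \<lambda>i x. of_real slow * U (2*i) x" and "\<mu> \<equiv> slow * lam"
  shows "AC L (u i) (z i)"
    "AC L (Y i) (\<lambda>x. \<i> * of_real \<mu> * z i x + gg F i x)"
    "AC L (z i) (\<lambda>x. \<i> * of_real \<mu> * Y i x + (lower_order l (k1/k2) u z i x + hh F U i x))"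
    "u i 0 = 0" "Y i 0 = 0"
proof -
  have odd: "2*i-1 \<in> {1,3,5}" "2*i-1 \<in> {1..6}" "2*i \<in> {1..6}" using i by auto
  have F: "inH L F" unfolding F_def by (rule res_inH[OF U])
  show u: "AC L (u i) (z i)" unfolding u_def z_def by (rule g[OF odd(1)])
  show "u i 0 = 0" "Y i 0 = 0" unfolding u_def Y_def using H10_ends(1)[OF domA_H10[OF U odd(2)]] H10_ends(1)[OF domA_H10[OF U odd(3)]] by simp_all
  have Fo: "F (2*i-1) x = \<i> * of_real lam * U (2*i-1) x - U (2*i) x" for x
    using i A_components(4-6)[of U] by (auto simp: F_def res_eq)
  have "AC L (\<lambda>x. of_real slow * (\<i> * of_real lam * U (2*i-1) x - F (2*i-1) x))
     (\<lambda>x. of_real slow * (\<i> * of_real lam * g (2*i-1) x - dx L (F (2*i-1)) x))"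
    by (intro AC_cmult AC_diff g odd H10_AC(1) inH_H10[OF F])
  then show "AC L (Y i) (\<lambda>x. \<i> * of_real \<mu> * z i x + gg F i x)"
    by (rule AC_cong) (simp_all only: Fo Y_def z_def \<mu>_def gg_def, simp_all add: algebra_simps)
  have UL2: "L2 L (U j)" if "j \<in> {1..6}" for j using inH_L2[OF domA_inH[OF U] that] .
  have FL2: "L2 L (F j)" if "j \<in> {1..6}" for j using inH_L2[OF F that] .
  have lo: "continuous_on {0..L} (lower_order l (k1/k2) u z i)"
  proof -
    have c: "continuous_on {0..L} (U j)" "continuous_on {0..L} (g j)" if "j \<in> {1,3,5}" for j
      using g[OF that] AC_continuous by blast+
    have "lower_order l (k1/k2) u z i = (if i = 1 then (\<lambda>x. - z 2 x - of_real (2*l) * z 3 x + of_real (l\<^sup>2) * u 1 x)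
     else if i = 2 then (\<lambda>x. of_real (k1/k2) * (z 1 x + u 2 x + of_real l * u 3 x))
     else (\<lambda>x. of_real (2*l) * z 1 x + of_real l * u 2 x + of_real (l\<^sup>2) * u 3 x))"
      by (auto simp: lower_order_def fun_eq_iff)
    then show ?thesis unfolding u_def z_def
      using c[of 1] c[of 3] c[of 5] par by (auto intro!: continuous_intros)
  qed
  have dmp: "L2 L (\<lambda>x. of_real (damp a0 \<beta> x / k1) * U 6 x)"
  proof -
    have "L2 L (\<lambda>x. of_real (1/k1) * (of_real (damp a0 \<beta> x) * U 6 x))" using par by (intro L2_cmult L2_damp UL2) auto
    then show ?thesis by (simp add: mult.assoc[symmetric])
  qed
  have hi: "L2 L (hh F U i)"
  proof -
    have 1: "L2 L (\<lambda>x. - of_real (slow\<^sup>2) * F (2*i) x)" by (rule L2_cmult[OF FL2[OF odd(3)]])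
    show ?thesis
    proof (cases "i = 3")
      case True
      show ?thesis unfolding hh_def[abs_def] if_P[OF True] by (rule L2_add[OF 1 dmp])
    next
      case False
      show ?thesis unfolding hh_def[abs_def] if_not_P[OF False] add_0_right by (rule 1)
    qed
  qed
  show "AC L (z i) (\<lambda>x. \<i> * of_real \<mu> * Y i x + (lower_order l (k1/k2) u z i x + hh F U i x))"
  proof (rule AC_cong_AE)
    show "AC L (z i) (dxx L (U (2*i-1)))" unfolding z_def by (rule g(2)[OF odd(1)])
    show "set_integrable lborel {0..L} (\<lambda>x. \<i> * of_real \<mu> * Y i x + (lower_order l (k1/k2) u z i x + hh F U i x))"
      unfolding Y_def by (intro set_integral_add(1) set_integrable_mult_right impI L2_integrable UL2 odd hi set_integrable_continuous lo)
    show "AE x in lborel. 0 \<le> x \<and> x \<le> L \<longrightarrow> dxx L (U (2*i-1)) x = \<i> * of_real \<mu> * Y i x + (lower_order l (k1/k2) u z i x + hh F U i x)"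
      using ae
    proof eventually_elim
      case (elim x)
      show ?case
      proof
        assume "0 \<le> x \<and> x \<le> L"
        then have e: "dx L (U 1) x = g 1 x" "dx L (U 3) x = g 3 x" "dx L (U 5) x = g 5 x" using elim by auto
        have s1: "of_real (slow * slow) = complex_of_real \<rho>1 / of_real k1" using slow(2) by (simp add: power2_eq_square)
        have s2: "of_real (slow * slow) = complex_of_real \<rho>2 / of_real k2" using slow(3) by (simp add: power2_eq_square)
        have k: "of_real k1 \<noteq> (0::complex)" "of_real k2 \<noteq> (0::complex)" using par by auto
        have muY: "\<i> * of_real \<mu> * Y i x = of_real (slow * slow) * (\<i> * of_real lam * U (2*i) x)"
          by (simp add: \<mu>_def Y_def algebra_simps)
        \<comment> \<open>By the resolvent equation, velocity term and datum together are a multiple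
          of \<open>A U\<close>, which \<open>A_components\<close> evaluates row by row.\<close>
        have comb: "\<i> * of_real \<mu> * Y i x - of_real (slow\<^sup>2) * F (2*i) x = of_real (slow * slow) * A U (2*i) x"
          unfolding muY F_def res_eq by (simp add: power2_eq_square algebra_simps)
        have "\<i> * of_real \<mu> * Y i x + (lower_order l (k1/k2) u z i x + hh F U i x)
          = of_real (slow * slow) * A U (2*i) x + lower_order l (k1/k2) u z i x + (if i = 3 then of_real (damp a0 \<beta> x / k1) * U 6 x else 0)"
          unfolding hh_def comb[symmetric] by (simp add: algebra_simps)
        also have "\<dots> = dxx L (U (2*i-1)) x"
        proof -
          consider "i = 1" | "i = 2" | "i = 3" using i by auto
          then show ?thesis
          proof cases
            case 1
            have "of_real k1 * (of_real (slow * slow) * A U 2 x) = of_real k1 * (dxx L (U 1) x + g 3 x + of_real l * g 5 x) + of_real (l * k1) * (g 5 x - of_real l * U 1 x)"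
              using A_components(1)[of U x] k unfolding s1 e by simp
            then have "of_real k1 * (of_real (slow * slow) * A U 2 x) = of_real k1 * (dxx L (U 1) x + g 3 x + of_real l * g 5 x + of_real l * (g 5 x - of_real l * U 1 x))"
              by (simp only:) (simp add: algebra_simps)
            then have "of_real (slow * slow) * A U 2 x = dxx L (U 1) x + g 3 x + of_real l * g 5 x + of_real l * (g 5 x - of_real l * U 1 x)"
              unfolding mult_left_cancel[OF k(1)] .
            moreover have t: "2 * i = 2" "2 * i - 1 = 1" using 1 by auto
            ultimately show ?thesis unfolding t using 1 by (simp add: lower_order_def u_def z_def power2_eq_square algebra_simps)
          next
            case 2
            have "of_real k2 * (of_real (slow * slow) * A U 4 x) = of_real k2 * dxx L (U 3) x - of_real k1 * (g 1 x + U 3 x + of_real l * U 5 x)"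
              using A_components(2)[of U x] k unfolding s2 e by simp
            then have "of_real (slow * slow) * A U 4 x = dxx L (U 3) x - of_real k1 / of_real k2 * (g 1 x + U 3 x + of_real l * U 5 x)"
              using k by (simp add: field_simps)
            then show ?thesis using 2 by (simp add: lower_order_def u_def z_def algebra_simps)
          next
            case 3
            have "of_real k1 * (of_real (slow * slow) * A U 6 x) = of_real k1 * (dxx L (U 5) x - of_real l * g 1 x) - of_real (l * k1) * (g 1 x + U 3 x + of_real l * U 5 x) - of_real (damp a0 \<beta> x) * U 6 x"
              using A_components(3)[of U x] k unfolding s1 e by simp
            then have "of_real (slow * slow) * A U 6 x = dxx L (U 5) x - of_real l * g 1 x - of_real l * (g 1 x + U 3 x + of_real l * U 5 x) - of_real (damp a0 \<beta> x) / of_real k1 * U 6 x"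
              using k by (simp add: field_simps)
            then show ?thesis using 3 by (simp add: lower_order_def u_def z_def power2_eq_square algebra_simps)
          qed
        qed
        finally show "dxx L (U (2*i-1)) x = \<i> * of_real \<mu> * Y i x + (lower_order l (k1/k2) u z i x + hh F U i x)" ..
      qed
    qed
  qed simp
qed

text \<open>Moduli dominating the data: odd indices bound \<open>gg\<close>, even indices bound the
  part of \<open>hh\<close> without damping.\<close>

definition "QF F i x = (if odd i then of_real slow * dx L (F i) x else of_real (slow\<^sup>2) * F (i::nat) x)"

lemma QF_L2: assumes "inH L F" "i \<in> {1..6}" shows "L2 L (QF F i)"
proof (cases "odd i")
  case True
  then have "i \<noteq> 2" "i \<noteq> 4" "i \<noteq> 6" by auto
  then have "i \<in> {1,3,5}" using assms(2) by auto
  then show ?thesis unfolding QF_def[abs_def] using True by (simp add: L2_cmult H10_AC(2) inH_H10[OF assms(1)])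
next
  case False
  then show ?thesis unfolding QF_def[abs_def] by (simp add: L2_cmult inH_L2[OF assms])
qed

text \<open>Derivatives of displacement data are controlled by coercivity. The pointwise bound on
  \<open>F 5\<close> serves where the displacement is recovered from the velocity through division
  by \<open>lam\<close>.\<close>

lemma QF_bound:
  "\<exists>C>0. \<forall>F. inH L F \<longrightarrow> (\<Sum>i\<in>{1..6}. LINT x:{0..L}|lborel. (cmod (QF F i x))\<^sup>2) \<le> C * (N F)\<^sup>2 \<and> (\<forall>x\<in>{0..L}. (cmod (F 5 x))\<^sup>2 \<le> C * (N F)\<^sup>2)"
proof -
  obtain Cc where Cc: "0 < Cc" and co: "\<And>U i. inH L U \<Longrightarrow> i \<in> {1,3,5} \<Longrightarrow> (\<forall>x\<in>{0..L}. (cmod (U i x))\<^sup>2 \<le> Cc * Strain U) \<and>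
      (LINT x:{0..L}|lborel. (cmod (dx L (U i) x))\<^sup>2) \<le> Cc * Strain U" using coercivity by blast
  define C where "C = 3 * slow\<^sup>2 * Cc + slow ^ 4 * (2 / \<rho>1 + 1 / \<rho>2) + Cc"
  have "0 \<le> slow ^ 4 * (2 / \<rho>1 + 1 / \<rho>2)" "0 \<le> 3 * slow\<^sup>2 * Cc" using par Cc by auto
  then have C: "0 < C" "Cc \<le> C" using Cc unfolding C_def by linarith+
  have "(\<Sum>i\<in>{1..6}. LINT x:{0..L}|lborel. (cmod (QF F i x))\<^sup>2) \<le> C * (N F)\<^sup>2 \<and> (\<forall>x\<in>{0..L}. (cmod (F 5 x))\<^sup>2 \<le> C * (N F)\<^sup>2)" if F: "inH L F" for F
  proof
    have st: "Cc * Strain F \<le> Cc * (N F)\<^sup>2" using Strain_le_N[OF F] Cc by simp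
    have o: "(LINT x:{0..L}|lborel. (cmod (QF F i x))\<^sup>2) \<le> slow\<^sup>2 * (Cc * (N F)\<^sup>2)" if "i \<in> {1,3,5}" for i
    proof -
      have "(LINT x:{0..L}|lborel. (cmod (QF F i x))\<^sup>2) = slow\<^sup>2 * (LINT x:{0..L}|lborel. (cmod (dx L (F i) x))\<^sup>2)"
        using that by (auto simp: QF_def norm_mult power_mult_distrib)
      also have "\<dots> \<le> slow\<^sup>2 * (Cc * (N F)\<^sup>2)" using co[OF F that] st by (intro mult_left_mono) auto
      finally show ?thesis .
    qed
    have e: "(LINT x:{0..L}|lborel. (cmod (QF F i x))\<^sup>2) \<le> slow ^ 4 * r" if "(LINT x:{0..L}|lborel. (cmod (F i x))\<^sup>2) \<le> r" "even i" for i r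
    proof -
      have "(LINT x:{0..L}|lborel. (cmod (QF F i x))\<^sup>2) = slow ^ 4 * (LINT x:{0..L}|lborel. (cmod (F i x))\<^sup>2)"
        using that by (simp add: QF_def norm_mult power_mult_distrib norm_power)
      also have "\<dots> \<le> slow ^ 4 * r" using that(1) by (intro mult_left_mono) auto
      finally show ?thesis .
    qed
    have "(\<Sum>i\<in>{1..6}. LINT x:{0..L}|lborel. (cmod (QF F i x))\<^sup>2) \<le> slow\<^sup>2 * (Cc * (N F)\<^sup>2) + slow ^ 4 * ((N F)\<^sup>2 / \<rho>1) + slow\<^sup>2 * (Cc * (N F)\<^sup>2)
      + slow ^ 4 * ((N F)\<^sup>2 / \<rho>2) + slow\<^sup>2 * (Cc * (N F)\<^sup>2) + slow ^ 4 * ((N F)\<^sup>2 / \<rho>1)"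
      unfolding sum_1_6 by (intro add_mono o e velocity_le[OF F]) auto
    also have "\<dots> = (3 * slow\<^sup>2 * Cc + slow ^ 4 * (2 / \<rho>1 + 1 / \<rho>2)) * (N F)\<^sup>2"
      using par by (simp add: field_simps)
    also have "\<dots> \<le> C * (N F)\<^sup>2" using Cc by (intro mult_right_mono) (auto simp: C_def)
    finally show "(\<Sum>i\<in>{1..6}. LINT x:{0..L}|lborel. (cmod (QF F i x))\<^sup>2) \<le> C * (N F)\<^sup>2" .
    have "Cc * (N F)\<^sup>2 \<le> C * (N F)\<^sup>2" using C by (intro mult_right_mono) auto
    then show "\<forall>x\<in>{0..L}. (cmod (F 5 x))\<^sup>2 \<le> C * (N F)\<^sup>2" using co[OF F, of 5] st by fastforce
  qed
  then show ?thesis using C by blast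
qed

text \<open>Pairs a state with continuous representatives of its derivatives:
  \<open>dx L (U i)\<close> is fixed only almost everywhere, so slopes at 0 are read off from
  \<open>g\<close>.\<close>

definition rep :: "state \<Rightarrow> (nat \<Rightarrow> real \<Rightarrow> complex) \<Rightarrow> bool" where
  "rep U g \<longleftrightarrow> domA L U \<and> (\<forall>i\<in>{1,3,5}. AC L (U i) (g i) \<and> AC L (g i) (dxx L (U i)))
     \<and> (AE x in lborel. x \<in> {0..L} \<longrightarrow> (\<forall>i\<in>{1,3,5}. dx L (U i) x = g i x))"

lemma rep_exists: "domA L U \<Longrightarrow> \<exists>g. rep U g"
  unfolding rep_def using domA_rep by blast

definition "slope g = cmod (g 1 0) + cmod (g 3 0) + cmod (g (5::nat) (0::real) :: complex)"

lemma rep_ode: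
  assumes "rep U g" "i \<in> {1,2,3}"
  shows "AC L (U (2*i-1)) (g (2*i-1))"
    "AC L (\<lambda>x. of_real slow * U (2*i) x) (\<lambda>x. \<i> * of_real (slow * lam) * g (2*i-1) x + gg (res lam U) i x)"
    "AC L (g (2*i-1)) (\<lambda>x. \<i> * of_real (slow * lam) * (of_real slow * U (2*i) x) + (lower_order l (k1/k2) (\<lambda>i. U (2*i-1)) (\<lambda>i. g (2*i-1)) i x + hh (res lam U) U i x))"
    "U (2*i-1) 0 = 0" "of_real slow * U (2*i) 0 = 0"
proof -
  have U: "domA L U" and g: "\<And>i. i \<in> {1,3,5} \<Longrightarrow> AC L (U i) (g i)" "\<And>i. i \<in> {1,3,5} \<Longrightarrow> AC L (g i) (dxx L (U i))"
    and ae: "AE x in lborel. x \<in> {0..L} \<longrightarrow> (\<forall>i\<in>{1,3,5}. dx L (U i) x = g i x)"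
    using assms(1) unfolding rep_def by blast+
  note o = ode_of_resolvent[OF U g ae assms(2)]
  show "AC L (U (2*i-1)) (g (2*i-1))" by (rule o(1))
  show "AC L (\<lambda>x. of_real slow * U (2*i) x) (\<lambda>x. \<i> * of_real (slow * lam) * g (2*i-1) x + gg (res lam U) i x)" by (rule o(2))
  show "AC L (g (2*i-1)) (\<lambda>x. \<i> * of_real (slow * lam) * (of_real slow * U (2*i) x) + (lower_order l (k1/k2) (\<lambda>i. U (2*i-1)) (\<lambda>i. g (2*i-1)) i x + hh (res lam U) U i x))"
    by (rule o(3))
  show "U (2*i-1) 0 = 0" by (rule o(4))
  show "of_real slow * U (2*i) 0 = 0" by (rule o(5))
qed

lemma gg_le: assumes "i \<in> {1,2,3}" shows "cmod (gg F i x) \<le> cmod (QF F (2*i-1) x)"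
  using assms slow(1) by (auto simp: gg_def QF_def norm_mult)

lemma hh_le: assumes "i \<in> {1,2,3}" shows "cmod (hh F U i x) \<le> cmod (QF F (2*i) x) + (if i = 3 then a0 / k1 * cmod (U 6 x) else 0)"
proof -
  have "cmod (hh F U i x) \<le> cmod (- of_real (slow\<^sup>2) * F (2*i) x) + cmod (if i = 3 then of_real (damp a0 \<beta> x / k1) * U 6 x else 0)"
    unfolding hh_def by (rule norm_triangle_ineq)
  moreover have "cmod (- of_real (slow\<^sup>2) * F (2*i) x) = cmod (QF F (2*i) x)" by (simp add: QF_def norm_mult)
  moreover have "cmod (of_real (damp a0 \<beta> x / k1) * U 6 x) \<le> a0 / k1 * cmod (U 6 x)"
    using par unfolding norm_mult norm_of_real by (intro mult_right_mono) (auto simp: damp_def)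
  ultimately show ?thesis by (auto split: if_splits)
qed

text \<open>Gronwall on the whole interval. Here the damping is a coefficient of the system, with
  \<open>D = a0 / (k1 * slow)\<close>, because \<open>U 6\<close> belongs to the quantity being
  bounded.\<close>

lemma upper_bound:
  "\<exists>C>0. \<forall>lam U g. rep U g \<longrightarrow> (N U)\<^sup>2 \<le> C * ((slope g)\<^sup>2 + (N (res lam U))\<^sup>2)"
proof -
  obtain CQ where CQ: "0 < CQ" "\<And>F. inH L F \<Longrightarrow> (\<Sum>i\<in>{1..6}. LINT x:{0..L}|lborel. (cmod (QF F i x))\<^sup>2) \<le> CQ * (N F)\<^sup>2"
    using QF_bound by blast
  define D where "D = a0 / (k1 * slow)"
  define K0 where "K0 = bresse_ode.K0 L l (k1/k2) D"
  define Cd where "Cd = k1 * (2 + l)\<^sup>2 + \<rho>1 / slow\<^sup>2 + k2 + \<rho>2 / slow\<^sup>2 + k1 * (1 + l)\<^sup>2 + \<rho>1 / slow\<^sup>2"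
  define C where "C = L * Cd * (2 * K0\<^sup>2) * (1 + 6 * CQ) + 1"
  have D: "0 \<le> D" using par slow(1) by (simp add: D_def)
  have Cd: "0 \<le> Cd" using par slow(1) by (simp add: Cd_def)
  have C: "0 < C" using par Cd CQ by (auto simp: C_def intro!: add_nonneg_pos)
  have "(N U)\<^sup>2 \<le> C * ((slope g)\<^sup>2 + (N (res lam U))\<^sup>2)" if r: "rep U g" for lam U g
  proof -
    let ?F = "res lam U"
    have U: "domA L U" using r by (simp add: rep_def)
    have F: "inH L ?F" by (rule res_inH[OF U])
    define \<gamma> where "\<gamma> x = (\<Sum>i\<in>{1..6}. cmod (QF ?F i x))" for x
    have mem: "cmod (QF ?F i x) \<le> \<gamma> x" if "i \<in> {1..6}" for i x
      unfolding \<gamma>_def by (rule member_le_sum) (use that in auto)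
    have Qi: "set_integrable lborel {0..L} (QF ?F i)" "set_integrable lborel {0..L} (\<lambda>x. (cmod (QF ?F i x))\<^sup>2)" if "i \<in> {1..6}" for i
      using QF_L2[OF F that] L2_integrable L2_square by blast+
    note sums = sum_cmod_L2[of "{1..6::nat}" L "QF ?F", OF _ Qi]
    interpret o: bresse_ode L l "k1/k2" "slow * lam" D "\<lambda>i. U (2*i-1)" "\<lambda>i x. of_real slow * U (2*i) x" "\<lambda>i. g (2*i-1)" "gg ?F" "hh ?F U" \<gamma>
    proof
      show "0 < L" "0 < l" "0 < k1/k2" "0 \<le> D" using par D by auto
      show "0 \<le> \<gamma> x" for x by (simp add: \<gamma>_def sum_nonneg)
      show "set_integrable lborel {0..L} \<gamma>" "set_integrable lborel {0..L} (\<lambda>x. (\<gamma> x)\<^sup>2)"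
        unfolding \<gamma>_def using sums by auto
      fix i :: nat assume i: "i \<in> {1,2,3}"
      then have i6: "2*i-1 \<in> {1..6}" "2*i \<in> {1..6}" by auto
      show "cmod (gg ?F i x) \<le> \<gamma> x" for x using gg_le[OF i, of ?F x] mem[OF i6(1), of x] by linarith
      show "cmod (hh ?F U i x) \<le> D * cmod (of_real slow * U (2*i) x) + \<gamma> x" for x
      proof -
        have "D * cmod (of_real slow * U (2*i) x) = a0 / k1 * cmod (U (2*i) x)" using slow(1) by (simp add: D_def norm_mult)
        moreover have "0 \<le> a0 / k1 * cmod (U (2*i) x)" using par by simp
        ultimately show ?thesis using hh_le[OF i, of ?F U x] mem[OF i6(2), of x] by (cases "i = 3") auto
      qed
    qed (use rep_ode[OF r] in auto)
    have pn: "o.pn = slope g" unfolding o.pn_def slope_def by simp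
    have K0: "o.K0 = K0" by (simp add: K0_def)
    have \<delta>: "o.\<delta>\<^sup>2 \<le> 6 * (CQ * (N ?F)\<^sup>2)"
    proof -
      have "o.\<delta>\<^sup>2 \<le> 6 * (\<Sum>i\<in>{1..6}. LINT x:{0..L}|lborel. (cmod (QF ?F i x))\<^sup>2)"
        unfolding o.\<delta>_square \<gamma>_def using sums(3) by simp
      then show ?thesis using CQ(2)[OF F] by linarith
    qed
    have en: "o.energy x \<le> 2 * K0\<^sup>2 * ((slope g)\<^sup>2 + 6 * (CQ * (N ?F)\<^sup>2))" if x: "x \<in> {0..L}" for x
    proof -
      have "o.energy x = (sqrt (o.energy x))\<^sup>2" using o.energy_nonneg by simp
      also have "\<dots> \<le> o.S\<^sup>2" using o.sqrt_energy_le_S[of x] x o.energy_nonneg by (intro power_mono) auto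
      also have "\<dots> = K0\<^sup>2 * (slope g + o.\<delta>)\<^sup>2" unfolding o.S_def K0 pn by (simp add: power_mult_distrib)
      also have "\<dots> \<le> K0\<^sup>2 * (2 * (slope g)\<^sup>2 + 2 * o.\<delta>\<^sup>2)"
        using sum_squares_bound[of "slope g" "o.\<delta>"] by (intro mult_left_mono) (auto simp: power2_sum)
      also have "\<dots> \<le> K0\<^sup>2 * (2 * (slope g)\<^sup>2 + 2 * (6 * (CQ * (N ?F)\<^sup>2)))"
        using \<delta> by (intro mult_left_mono) auto
      finally show ?thesis by (simp add: algebra_simps)
    qed
    have ae: "AE x in lborel. x \<in> {0..L} \<longrightarrow> (\<forall>i\<in>{1,3,5}. dx L (U i) x = g i x)" using r by (simp add: rep_def)
    have dens: "AE x in lborel. x \<in> {0..L} \<longrightarrow> (\<Sum>i\<in>{1..6}. (cmod (J U i x))\<^sup>2) \<le> Cd * (2 * K0\<^sup>2 * ((slope g)\<^sup>2 + 6 * (CQ * (N ?F)\<^sup>2)))"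
      using ae
    proof eventually_elim
      case (elim x)
      show ?case
      proof
        assume x: "x \<in> {0..L}"
        let ?e = "sqrt (o.energy x)"
        have e: "dx L (U 1) x = g 1 x" "dx L (U 3) x = g 3 x" "dx L (U 5) x = g 5 x" using elim x by auto
        have b: "cmod (U 1 x) \<le> ?e" "cmod (U 3 x) \<le> ?e" "cmod (U 5 x) \<le> ?e" "cmod (g 1 x) \<le> ?e" "cmod (g 3 x) \<le> ?e" "cmod (g 5 x) \<le> ?e"
          "slow * cmod (U 2 x) \<le> ?e" "slow * cmod (U 4 x) \<le> ?e" "slow * cmod (U 6 x) \<le> ?e"
          using o.energy_components[of 1 x] o.energy_components[of 2 x] o.energy_components[of 3 x] slow(1) by (auto simp: norm_mult)
        have e2: "?e\<^sup>2 = o.energy x" using o.energy_nonneg by simp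
        have s: "(cmod w)\<^sup>2 \<le> c\<^sup>2 * o.energy x" if "cmod w \<le> c * ?e" for w c
          using power_mono[OF that, of 2] e2 by (simp add: power_mult_distrib)
        have 1: "(cmod (g 1 x + U 3 x + of_real l * U 5 x))\<^sup>2 \<le> (2 + l)\<^sup>2 * o.energy x"
        proof (rule s)
          have "cmod (g 1 x + U 3 x + of_real l * U 5 x) \<le> ?e + ?e + l * ?e"
            using b par by (intro norm_triangle_mono cmod_of_real_mult_le) auto
          then show "cmod (g 1 x + U 3 x + of_real l * U 5 x) \<le> (2 + l) * ?e" by (simp add: algebra_simps)
        qed
        have 2: "(cmod (g 5 x - of_real l * U 1 x))\<^sup>2 \<le> (1 + l)\<^sup>2 * o.energy x"
        proof (rule s)
          have "cmod (g 5 x - of_real l * U 1 x) \<le> ?e + l * ?e"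
            using norm_triangle_ineq4[of "g 5 x" "of_real l * U 1 x"] b cmod_of_real_mult_le[of "U 1 x" ?e l] par by linarith
          then show "cmod (g 5 x - of_real l * U 1 x) \<le> (1 + l) * ?e" by (simp add: algebra_simps)
        qed
        have 3: "(cmod (g 3 x))\<^sup>2 \<le> o.energy x" using s[of "g 3 x" 1] b by simp
        have v: "r * (cmod w)\<^sup>2 \<le> r / slow\<^sup>2 * o.energy x" if "slow * cmod w \<le> ?e" "0 < r" for w r
        proof -
          have "slow\<^sup>2 * (cmod w)\<^sup>2 \<le> o.energy x" using power_mono[OF that(1), of 2] e2 slow(1) by (simp add: power_mult_distrib)
          then show ?thesis using that(2) slow(1) by (simp add: field_simps)
        qed
        have "(\<Sum>i\<in>{1..6}. (cmod (J U i x))\<^sup>2) \<le> k1 * ((2 + l)\<^sup>2 * o.energy x) + \<rho>1 / slow\<^sup>2 * o.energy x + k2 * o.energy x + \<rho>2 / slow\<^sup>2 * o.energy x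
           + k1 * ((1 + l)\<^sup>2 * o.energy x) + \<rho>1 / slow\<^sup>2 * o.energy x"
          unfolding J_norms e using 1 2 3 v[OF b(7) par(1)] v[OF b(8) par(2)] v[OF b(9) par(1)] par
          by (intro add_mono mult_left_mono) auto
        also have "\<dots> = Cd * o.energy x" by (simp add: Cd_def algebra_simps)
        also have "\<dots> \<le> Cd * (2 * K0\<^sup>2 * ((slope g)\<^sup>2 + 6 * (CQ * (N ?F)\<^sup>2)))" using en[OF x] Cd by (intro mult_left_mono) auto
        finally show "(\<Sum>i\<in>{1..6}. (cmod (J U i x))\<^sup>2) \<le> Cd * (2 * K0\<^sup>2 * ((slope g)\<^sup>2 + 6 * (CQ * (N ?F)\<^sup>2)))" .
      qed
    qed
    have "(N U)\<^sup>2 \<le> (LINT x:{0..L}|lborel. Cd * (2 * K0\<^sup>2 * ((slope g)\<^sup>2 + 6 * (CQ * (N ?F)\<^sup>2))))"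
      unfolding N_eq[of U] norm6_square by (rule set_integral_mono_AE'[OF L2_6_int[OF J_L2[OF domA_inH[OF U]]] set_integrable_one dens])
    also have "\<dots> = L * Cd * (2 * K0\<^sup>2) * ((slope g)\<^sup>2 + 6 * CQ * (N ?F)\<^sup>2)" using par by (simp add: set_integral_const)
    also have "\<dots> \<le> L * Cd * (2 * K0\<^sup>2) * ((1 + 6 * CQ) * ((slope g)\<^sup>2 + (N ?F)\<^sup>2))"
      using par Cd CQ by (intro mult_left_mono) (auto simp: algebra_simps)
    also have "\<dots> \<le> C * ((slope g)\<^sup>2 + (N ?F)\<^sup>2)"
      unfolding C_def by (simp add: algebra_simps)
    finally show ?thesis .
  qed
  then show ?thesis using C by blast
qed

text \<open>The system is restricted to the damped interval, where \<open>U 6\<close> belongs to the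
  data. The lower bound on \<open>\<bar>lam\<bar>\<close> allows the passage from \<open>U 6\<close>
  to the displacement \<open>U 5\<close> at bounded frequency; the threshold \<Lambda> separates the
  two regimes.\<close>

lemma observability:
  assumes l1: "0 < lam1"
  shows "\<exists>C>0. \<forall>lam U g. rep U g \<longrightarrow> lam1 \<le> \<bar>lam\<bar> \<longrightarrow> (slope g)\<^sup>2 \<le> C * ((N (res lam U))\<^sup>2 + I6 U)"
proof -
  obtain CQ where CQ: "0 < CQ" "\<And>F. inH L F \<Longrightarrow> (\<Sum>i\<in>{1..6}. LINT x:{0..L}|lborel. (cmod (QF F i x))\<^sup>2) \<le> CQ * (N F)\<^sup>2"
      "\<And>F x. inH L F \<Longrightarrow> x \<in> {0..L} \<Longrightarrow> (cmod (F 5 x))\<^sup>2 \<le> CQ * (N F)\<^sup>2"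
    using QF_bound by blast
  have kap: "0 < k1/k2" using par by simp
  obtain Ch \<Lambda> where Ch: "0 < Ch" "0 < \<Lambda>" and high: "\<And>\<mu> u Y z g h \<gamma>. bresse_ode0 \<beta> l (k1/k2) \<mu> u Y z g h \<gamma> \<Longrightarrow> \<Lambda> \<le> \<bar>\<mu>\<bar> \<Longrightarrow>
    (\<forall>x\<in>{0..\<beta>}. cmod (Y 3 x) \<le> \<gamma> x) \<Longrightarrow> bresse_ode.pn z \<le> Ch * bresse_ode.\<delta> \<beta> \<gamma>"
    using observability_high[OF par(7) par(5) kap] by blast
  obtain Cl where Cl: "0 < Cl" and low: "\<And>\<mu> u Y z g h \<gamma>. bresse_ode0 \<beta> l (k1/k2) \<mu> u Y z g h \<gamma> \<Longrightarrow> \<bar>\<mu>\<bar> \<le> \<Lambda> \<Longrightarrow>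
    (\<forall>x\<in>{0..\<beta>}. cmod (u 3 x) \<le> \<gamma> x) \<Longrightarrow> bresse_ode.pn z \<le> Cl * bresse_ode.\<delta> \<beta> \<gamma>"
    using observability_low[OF par(7) par(5) kap less_imp_le[OF Ch(2)]] by blast
  \<comment> \<open>\<open>c\<close> dominates the three factors with which \<open>U 6\<close> and
    \<open>F 5\<close> occur: in the damping term, in the rescaled velocity and in the
    displacement.\<close>
  define c where "c = a0 / k1 + slow + 1 / lam1"
  have c: "0 < c" "a0 / k1 \<le> c" "slow \<le> c" "1 / lam1 \<le> c"
  proof -
    have "0 < a0 / k1" "0 < slow" "0 < 1 / lam1" using par slow(1) l1 by auto
    then show "0 < c" "a0 / k1 \<le> c" "slow \<le> c" "1 / lam1 \<le> c" unfolding c_def by linarith+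
  qed
  define Cd where "Cd = 8 * (CQ + c\<^sup>2 * (\<beta> * CQ) + c\<^sup>2)"
  define C where "C = (Ch + Cl)\<^sup>2 * Cd"
  have Cd: "0 < Cd" using CQ(1) c par by (simp add: Cd_def add_pos_pos)
  have C: "0 < C" using Cd Ch Cl by (simp add: C_def)
  have "(slope g)\<^sup>2 \<le> C * ((N (res lam U))\<^sup>2 + I6 U)" if r: "rep U g" and lam: "lam1 \<le> \<bar>lam\<bar>" for lam U g
  proof -
    let ?F = "res lam U"
    have U: "domA L U" using r by (simp add: rep_def)
    have F: "inH L ?F" by (rule res_inH[OF U])
    \<comment> \<open>Indices 1 to 6 are data, 7 is the observed velocity, 8 the datum of the
      displacement. Some estimates use two entries at the same point, which is why \<gamma> is their
      sum.\<close>
    define Q where "Q i = (if i \<le> 6 then QF ?F i else if i = 7 then (\<lambda>x. of_real c * U 6 x) else (\<lambda>x. of_real c * ?F 5 x))" for i :: nat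
    define \<gamma> where "\<gamma> x = (\<Sum>i\<in>{1..8}. cmod (Q i x))" for x
    have QL: "L2 L (Q i)" if "i \<in> {1..8}" for i
      unfolding Q_def using that inH_L2[OF F, of 5] inH_L2[OF domA_inH[OF U], of 6] by (auto intro!: QF_L2[OF F] L2_cmult)
    have Qi: "set_integrable lborel {0..\<beta>} (Q i)" "set_integrable lborel {0..\<beta>} (\<lambda>x. (cmod (Q i x))\<^sup>2)" if "i \<in> {1..8}" for i
      using L2_integrable[OF QL[OF that]] L2_square[OF QL[OF that]] set_integrable_sub[of L _ \<beta>] par by auto
    note sums = sum_cmod_L2[of "{1..8::nat}" \<beta> Q, OF _ Qi]
    have two: "cmod (Q i x) + cmod (Q j x) \<le> \<gamma> x" if "i \<in> {1..8}" "j \<in> {1..8}" "i \<noteq> j" for i j x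
    proof -
      have "(\<Sum>k\<in>{i,j}. cmod (Q k x)) \<le> \<gamma> x" unfolding \<gamma>_def using that by (intro sum_mono2) auto
      then show ?thesis using that(3) by simp
    qed
    have one: "cmod (Q i x) \<le> \<gamma> x" if "i \<in> {1..8}" for i x
      unfolding \<gamma>_def by (rule member_le_sum) (use that in auto)
    have ode: "bresse_ode0 \<beta> l (k1/k2) (slow * lam) (\<lambda>i. U (2*i-1)) (\<lambda>i x. of_real slow * U (2*i) x) (\<lambda>i. g (2*i-1)) (gg ?F) (hh ?F U) \<gamma>"
    proof
      show "0 < \<beta>" "0 < l" "0 < k1/k2" "0 \<le> (0::real)" using par by auto
      show "0 \<le> \<gamma> x" for x by (simp add: \<gamma>_def sum_nonneg)
      show "set_integrable lborel {0..\<beta>} \<gamma>" "set_integrable lborel {0..\<beta>} (\<lambda>x. (\<gamma> x)\<^sup>2)"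
        unfolding \<gamma>_def using sums by auto
      fix i :: nat assume i: "i \<in> {1,2,3}"
      then have i6: "2*i-1 \<in> {1..8}" "2*i-1 \<le> 6" "2*i \<in> {1..8}" "2*i \<le> 6" by auto
      have b: "\<beta> \<le> L" using par by simp
      note ode = rep_ode(1)[OF r i] rep_ode(2)[OF r i, of lam] rep_ode(3)[OF r i, of lam] rep_ode(4,5)[OF r i]
      show "AC \<beta> (U (2*i-1)) (g (2*i-1))"
        "AC \<beta> (\<lambda>x. of_real slow * U (2*i) x) (\<lambda>x. \<i> * of_real (slow * lam) * g (2*i-1) x + gg ?F i x)"
        "AC \<beta> (g (2*i-1)) (\<lambda>x. \<i> * of_real (slow * lam) * (of_real slow * U (2*i) x) + (lower_order l (k1/k2) (\<lambda>i. U (2*i-1)) (\<lambda>i. g (2*i-1)) i x + hh ?F U i x))"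
        "U (2*i-1) 0 = 0" "of_real slow * U (2*i) 0 = 0"
        using ode(1-3)[THEN AC_subset, OF b] ode(4,5) by blast+
      show "cmod (gg ?F i x) \<le> \<gamma> x" for x using gg_le[OF i, of ?F x] one[OF i6(1), of x] i6(2) by (simp add: Q_def)
      show "cmod (hh ?F U i x) \<le> 0 * cmod (of_real slow * U (2*i) x) + \<gamma> x" for x
      proof (cases "i = 3")
        case True
        have "a0 / k1 * cmod (U 6 x) \<le> c * cmod (U 6 x)" using c by (intro mult_right_mono) auto
        then show ?thesis using hh_le[OF i, of ?F U x] two[of 6 7 x] True c(1) by (simp add: Q_def norm_mult)
      next
        case False
        then show ?thesis using hh_le[OF i, of ?F U x] one[OF i6(3), of x] i6(4) by (simp add: Q_def)
      qed
    qed
    have Y3: "\<forall>x\<in>{0..\<beta>}. cmod (of_real slow * U (2*3) x) \<le> \<gamma> x"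
    proof
      fix x
      have "slow * cmod (U 6 x) \<le> c * cmod (U 6 x)" using c by (intro mult_right_mono) auto
      then show "cmod (of_real slow * U (2*3) x) \<le> \<gamma> x" using one[of 7 x] c slow(1) by (simp add: Q_def norm_mult)
    qed
    have u3: "\<forall>x\<in>{0..\<beta>}. cmod (U (2*3-1) x) \<le> \<gamma> x"
    proof
      fix x
      have "\<i> * of_real lam * U 5 x = ?F 5 x + U 6 x" by (simp add: res_eq A_components)
      then have "\<bar>lam\<bar> * cmod (U 5 x) = cmod (?F 5 x + U 6 x)" by (metis norm_mult norm_ii norm_of_real mult_1)
      then have "lam1 * cmod (U 5 x) \<le> cmod (?F 5 x) + cmod (U 6 x)"
        using norm_triangle_ineq[of "?F 5 x" "U 6 x"] mult_right_mono[OF lam, of "cmod (U 5 x)"] by simp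
      then have "cmod (U 5 x) \<le> 1 / lam1 * (cmod (?F 5 x) + cmod (U 6 x))" using l1 by (simp add: field_simps)
      also have "\<dots> \<le> c * (cmod (?F 5 x) + cmod (U 6 x))" using c by (intro mult_right_mono) auto
      also have "\<dots> \<le> \<gamma> x" using two[of 7 8 x] c by (simp add: Q_def norm_mult algebra_simps)
      finally show "cmod (U (2*3-1) x) \<le> \<gamma> x" by simp
    qed
    interpret o: bresse_ode0 \<beta> l "k1/k2" "slow * lam" "\<lambda>i. U (2*i-1)" "\<lambda>i x. of_real slow * U (2*i) x" "\<lambda>i. g (2*i-1)" "gg ?F" "hh ?F U" \<gamma>
      by (rule ode)
    have "o.pn \<le> (Ch + Cl) * o.\<delta>"
    proof (cases "\<Lambda> \<le> \<bar>slow * lam\<bar>")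
      case True
      have "o.pn \<le> Ch * o.\<delta>" by (rule high[OF ode True Y3])
      also have "\<dots> \<le> (Ch + Cl) * o.\<delta>" using Cl o.\<delta>_nonneg by (intro mult_right_mono) auto
      finally show ?thesis .
    next
      case False
      then have "\<bar>slow * lam\<bar> \<le> \<Lambda>" by simp
      then have "o.pn \<le> Cl * o.\<delta>" by (rule low[OF ode _ u3])
      also have "\<dots> \<le> (Ch + Cl) * o.\<delta>" using Ch o.\<delta>_nonneg by (intro mult_right_mono) auto
      finally show ?thesis .
    qed
    moreover have "o.pn = slope g" unfolding o.pn_def slope_def by simp
    ultimately have "(slope g)\<^sup>2 \<le> ((Ch + Cl) * o.\<delta>)\<^sup>2" using o.pn_nonneg by (intro power_mono) auto
    also have "\<dots> = (Ch + Cl)\<^sup>2 * o.\<delta>\<^sup>2" by (simp add: power_mult_distrib)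
    also have "o.\<delta>\<^sup>2 \<le> Cd * ((N ?F)\<^sup>2 + I6 U)"
    proof -
      have "o.\<delta>\<^sup>2 \<le> 8 * (\<Sum>i\<in>{1..8}. LINT x:{0..\<beta>}|lborel. (cmod (Q i x))\<^sup>2)"
        unfolding o.\<delta>_square \<gamma>_def using sums(3) by simp
      also have "(\<Sum>i\<in>{1..8}. LINT x:{0..\<beta>}|lborel. (cmod (Q i x))\<^sup>2) = (\<Sum>i\<in>{1..6}. LINT x:{0..\<beta>}|lborel. (cmod (Q i x))\<^sup>2)
         + (LINT x:{0..\<beta>}|lborel. (cmod (Q 7 x))\<^sup>2) + (LINT x:{0..\<beta>}|lborel. (cmod (Q 8 x))\<^sup>2)"
      proof -
        have "{1..8::nat} = insert 7 (insert 8 {1..6})" by auto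
        then show ?thesis by simp
      qed
      also have "\<dots> \<le> CQ * (N ?F)\<^sup>2 + c\<^sup>2 * I6 U + c\<^sup>2 * (\<beta> * (CQ * (N ?F)\<^sup>2))"
      proof (intro add_mono)
        have "(\<Sum>i\<in>{1..6}. LINT x:{0..\<beta>}|lborel. (cmod (Q i x))\<^sup>2) \<le> (\<Sum>i\<in>{1..6}. LINT x:{0..L}|lborel. (cmod (QF ?F i x))\<^sup>2)"
        proof (rule sum_mono)
          fix i :: nat assume i: "i \<in> {1..6}"
          then have "Q i = QF ?F i" by (simp add: Q_def)
          then show "(LINT x:{0..\<beta>}|lborel. (cmod (Q i x))\<^sup>2) \<le> (LINT x:{0..L}|lborel. (cmod (QF ?F i x))\<^sup>2)"
            using L2_square[OF QF_L2[OF F i]] par by (simp add: set_integral_subset_le)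
        qed
        then show "(\<Sum>i\<in>{1..6}. LINT x:{0..\<beta>}|lborel. (cmod (Q i x))\<^sup>2) \<le> CQ * (N ?F)\<^sup>2" using CQ(2)[OF F] by linarith
        have "(LINT x:{0..\<beta>}|lborel. (cmod (Q 7 x))\<^sup>2) = c\<^sup>2 * I6 U"
          unfolding I6_def by (simp add: Q_def norm_mult power_mult_distrib)
        then show "(LINT x:{0..\<beta>}|lborel. (cmod (Q 7 x))\<^sup>2) \<le> c\<^sup>2 * I6 U" by simp
        have "(LINT x:{0..\<beta>}|lborel. (cmod (Q 8 x))\<^sup>2) \<le> (LINT x:{0..\<beta>}|lborel. c\<^sup>2 * (CQ * (N ?F)\<^sup>2))"
        proof (rule set_integral_mono[OF Qi(2) set_integrable_one])
          fix x assume "x \<in> {0..\<beta>}"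
          then have "(cmod (?F 5 x))\<^sup>2 \<le> CQ * (N ?F)\<^sup>2" using CQ(3)[OF F, of x] par by auto
          then show "(cmod (Q 8 x))\<^sup>2 \<le> c\<^sup>2 * (CQ * (N ?F)\<^sup>2)" by (simp add: Q_def norm_mult power_mult_distrib mult_left_mono)
        qed auto
        also have "\<dots> = c\<^sup>2 * (\<beta> * (CQ * (N ?F)\<^sup>2))" using par by (simp add: set_integral_const)
        finally show "(LINT x:{0..\<beta>}|lborel. (cmod (Q 8 x))\<^sup>2) \<le> c\<^sup>2 * (\<beta> * (CQ * (N ?F)\<^sup>2))" .
      qed
      also have "8 * (CQ * (N ?F)\<^sup>2 + c\<^sup>2 * I6 U + c\<^sup>2 * (\<beta> * (CQ * (N ?F)\<^sup>2))) \<le> Cd * ((N ?F)\<^sup>2 + I6 U)"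
      proof -
        have "0 \<le> I6 U" unfolding I6_def set_lebesgue_integral_def by (intro Bochner_Integration.integral_nonneg) auto
        then have "0 \<le> (CQ + c\<^sup>2 * (\<beta> * CQ)) * I6 U" "0 \<le> c\<^sup>2 * (N ?F)\<^sup>2" using CQ(1) par by auto
        moreover have "Cd * ((N ?F)\<^sup>2 + I6 U) = 8 * (CQ * (N ?F)\<^sup>2 + c\<^sup>2 * I6 U + c\<^sup>2 * (\<beta> * (CQ * (N ?F)\<^sup>2)))
            + 8 * ((CQ + c\<^sup>2 * (\<beta> * CQ)) * I6 U) + 8 * (c\<^sup>2 * (N ?F)\<^sup>2)"
          by (simp add: Cd_def algebra_simps)
        ultimately show ?thesis by linarith
      qed
      finally show ?thesis by simp
    qed
    finally show ?thesis using Ch Cl by (simp add: C_def mult.assoc)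
  qed
  then show ?thesis using C by blast
qed

text \<open>Near \<open>lam = 0\<close> the displacement cannot be obtained from the velocity by
  division, but the velocity is then a small multiple of the displacement plus data. Testing with
  the displacements bounds the elastic energy, and the velocities follow from the equations.\<close>

lemma resolvent_small:
  "\<exists>lam1 C. 0 < lam1 \<and> 0 < C \<and> (\<forall>lam U. domA L U \<longrightarrow> \<bar>lam\<bar> \<le> lam1 \<longrightarrow> (N U)\<^sup>2 \<le> C * (N (res lam U))\<^sup>2)"
proof -
  obtain Cc where Cc: "0 < Cc" and co: "\<And>U i x. inH L U \<Longrightarrow> i \<in> {1,3,5} \<Longrightarrow> x \<in> {0..L} \<Longrightarrow> (cmod (U i x))\<^sup>2 \<le> Cc * Strain U" using coercivity by blast
  define R where "R = \<rho>1 + \<rho>2 + a0"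
  \<comment> \<open>Chosen so that \<open>8 * R * \<tau> * Cc * L\<close> equals 1/2; this share of
    the elastic energy is absorbed on the left.\<close>
  define \<tau> where "\<tau> = 1 / (16 * R * L * Cc)"
  \<comment> \<open>Both bounds are used together: \<open>lam\<^sup>2 \<le> \<tau>\<close> follows
    from \<open>\<bar>lam\<bar> \<le> 1\<close> and
    \<open>\<bar>lam\<bar> \<le> \<tau>\<close>.\<close>
  define lam1 where "lam1 = min 1 \<tau>"
  define C1 where "C1 = R * (3 + 1 / (4 * \<tau>)) * Cc * L + R / (4 * \<tau>) * (2 / \<rho>1 + 1 / \<rho>2)"
  define C2 where "C2 = 2 * C1 + 6 * R * L * Cc * (2 * C1 + 1)"
  have R: "0 < R" "\<rho>1 \<le> R" "\<rho>2 \<le> R" "a0 \<le> R" using par by (auto simp: R_def)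
  have \<tau>: "0 < \<tau>" using R par Cc by (simp add: \<tau>_def)
  have lam1: "0 < lam1" "lam1 \<le> 1" "lam1 \<le> \<tau>" using \<tau> by (auto simp: lam1_def)
  have C1: "0 < C1"
  proof -
    have "0 < 3 + 1 / (4 * \<tau>)" using \<tau> by (simp add: add_pos_pos)
    then have "0 < R * (3 + 1 / (4 * \<tau>)) * Cc * L" using R Cc par by simp
    moreover have "0 \<le> R / (4 * \<tau>) * (2 / \<rho>1 + 1 / \<rho>2)" using R \<tau> par by simp
    ultimately show ?thesis unfolding C1_def by linarith
  qed
  have C2: "0 < C2" using R C1 par Cc by (auto simp: C2_def intro!: add_pos_nonneg)
  have "(N U)\<^sup>2 \<le> C2 * (N (res lam U))\<^sup>2" if U: "domA L U" and lam: "\<bar>lam\<bar> \<le> lam1" for lam U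
  proof -
    let ?F = "res lam U"
    have UH: "inH L U" and F: "inH L ?F" and AU: "inH L (A U)" using domA_inH[OF U] res_inH[OF U] inH_A[OF U] by auto
    have UL: "L2 L (U i)" "L2 L (?F i)" "L2 L (A U i)" if "i \<in> {1..6}" for i using inH_L2 UH F AU that by auto
    have l1: "\<bar>lam\<bar> \<le> 1" "\<bar>lam\<bar> \<le> \<tau>" using lam lam1 by linarith+
    let ?SU = "Cc * Strain U" and ?SF = "Cc * Strain ?F"
    have fe: "set_integrable lborel {0..L} (\<lambda>x. (cmod (?F i x))\<^sup>2)" if "i \<in> {1..6}" for i using L2_square UL that by blast
    define wi where "wi x = Re (of_real \<rho>1 * (A U 2 x * cnj (U 1 x)) + of_real \<rho>2 * (A U 4 x * cnj (U 3 x)) + of_real \<rho>1 * (A U 6 x * cnj (U 5 x)))" for x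
    have iwi: "set_integrable lborel {0..L} wi"
      unfolding wi_def[abs_def] by (intro set_integral_Re set_integral_add(1) set_integrable_mult_right impI L2_mult_integrable L2_cnj UL) auto
    note idamp = weak_identity(2)[OF U]
    have prod: "p * q \<le> t * q\<^sup>2 + 1 / (4*t) * p\<^sup>2" if "0 < t" for p q t :: real
    proof -
      have "0 \<le> (2 * t * q - p)\<^sup>2" by simp
      then have "4 * t * (p * q) \<le> 4 * t * (t * q\<^sup>2) + p\<^sup>2" by (simp add: power2_eq_square algebra_simps)
      then show ?thesis using that by (simp add: field_simps)
    qed
    \<comment> \<open>With \<open>y = i \<lambda> u - f\<close> every velocity term is small or controlled by the data.\<close>
    have pair: "- Re (A U (j+1) x * cnj (U j x)) \<le> 3 * \<tau> * ?SU + (?SF + 1 / (4 * \<tau>) * (cmod (?F (j+1) x))\<^sup>2)"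
      if j: "j \<in> {1,3,5}" and x: "x \<in> {0..L}" for j x
    proof -
      have j6: "A U j = U (j+1)" using j by (auto simp: A_components simp del: One_nat_def)
      have y: "U (j+1) x = \<i> * of_real lam * U j x - ?F j x" using j6 by (simp add: res_eq)
      have a: "A U (j+1) x = \<i> * of_real lam * U (j+1) x - ?F (j+1) x" by (simp add: res_eq)
      have u: "(cmod (U j x))\<^sup>2 \<le> ?SU" "(cmod (?F j x))\<^sup>2 \<le> ?SF" using co[OF UH j x] co[OF F j x] by auto
      have "- Re (A U (j+1) x * cnj (U j x)) = lam\<^sup>2 * (cmod (U j x))\<^sup>2 + lam * Re (\<i> * ?F j x * cnj (U j x)) + Re (?F (j+1) x * cnj (U j x))"
        unfolding a y cmod_power2 by (simp add: power2_eq_square algebra_simps)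
      also have "\<dots> \<le> \<tau> * ?SU + (\<tau> * ?SU + ?SF) + (\<tau> * ?SU + 1 / (4 * \<tau>) * (cmod (?F (j+1) x))\<^sup>2)"
      proof (intro add_mono)
        have "lam\<^sup>2 \<le> \<tau>" using mult_mono[OF l1(2) l1(1)] \<tau> by (simp add: power2_eq_square)
        then show "lam\<^sup>2 * (cmod (U j x))\<^sup>2 \<le> \<tau> * ?SU" using u \<tau> by (intro mult_mono) auto
        have "lam * Re (\<i> * ?F j x * cnj (U j x)) \<le> \<bar>lam\<bar> * cmod (\<i> * ?F j x * cnj (U j x))"
        proof -
          have "lam * r \<le> \<bar>lam\<bar> * c" if "\<bar>r\<bar> \<le> c" for r c :: real
            using mult_left_mono[OF that abs_ge_zero[of lam]] abs_ge_self[of "lam * r"] by (simp add: abs_mult)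
          from this[OF abs_Re_le_cmod] show ?thesis .
        qed
        also have "\<dots> = \<bar>lam\<bar> * (cmod (?F j x) * cmod (U j x))" by (simp add: norm_mult)
        also have "\<dots> \<le> \<bar>lam\<bar> * (1 * (cmod (U j x))\<^sup>2 + 1 / (4*1) * (cmod (?F j x))\<^sup>2)" by (intro mult_left_mono prod) auto
        also have "\<dots> \<le> \<bar>lam\<bar> * (?SU + ?SF)"
        proof (rule mult_left_mono)
          show "1 * (cmod (U j x))\<^sup>2 + 1 / (4*1) * (cmod (?F j x))\<^sup>2 \<le> ?SU + ?SF"
            using u zero_le_power2[of "cmod (?F j x)"] by linarith
        qed simp
        also have "\<dots> \<le> \<tau> * ?SU + 1 * ?SF"
          using l1 Cc Strain_nonneg[of U] Strain_nonneg[of ?F] unfolding distrib_left by (intro add_mono mult_right_mono) auto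
        finally show "lam * Re (\<i> * ?F j x * cnj (U j x)) \<le> \<tau> * ?SU + ?SF" by simp
        have "Re (?F (j+1) x * cnj (U j x)) \<le> cmod (?F (j+1) x) * cmod (U j x)"
          using complex_Re_le_cmod[of "?F (j+1) x * cnj (U j x)"] by (simp add: norm_mult)
        also have "\<dots> \<le> \<tau> * (cmod (U j x))\<^sup>2 + 1 / (4 * \<tau>) * (cmod (?F (j+1) x))\<^sup>2" by (rule prod[OF \<tau>])
        also have "\<dots> \<le> \<tau> * ?SU + 1 / (4 * \<tau>) * (cmod (?F (j+1) x))\<^sup>2" using u \<tau> by (intro add_mono mult_left_mono) auto
        finally show "Re (?F (j+1) x * cnj (U j x)) \<le> \<tau> * ?SU + 1 / (4 * \<tau>) * (cmod (?F (j+1) x))\<^sup>2" .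
      qed
      finally show ?thesis by (simp add: algebra_simps)
    qed
    have dmp: "- (damp a0 \<beta> x * Re (U 6 x * cnj (U 5 x))) \<le> a0 * (\<tau> * ?SU + 1 / (4 * \<tau>) * ?SF)" if x: "x \<in> {0..L}" for x
    proof -
      have y: "U 6 x = \<i> * of_real lam * U 5 x - ?F 5 x" by (simp add: res_eq A_components)
      have u: "(cmod (U 5 x))\<^sup>2 \<le> ?SU" "(cmod (?F 5 x))\<^sup>2 \<le> ?SF" using co[OF UH _ x] co[OF F _ x] by auto
      have "- Re (U 6 x * cnj (U 5 x)) = Re (?F 5 x * cnj (U 5 x))" unfolding y by (simp add: algebra_simps)
      also have "\<dots> \<le> cmod (?F 5 x) * cmod (U 5 x)"
        using complex_Re_le_cmod[of "?F 5 x * cnj (U 5 x)"] by (simp add: norm_mult)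
      also have "\<dots> \<le> \<tau> * (cmod (U 5 x))\<^sup>2 + 1 / (4 * \<tau>) * (cmod (?F 5 x))\<^sup>2" by (rule prod[OF \<tau>])
      also have "\<dots> \<le> \<tau> * ?SU + 1 / (4 * \<tau>) * ?SF" using u \<tau> by (intro add_mono mult_left_mono) auto
      finally have 1: "- Re (U 6 x * cnj (U 5 x)) \<le> \<tau> * ?SU + 1 / (4 * \<tau>) * ?SF" .
      have 2: "0 \<le> \<tau> * ?SU + 1 / (4 * \<tau>) * ?SF" using \<tau> Cc Strain_nonneg[of U] Strain_nonneg[of ?F] by simp
      have "damp a0 \<beta> x * (- Re (U 6 x * cnj (U 5 x))) \<le> damp a0 \<beta> x * (\<tau> * ?SU + 1 / (4 * \<tau>) * ?SF)"
        using par by (intro mult_left_mono[OF 1]) (auto simp: damp_def)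
      also have "\<dots> \<le> a0 * (\<tau> * ?SU + 1 / (4 * \<tau>) * ?SF)" using 2 par by (intro mult_right_mono) (auto simp: damp_def)
      finally show ?thesis by (simp only: mult_minus_right)
    qed
    have "Strain U = - (LINT x:{0..L}|lborel. wi x) - (LINT x:{0..L}|lborel. damp a0 \<beta> x * Re (U 6 x * cnj (U 5 x)))"
      unfolding wi_def using weak_identity(1)[OF U] by linarith
    also have "\<dots> = (LINT x:{0..L}|lborel. (-1) * wi x + (-1) * (damp a0 \<beta> x * Re (U 6 x * cnj (U 5 x))))"
    proof -
      have a: "set_integrable lborel {0..L} (\<lambda>x. (-1) * wi x)" "set_integrable lborel {0..L} (\<lambda>x. (-1) * (damp a0 \<beta> x * Re (U 6 x * cnj (U 5 x))))"
        by (rule set_integrable_mult_right, rule iwi) (rule set_integrable_mult_right, rule idamp)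
      show ?thesis unfolding set_integral_add(2)[OF a] set_integral_mult_right by simp
    qed
    also have "\<dots> \<le> (LINT x:{0..L}|lborel. (8 * R * \<tau> * ?SU + R * (3 + 1 / (4 * \<tau>)) * ?SF)
       + R / (4 * \<tau>) * ((cmod (?F 2 x))\<^sup>2 + (cmod (?F 4 x))\<^sup>2 + (cmod (?F 6 x))\<^sup>2))"
    proof (rule set_integral_mono)
      show "set_integrable lborel {0..L} (\<lambda>x. (-1) * wi x + (-1) * (damp a0 \<beta> x * Re (U 6 x * cnj (U 5 x))))"
        using iwi idamp by (intro set_integral_add(1) set_integrable_mult_right impI)
      show "set_integrable lborel {0..L} (\<lambda>x. (8 * R * \<tau> * ?SU + R * (3 + 1 / (4 * \<tau>)) * ?SF)
       + R / (4 * \<tau>) * ((cmod (?F 2 x))\<^sup>2 + (cmod (?F 4 x))\<^sup>2 + (cmod (?F 6 x))\<^sup>2))"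
        by (intro set_integral_add(1) set_integrable_mult_right impI set_integrable_one fe) auto
      fix x assume x: "x \<in> {0..L}"
      define G where "G j = 1 / (4 * \<tau>) * (cmod (?F j x))\<^sup>2" for j
      define P where "P = 3 * \<tau> * ?SU + ?SF"
      have P: "0 \<le> P" using \<tau> Cc Strain_nonneg[of U] Strain_nonneg[of ?F] by (simp add: P_def)
      have G: "0 \<le> G j" for j using \<tau> by (simp add: G_def)
      have pr: "- Re (A U 2 x * cnj (U 1 x)) \<le> P + G 2" "- Re (A U 4 x * cnj (U 3 x)) \<le> P + G 4" "- Re (A U 6 x * cnj (U 5 x)) \<le> P + G 6"
        using pair[of 1 x] pair[of 3 x] pair[of 5 x] x by (simp_all add: P_def G_def del: One_nat_def)
      have "(-1) * wi x = \<rho>1 * (- Re (A U 2 x * cnj (U 1 x))) + \<rho>2 * (- Re (A U 4 x * cnj (U 3 x))) + \<rho>1 * (- Re (A U 6 x * cnj (U 5 x)))"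
        unfolding wi_def by (simp add: algebra_simps)
      also have "\<dots> \<le> \<rho>1 * (P + G 2) + \<rho>2 * (P + G 4) + \<rho>1 * (P + G 6)"
        using par by (intro add_mono mult_left_mono pr) auto
      also have "\<dots> = (2 * \<rho>1 + \<rho>2) * P + \<rho>1 * G 2 + \<rho>2 * G 4 + \<rho>1 * G 6" by (simp add: algebra_simps)
      also have "\<dots> \<le> (2 * \<rho>1 + \<rho>2) * P + R * G 2 + R * G 4 + R * G 6"
        using R G P par by (intro add_mono mult_right_mono) auto
      finally have 1: "(-1) * wi x \<le> (2 * \<rho>1 + \<rho>2) * P + R * (G 2 + G 4 + G 6)" by (simp add: algebra_simps)
      have 2: "(-1) * (damp a0 \<beta> x * Re (U 6 x * cnj (U 5 x))) \<le> a0 * (\<tau> * ?SU + 1 / (4 * \<tau>) * ?SF)" using dmp[OF x] by simp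
      have SU: "0 \<le> \<tau> * ?SU" "0 \<le> ?SF" "0 \<le> 1 / (4 * \<tau>) * ?SF" using \<tau> Cc Strain_nonneg[of U] Strain_nonneg[of ?F] by simp_all
      have 3: "(2 * \<rho>1 + \<rho>2) * P + a0 * (\<tau> * ?SU + 1 / (4 * \<tau>) * ?SF) \<le> 8 * R * (\<tau> * ?SU) + (3 * R * ?SF + R * (1 / (4 * \<tau>) * ?SF))"
      proof -
        have "(2 * \<rho>1 + \<rho>2) * P + a0 * (\<tau> * ?SU + 1 / (4 * \<tau>) * ?SF) = (6 * \<rho>1 + 3 * \<rho>2 + a0) * (\<tau> * ?SU) + ((2 * \<rho>1 + \<rho>2) * ?SF + a0 * (1 / (4 * \<tau>) * ?SF))"
          by (simp add: P_def algebra_simps)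
        also have "\<dots> \<le> 8 * R * (\<tau> * ?SU) + (3 * R * ?SF + R * (1 / (4 * \<tau>) * ?SF))"
          using par SU by (intro add_mono mult_right_mono) (auto simp: R_def)
        finally show ?thesis .
      qed
      have "8 * R * (\<tau> * ?SU) + (3 * R * ?SF + R * (1 / (4 * \<tau>) * ?SF)) + R * (G 2 + G 4 + G 6)
         = (8 * R * \<tau> * ?SU + R * (3 + 1 / (4 * \<tau>)) * ?SF) + R / (4 * \<tau>) * ((cmod (?F 2 x))\<^sup>2 + (cmod (?F 4 x))\<^sup>2 + (cmod (?F 6 x))\<^sup>2)"
        by (simp add: G_def algebra_simps add_divide_distrib)
      then show "(-1) * wi x + (-1) * (damp a0 \<beta> x * Re (U 6 x * cnj (U 5 x))) \<le> (8 * R * \<tau> * ?SU + R * (3 + 1 / (4 * \<tau>)) * ?SF)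
       + R / (4 * \<tau>) * ((cmod (?F 2 x))\<^sup>2 + (cmod (?F 4 x))\<^sup>2 + (cmod (?F 6 x))\<^sup>2)" using 1 2 3 by linarith
    qed
    also have "\<dots> = (8 * R * \<tau> * ?SU + R * (3 + 1 / (4 * \<tau>)) * ?SF) * L + R / (4 * \<tau>) * ((LINT x:{0..L}|lborel. (cmod (?F 2 x))\<^sup>2) + (LINT x:{0..L}|lborel. (cmod (?F 4 x))\<^sup>2) + (LINT x:{0..L}|lborel. (cmod (?F 6 x))\<^sup>2))"
    proof -
      have c: "(LINT x:{0..L}|lborel. q) = q * L" for q :: real using par by (simp add: set_integral_const)
      have i: "set_integrable lborel {0..L} (\<lambda>x. (cmod (?F 2 x))\<^sup>2 + (cmod (?F 4 x))\<^sup>2 + (cmod (?F 6 x))\<^sup>2)" "set_integrable lborel {0..L} (\<lambda>x. (cmod (?F 2 x))\<^sup>2 + (cmod (?F 4 x))\<^sup>2)"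
        by (intro set_integral_add(1) fe; simp)+
      show ?thesis
        by (subst set_integral_add(2)[OF set_integrable_one set_integrable_mult_right[OF i(1)]])
          (simp only: c set_integral_mult_right set_integral_add(2)[OF i(2) fe] set_integral_add(2)[OF fe fe], simp add: set_integral_add(2)[OF i(2) fe] set_integral_add(2)[OF fe fe])
    qed
    finally have S1: "Strain U \<le> (8 * R * \<tau> * ?SU + R * (3 + 1 / (4 * \<tau>)) * ?SF) * L + R / (4 * \<tau>) * ((LINT x:{0..L}|lborel. (cmod (?F 2 x))\<^sup>2) + (LINT x:{0..L}|lborel. (cmod (?F 4 x))\<^sup>2) + (LINT x:{0..L}|lborel. (cmod (?F 6 x))\<^sup>2))" .
    have S2: "Strain U \<le> 1/2 * Strain U + C1 * (N ?F)\<^sup>2"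
    proof -
      have h: "8 * R * \<tau> * ?SU * L = 1/2 * Strain U" using R par Cc by (simp add: \<tau>_def field_simps)
      have n: "(LINT x:{0..L}|lborel. (cmod (?F 2 x))\<^sup>2) + (LINT x:{0..L}|lborel. (cmod (?F 4 x))\<^sup>2) + (LINT x:{0..L}|lborel. (cmod (?F 6 x))\<^sup>2)
         \<le> (2 / \<rho>1 + 1 / \<rho>2) * (N ?F)\<^sup>2"
      proof -
        have "(2 / \<rho>1 + 1 / \<rho>2) * (N ?F)\<^sup>2 = (N ?F)\<^sup>2 / \<rho>1 + (N ?F)\<^sup>2 / \<rho>2 + (N ?F)\<^sup>2 / \<rho>1" by (simp add: algebra_simps)
        then show ?thesis using velocity_le[OF F] by linarith
      qed
      have "Strain U \<le> 8 * R * \<tau> * ?SU * L + R * (3 + 1 / (4 * \<tau>)) * L * ?SF + R / (4 * \<tau>) * ((LINT x:{0..L}|lborel. (cmod (?F 2 x))\<^sup>2) + (LINT x:{0..L}|lborel. (cmod (?F 4 x))\<^sup>2) + (LINT x:{0..L}|lborel. (cmod (?F 6 x))\<^sup>2))"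
        using S1 by (simp add: algebra_simps)
      also have "\<dots> \<le> 1/2 * Strain U + R * (3 + 1 / (4 * \<tau>)) * L * (Cc * (N ?F)\<^sup>2) + R / (4 * \<tau>) * ((2 / \<rho>1 + 1 / \<rho>2) * (N ?F)\<^sup>2)"
        unfolding h using R \<tau> par Cc Strain_le_N[OF F] by (intro add_mono mult_left_mono n order_refl) auto
      also have "\<dots> = 1/2 * Strain U + C1 * (N ?F)\<^sup>2" by (simp add: C1_def algebra_simps)
      finally show ?thesis .
    qed
    then have S3: "Strain U \<le> 2 * C1 * (N ?F)\<^sup>2" by linarith
    have vel: "(cmod (U (j+1) x))\<^sup>2 \<le> 2 * Cc * (2 * C1 + 1) * (N ?F)\<^sup>2" if j: "j \<in> {1,3,5}" and x: "x \<in> {0..L}" for j x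
    proof -
      have j6: "A U j = U (j+1)" using j by (auto simp: A_components simp del: One_nat_def)
      have y: "U (j+1) x = \<i> * of_real lam * U j x - ?F j x" using j6 by (simp add: res_eq)
      have "cmod (U (j+1) x) \<le> \<bar>lam\<bar> * cmod (U j x) + cmod (?F j x)"
        unfolding y using norm_triangle_ineq4[of "\<i> * of_real lam * U j x" "?F j x"] by (simp add: norm_mult)
      also have "\<dots> \<le> 1 * cmod (U j x) + cmod (?F j x)" using l1 by (intro add_mono mult_right_mono) auto
      finally have "(cmod (U (j+1) x))\<^sup>2 \<le> (cmod (U j x) + cmod (?F j x))\<^sup>2" by (intro power_mono) auto
      also have "\<dots> \<le> 2 * (cmod (U j x))\<^sup>2 + 2 * (cmod (?F j x))\<^sup>2"
        using sum_squares_bound[of "cmod (U j x)" "cmod (?F j x)"] by (simp add: power2_sum)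
      also have "\<dots> \<le> 2 * (Cc * (2 * C1 * (N ?F)\<^sup>2)) + 2 * (Cc * (N ?F)\<^sup>2)"
      proof (intro add_mono mult_left_mono)
        have "Cc * Strain U \<le> Cc * (2 * C1 * (N ?F)\<^sup>2)" using S3 Cc by (intro mult_left_mono) auto
        then show "(cmod (U j x))\<^sup>2 \<le> Cc * (2 * C1 * (N ?F)\<^sup>2)" using co[OF UH j x] by linarith
        have "Cc * Strain ?F \<le> Cc * (N ?F)\<^sup>2" using Strain_le_N[OF F] Cc by (intro mult_left_mono) auto
        then show "(cmod (?F j x))\<^sup>2 \<le> Cc * (N ?F)\<^sup>2" using co[OF F j x] by linarith
      qed auto
      finally show ?thesis by (simp add: algebra_simps)
    qed
    let ?V = "2 * Cc * (2 * C1 + 1) * (N ?F)\<^sup>2"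
    have V: "0 \<le> ?V" using Cc C1 by simp
    have "(N U)\<^sup>2 = Strain U + (LINT x:{0..L}|lborel. \<rho>1 * (cmod (U 2 x))\<^sup>2 + \<rho>2 * (cmod (U 4 x))\<^sup>2 + \<rho>1 * (cmod (U 6 x))\<^sup>2)" by (rule N_square[OF UH])
    moreover have "(LINT x:{0..L}|lborel. \<rho>1 * (cmod (U 2 x))\<^sup>2 + \<rho>2 * (cmod (U 4 x))\<^sup>2 + \<rho>1 * (cmod (U 6 x))\<^sup>2) \<le> (LINT x:{0..L}|lborel. 3 * R * ?V)"
    proof (rule set_integral_mono[OF _ set_integrable_one])
      show "set_integrable lborel {0..L} (\<lambda>x. \<rho>1 * (cmod (U 2 x))\<^sup>2 + \<rho>2 * (cmod (U 4 x))\<^sup>2 + \<rho>1 * (cmod (U 6 x))\<^sup>2)"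
        using inH_L2[OF UH] by (intro set_integral_add(1) set_integrable_mult_right impI L2_square) auto
      fix x assume x: "x \<in> {0..L}"
      have v: "(cmod (U 2 x))\<^sup>2 \<le> ?V" "(cmod (U 4 x))\<^sup>2 \<le> ?V" "(cmod (U 6 x))\<^sup>2 \<le> ?V"
        using vel[of 1 x] vel[of 3 x] vel[of 5 x] x by (simp_all add: numeral_2_eq_2)
      have "\<rho>1 * (cmod (U 2 x))\<^sup>2 + \<rho>2 * (cmod (U 4 x))\<^sup>2 + \<rho>1 * (cmod (U 6 x))\<^sup>2 \<le> R * ?V + R * ?V + R * ?V"
        using R by (intro add_mono mult_mono v) auto
      then show "\<rho>1 * (cmod (U 2 x))\<^sup>2 + \<rho>2 * (cmod (U 4 x))\<^sup>2 + \<rho>1 * (cmod (U 6 x))\<^sup>2 \<le> 3 * R * ?V" by (simp add: mult_ac)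
    qed
    moreover have "(LINT x:{0..L}|lborel. 3 * R * ?V) = 3 * R * ?V * L"
    proof -
      have "(LINT x:{0..L}|lborel. q) = q * L" for q :: real using par by (simp add: set_integral_const)
      then show ?thesis .
    qed
    ultimately have "(N U)\<^sup>2 \<le> 2 * C1 * (N ?F)\<^sup>2 + 3 * R * ?V * L" using S3 by linarith
    then show ?thesis by (simp add: C2_def algebra_simps)
  qed
  then show ?thesis using lam1(1) C2 by blast
qed

text \<open>Away from small frequencies the state is bounded by the slopes, the slopes by the
  observed velocity, and the latter by dissipation, which returns an arbitrarily small multiple of
  the state.\<close>

theorem resolvent_bound: "\<exists>M>0. \<forall>lam U. domA L U \<longrightarrow> N U \<le> M * N (res lam U)"
proof -
  obtain lam1 Cs where s: "0 < lam1" "0 < Cs" "\<And>lam U. domA L U \<Longrightarrow> \<bar>lam\<bar> \<le> lam1 \<Longrightarrow> (N U)\<^sup>2 \<le> Cs * (N (res lam U))\<^sup>2"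
    using resolvent_small by blast
  obtain Co where o: "0 < Co" "\<And>lam U g. rep U g \<Longrightarrow> lam1 \<le> \<bar>lam\<bar> \<Longrightarrow> (slope g)\<^sup>2 \<le> Co * ((N (res lam U))\<^sup>2 + I6 U)"
    using observability[OF s(1)] by blast
  obtain Cu where u: "0 < Cu" "\<And>lam U g. rep U g \<Longrightarrow> (N U)\<^sup>2 \<le> Cu * ((slope g)\<^sup>2 + (N (res lam U))\<^sup>2)"
    using upper_bound by blast
  define C where "C = Cu * (Co + 1)"
  \<comment> \<open>Makes \<open>C / a0 * e\<close> equal to 1/2, so that the returned
    \<open>(N U)^2\<close> is absorbed.\<close>
  define e where "e = a0 / (2 * C)"
  define M2 where "M2 = Cs + 2 * C + 2 * (C / a0) / (4 * e)"
  have C: "0 < C" using o(1) u(1) by (simp add: C_def)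
  have e: "0 < e" using C par by (simp add: e_def)
  have M2: "0 < M2" "Cs \<le> M2" "2 * C + 2 * (C / a0) / (4 * e) \<le> M2" using s C e par by (auto simp: M2_def intro!: add_pos_nonneg)
  have main: "(N U)\<^sup>2 \<le> M2 * (N (res lam U))\<^sup>2" if U: "domA L U" for lam U
  proof (cases "\<bar>lam\<bar> \<le> lam1")
    case True
    have "Cs * (N (res lam U))\<^sup>2 \<le> M2 * (N (res lam U))\<^sup>2" using M2 by (intro mult_right_mono) auto
    then show ?thesis using s(3)[OF U True] by linarith
  next
    case False
    obtain g where g: "rep U g" using rep_exists[OF U] by blast
    let ?f = "(N (res lam U))\<^sup>2" and ?n = "(N U)\<^sup>2"
    have I0: "0 \<le> I6 U" unfolding I6_def set_lebesgue_integral_def by (intro Bochner_Integration.integral_nonneg) auto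
    have "?n \<le> Cu * ((slope g)\<^sup>2 + ?f)" by (rule u(2)[OF g])
    also have "\<dots> \<le> Cu * (Co * (?f + I6 U) + ?f)" using o(2)[OF g, of lam] False u(1) by (intro mult_left_mono) auto
    also have "\<dots> \<le> Cu * ((Co + 1) * (?f + I6 U))" using u(1) I0 by (intro mult_left_mono) (auto simp: algebra_simps)
    also have "\<dots> = C * ?f + C / a0 * (a0 * I6 U)"
    proof -
      have "C / a0 * (a0 * I6 U) = C * I6 U" using par by simp
      then show ?thesis by (simp only:) (simp add: C_def algebra_simps)
    qed
    also have "\<dots> \<le> C * ?f + C / a0 * (e * ?n + ?f / (4 * e))"
      using dissipation_res_le[OF U e] C par by (intro add_left_mono mult_left_mono) auto
    also have "\<dots> = C * ?f + 1/2 * ?n + (C / a0) / (4 * e) * ?f" using C par e by (simp add: e_def field_simps)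
    finally have "?n \<le> 2 * (C * ?f) + 2 * ((C / a0) / (4 * e) * ?f)" by linarith
    also have "\<dots> = (2 * C + 2 * (C / a0) / (4 * e)) * ?f" by (simp add: algebra_simps)
    also have "\<dots> \<le> M2 * ?f" using M2 by (intro mult_right_mono) auto
    finally show ?thesis .
  qed
  have "N U \<le> sqrt M2 * N (res lam U)" if U: "domA L U" for lam U
  proof (rule power2_le_imp_le)
    show "(N U)\<^sup>2 \<le> (sqrt M2 * N (res lam U))\<^sup>2" using main[OF U] M2 by (simp add: power_mult_distrib)
    show "0 \<le> sqrt M2 * N (res lam U)" using N_nonneg M2 by simp
  qed
  then show ?thesis using M2(1) by (intro exI[of _ "sqrt M2"]) auto
qed

end

section \<open>Density of the domain\<close>

lemma L2_dominated_convergence: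
  fixes f :: "real \<Rightarrow> complex" and g :: "nat \<Rightarrow> real \<Rightarrow> complex" and w :: "real \<Rightarrow> real"
  assumes f: "L2 L f" and g: "\<And>n. L2 L (g n)"
    and lim: "AE x in lborel. x \<in> {0..L} \<longrightarrow> (\<lambda>n. g n x) \<longlonglongrightarrow> f x"
    and w: "set_integrable lborel {0..L} w" and le: "\<And>n x. x \<in> {0..L} \<Longrightarrow> (cmod (f x - g n x))\<^sup>2 \<le> w x"
  shows "(\<lambda>n. LINT x:{0..L}|lborel. (cmod (f x - g n x))\<^sup>2) \<longlonglongrightarrow> 0"
proof -
  have i: "set_integrable lborel {0..L} (\<lambda>x. (cmod (f x - g n x))\<^sup>2)" for n
    by (rule L2_square[OF L2_diff[OF f g]])
  have "(\<lambda>n. \<integral>x. indicat_real {0..L} x *\<^sub>R (cmod (f x - g n x))\<^sup>2 \<partial>lborel) \<longlonglongrightarrow> integral\<^sup>L lborel (\<lambda>x::real. 0::real)"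
  proof (rule integral_dominated_convergence[where w = "\<lambda>x. indicat_real {0..L} x *\<^sub>R w x"])
    show "integrable lborel (\<lambda>x. indicat_real {0..L} x *\<^sub>R w x)" using w by (simp add: set_integrable_def)
    show "(\<lambda>x. indicat_real {0..L} x *\<^sub>R (cmod (f x - g n x))\<^sup>2) \<in> borel_measurable lborel" for n
      using i[of n] unfolding set_integrable_def by (rule borel_measurable_integrable)
    show "AE x in lborel. norm (indicat_real {0..L} x *\<^sub>R (cmod (f x - g n x))\<^sup>2) \<le> indicat_real {0..L} x *\<^sub>R w x" for n
      using le by (intro AE_I2) (auto split: split_indicator)
    show "AE x in lborel. (\<lambda>n. indicat_real {0..L} x *\<^sub>R (cmod (f x - g n x))\<^sup>2) \<longlonglongrightarrow> 0"
      using lim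
    proof eventually_elim
      case (elim x)
      show ?case
      proof (cases "x \<in> {0..L}")
        case True
        then have "(\<lambda>n. (cmod (f x - g n x))\<^sup>2) \<longlonglongrightarrow> (cmod (f x - f x))\<^sup>2" using elim by (intro tendsto_intros) auto
        then show ?thesis using True by simp
      qed simp
    qed
  qed simp
  then show ?thesis by (simp add: set_lebesgue_integral_def)
qed

lemma L2_dist_triangle:
  assumes "L2 L f" "L2 L g" "L2 L h" "(LINT x:{0..L}|lborel. (cmod (f x - g x))\<^sup>2) < e / 4" "(LINT x:{0..L}|lborel. (cmod (g x - h x))\<^sup>2) < e / 4"
  shows "(LINT x:{0..L}|lborel. (cmod (f x - h x))\<^sup>2) < e"
proof -
  have i: "set_integrable lborel {0..L} (\<lambda>x. (cmod (f x - g x))\<^sup>2)" "set_integrable lborel {0..L} (\<lambda>x. (cmod (g x - h x))\<^sup>2)" "set_integrable lborel {0..L} (\<lambda>x. (cmod (f x - h x))\<^sup>2)"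
    using assms by (auto intro: L2_square L2_diff)
  have "(LINT x:{0..L}|lborel. (cmod (f x - h x))\<^sup>2) \<le> (LINT x:{0..L}|lborel. 2 * (cmod (f x - g x))\<^sup>2 + 2 * (cmod (g x - h x))\<^sup>2)"
  proof (rule set_integral_mono[OF i(3)])
    show "set_integrable lborel {0..L} (\<lambda>x. 2 * (cmod (f x - g x))\<^sup>2 + 2 * (cmod (g x - h x))\<^sup>2)"
      using i by (intro set_integral_add(1) set_integrable_mult_right)
    fix x
    have "cmod (f x - h x) \<le> cmod (f x - g x) + cmod (g x - h x)" using norm_triangle_ineq[of "f x - g x" "g x - h x"] by simp
    then have "(cmod (f x - h x))\<^sup>2 \<le> (cmod (f x - g x) + cmod (g x - h x))\<^sup>2" by (intro power_mono) auto
    also have "\<dots> \<le> 2 * (cmod (f x - g x))\<^sup>2 + 2 * (cmod (g x - h x))\<^sup>2"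
      using sum_squares_bound[of "cmod (f x - g x)" "cmod (g x - h x)"] by (simp add: power2_sum)
    finally show "(cmod (f x - h x))\<^sup>2 \<le> 2 * (cmod (f x - g x))\<^sup>2 + 2 * (cmod (g x - h x))\<^sup>2" .
  qed
  also have "\<dots> = 2 * (LINT x:{0..L}|lborel. (cmod (f x - g x))\<^sup>2) + 2 * (LINT x:{0..L}|lborel. (cmod (g x - h x))\<^sup>2)"
    using i by simp
  finally show ?thesis using assms(4,5) by linarith
qed

text \<open>A measurable function is almost everywhere a limit of continuous ones. To obtain a
  dominating function the values are truncated first, and the same truncation is applied to the
  approximants.\<close>

lemma L2_approx_continuous:
  assumes f: "L2 L f" and e: "0 < e"
  shows "\<exists>g. continuous_on UNIV g \<and> (LINT x:{0..L}|lborel. (cmod (f x - g x))\<^sup>2) < e"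
proof -
  \<comment> \<open>Radial retraction onto the disc of radius \<open>B\<close>, continuous because
    the denominator never drops below \<open>B\<close>.\<close>
  define cl where "cl B w = of_real (B / max B (cmod w)) * w" for B w
  have cl_le: "cmod (cl B w) \<le> B" if "0 < B" for B w
  proof -
    have "cmod (cl B w) = B * (cmod w / max B (cmod w))" using that unfolding cl_def norm_mult norm_of_real by simp
    also have "\<dots> \<le> B * 1" using that by (intro mult_left_mono) (auto simp: divide_le_eq_1)
    finally show ?thesis by simp
  qed
  have cl_id: "cl B w = w" if "cmod w \<le> B" "0 < B" for B w using that by (simp add: cl_def max_def)
  have cl_le2: "cmod (cl B w) \<le> cmod w" if "0 < B" for B w
  proof -
    have "cmod (cl B w) = B / max B (cmod w) * cmod w" using that unfolding cl_def norm_mult norm_of_real by simp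
    also have "\<dots> \<le> 1 * cmod w" using that by (intro mult_right_mono) (auto simp: divide_le_eq_1)
    finally show ?thesis by simp
  qed
  have cl_cont: "continuous_on UNIV (cl B)" if "0 < B" for B
    unfolding cl_def[abs_def] using that by (intro continuous_intros) (auto simp: max_def)
  have cL2: "L2 L (\<lambda>x. cl B (f x))" if B: "0 < B" for B
    unfolding L2_def
  proof
    show m: "set_borel_measurable lborel {0..L} (\<lambda>x. cl B (f x))"
      by (rule sbm_compose[OF L2_measurable[OF f] cl_cont[OF B]]) simp
    show "set_integrable lborel {0..L} (\<lambda>x. (cmod (cl B (f x)))\<^sup>2)"
    proof (rule set_integrable_I_bound[OF L2_square[OF f]])
      show "set_borel_measurable lborel {0..L} (\<lambda>x. (cmod (cl B (f x)))\<^sup>2)"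
        by (rule sbm_compose[OF m, of "\<lambda>w. (cmod w)\<^sup>2"]) (auto intro!: continuous_intros)
      show "norm ((cmod (cl B (f x)))\<^sup>2) \<le> (cmod (f x))\<^sup>2" for x using cl_le2[OF B, of "f x"] by (simp add: power_mono)
    qed
  qed
  have "(\<lambda>n. LINT x:{0..L}|lborel. (cmod (f x - cl (real (Suc n)) (f x)))\<^sup>2) \<longlonglongrightarrow> 0"
  proof (rule L2_dominated_convergence[OF f cL2])
    show "AE x in lborel. x \<in> {0..L} \<longrightarrow> (\<lambda>n. cl (real (Suc n)) (f x)) \<longlonglongrightarrow> f x"
    proof (intro AE_I2 impI)
      fix x
      obtain m where m: "cmod (f x) \<le> real m" using real_arch_simple by blast
      have "\<forall>\<^sub>F n in sequentially. cl (real (Suc n)) (f x) = f x"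
        using eventually_ge_at_top[of m] by eventually_elim (use m in \<open>intro cl_id, auto\<close>)
      then show "(\<lambda>n. cl (real (Suc n)) (f x)) \<longlonglongrightarrow> f x" by (rule tendsto_eventually)
    qed
    show "set_integrable lborel {0..L} (\<lambda>x. 4 * (cmod (f x))\<^sup>2)" using L2_square[OF f] by simp
    fix n x
    have "cmod (f x - cl (real (Suc n)) (f x)) \<le> 2 * cmod (f x)"
      using norm_triangle_ineq4[of "f x" "cl (real (Suc n)) (f x)"] cl_le2[of "real (Suc n)" "f x"] by simp
    then have "(cmod (f x - cl (real (Suc n)) (f x)))\<^sup>2 \<le> (2 * cmod (f x))\<^sup>2" by (intro power_mono) auto
    then show "(cmod (f x - cl (real (Suc n)) (f x)))\<^sup>2 \<le> 4 * (cmod (f x))\<^sup>2" by (simp add: power_mult_distrib)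
  qed simp
  then obtain n where n: "(LINT x:{0..L}|lborel. (cmod (f x - cl (real (Suc n)) (f x)))\<^sup>2) < e / 4"
    using order_tendstoD(2)[of _ 0 sequentially "e/4"] e by (auto simp: eventually_sequentially)
  define B where "B = real (Suc n)"
  have B: "0 < B" by (simp add: B_def)
  let ?f = "\<lambda>x. indicat_real {0..L} x *\<^sub>R f x"
  have "?f \<in> borel_measurable borel" using L2_measurable[OF f] by (simp add: set_borel_measurable_def)
  then have "?f \<in> borel_measurable lebesgue" by (simp add: measurable_completion)
  then have "?f measurable_on UNIV" by (intro lebesgue_measurable_imp_measurable_on) auto
  then obtain Z G where Z: "negligible Z" and G: "\<And>k. continuous_on UNIV (G k)" and lim: "\<And>x. x \<notin> Z \<Longrightarrow> (\<lambda>k. G k x) \<longlonglongrightarrow> ?f x"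
    unfolding measurable_on_def by auto
  have cG: "continuous_on UNIV (\<lambda>x. cl B (G k x))" for k
    using continuous_on_compose2[OF cl_cont[OF B] G[of k]] by auto
  have "(\<lambda>k. LINT x:{0..L}|lborel. (cmod (cl B (f x) - cl B (G k x)))\<^sup>2) \<longlonglongrightarrow> 0"
  proof (rule L2_dominated_convergence[OF cL2[OF B]])
    show "L2 L (\<lambda>x. cl B (G k x))" for k by (rule L2_continuous[OF continuous_on_subset[OF cG]]) auto
    have "AE x in lebesgue. x \<notin> Z" using Z by (simp add: negligible_iff_null_sets AE_not_in)
    then have "AE x in lborel. x \<notin> Z" by (simp add: AE_completion_iff)
    then show "AE x in lborel. x \<in> {0..L} \<longrightarrow> (\<lambda>k. cl B (G k x)) \<longlonglongrightarrow> cl B (f x)"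
    proof eventually_elim
      case (elim x)
      show ?case
      proof
        assume "x \<in> {0..L}"
        then have "(\<lambda>k. G k x) \<longlonglongrightarrow> f x" using lim[OF elim] by simp
        moreover have "isCont (cl B) (f x)" using cl_cont[OF B] by (simp add: continuous_on_eq_continuous_at)
        ultimately show "(\<lambda>k. cl B (G k x)) \<longlonglongrightarrow> cl B (f x)" by (rule isCont_tendsto_compose[rotated])
      qed
    qed
    show "set_integrable lborel {0..L} (\<lambda>x. (2 * B)\<^sup>2)" by (rule set_integrable_one)
    show "(cmod (cl B (f x) - cl B (G k x)))\<^sup>2 \<le> (2 * B)\<^sup>2" for k x
      using norm_triangle_ineq4[of "cl B (f x)" "cl B (G k x)"] cl_le[OF B, of "f x"] cl_le[OF B, of "G k x"] by (intro power_mono) auto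
  qed
  then obtain k where k: "(LINT x:{0..L}|lborel. (cmod (cl B (f x) - cl B (G k x)))\<^sup>2) < e / 4"
    using order_tendstoD(2)[of _ 0 sequentially "e/4"] e by (auto simp: eventually_sequentially)
  have "(LINT x:{0..L}|lborel. (cmod (f x - cl B (G k x)))\<^sup>2) < e"
    by (rule L2_dist_triangle[OF f cL2[OF B] L2_continuous[OF continuous_on_subset[OF cG]] _ k]) (use n in \<open>auto simp: B_def\<close>)
  then show ?thesis using cG by blast
qed

lemma L2_approx_polynomial:
  assumes f: "L2 L f" and e: "0 < e" and L: "0 < L"
  shows "\<exists>p p'. (\<forall>x. (p has_vector_derivative p' x) (at x)) \<and> continuous_on UNIV p' \<and> (LINT x:{0..L}|lborel. (cmod (f x - p x))\<^sup>2) < e"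
proof -
  obtain g where g: "continuous_on UNIV g" "(LINT x:{0..L}|lborel. (cmod (f x - g x))\<^sup>2) < e / 4"
    using L2_approx_continuous[OF f, of "e/4"] e by auto
  define d where "d = sqrt (e / (8 * L))"
  have d: "0 < d" using e L by (simp add: d_def)
  obtain p where p: "polynomial_function p" "\<And>x. x \<in> {0..L} \<Longrightarrow> norm (g x - p x) < d"
    using Stone_Weierstrass_polynomial_function[of "{0..L}" g d] continuous_on_subset[OF g(1)] d by auto
  obtain p' where p': "polynomial_function p'" "\<And>x. (p has_vector_derivative p' x) (at x)"
    using has_vector_derivative_polynomial_function[OF p(1)] by blast
  have cp: "continuous_on A p" "continuous_on A p'" for A using continuous_on_polymonial_function p(1) p'(1) by blast+
  have gp: "L2 L g" "L2 L p" using L2_continuous continuous_on_subset[OF g(1)] cp by blast+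
  have "(LINT x:{0..L}|lborel. (cmod (g x - p x))\<^sup>2) \<le> (LINT x:{0..L}|lborel. d\<^sup>2)"
  proof (rule set_integral_mono[OF L2_square[OF L2_diff[OF gp]] set_integrable_one])
    show "(cmod (g x - p x))\<^sup>2 \<le> d\<^sup>2" if "x \<in> {0..L}" for x using p(2)[OF that] by (intro power_mono) auto
  qed
  also have "\<dots> = e / 8" using e L by (simp add: set_integral_const d_def)
  also have "\<dots> < e / 4" using e by simp
  finally have "(LINT x:{0..L}|lborel. (cmod (f x - p x))\<^sup>2) < e"
    by (rule L2_dist_triangle[OF f gp g(2)])
  then show ?thesis using p'(2) cp by blast
qed

text \<open>A polynomial approximant is multiplied by cutoffs that vanish at the end points; the
  error concentrates near the ends and tends to 0 by dominated convergence.\<close>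

lemma L2_approx_H10:
  assumes f: "L2 L f" and e: "0 < e" and L: "0 < L"
  shows "\<exists>q. H10 L q \<and> (LINT x:{0..L}|lborel. (cmod (f x - q x))\<^sup>2) < e"
proof -
  obtain p p' where p: "\<And>x. (p has_vector_derivative p' x) (at x)" "continuous_on UNIV p'" "(LINT x:{0..L}|lborel. (cmod (f x - p x))\<^sup>2) < e / 4"
    using L2_approx_polynomial[OF f _ L, of "e/4"] e by auto
  have acp: "AC L p p'" by (rule AC_C1[OF p(1,2)])
  \<comment> \<open>\<open>s\<close> equals \<open>((L - 2*x) / L)^2\<close>: it is 1 at both ends
    and below 1 inside, so the functions \<open>1 - s ^ Suc n\<close> vanish at the ends and
    increase to 1 inside.\<close>
  define s where "s x = 1 - 4 * x * (L - x) / L\<^sup>2" for x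
  define \<theta> where "\<theta> n x = complex_of_real (1 - s x ^ Suc n)" for n :: nat and x
  define \<theta>' where "\<theta>' n x = complex_of_real (- (real (Suc n) * s x ^ n * (- (4 * (L - x) - 4 * x) / L\<^sup>2)))" for n :: nat and x
  have s01: "0 \<le> s x \<and> s x \<le> 1" if "x \<in> {0..L}" for x
  proof -
    have "s x = ((L - 2 * x) / L)\<^sup>2" using L by (simp add: s_def power2_eq_square field_simps)
    moreover have "0 \<le> 4 * x * (L - x) / L\<^sup>2" using that L by simp
    ultimately show ?thesis by (simp add: s_def)
  qed
  have ac\<theta>: "AC L (\<theta> n) (\<theta>' n)" for n
  proof (rule AC_C1)
    fix x
    have "((\<lambda>x. 1 - s x ^ Suc n) has_real_derivative - (real (Suc n) * s x ^ n * (- (4 * (L - x) - 4 * x) / L\<^sup>2))) (at x)"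
      unfolding s_def by (rule derivative_eq_intros refl | use L in \<open>simp add: power2_eq_square field_simps\<close>)+
    then show "(\<theta> n has_vector_derivative \<theta>' n x) (at x)"
      unfolding \<theta>_def \<theta>'_def by (intro has_vector_derivative_of_real) (simp add: has_real_derivative_iff_has_vector_derivative)
    show "continuous_on UNIV (\<theta>' n)" unfolding \<theta>'_def s_def using L by (intro continuous_intros) auto
  qed
  have H: "H10 L (\<lambda>x. p x * \<theta> n x)" for n
  proof (rule H10_I[OF AC_mult[OF acp ac\<theta>]])
    have "continuous_on {0..L} p'" "continuous_on {0..L} p" "continuous_on {0..L} (\<theta> n)"
      using AC_continuous[OF acp] AC_continuous[OF ac\<theta>] continuous_on_subset[OF p(2)] by auto
    moreover have "continuous_on {0..L} (\<theta>' n)" unfolding \<theta>'_def s_def using L by (intro continuous_intros) auto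
    ultimately show "L2 L (\<lambda>x. p' x * \<theta> n x + p x * \<theta>' n x)" by (intro L2_continuous continuous_intros)
    show "p 0 * \<theta> n 0 = 0" "p L * \<theta> n L = 0" by (simp_all add: \<theta>_def s_def)
  qed
  have "bounded (p ` {0..L})" by (intro compact_imp_bounded compact_continuous_image AC_continuous[OF acp]) auto
  then obtain B where B: "\<And>x. x \<in> {0..L} \<Longrightarrow> cmod (p x) \<le> B" unfolding bounded_iff by blast
  have "(\<lambda>n. LINT x:{0..L}|lborel. (cmod (p x - p x * \<theta> n x))\<^sup>2) \<longlonglongrightarrow> 0"
  proof (rule L2_dominated_convergence[OF L2_AC[OF acp] H10_L2[OF H]])
    have "AE x in lborel. x \<noteq> 0 \<and> x \<noteq> L" using AE_lborel_singleton[of 0] AE_lborel_singleton[of L] by eventually_elim simp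
    then show "AE x in lborel. x \<in> {0..L} \<longrightarrow> (\<lambda>n. p x * \<theta> n x) \<longlonglongrightarrow> p x"
    proof eventually_elim
      case (elim x)
      show ?case
      proof
        assume x: "x \<in> {0..L}"
        have "0 < 4 * x * (L - x) / L\<^sup>2" using elim x L by (intro divide_pos_pos mult_pos_pos) auto
        then have "\<bar>s x\<bar> < 1" using s01[OF x] by (simp add: s_def)
        then have "(\<lambda>n. s x ^ Suc n) \<longlonglongrightarrow> 0" by (intro LIMSEQ_Suc LIMSEQ_power_zero) simp
        then have "(\<lambda>n. p x * complex_of_real (1 - s x ^ Suc n)) \<longlonglongrightarrow> p x * complex_of_real (1 - 0)"
          by (intro tendsto_intros)
        then show "(\<lambda>n. p x * \<theta> n x) \<longlonglongrightarrow> p x" by (simp add: \<theta>_def)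
      qed
    qed
    show "set_integrable lborel {0..L} (\<lambda>x. B\<^sup>2)" by (rule set_integrable_one)
    fix n x assume x: "x \<in> {0..L}"
    have "p x - p x * \<theta> n x = p x * of_real (s x ^ Suc n)" by (simp add: \<theta>_def algebra_simps)
    then have "cmod (p x - p x * \<theta> n x) = cmod (p x) * s x ^ Suc n" using s01[OF x] by (simp add: norm_mult norm_power)
    also have "\<dots> \<le> B * 1" using B[OF x] s01[OF x] by (intro mult_mono power_le_one) (auto intro: order_trans[OF norm_ge_zero])
    finally show "(cmod (p x - p x * \<theta> n x))\<^sup>2 \<le> B\<^sup>2" by (intro power_mono) auto
  qed
  then obtain n where n: "(LINT x:{0..L}|lborel. (cmod (p x - p x * \<theta> n x))\<^sup>2) < e / 4"
    using order_tendstoD(2)[of _ 0 sequentially "e/4"] e by (auto simp: eventually_sequentially)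
  have "(LINT x:{0..L}|lborel. (cmod (f x - p x * \<theta> n x))\<^sup>2) < e"
    by (rule L2_dist_triangle[OF f L2_AC[OF acp] H10_L2[OF H] p(3) n])
  then show ?thesis using H by blast
qed

lemma cmod_integral_square_le:
  assumes "L2 L f" "0 < L" "0 \<le> x" "x \<le> L"
  shows "(cmod (LINT t:{0..x}|lborel. f t))\<^sup>2 \<le> L * (LINT t:{0..L}|lborel. (cmod (f t))\<^sup>2)"
proof -
  have i: "set_integrable lborel {0..L} (\<lambda>t. cmod (f t))"
    using integrable_norm[OF L2_integrable[OF assms(1), unfolded set_integrable_def]] by (simp add: set_integrable_def)
  have "cmod (LINT t:{0..x}|lborel. f t) \<le> (LINT t:{0..L}|lborel. cmod (f t))"
    by (rule norm_integral_le[OF L2_integrable[OF assms(1)] _ i _ assms(3,4)]) auto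
  then have "(cmod (LINT t:{0..x}|lborel. f t))\<^sup>2 \<le> (LINT t:{0..L}|lborel. cmod (f t))\<^sup>2" by (intro power_mono) auto
  also have "\<dots> \<le> L * (LINT t:{0..L}|lborel. (cmod (f t))\<^sup>2)"
    by (rule cauchy_schwarz_interval[OF i L2_square[OF assms(1)] assms(2)])
  finally show ?thesis .
qed

text \<open>The approximation takes place at the level of the derivative. The polynomial is
  corrected by its mean so that the primitive returns to 0 at \<open>L\<close>; this mean is small
  because the derivative of \<open>f\<close> has mean zero.\<close>

lemma H10_approx_H2:
  assumes f: "H10 L f" and e: "0 < e" and L: "0 < L"
  shows "\<exists>q. H2 L q \<and> H10 L q \<and> (LINT x:{0..L}|lborel. (cmod (dx L f x - dx L q x))\<^sup>2) < e"
proof -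
  note f' = H10_AC[OF f]
  obtain p p' where p: "\<And>x. (p has_vector_derivative p' x) (at x)" "continuous_on UNIV p'" "(LINT x:{0..L}|lborel. (cmod (dx L f x - p x))\<^sup>2) < e / 8"
    using L2_approx_polynomial[OF f'(2) _ L, of "e/8"] e by auto
  have acp: "AC L p p'" by (rule AC_C1[OF p(1,2)])
  have ip: "set_integrable lborel {0..L} p" using L2_integrable[OF L2_AC[OF acp]] .
  define m where "m = (LINT x:{0..L}|lborel. p x) / of_real L"
  define q' where "q' x = p x - m" for x
  have acq': "AC L q' p'" unfolding q'_def[abs_def] using AC_diff[OF acp AC_const[of L m]] by simp
  define q where "q x = (LINT t:{0..x}|lborel. q' t)" for x
  have acq: "AC L q q'" unfolding q_def[abs_def] by (rule AC_integral[OF L2_integrable[OF L2_AC[OF acq']]])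
  have qL: "q L = 0"
  proof -
    have "q L = (LINT x:{0..L}|lborel. p x) - (LINT x:{0..L}|lborel. m)"
      unfolding q_def q'_def using ip set_integrable_continuous[OF continuous_on_const] by (subst set_integral_diff(2)) auto
    then show ?thesis using L by (simp add: m_def set_integral_const scaleR_conv_of_real)
  qed
  have q0: "q 0 = 0" by (simp add: q_def)
  have Hq: "H10 L q" by (rule H10_I[OF acq L2_AC[OF acq'] q0 qL])
  have H2q: "H2 L q" by (rule H2_I[OF acq acq']) (intro L2_continuous continuous_on_subset[OF p(2)], simp)
  have dp: "L2 L (\<lambda>x. dx L f x - p x)" by (rule L2_diff[OF f'(2) L2_AC[OF acp]])
  have mle: "(cmod m)\<^sup>2 * L < e / 8"
  proof -
    have "(LINT x:{0..L}|lborel. dx L f x) = 0"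
      using AC_integral_ends[OF f'(1)] L H10_ends[OF f] by simp
    then have "(LINT x:{0..L}|lborel. dx L f x - p x) = - (m * of_real L)"
      using L L2_integrable[OF f'(2)] ip by (simp add: set_integral_diff m_def)
    then have "(cmod (m * of_real L))\<^sup>2 \<le> L * (LINT x:{0..L}|lborel. (cmod (dx L f x - p x))\<^sup>2)"
      using cmod_integral_square_le[OF dp L, of L] L by simp
    also have "\<dots> < L * (e / 8)" using p(3) L by (intro mult_strict_left_mono) auto
    finally have "L * ((cmod m)\<^sup>2 * L) < L * (e / 8)" by (simp add: norm_mult power_mult_distrib power2_eq_square mult_ac)
    then show ?thesis using L by simp
  qed
  have ae: "AE x in lborel. x \<in> {0..L} \<longrightarrow> dx L q x = q' x" using dx_unique[OF Hq acq] L by simp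
  have dq: "L2 L (\<lambda>x. dx L f x - dx L q x)" by (rule L2_diff[OF f'(2) H10_AC(2)[OF Hq]])
  have "(LINT x:{0..L}|lborel. (cmod (dx L f x - dx L q x))\<^sup>2) \<le> (LINT x:{0..L}|lborel. 2 * (cmod (dx L f x - p x))\<^sup>2 + 2 * (cmod m)\<^sup>2)"
  proof (rule set_integral_mono_AE'[OF L2_square[OF dq]])
    show "set_integrable lborel {0..L} (\<lambda>x. 2 * (cmod (dx L f x - p x))\<^sup>2 + 2 * (cmod m)\<^sup>2)"
      by (intro set_integral_add(1) set_integrable_mult_right L2_square[OF dp] set_integrable_one)
    show "AE x in lborel. x \<in> {0..L} \<longrightarrow> (cmod (dx L f x - dx L q x))\<^sup>2 \<le> 2 * (cmod (dx L f x - p x))\<^sup>2 + 2 * (cmod m)\<^sup>2"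
      using ae
    proof eventually_elim
      case (elim x)
      show ?case
      proof
        assume "x \<in> {0..L}"
        then have "dx L f x - dx L q x = (dx L f x - p x) + m" using elim by (simp add: q'_def)
        then have "cmod (dx L f x - dx L q x) \<le> cmod (dx L f x - p x) + cmod m" by (simp only: norm_triangle_ineq)
        then have "(cmod (dx L f x - dx L q x))\<^sup>2 \<le> (cmod (dx L f x - p x) + cmod m)\<^sup>2" by (intro power_mono) auto
        also have "\<dots> \<le> 2 * (cmod (dx L f x - p x))\<^sup>2 + 2 * (cmod m)\<^sup>2"
          using sum_squares_bound[of "cmod (dx L f x - p x)" "cmod m"] by (simp add: power2_sum)
        finally show "(cmod (dx L f x - dx L q x))\<^sup>2 \<le> 2 * (cmod (dx L f x - p x))\<^sup>2 + 2 * (cmod m)\<^sup>2" .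
      qed
    qed
  qed
  also have "\<dots> = 2 * (LINT x:{0..L}|lborel. (cmod (dx L f x - p x))\<^sup>2) + 2 * ((cmod m)\<^sup>2 * L)"
    using L2_square[OF dp] set_integrable_one L by (subst set_integral_add(2)) (auto simp: set_integral_const)
  also have "\<dots> < e" using p(3) mle e by linarith
  finally show ?thesis using H2q Hq by blast
qed

section \<open>Density in the energy norm\<close>

context bresse
begin

text \<open>Displacements vanish at 0 and are therefore bounded by their derivatives, so
  approximating the derivatives of the displacements and the velocities themselves is
  enough.\<close>

lemma N_le_components:
  "\<exists>C>0. \<forall>W. inH L W \<longrightarrow> (N W)\<^sup>2 \<le> C * ((\<Sum>i\<in>{1,3,5}. LINT x:{0..L}|lborel. (cmod (dx L (W i) x))\<^sup>2) + (\<Sum>i\<in>{2,4,6}. LINT x:{0..L}|lborel. (cmod (W i x))\<^sup>2))"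
proof -
  define C where "C = 3 * k1 * (1 + L * L + l\<^sup>2 * (L * L)) + k2 + 2 * k1 * (1 + l\<^sup>2 * (L * L)) + \<rho>1 + \<rho>2"
  have C: "0 < C" using par unfolding C_def by (intro add_nonneg_pos add_nonneg_nonneg) auto
  have "(N W)\<^sup>2 \<le> C * ((\<Sum>i\<in>{1,3,5}. LINT x:{0..L}|lborel. (cmod (dx L (W i) x))\<^sup>2) + (\<Sum>i\<in>{2,4,6}. LINT x:{0..L}|lborel. (cmod (W i x))\<^sup>2))" if W: "inH L W" for W
  proof -
    define D where "D i = (LINT x:{0..L}|lborel. (cmod (dx L (W i) x))\<^sup>2)" for i
    define E where "E i = (LINT x:{0..L}|lborel. (cmod (W i x))\<^sup>2)" for i
    have D0: "0 \<le> D i" "0 \<le> E i" for i unfolding D_def E_def set_lebesgue_integral_def by (intro Bochner_Integration.integral_nonneg; simp)+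
    have H: "H10 L (W i)" if "i \<in> {1,3,5}" for i using inH_H10[OF W that] .
    have dL2: "L2 L (dx L (W i))" if "i \<in> {1,3,5}" for i using H10_AC(2)[OF H[OF that]] .
    have sup: "(cmod (W i x))\<^sup>2 \<le> L * D i" if i: "i \<in> {1,3,5}" and x: "x \<in> {0..L}" for i x
    proof -
      have "W i x = (LINT t:{0..x}|lborel. dx L (W i) t)" using AC_eq[OF H10_AC(1)[OF H[OF i]], of x] x H10_ends(1)[OF H[OF i]] by simp
      then show ?thesis using cmod_integral_square_le[OF dL2[OF i], of x] x par by (simp add: D_def)
    qed
    have q3: "(cmod (a + b + c))\<^sup>2 \<le> 3 * ((cmod a)\<^sup>2 + (cmod b)\<^sup>2 + (cmod c)\<^sup>2)" for a b c
    proof -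
      have "(cmod (a + b + c))\<^sup>2 \<le> (cmod a + cmod b + cmod c)\<^sup>2" by (intro power_mono norm_triangle_mono) auto
      also have "\<dots> \<le> 3 * ((cmod a)\<^sup>2 + (cmod b)\<^sup>2 + (cmod c)\<^sup>2)"
        using sum_squares_bound[of "cmod a" "cmod b"] sum_squares_bound[of "cmod a" "cmod c"] sum_squares_bound[of "cmod b" "cmod c"]
        by (simp add: power2_eq_square algebra_simps)
      finally show ?thesis .
    qed
    have i_d: "set_integrable lborel {0..L} (\<lambda>x. (cmod (dx L (W i) x))\<^sup>2)" if "i \<in> {1,3,5}" for i using L2_square[OF dL2[OF that]] .
    have i_w: "set_integrable lborel {0..L} (\<lambda>x. (cmod (W i x))\<^sup>2)" if "i \<in> {1..6}" for i using L2_square[OF inH_L2[OF W that]] .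
    let ?g = "\<lambda>x. 3 * k1 * (cmod (dx L (W 1) x))\<^sup>2 + k2 * (cmod (dx L (W 3) x))\<^sup>2 + 2 * k1 * (cmod (dx L (W 5) x))\<^sup>2 + \<rho>1 * (cmod (W 2 x))\<^sup>2 + \<rho>2 * (cmod (W 4 x))\<^sup>2 + \<rho>1 * (cmod (W 6 x))\<^sup>2
       + (3 * k1 * (L * D 3 + l\<^sup>2 * (L * D 5)) + 2 * k1 * (l\<^sup>2 * (L * D 1)))"
    have "(N W)\<^sup>2 \<le> (LINT x:{0..L}|lborel. ?g x)"
      unfolding N_eq norm6_square
    proof (rule set_integral_mono[OF L2_6_int[OF J_L2[OF W]]])
      show "set_integrable lborel {0..L} ?g"
        by (intro set_integral_add(1) set_integrable_mult_right i_d i_w set_integrable_one) auto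
      fix x assume x: "x \<in> {0..L}"
      have 1: "k1 * (cmod (dx L (W 1) x + W 3 x + of_real l * W 5 x))\<^sup>2 \<le> k1 * (3 * ((cmod (dx L (W 1) x))\<^sup>2 + L * D 3 + l\<^sup>2 * (L * D 5)))"
      proof (rule mult_left_mono)
        have "(cmod (of_real l * W 5 x))\<^sup>2 = l\<^sup>2 * (cmod (W 5 x))\<^sup>2" by (simp add: norm_mult power_mult_distrib)
        then have "(cmod (of_real l * W 5 x))\<^sup>2 \<le> l\<^sup>2 * (L * D 5)" using sup[OF _ x, of 5] by (simp add: mult_left_mono)
        then show "(cmod (dx L (W 1) x + W 3 x + of_real l * W 5 x))\<^sup>2 \<le> 3 * ((cmod (dx L (W 1) x))\<^sup>2 + L * D 3 + l\<^sup>2 * (L * D 5))"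
          using q3[of "dx L (W 1) x" "W 3 x" "of_real l * W 5 x"] sup[OF _ x, of 3] by (smt (verit) insertCI)
      qed (use par in simp)
      have 2: "k1 * (cmod (dx L (W 5) x - of_real l * W 1 x))\<^sup>2 \<le> k1 * (2 * ((cmod (dx L (W 5) x))\<^sup>2 + l\<^sup>2 * (L * D 1)))"
      proof (rule mult_left_mono)
        have "(cmod (dx L (W 5) x - of_real l * W 1 x))\<^sup>2 \<le> (cmod (dx L (W 5) x) + cmod (of_real l * W 1 x))\<^sup>2"
          by (intro power_mono norm_triangle_ineq4) auto
        also have "\<dots> \<le> 2 * (cmod (dx L (W 5) x))\<^sup>2 + 2 * (cmod (of_real l * W 1 x))\<^sup>2"
          using sum_squares_bound[of "cmod (dx L (W 5) x)" "cmod (of_real l * W 1 x)"] by (simp add: power2_sum)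
        also have "(cmod (of_real l * W 1 x))\<^sup>2 = l\<^sup>2 * (cmod (W 1 x))\<^sup>2" by (simp add: norm_mult power_mult_distrib)
        also have "l\<^sup>2 * (cmod (W 1 x))\<^sup>2 \<le> l\<^sup>2 * (L * D 1)" using sup[OF _ x, of 1] by (simp add: mult_left_mono)
        finally show "(cmod (dx L (W 5) x - of_real l * W 1 x))\<^sup>2 \<le> 2 * ((cmod (dx L (W 5) x))\<^sup>2 + l\<^sup>2 * (L * D 1))" by simp
      qed (use par in simp)
      show "(\<Sum>i\<in>{1..6}. (cmod (J W i x))\<^sup>2) \<le> ?g x" unfolding J_norms using 1 2 by (simp add: algebra_simps)
    qed
    also have "(LINT x:{0..L}|lborel. ?g x) = 3 * k1 * D 1 + k2 * D 3 + 2 * k1 * D 5 + \<rho>1 * E 2 + \<rho>2 * E 4 + \<rho>1 * E 6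
       + (3 * k1 * (L * D 3 + l\<^sup>2 * (L * D 5)) + 2 * k1 * (l\<^sup>2 * (L * D 1))) * L"
    proof -
      \<comment> \<open>Integrability and value are carried together, so that the integral of a long
        sum is found by composing rules.\<close>
      define hs where "hs f a \<longleftrightarrow> set_integrable lborel {0..L} f \<and> (LINT x:{0..L}|lborel. f x) = a" for f :: "real \<Rightarrow> real" and a
      have add: "hs (\<lambda>x. f x + g x) (a + b)" if "hs f a" "hs g b" for f g a b
        using that set_integral_add[of lborel "{0..L}" f g] unfolding hs_def by simp
      have mult: "hs (\<lambda>x. c * f x) (c * a)" if "hs f a" for f a c
        using that unfolding hs_def by simp
      have const: "hs (\<lambda>x. c) (c * L)" for c
        using par set_integrable_one[of L c] unfolding hs_def by (simp add: set_integral_const)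
      have d: "hs (\<lambda>x. (cmod (dx L (W i) x))\<^sup>2) (D i)" if "i \<in> {1,3,5}" for i using i_d[OF that] unfolding hs_def D_def by simp
      have w: "hs (\<lambda>x. (cmod (W i x))\<^sup>2) (E i)" if "i \<in> {1..6}" for i using i_w[OF that] unfolding hs_def E_def by simp
      have "hs ?g (3 * k1 * D 1 + k2 * D 3 + 2 * k1 * D 5 + \<rho>1 * E 2 + \<rho>2 * E 4 + \<rho>1 * E 6
       + (3 * k1 * (L * D 3 + l\<^sup>2 * (L * D 5)) + 2 * k1 * (l\<^sup>2 * (L * D 1))) * L)"
        by (rule add[OF add[OF add[OF add[OF add[OF add[OF mult[OF d] mult[OF d]] mult[OF d]] mult[OF w]] mult[OF w]] mult[OF w]] const]) auto
      then show ?thesis unfolding hs_def by blast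
    qed
    also have "\<dots> \<le> C * ((D 1 + D 3 + D 5) + (E 2 + E 4 + E 6))"
    proof -
      have nn: "0 \<le> k1" "0 \<le> k2" "0 \<le> \<rho>1" "0 \<le> \<rho>2" "0 \<le> k1 * (L * L)" "0 \<le> k1 * (l\<^sup>2 * (L * L))" using par by auto
      define P where "P = 3 * k1 * (1 + L * L + l\<^sup>2 * (L * L)) + k2 + 2 * k1 * (1 + l\<^sup>2 * (L * L))"
      have Pe: "P = 3 * k1 + 3 * (k1 * (L * L)) + 3 * (k1 * (l\<^sup>2 * (L * L))) + k2 + 2 * k1 + 2 * (k1 * (l\<^sup>2 * (L * L)))" by (simp add: P_def algebra_simps)
      have cf: "3 * k1 + 2 * (k1 * (l\<^sup>2 * (L * L))) \<le> C" "k2 + 3 * (k1 * (L * L)) \<le> C" "2 * k1 + 3 * (k1 * (l\<^sup>2 * (L * L))) \<le> C" "\<rho>1 \<le> C" "\<rho>2 \<le> C"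
        using nn Pe unfolding C_def P_def[symmetric] by linarith+
      have "3 * k1 * D 1 + k2 * D 3 + 2 * k1 * D 5 + \<rho>1 * E 2 + \<rho>2 * E 4 + \<rho>1 * E 6
       + (3 * k1 * (L * D 3 + l\<^sup>2 * (L * D 5)) + 2 * k1 * (l\<^sup>2 * (L * D 1))) * L
       = (3 * k1 + 2 * (k1 * (l\<^sup>2 * (L * L)))) * D 1 + (k2 + 3 * (k1 * (L * L))) * D 3 + (2 * k1 + 3 * (k1 * (l\<^sup>2 * (L * L)))) * D 5 + \<rho>1 * E 2 + \<rho>2 * E 4 + \<rho>1 * E 6"
        by (simp add: algebra_simps)
      also have "\<dots> \<le> C * D 1 + C * D 3 + C * D 5 + C * E 2 + C * E 4 + C * E 6"
        by (intro add_mono mult_right_mono cf D0)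
      finally show ?thesis by (simp add: algebra_simps)
    qed
    finally show ?thesis by (simp add: D_def E_def add.assoc)
  qed
  then show ?thesis using C by blast
qed

theorem domA_dense:
  assumes U: "inH L U" and e: "0 < e"
  shows "\<exists>V. domA L V \<and> N (sdiff U V) < e"
proof -
  obtain C where C: "0 < C" "\<And>W. inH L W \<Longrightarrow> (N W)\<^sup>2 \<le> C * ((\<Sum>i\<in>{1,3,5}. LINT x:{0..L}|lborel. (cmod (dx L (W i) x))\<^sup>2) + (\<Sum>i\<in>{2,4,6}. LINT x:{0..L}|lborel. (cmod (W i x))\<^sup>2))"
    using N_le_components by blast
  \<comment> \<open>Six components with errors below \<open>r\<close> add up, after multiplication
    by \<open>C\<close>, to less than \<open>e\<^sup>2\<close>.\<close>
  define r where "r = e\<^sup>2 / (6 * C)"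
  have r: "0 < r" using e C by (simp add: r_def)
  have "\<forall>i\<in>{1,3,5}. \<exists>q. H2 L q \<and> H10 L q \<and> (LINT x:{0..L}|lborel. (cmod (dx L (U i) x - dx L q x))\<^sup>2) < r"
    using H10_approx_H2[OF inH_H10[OF U] r par(6)] by blast
  from bchoice[OF this] obtain V1 where V1: "\<forall>i\<in>{1,3,5}. H2 L (V1 i) \<and> H10 L (V1 i) \<and> (LINT x:{0..L}|lborel. (cmod (dx L (U i) x - dx L (V1 i) x))\<^sup>2) < r" ..
  have "\<forall>i\<in>{2,4,6}. \<exists>q. H10 L q \<and> (LINT x:{0..L}|lborel. (cmod (U i x - q x))\<^sup>2) < r"
  proof
    fix i :: nat assume "i \<in> {2,4,6}"
    then have "i \<in> {1..6}" by auto
    then show "\<exists>q. H10 L q \<and> (LINT x:{0..L}|lborel. (cmod (U i x - q x))\<^sup>2) < r"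
      using L2_approx_H10[OF inH_L2[OF U] r par(6)] by blast
  qed
  from bchoice[OF this] obtain V2 where V2: "\<forall>i\<in>{2,4,6}. H10 L (V2 i) \<and> (LINT x:{0..L}|lborel. (cmod (U i x - V2 i x))\<^sup>2) < r" ..
  define V :: state where "V i = (if i \<in> {1,3,5} then V1 i else if i \<in> {2,4,6} then V2 i else (\<lambda>_. 0))" for i
  have V: "domA L V" using V1 V2 unfolding domA_def V_def by auto
  have W: "inH L (sdiff U V)" by (intro inH_sdiff U domA_inH V)
  have "(N (sdiff U V))\<^sup>2 \<le> C * ((\<Sum>i\<in>{1,3,5}. LINT x:{0..L}|lborel. (cmod (dx L (sdiff U V i) x))\<^sup>2) + (\<Sum>i\<in>{2,4,6}. LINT x:{0..L}|lborel. (cmod (sdiff U V i x))\<^sup>2))"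
    by (rule C(2)[OF W])
  also have "\<dots> < C * (3 * r + 3 * r)"
  proof -
    have o: "(LINT x:{0..L}|lborel. (cmod (dx L (sdiff U V i) x))\<^sup>2) < r" if i: "i \<in> {1,3,5}" for i
    proof -
      have Hs: "H10 L (U i)" "H10 L (V i)" "H10 L (sdiff U V i)" using inH_H10[OF U i] inH_H10[OF domA_inH[OF V] i] inH_H10[OF W i] by auto
      have "AE x in lborel. x \<in> {0..L} \<longrightarrow> dx L (sdiff U V i) x = dx L (U i) x - dx L (V i) x"
        using dx_lin[OF Hs(1,2), of 1 "-1"] par by (simp add: sdiff_def)
      then have "AE x in lborel. x \<in> {0..L} \<longrightarrow> (cmod (dx L (sdiff U V i) x))\<^sup>2 = (cmod (dx L (U i) x - dx L (V i) x))\<^sup>2" by eventually_elim auto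
      then have "(LINT x:{0..L}|lborel. (cmod (dx L (sdiff U V i) x))\<^sup>2) = (LINT x:{0..L}|lborel. (cmod (dx L (U i) x - dx L (V i) x))\<^sup>2)"
        by (intro set_integral_cong_AE' L2_square L2_diff H10_AC(2) Hs)
      then show ?thesis using bspec[OF V1 i] i by (simp only: V_def if_True)
    qed
    have ev: "(LINT x:{0..L}|lborel. (cmod (sdiff U V i x))\<^sup>2) < r" if i: "i \<in> {2,4,6}" for i
      using V2 i by (auto simp: V_def sdiff_def)
    have "(\<Sum>i\<in>{1,3,5::nat}. LINT x:{0..L}|lborel. (cmod (dx L (sdiff U V i) x))\<^sup>2) < 3 * r" using o[of 1] o[of 3] o[of 5] by simp
    moreover have "(\<Sum>i\<in>{2,4,6::nat}. LINT x:{0..L}|lborel. (cmod (sdiff U V i x))\<^sup>2) < 3 * r" using ev[of 2] ev[of 4] ev[of 6] by simp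
    ultimately show ?thesis using C(1) by (intro mult_strict_left_mono add_strict_mono)
  qed
  also have "\<dots> = e\<^sup>2" using C(1) by (simp add: r_def)
  finally have "N (sdiff U V) < e" using e by (intro power2_less_imp_less[of "N (sdiff U V)" e]) auto
  then show ?thesis using V by blast
qed

end

section \<open>Contractivity of the semigroup\<close>

text \<open>The generator yields estimates to the right only, so a supremum argument with a small
  slope \<open>r\<close> replaces the mean value theorem: continuity carries the bound to the last
  admissible time, and the estimate to the right carries it beyond.\<close>

lemma nonincreasing_of_right_derivative:
  fixes f :: "real \<Rightarrow> real"
  assumes c: "continuous_on {0..} f"
    and d: "\<And>t e. 0 \<le> t \<Longrightarrow> 0 < e \<Longrightarrow> \<exists>d>0. \<forall>h. 0 < h \<and> h < d \<longrightarrow> f (t + h) \<le> f t + e * h"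
    and t: "0 \<le> t"
  shows "f t \<le> f 0"
proof (rule field_le_epsilon)
  fix e :: real assume e: "0 < e"
  define r where "r = e / (t + 1)"
  have r: "0 < r" using e t by (simp add: r_def)
  define A where "A = {s. 0 \<le> s \<and> s \<le> t \<and> (\<forall>x. 0 \<le> x \<and> x \<le> s \<longrightarrow> f x \<le> f 0 + r * x)}"
  have A0: "0 \<in> A" using t by (auto simp: A_def)
  have bd: "bdd_above A" by (rule bdd_aboveI[of _ t]) (auto simp: A_def)
  define s where "s = Sup A"
  have "0 \<le> s" using cSup_upper[OF A0 bd] by (simp add: s_def)
  moreover have "s \<le> t" unfolding s_def by (rule cSup_least) (use A0 in \<open>auto simp: A_def\<close>)
  ultimately have s: "0 \<le> s" "s \<le> t" .
  have below: "f x \<le> f 0 + r * x" if x: "0 \<le> x" "x < s" for x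
  proof -
    obtain y where "y \<in> A" "x < y" using less_cSup_iff[OF _ bd, of x] A0 x(2) by (auto simp: s_def)
    then show ?thesis using x by (auto simp: A_def)
  qed
  have at_s: "f s \<le> f 0 + r * s"
  proof (cases "s = 0")
    case False
    then have s0: "0 < s" using s by simp
    have "continuous_on {0..s} f" by (rule continuous_on_subset[OF c]) auto
    then have lim: "(f \<longlongrightarrow> f s) (at_left s)"
      using s0 by (simp add: continuous_on_Icc_at_leftD)
    have "((\<lambda>x. f 0 + r * x) \<longlongrightarrow> f 0 + r * s) (at_left s)" by (intro tendsto_intros)
    moreover have "\<forall>\<^sub>F x in at_left s. f x \<le> f 0 + r * x"
      using eventually_at_left_real[OF s0] by eventually_elim (use below in auto)
    ultimately show ?thesis using lim by (intro tendsto_le[of "at_left s"]) auto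
  qed simp
  have "s = t"
  proof (rule ccontr)
    assume "s \<noteq> t"
    then have st: "s < t" using s by simp
    obtain d where dd: "0 < d" "\<And>h. 0 < h \<Longrightarrow> h < d \<Longrightarrow> f (s + h) \<le> f s + r * h" using d[OF s(1) r] by blast
    define y where "y = s + min (d/2) (t - s)"
    have y: "s < y" "y \<le> t" using dd st by (auto simp: y_def)
    have "f x \<le> f 0 + r * x" if x: "0 \<le> x" "x \<le> y" for x
    proof (cases "x \<le> s")
      case True
      then show ?thesis using below[of x] at_s x by (cases "x = s") auto
    next
      case False
      have "f (s + (x - s)) \<le> f s + r * (x - s)" using False x dd by (intro dd(2)) (auto simp: y_def)
      then show ?thesis using at_s by (simp add: algebra_simps)
    qed
    then have "y \<in> A" using y s by (auto simp: A_def)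
    then have "y \<le> s" unfolding s_def by (rule cSup_upper[OF _ bd])
    then show False using y by simp
  qed
  then have "f t \<le> f 0 + r * t" using at_s by simp
  also have "r * t \<le> e" using e t by (simp add: r_def field_simps)
  finally show "f t \<le> f 0 + e" by simp
qed

lemma set_integral_sum:
  fixes f :: "nat \<Rightarrow> real \<Rightarrow> real"
  assumes "\<And>i. i \<in> I \<Longrightarrow> set_integrable lborel S (f i)"
  shows "set_integrable lborel S (\<lambda>x. \<Sum>i\<in>I. f i x)" "(LINT x:S|lborel. \<Sum>i\<in>I. f i x) = (\<Sum>i\<in>I. LINT x:S|lborel. f i x)"
  using assms unfolding set_lebesgue_integral_def set_integrable_def scaleR_sum_right
  by (auto intro: Bochner_Integration.integrable_sum Bochner_Integration.integral_sum)

section \<open>Parseval's identity for the discrete Fourier transform\<close>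

lemma dft_parseval:
  fixes z :: "nat \<Rightarrow> complex"
  assumes m: "0 < m"
  shows "(\<Sum>k<m. (cmod (\<Sum>j<m. cis (2 * pi * real k * real j / real m) * z j))\<^sup>2) = real m * (\<Sum>j<m. (cmod (z j))\<^sup>2)"
proof -
  define w where "w k j = cis (2 * pi * real k * real j / real m)" for k j
  have orth: "(\<Sum>k<m. w k j * cnj (w k i)) = (if j = i then of_nat m else 0)" if ji: "j < m" "i < m" for j i
  proof -
    define r where "r = cis (2 * pi * (real j - real i) / real m)"
    have e: "w k j * cnj (w k i) = r ^ k" for k
    proof -
      have "w k j * cnj (w k i) = cis (2 * pi * real k * real j / real m + - (2 * pi * real k * real i / real m))"
        by (simp only: w_def cis_cnj cis_mult)
      also have "2 * pi * real k * real j / real m + - (2 * pi * real k * real i / real m) = real k * (2 * pi * (real j - real i) / real m)"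
        by (simp add: diff_divide_distrib algebra_simps)
      finally show ?thesis unfolding r_def Complex.DeMoivre .
    qed
    show ?thesis
    proof (cases "j = i")
      case True
      then show ?thesis unfolding e r_def by simp
    next
      case False
      \<comment> \<open>Otherwise \<open>m\<close> would divide the difference of two distinct
        indices below \<open>m\<close>. For such a root of unity the geometric sum vanishes.\<close>
      have "r \<noteq> 1"
      proof
        assume "r = 1"
        then have "cos (2 * pi * (real j - real i) / real m) = 1" unfolding r_def by (metis cis.sel(1) one_complex.sel(1))
        then obtain n :: int where n: "2 * pi * (real j - real i) / real m = of_int n * 2 * pi" using cos_one_2pi_int by auto
        have "2 * pi * ((real j - real i) / real m) = 2 * pi * of_int n" using n by simp
        then have "(real j - real i) / real m = of_int n" by (subst (asm) mult_left_cancel) auto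
        then have "real j - real i = of_int n * real m" using m by (simp add: field_simps)
        then have nm: "int j - int i = n * int m" by (metis of_int_diff of_int_eq_iff of_int_mult of_int_of_nat_eq)
        then have "int m dvd int j - int i" by simp
        moreover have "\<bar>int j - int i\<bar> < int m" "int j - int i \<noteq> 0" using ji False by auto
        ultimately show False using zdvd_imp_le[of "int m" "\<bar>int j - int i\<bar>"] by simp
      qed
      moreover have "r ^ m = 1"
      proof -
        have "r ^ m = cis (2 * pi * of_int (int j - int i))"
        proof -
          have "real m * (2 * pi * (real j - real i) / real m) = 2 * pi * of_int (int j - int i)" using m by simp
          then show ?thesis unfolding r_def Complex.DeMoivre by (simp only:)
        qed
        then show ?thesis by (simp only: cis_multiple_2pi Ints_of_int)
      qed
      ultimately show ?thesis unfolding e using False by (simp add: geometric_sum)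
    qed
  qed
  have "complex_of_real (\<Sum>k<m. (cmod (\<Sum>j<m. w k j * z j))\<^sup>2) = (\<Sum>k<m. (\<Sum>j<m. w k j * z j) * cnj (\<Sum>i<m. w k i * z i))"
    by (simp only: of_real_sum complex_norm_square)
  also have "\<dots> = (\<Sum>k<m. \<Sum>j<m. \<Sum>i<m. (w k j * cnj (w k i)) * (z j * cnj (z i)))"
    by (simp add: sum_product mult_ac)
  also have "\<dots> = (\<Sum>j<m. \<Sum>k<m. \<Sum>i<m. (w k j * cnj (w k i)) * (z j * cnj (z i)))" by (rule sum.swap)
  also have "\<dots> = (\<Sum>j<m. \<Sum>i<m. \<Sum>k<m. (w k j * cnj (w k i)) * (z j * cnj (z i)))"
    by (rule sum.cong[OF refl sum.swap])
  also have "\<dots> = (\<Sum>j<m. \<Sum>i<m. (if j = i then of_nat m else 0) * (z j * cnj (z i)))"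
    unfolding sum_distrib_right[symmetric] by (intro sum.cong refl) (simp add: orth)
  also have "\<dots> = (\<Sum>j<m. of_nat m * (z j * cnj (z j)))"
    by (intro sum.cong refl) (simp add: if_distrib if_distribR sum.delta' cong: if_cong)
  also have "\<dots> = complex_of_real (real m * (\<Sum>j<m. (cmod (z j))\<^sup>2))"
    by (simp only: of_real_mult of_real_sum complex_norm_square sum_distrib_left of_real_of_nat_eq)
  finally show ?thesis unfolding w_def of_real_eq_iff .
qed

context bresse
begin

section \<open>States up to the seminorm, and finite combinations\<close>

definition lin :: "complex \<Rightarrow> state \<Rightarrow> complex \<Rightarrow> state \<Rightarrow> state" where
  "lin c U d V = sadd (sscale c U) (sscale d V)"

text \<open>States are representatives: equality in the energy space is equality up to the seminorm.\<close>
definition eqv :: "state \<Rightarrow> state \<Rightarrow> bool" where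
  "eqv U V \<longleftrightarrow> inH L U \<and> inH L V \<and> N (sdiff U V) = 0"

lemma lin_inH: "inH L U \<Longrightarrow> inH L V \<Longrightarrow> inH L (lin c U d V)" unfolding lin_def by (rule inH_lin)
lemma lin_le: "inH L U \<Longrightarrow> inH L V \<Longrightarrow> N (lin c U d V) \<le> cmod c * N U + cmod d * N V" unfolding lin_def by (rule N_lin_le)
lemma sdiff_lin: "sdiff U V = lin 1 U (-1) V" unfolding lin_def by (rule sdiff_eq)

lemma eqv_inH: "eqv U V \<Longrightarrow> inH L U" "eqv U V \<Longrightarrow> inH L V" by (auto simp: eqv_def)
lemma eqv_N: "eqv U V \<Longrightarrow> N U = N V" by (simp add: eqv_def N_eq_0)
lemma eqv_sym: "eqv U V \<Longrightarrow> eqv V U" using N_sdiff_commute by (auto simp: eqv_def)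
lemma N_self: assumes "inH L U" shows "N (sdiff U U) = 0"
proof -
  have "sdiff U U = sscale 0 U" by (simp add: sdiff_def sscale_def)
  then show ?thesis using N_sscale[OF assms, of 0] by simp
qed
lemma eqv_refl: "inH L U \<Longrightarrow> eqv U U" by (simp add: eqv_def N_self)
lemma eqv_trans [trans]: "eqv U V \<Longrightarrow> eqv V W \<Longrightarrow> eqv U W"
  using N_sdiff_triangle[of U V W] N_nonneg[of "sdiff U W"] by (auto simp: eqv_def)

lemma eqv_lin: assumes "eqv U U'" "eqv V V'" shows "eqv (lin c U d V) (lin c U' d V')"
proof -
  have e: "sdiff (lin c U d V) (lin c U' d V') = lin c (sdiff U U') d (sdiff V V')"
    by (simp add: sdiff_def lin_def sadd_def sscale_def algebra_simps)
  have "N (lin c (sdiff U U') d (sdiff V V')) \<le> cmod c * N (sdiff U U') + cmod d * N (sdiff V V')"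
    using assms by (intro lin_le inH_sdiff) (auto simp: eqv_def)
  then show ?thesis using assms N_nonneg[of "lin c (sdiff U U') d (sdiff V V')"] unfolding eqv_def e by (auto intro: lin_inH)
qed

lemma eqv_sdiff: "eqv U U' \<Longrightarrow> eqv V V' \<Longrightarrow> eqv (sdiff U V) (sdiff U' V')"
  unfolding sdiff_lin by (rule eqv_lin)

lemma eqv_sscale: assumes "eqv U U'" shows "eqv (sscale c U) (sscale c U')"
proof -
  have "sscale c U = lin c U 0 U" "sscale c U' = lin c U' 0 U'" by (simp_all add: lin_def sadd_def sscale_def)
  then show ?thesis using eqv_lin[OF assms assms, of c 0] by simp
qed

text \<open>Displacement components are required to coincide as functions, since \<open>dx\<close>
  is a choice made for each function; for the velocities equality almost everywhere is
  enough.\<close>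

lemma eqv_I:
  assumes "inH L X" "inH L Y" "\<And>i. i \<in> {1,3,5} \<Longrightarrow> X i = Y i"
    "\<And>i. i \<in> {2,4,6} \<Longrightarrow> AE x in lborel. x \<in> {0..L} \<longrightarrow> X i x = Y i x"
  shows "eqv X Y"
proof -
  have ae2: "AE x in lborel. x \<in> {0..L} \<longrightarrow> X 2 x = Y 2 x" "AE x in lborel. x \<in> {0..L} \<longrightarrow> X 4 x = Y 4 x" "AE x in lborel. x \<in> {0..L} \<longrightarrow> X 6 x = Y 6 x"
    using assms(4) by auto
  have odd: "X 1 = Y 1" "X 3 = Y 3" "X 5 = Y 5" using assms(3) by auto
  have J: "AE x in lborel. x \<in> {0..L} \<longrightarrow> J (sdiff X Y) i x = 0" for i
  proof -
    have "AE x in lborel. x \<in> {0..L} \<longrightarrow> J (sdiff X Y) i x = 1 * J X i x + (-1) * J Y i x"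
      unfolding sdiff_eq by (rule J_lin[OF assms(1,2)])
    then show ?thesis using ae2
      by eventually_elim (auto simp: J_def odd simp del: One_nat_def)
  qed
  have "norm6 L (J (sdiff X Y)) = norm6 L (\<lambda>i x. 0)"
  proof (rule norm6_cong_AE[OF J_L2[OF inH_sdiff[OF assms(1,2)]]])
    show "L2_6 L (\<lambda>i x. 0)" by (auto simp: L2_6_def intro!: L2_continuous)
  qed (rule J)
  also have "\<dots> = 0" by (simp add: norm6_def)
  finally show ?thesis using assms by (simp add: eqv_def N_eq)
qed

lemma A_lin:
  assumes U: "domA L U" and V: "domA L V"
  shows "eqv (A (lin c U d V)) (lin c (A U) d (A V))"
proof (rule eqv_I)
  have UV: "domA L (lin c U d V)" unfolding lin_def by (rule domA_lin[OF U V])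
  show "inH L (A (lin c U d V))" by (rule inH_A[OF UV])
  show "inH L (lin c (A U) d (A V))" by (intro lin_inH inH_A U V)
  show "A (lin c U d V) i = lin c (A U) d (A V) i" if "i \<in> {1,3,5}" for i
    using that by (auto simp: A_def opA_def lin_def sadd_def sscale_def)
  have dx: "AE x in lborel. x \<in> {0..L} \<longrightarrow> dx L (\<lambda>x. c * U i x + d * V i x) x = c * dx L (U i) x + d * dx L (V i) x" if "i \<in> {1..6}" for i
    using domA_H10[OF U that] domA_H10[OF V that] par by (intro dx_lin) auto
  have dxx: "AE x in lborel. x \<in> {0..L} \<longrightarrow> dxx L (\<lambda>x. c * U i x + d * V i x) x = c * dxx L (U i) x + d * dxx L (V i) x" if "i \<in> {1,3,5}" for i
    using domA_H2[OF U that] domA_H2[OF V that] par by (intro dxx_lin) auto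
  have m: "1 \<in> {1..6::nat}" "3 \<in> {1..6::nat}" "5 \<in> {1..6::nat}" "1 \<in> {1,3,5::nat}" "3 \<in> {1,3,5::nat}" "5 \<in> {1,3,5::nat}" by auto
  show "AE x in lborel. x \<in> {0..L} \<longrightarrow> A (lin c U d V) i x = lin c (A U) d (A V) i x" if "i \<in> {2,4,6}" for i
    using dx[OF m(1)] dx[OF m(2)] dx[OF m(3)] dxx[OF m(4)] dxx[OF m(5)] dxx[OF m(6)]
    by eventually_elim (use that in \<open>auto simp: A_def opA_def lin_def sadd_def sscale_def algebra_simps\<close>)
qed

text \<open>In the expanded square the cross term is \<open>- 2 * h\<close> times the dissipation,
  hence nonpositive. An explicit Euler step thus increases the squared norm only at second order in
  \<open>h\<close>.\<close>

lemma euler_step: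
  assumes U: "domA L U" and h: "0 \<le> h"
  shows "(N (lin 1 U (of_real h) (A U)))\<^sup>2 \<le> (N U)\<^sup>2 + h\<^sup>2 * (N (A U))\<^sup>2"
proof -
  have UH: "inH L U" "inH L (A U)" using domA_inH[OF U] inH_A[OF U] by auto
  let ?G = "lin 1 U (of_real h) (A U)"
  have G: "inH L ?G" by (rule lin_inH[OF UH])
  have ae: "AE x in lborel. \<forall>i\<in>{1..6}. x \<in> {0..L} \<longrightarrow> J ?G i x = J U i x + of_real h * J (A U) i x"
  proof (intro AE_finite_allI)
    fix i
    show "AE x in lborel. x \<in> {0..L} \<longrightarrow> J ?G i x = J U i x + of_real h * J (A U) i x"
      using J_lin[OF UH, of 1 "of_real h" i] unfolding lin_def by simp
  qed simp
  note i = dissipation(3)[OF U]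
  have I0: "0 \<le> I6 U" unfolding I6_def set_lebesgue_integral_def by (intro Bochner_Integration.integral_nonneg) auto
  have "(N ?G)\<^sup>2 \<le> (LINT x:{0..L}|lborel. ((\<Sum>i\<in>{1..6}. (cmod (J U i x))\<^sup>2) + h\<^sup>2 * (\<Sum>i\<in>{1..6}. (cmod (J (A U) i x))\<^sup>2)) + 2 * h * Re (\<Sum>i\<in>{1..6}. J (A U) i x * cnj (J U i x)))"
    unfolding N_eq norm6_square
  proof (rule set_integral_mono_AE')
    show "AE x in lborel. x \<in> {0..L} \<longrightarrow> (\<Sum>i\<in>{1..6}. (cmod (J ?G i x))\<^sup>2) \<le> ((\<Sum>i\<in>{1..6}. (cmod (J U i x))\<^sup>2) + h\<^sup>2 * (\<Sum>i\<in>{1..6}. (cmod (J (A U) i x))\<^sup>2)) + 2 * h * Re (\<Sum>i\<in>{1..6}. J (A U) i x * cnj (J U i x))"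
      using ae
    proof eventually_elim
      case (elim x)
      have sq: "(cmod (u + of_real h * a))\<^sup>2 = (cmod u)\<^sup>2 + h\<^sup>2 * (cmod a)\<^sup>2 + 2 * h * Re (a * cnj u)" for u a
        unfolding cmod_power2 by (simp add: power2_eq_square algebra_simps)
      show ?case
      proof
        assume x: "x \<in> {0..L}"
        have "(\<Sum>i\<in>{1..6}. (cmod (J ?G i x))\<^sup>2) = (\<Sum>i\<in>{1..6}. (cmod (J U i x))\<^sup>2 + h\<^sup>2 * (cmod (J (A U) i x))\<^sup>2 + 2 * h * Re (J (A U) i x * cnj (J U i x)))"
          by (rule sum.cong[OF refl]) (use elim x sq in metis)
        then show "(\<Sum>i\<in>{1..6}. (cmod (J ?G i x))\<^sup>2) \<le> ((\<Sum>i\<in>{1..6}. (cmod (J U i x))\<^sup>2) + h\<^sup>2 * (\<Sum>i\<in>{1..6}. (cmod (J (A U) i x))\<^sup>2)) + 2 * h * Re (\<Sum>i\<in>{1..6}. J (A U) i x * cnj (J U i x))"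
          by (simp only: Re_sum sum.distrib sum_distrib_left)
      qed
    qed
  qed (intro set_integral_add(1) set_integrable_mult_right i L2_6_int J_L2 UH G)+
  also have "\<dots> = (N U)\<^sup>2 + h\<^sup>2 * (N (A U))\<^sup>2 - 2 * h * (a0 * I6 U)"
  proof -
    have 1: "set_integrable lborel {0..L} (\<lambda>x. (\<Sum>i\<in>{1..6}. (cmod (J U i x))\<^sup>2) + h\<^sup>2 * (\<Sum>i\<in>{1..6}. (cmod (J (A U) i x))\<^sup>2))"
      "set_integrable lborel {0..L} (\<lambda>x. 2 * h * Re (\<Sum>i\<in>{1..6}. J (A U) i x * cnj (J U i x)))"
      "set_integrable lborel {0..L} (\<lambda>x. h\<^sup>2 * (\<Sum>i\<in>{1..6}. (cmod (J (A U) i x))\<^sup>2))"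
      by (intro set_integral_add(1) set_integrable_mult_right i L2_6_int J_L2 UH)+
    show ?thesis
      unfolding set_integral_add(2)[OF 1(1,2)] set_integral_add(2)[OF L2_6_int[OF J_L2[OF UH(1)]] 1(3)] set_integral_mult_right
        dissipation(1)[OF U] I6_damp[OF UH(1)] N_eq norm6_square by simp
  qed
  also have "\<dots> \<le> (N U)\<^sup>2 + h\<^sup>2 * (N (A U))\<^sup>2" using h I0 par by simp
  finally show ?thesis .
qed

text \<open>Finite combinations are built recursively from \<open>lin\<close>, so that membership in
  the domain and linearity of \<open>A\<close> up to \<open>eqv\<close> pass through by
  induction.\<close>

fun comb :: "nat \<Rightarrow> (nat \<Rightarrow> complex) \<Rightarrow> (nat \<Rightarrow> state) \<Rightarrow> state" where
  "comb 0 c W = (\<lambda>i x. 0)"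
| "comb (Suc m) c W = lin 1 (comb m c W) (c m) (W m)"

lemma comb_eq: "comb m c W i x = (\<Sum>j<m. c j * W j i x)"
  by (induction m) (simp_all add: lin_def sadd_def sscale_def)

lemma H10_zero: "H10 L (\<lambda>_. 0)"
  by (rule H10_I[OF AC_const]) (auto intro!: L2_continuous)

lemma domA_zero: "domA L (\<lambda>i x. 0)"
  unfolding domA_def using H10_zero H2_I[OF AC_const[of L 0] AC_const] L2_continuous[OF continuous_on_const] by auto

lemma comb_inH: "(\<And>j. j < m \<Longrightarrow> inH L (W j)) \<Longrightarrow> inH L (comb m c W)"
  by (induction m) (auto intro: lin_inH domA_inH[OF domA_zero])

lemma comb_domA: "(\<And>j. j < m \<Longrightarrow> domA L (W j)) \<Longrightarrow> domA L (comb m c W)"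
  by (induction m) (auto simp: lin_def intro: domA_lin domA_zero)

lemma A_zero: "eqv (A (\<lambda>i x. 0)) (\<lambda>i x. 0)"
proof -
  have "eqv (A (lin 0 (\<lambda>i x. 0) 0 (\<lambda>i x. 0))) (lin 0 (A (\<lambda>i x. 0)) 0 (A (\<lambda>i x. 0)))" by (rule A_lin[OF domA_zero domA_zero])
  then show ?thesis by (simp add: lin_def sadd_def sscale_def)
qed

lemma A_comb: "(\<And>j. j < m \<Longrightarrow> domA L (W j)) \<Longrightarrow> eqv (A (comb m c W)) (comb m c (\<lambda>j. A (W j)))"
proof (induction m)
  case 0
  then show ?case using A_zero by simp
next
  case (Suc m)
  have "eqv (A (comb (Suc m) c W)) (lin 1 (A (comb m c W)) (c m) (A (W m)))"
    unfolding comb.simps by (rule A_lin) (use Suc.prems in \<open>auto intro: comb_domA\<close>)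
  also have "eqv \<dots> (lin 1 (comb m c (\<lambda>j. A (W j))) (c m) (A (W m)))"
    by (rule eqv_lin) (use Suc in \<open>auto intro: eqv_refl inH_A\<close>)
  finally show ?case by simp
qed

lemma J_comb: "(\<And>j. j < m \<Longrightarrow> inH L (W j)) \<Longrightarrow> AE x in lborel. x \<in> {0..L} \<longrightarrow> J (comb m c W) i x = (\<Sum>j<m. c j * J (W j) i x)"
proof (induction m)
  case 0
  have z: "inH L (\<lambda>i x. 0)" by (rule domA_inH[OF domA_zero])
  have "AE x in lborel. x \<in> {0..L} \<longrightarrow> J (sadd (sscale 0 (\<lambda>i x. 0)) (sscale 0 (\<lambda>i x. 0))) i x = 0 * J (\<lambda>i x. 0) i x + 0 * J (\<lambda>i x. 0) i x"
    by (rule J_lin[OF z z])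
  then show ?case by (simp add: sadd_def sscale_def)
next
  case (Suc m)
  have "AE x in lborel. x \<in> {0..L} \<longrightarrow> J (comb (Suc m) c W) i x = 1 * J (comb m c W) i x + c m * J (W m) i x"
    unfolding comb.simps lin_def by (rule J_lin) (use Suc.prems in \<open>auto intro: comb_inH\<close>)
  moreover have "AE x in lborel. x \<in> {0..L} \<longrightarrow> J (comb m c W) i x = (\<Sum>j<m. c j * J (W j) i x)" using Suc by auto
  ultimately show ?case by eventually_elim auto
qed

text \<open>The scalar identity holds at almost every point for each of the six components of
  \<open>J\<close>; summation and integration give it for the energy norm.\<close>

lemma parseval_states:
  assumes m: "0 < m" and W: "\<And>j. j < m \<Longrightarrow> inH L (W j)"
  shows "(\<Sum>k<m. (N (comb m (\<lambda>j. cis (2 * pi * real k * real j / real m)) W))\<^sup>2) = real m * (\<Sum>j<m. (N (W j))\<^sup>2)"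
proof -
  define e where "e k j = cis (2 * pi * real k * real j / real m)" for k j
  have i: "set_integrable lborel {0..L} (\<lambda>x. \<Sum>i\<in>{1..6}. (cmod (J (comb m (e k) W) i x))\<^sup>2)" for k
    by (rule L2_6_int[OF J_L2[OF comb_inH[OF W]]])
  have i2: "set_integrable lborel {0..L} (\<lambda>x. \<Sum>i\<in>{1..6}. (cmod (J (W j) i x))\<^sup>2)" if "j < m" for j
    by (rule L2_6_int[OF J_L2[OF W[OF that]]])
  have sum1: "(\<Sum>k<m. (N (comb m (e k) W))\<^sup>2) = (LINT x:{0..L}|lborel. \<Sum>k<m. \<Sum>i\<in>{1..6}. (cmod (J (comb m (e k) W) i x))\<^sup>2)"
    "set_integrable lborel {0..L} (\<lambda>x. \<Sum>k<m. \<Sum>i\<in>{1..6}. (cmod (J (comb m (e k) W) i x))\<^sup>2)"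
    unfolding N_eq norm6_square using set_integral_sum[of "{..<m}", OF i] by auto
  have sum2: "(\<Sum>j<m. (N (W j))\<^sup>2) = (LINT x:{0..L}|lborel. \<Sum>j<m. \<Sum>i\<in>{1..6}. (cmod (J (W j) i x))\<^sup>2)"
    "set_integrable lborel {0..L} (\<lambda>x. \<Sum>j<m. \<Sum>i\<in>{1..6}. (cmod (J (W j) i x))\<^sup>2)"
    unfolding N_eq norm6_square using set_integral_sum[of "{..<m}", OF i2] by auto
  have "AE x in lborel. \<forall>k\<in>{..<m}. \<forall>i\<in>{1..6}. x \<in> {0..L} \<longrightarrow> J (comb m (e k) W) i x = (\<Sum>j<m. e k j * J (W j) i x)"
    by (intro AE_finite_allI J_comb W) auto
  then have "AE x in lborel. x \<in> {0..L} \<longrightarrow> (\<Sum>k<m. \<Sum>i\<in>{1..6}. (cmod (J (comb m (e k) W) i x))\<^sup>2) = real m * (\<Sum>j<m. \<Sum>i\<in>{1..6}. (cmod (J (W j) i x))\<^sup>2)"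
  proof eventually_elim
    case (elim x)
    show ?case
    proof
      assume x: "x \<in> {0..L}"
      have "(\<Sum>k<m. \<Sum>i\<in>{1..6}. (cmod (J (comb m (e k) W) i x))\<^sup>2) = (\<Sum>i\<in>{1..6}. \<Sum>k<m. (cmod (\<Sum>j<m. e k j * J (W j) i x))\<^sup>2)"
        by (subst sum.swap, intro sum.cong refl) (use elim x in auto)
      also have "\<dots> = (\<Sum>i\<in>{1..6}. real m * (\<Sum>j<m. (cmod (J (W j) i x))\<^sup>2))"
        unfolding e_def by (intro sum.cong refl dft_parseval m)
      also have "\<dots> = real m * (\<Sum>j<m. \<Sum>i\<in>{1..6}. (cmod (J (W j) i x))\<^sup>2)"
        unfolding sum_distrib_left[symmetric] by (subst sum.swap) (rule refl)
      finally show "(\<Sum>k<m. \<Sum>i\<in>{1..6}. (cmod (J (comb m (e k) W) i x))\<^sup>2) = real m * (\<Sum>j<m. \<Sum>i\<in>{1..6}. (cmod (J (W j) i x))\<^sup>2)" .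
    qed
  qed
  then have "(LINT x:{0..L}|lborel. \<Sum>k<m. \<Sum>i\<in>{1..6}. (cmod (J (comb m (e k) W) i x))\<^sup>2) = (LINT x:{0..L}|lborel. real m * (\<Sum>j<m. \<Sum>i\<in>{1..6}. (cmod (J (W j) i x))\<^sup>2))"
    by (intro set_integral_cong_AE' sum1 sum2 set_integrable_mult_right)
  then show ?thesis unfolding e_def[symmetric] sum1(1) sum2(1) by simp
qed

end

section \<open>Orbits: representatives, local bounds, continuity, contractivity\<close>

locale bresse_semigroup = bresse +
  fixes T :: "real \<Rightarrow> state \<Rightarrow> state"
  assumes semigroup: "is_semigroup_of_A \<rho>1 \<rho>2 k1 k2 k1 l L a0 \<beta> T"
begin

lemmas props = semigroup[unfolded is_semigroup_of_A_def Let_def, folded N_def A_def]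

lemma T_inH: "0 \<le> t \<Longrightarrow> inH L U \<Longrightarrow> inH L (T t U)"
  by (rule props[THEN conjunct1, rule_format])

lemma T_lin: "0 \<le> t \<Longrightarrow> inH L U \<Longrightarrow> inH L V \<Longrightarrow> eqv (T t (lin c U d V)) (lin c (T t U) d (T t V))"
  using props[THEN conjunct2, THEN conjunct1, rule_format, of t U V c d]
  by (simp add: eqv_def lin_def T_inH inH_lin)

lemma T_bounded: "0 \<le> t \<Longrightarrow> \<exists>C. \<forall>U. inH L U \<longrightarrow> N (T t U) \<le> C * N U"
  by (rule props[THEN conjunct2, THEN conjunct2, THEN conjunct1, THEN spec, THEN mp])

lemma T_0: assumes "inH L U" shows "eqv (T 0 U) U"
proof -
  have "N (sdiff (T 0 U) U) = 0"
    by (rule props[THEN conjunct2, THEN conjunct2, THEN conjunct2, THEN conjunct1, rule_format, OF assms])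
  then show ?thesis using assms by (simp add: eqv_def T_inH)
qed

lemma T_add: assumes "0 \<le> s" "0 \<le> t" "inH L U" shows "eqv (T (s + t) U) (T s (T t U))"
proof -
  have "N (sdiff (T (s + t) U) (T s (T t U))) = 0"
    using props[THEN conjunct2, THEN conjunct2, THEN conjunct2, THEN conjunct2, THEN conjunct1, rule_format, of s t U] assms by simp
  then show ?thesis using assms by (simp add: eqv_def T_inH)
qed

lemma T_cont0: "inH L U \<Longrightarrow> ((\<lambda>t. N (sdiff (T t U) U)) \<longlongrightarrow> 0) (at_right 0)"
  by (rule props[THEN conjunct2, THEN conjunct2, THEN conjunct2, THEN conjunct2, THEN conjunct2, THEN conjunct1, rule_format])

lemma T_generator: "domA L U \<Longrightarrow> ((\<lambda>h. N (sdiff (sscale (of_real (1/h)) (sdiff (T h U) U)) (A U))) \<longlongrightarrow> 0) (at_right 0)"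
  by (rule props[THEN conjunct2, THEN conjunct2, THEN conjunct2, THEN conjunct2, THEN conjunct2, THEN conjunct2, THEN conjunct1, rule_format])

lemma T_generator_conv:
  "inH L U \<Longrightarrow> inH L V \<Longrightarrow> ((\<lambda>h. N (sdiff (sscale (of_real (1/h)) (sdiff (T h U) U)) V)) \<longlongrightarrow> 0) (at_right 0)
    \<Longrightarrow> \<exists>U'. domA L U' \<and> N (sdiff U U') = 0 \<and> N (sdiff (A U') V) = 0"
  using props[THEN conjunct2, THEN conjunct2, THEN conjunct2, THEN conjunct2, THEN conjunct2, THEN conjunct2, THEN conjunct2, THEN spec, THEN spec, THEN mp] by simp

lemma T_sdiff: "0 \<le> t \<Longrightarrow> inH L U \<Longrightarrow> inH L V \<Longrightarrow> eqv (T t (sdiff U V)) (sdiff (T t U) (T t V))"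
  unfolding sdiff_lin by (rule T_lin)

lemma T_sscale: assumes "0 \<le> t" "inH L U" shows "eqv (T t (sscale c U)) (sscale c (T t U))"
proof -
  have e: "sscale c X = lin c X 0 X" for X by (simp add: lin_def sadd_def sscale_def)
  show ?thesis unfolding e by (rule T_lin[OF assms assms(2)])
qed

lemma T_eqv: assumes "0 \<le> t" "eqv U V" shows "eqv (T t U) (T t V)"
proof -
  have i: "inH L U" "inH L V" using eqv_inH[OF assms(2)] by auto
  obtain C where C: "\<And>U. inH L U \<Longrightarrow> N (T t U) \<le> C * N U" using T_bounded[OF assms(1)] by blast
  have "N (sdiff (T t U) (T t V)) = N (T t (sdiff U V))" using eqv_N[OF T_sdiff[OF assms(1) i]] by simp
  also have "\<dots> \<le> C * N (sdiff U V)" by (rule C[OF inH_sdiff[OF i]])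
  also have "\<dots> = 0" using assms(2) by (simp add: eqv_def)
  finally show ?thesis using N_nonneg[of "sdiff (T t U) (T t V)"] T_inH[OF assms(1)] i by (auto simp: eqv_def)
qed

lemma T_commute:
  assumes "0 \<le> s" "0 \<le> t" "inH L U" shows "eqv (T s (T t U)) (T t (T s U))"
  using eqv_trans[OF eqv_sym[OF T_add[OF assms]]] T_add[OF assms(2,1,3)] by (simp add: add.commute)

lemma small_time:
  assumes "inH L U" "0 < e" shows "\<exists>d>0. \<forall>h. 0 < h \<and> h < d \<longrightarrow> N (sdiff (T h U) U) < e"
proof -
  have "\<forall>\<^sub>F h in at_right 0. N (sdiff (T h U) U) < e" by (rule order_tendstoD(2)[OF T_cont0[OF assms(1)] assms(2)])
  then show ?thesis unfolding eventually_at_right_field by auto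
qed

lemma step_right:
  assumes t: "0 \<le> t" and h: "0 < h" and U: "inH L U"
  shows "\<bar>N (T (t + h) U) - N (T t U)\<bar> \<le> N (sdiff (T h (T t U)) (T t U))"
proof -
  have TU: "inH L (T t U)" using T_inH[OF t U] .
  have "eqv (T (t + h) U) (T h (T t U))" using T_add[of h t U] h t U by (simp add: add.commute)
  then have "N (T (t + h) U) = N (T h (T t U))" by (rule eqv_N)
  then show ?thesis using N_diff_le[OF T_inH[of h] TU] h TU by auto
qed

text \<open>The operator norm is finite for every \<open>t\<close>; since its superlevel sets are open from the right,
  Baire's theorem makes it bounded on some interval inside every interval.\<close>
lemma bounded_on_subinterval:
  assumes ab: "0 \<le> a" "a < b"
  shows "\<exists>c d n. a < c \<and> c < d \<and> d < b \<and> (\<forall>t U. c < t \<longrightarrow> t < d \<longrightarrow> inH L U \<longrightarrow> N (T t U) \<le> real n * N U)"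
proof (rule ccontr)
  assume neg: "\<not> ?thesis"
  define V where "V n = {t. a < t \<and> t < b \<and> (\<exists>U. inH L U \<and> N (T t U) > real n * N U)}" for n
  have dense: "\<exists>t\<in>V n. c < t \<and> t < d" if "a < c" "c < d" "d < b" for c d n
  proof -
    have "\<not> (\<forall>t U. c < t \<longrightarrow> t < d \<longrightarrow> inH L U \<longrightarrow> N (T t U) \<le> real n * N U)" using neg that by blast
    then obtain t U where "c < t" "t < d" "inH L U" "real n * N U < N (T t U)" by (auto simp: not_le)
    then show ?thesis using that by (intro bexI[of _ t]) (auto simp: V_def)
  qed
  have right_open: "\<exists>d>t. {t..<d} \<subseteq> V n" if t: "t \<in> V n" for t n
  proof -
    obtain U where U: "inH L U" "N (T t U) > real n * N U" and tb: "a < t" "t < b" using t by (auto simp: V_def)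
    have t0: "0 \<le> t" using tb ab by simp
    define e where "e = N (T t U) - real n * N U"
    obtain d where d: "0 < d" "\<And>h. 0 < h \<Longrightarrow> h < d \<Longrightarrow> N (sdiff (T h (T t U)) (T t U)) < e"
      using small_time[OF T_inH[OF t0 U(1)], of e] U by (auto simp: e_def)
    have "{t..<min b (t + d)} \<subseteq> V n"
    proof
      fix x assume x: "x \<in> {t..<min b (t + d)}"
      show "x \<in> V n"
      proof (cases "x = t")
        case False
        then have "\<bar>N (T (t + (x - t)) U) - N (T t U)\<bar> \<le> N (sdiff (T (x - t) (T t U)) (T t U))"
          using x by (intro step_right t0 U) auto
        also have "\<dots> < e" using False x by (intro d) auto
        finally have "N (T x U) > real n * N U" by (simp add: e_def)
        then show ?thesis using x tb U by (auto simp: V_def)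
      qed (use t in simp)
    qed
    then show ?thesis using tb d by (intro exI[of _ "min b (t + d)"]) auto
  qed
  \<comment> \<open>A compact subinterval provides the closed set for Baire's theorem and keeps some
    room on both sides inside the given interval.\<close>
  define a' b' where "a' = a + (b - a)/3" and "b' = b - (b - a)/3"
  have a'b': "a < a'" "a' < b'" "b' < b" using ab by (auto simp: a'_def b'_def field_simps)
  define S where "S = {a'..b'}"
  define G where "G = range (\<lambda>n::nat. S \<inter> interior (V n))"
  have "S \<subseteq> closure (\<Inter>G)"
  proof (rule Baire)
    show "closed S" by (simp add: S_def)
    show "countable G" by (simp add: G_def)
    fix W assume "W \<in> G"
    then obtain n where W: "W = S \<inter> interior (V n)" by (auto simp: G_def)
    have "x \<in> closure W" if x: "x \<in> S" for x
      unfolding closure_approachable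
    proof (intro allI impI)
      fix e :: real assume e: "0 < e"
      define c d where "c = max a' (x - e)" and "d = min b' (x + e)"
      have cd: "a < c" "c < d" "d < b" using x e a'b' by (auto simp: c_def d_def S_def)
      obtain t where t: "t \<in> V n" "c < t" "t < d" using dense[OF cd] by blast
      obtain r where r: "t < r" "{t..<r} \<subseteq> V n" using right_open[OF t(1)] by blast
      \<comment> \<open>The point \<open>t\<close> itself may fail to be interior to
        \<open>V n\<close>; a point slightly to its right is interior.\<close>
      define y where "y = t + (min r d - t)/2"
      have y: "t < y" "y < r" "y < d" using r t by (auto simp: y_def min_def field_simps)
      have "{t<..<r} \<subseteq> V n" using r(2) by auto
      then have "y \<in> interior (V n)" using y by (intro interiorI[of "{t<..<r}"]) auto
      moreover have "y \<in> S" "dist y x < e" using y t by (auto simp: S_def c_def d_def dist_real_def)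
      ultimately show "\<exists>y\<in>W. dist y x < e" by (auto simp: W)
    qed
    then show "openin (top_of_set S) W \<and> S \<subseteq> closure W" unfolding W by (auto intro: openin_open_Int)
  qed
  moreover have "a' \<in> S" using a'b' by (simp add: S_def)
  ultimately have "\<Inter>G \<noteq> {}" by (metis closure_empty empty_iff subsetD)
  \<comment> \<open>A time lying in every \<open>V n\<close> contradicts the boundedness of the
    single operator \<open>T t\<close>.\<close>
  then obtain t where t: "\<And>n. t \<in> V n" unfolding G_def using interior_subset by fastforce
  have "0 \<le> t" using t[of 0] ab by (auto simp: V_def)
  then obtain C where C: "\<And>U. inH L U \<Longrightarrow> N (T t U) \<le> C * N U" using T_bounded by blast
  obtain n where n: "C \<le> real n" using real_arch_simple by blast
  obtain U where U: "inH L U" "N (T t U) > real n * N U" using t[of n] by (auto simp: V_def)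
  have "C * N U \<le> real n * N U" using n N_nonneg by (rule mult_right_mono)
  then show False using C[OF U(1)] U(2) by linarith
qed

text \<open>An interval of boundedness found somewhere before \<open>t\<close> is carried to
  \<open>t\<close> by the fixed bounded operator \<open>T r\<close>, where \<open>r\<close> moves
  the midpoint of that interval to \<open>t\<close>.\<close>

lemma locally_bounded:
  assumes t: "0 < t"
  shows "\<exists>d>0. d < t \<and> (\<exists>K\<ge>0. \<forall>s U. \<bar>s - t\<bar> < d \<longrightarrow> inH L U \<longrightarrow> N (T s U) \<le> K * N U)"
proof -
  obtain c d n where cd: "0 < c" "c < d" "d < t" and n: "\<forall>s U. c < s \<longrightarrow> s < d \<longrightarrow> inH L U \<longrightarrow> N (T s U) \<le> real n * N U"
    using bounded_on_subinterval[OF order_refl t] by blast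
  define r where "r = t - (c + d) / 2"
  have r: "0 < r" using cd by (simp add: r_def)
  obtain C where C: "\<And>U. inH L U \<Longrightarrow> N (T r U) \<le> C * N U" using T_bounded[of r] r by auto
  have "N (T s U) \<le> (\<bar>C\<bar> * real n) * N U" if s: "\<bar>s - t\<bar> < (d - c) / 2" and U: "inH L U" for s U
  proof -
    have "\<bar>s - t\<bar> < (d - c) / 2" by (rule s)
    then have sr: "c < s - r" "s - r < d" unfolding r_def by argo+
    have "N (T s U) = N (T r (T (s - r) U))" using eqv_N[OF T_add[of r "s - r" U]] r sr cd U by simp
    also have "\<dots> \<le> C * N (T (s - r) U)" using sr cd by (intro C T_inH U) auto
    also have "\<dots> \<le> \<bar>C\<bar> * N (T (s - r) U)" by (intro mult_right_mono N_nonneg) simp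
    also have "\<dots> \<le> \<bar>C\<bar> * (real n * N U)" by (intro mult_left_mono n[rule_format] sr U) simp
    finally show ?thesis by (simp add: mult.assoc)
  qed
  then show ?thesis using cd by (intro exI[of _ "(d - c)/2"] conjI exI[of _ "\<bar>C\<bar> * real n"]) (auto simp: field_simps)
qed

text \<open>From the right this is continuity at time zero, applied to \<open>T t U\<close>. From
  the left, \<open>T t U - T x U\<close> is \<open>T x\<close> applied to
  \<open>T (t - x) U - U\<close>, and the bounds on \<open>T x\<close> must be uniform for
  \<open>x\<close> near \<open>t\<close>.\<close>

lemma orbit_continuous:
  assumes U: "inH L U" shows "continuous_on {0..} (\<lambda>t. N (T t U))"
  unfolding continuous_on_iff
proof (intro ballI allI impI)
  fix t e :: real assume "t \<in> {0..}" and e: "0 < e"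
  then have t: "0 \<le> t" by simp
  obtain d where d: "0 < d" "\<And>h. 0 < h \<Longrightarrow> h < d \<Longrightarrow> N (sdiff (T h (T t U)) (T t U)) < e"
    using small_time[OF T_inH[OF t U] e] by blast
  have right: "dist (N (T x U)) (N (T t U)) < e" if "t < x" "x < t + d" for x
    using step_right[OF t, of "x - t" U] d(2)[of "x - t"] that U by (simp add: dist_real_def)
  show "\<exists>d>0. \<forall>x\<in>{0..}. dist x t < d \<longrightarrow> dist (N (T x U)) (N (T t U)) < e"
  proof (cases "t = 0")
    case True
    have "dist (N (T x U)) (N (T t U)) < e" if "x \<in> {0..}" "dist x t < d" for x
      using right[of x] that True e by (cases "x = t") (auto simp: dist_real_def)
    then show ?thesis using d by blast
  next
    case False
    then have t0: "0 < t" using t by simp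
    obtain r K where r: "0 < r" "r < t" and K: "0 \<le> K" "\<And>s U. \<bar>s - t\<bar> < r \<Longrightarrow> inH L U \<Longrightarrow> N (T s U) \<le> K * N U"
      using locally_bounded[OF t0] by blast
    obtain d' where d': "0 < d'" "\<And>h. 0 < h \<Longrightarrow> h < d' \<Longrightarrow> N (sdiff (T h U) U) < e / (K + 1)"
      using small_time[OF U, of "e / (K + 1)"] e K by auto
    have left: "dist (N (T x U)) (N (T t U)) < e" if x: "x < t" "t - x < r" "t - x < d'" for x
    proof -
      have x0: "0 \<le> x" using x r by simp
      have h: "0 \<le> t - x" using x by simp
      have i: "inH L (T (t - x) U)" by (rule T_inH[OF h U])
      have "eqv (T t U) (T x (T (t - x) U))" using T_add[OF x0 h U] by simp
      then have "N (T t U) = N (T x (T (t - x) U))" by (rule eqv_N)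
      then have "dist (N (T x U)) (N (T t U)) \<le> N (sdiff (T x (T (t - x) U)) (T x U))"
        using N_diff_le[OF T_inH[OF x0 i] T_inH[OF x0 U]] by (simp add: dist_real_def abs_minus_commute)
      also have "\<dots> = N (T x (sdiff (T (t - x) U) U))" using eqv_N[OF T_sdiff[OF x0 i U]] by simp
      also have "\<dots> \<le> K * N (sdiff (T (t - x) U) U)" using x by (intro K inH_sdiff i U) auto
      also have "\<dots> \<le> K * (e / (K + 1))" using x K d'(2)[of "t - x"] by (intro mult_left_mono) auto
      also have "\<dots> < e" using K e by (simp add: field_simps)
      finally show ?thesis .
    qed
    define q where "q = min d (min r d')"
    have "dist (N (T x U)) (N (T t U)) < e" if "dist x t < q" for x
      using right[of x] left[of x] that e by (cases x t rule: linorder_cases) (auto simp: dist_real_def q_def)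
    then show ?thesis using d r d' by (intro exI[of _ q]) (auto simp: q_def)
  qed
qed

text \<open>Applying \<open>T t\<close> to the difference quotient of \<open>U\<close> gives that of
  \<open>T t U\<close>, which therefore converges to \<open>T t (A U)\<close>. The clause that every
  differentiable state lies in the domain then provides a representative.\<close>

lemma orbit_in_domain:
  assumes U: "domA L U" and t: "0 \<le> t"
  shows "\<exists>U'. domA L U' \<and> eqv (T t U) U' \<and> eqv (A U') (T t (A U))"
proof -
  have UH: "inH L U" "inH L (A U)" using domA_inH[OF U] inH_A[OF U] by auto
  have TH: "inH L (T t U)" "inH L (T t (A U))" using T_inH[OF t] UH by auto
  obtain C where C: "\<And>U. inH L U \<Longrightarrow> N (T t U) \<le> C * N U" using T_bounded[OF t] by blast
  have le: "N (sdiff (sscale (of_real (1/h)) (sdiff (T h (T t U)) (T t U))) (T t (A U))) \<le> C * N (sdiff (sscale (of_real (1/h)) (sdiff (T h U) U)) (A U))"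
    if h: "0 < h" for h
  proof -
    have h0: "0 \<le> h" using h by simp
    have Th: "inH L (T h U)" by (rule T_inH[OF h0 UH(1)])
    have d: "inH L (sdiff (T h U) U)" "inH L (sscale (of_real (1/h)) (sdiff (T h U) U))" by (intro inH_sscale inH_sdiff Th UH)+
    have "eqv (T t (sdiff (sscale (of_real (1/h)) (sdiff (T h U) U)) (A U))) (sdiff (T t (sscale (of_real (1/h)) (sdiff (T h U) U))) (T t (A U)))"
      by (rule T_sdiff[OF t d(2) UH(2)])
    also have "eqv \<dots> (sdiff (sscale (of_real (1/h)) (T t (sdiff (T h U) U))) (T t (A U)))"
      by (intro eqv_sdiff T_sscale t d eqv_refl TH)
    also have "eqv \<dots> (sdiff (sscale (of_real (1/h)) (sdiff (T t (T h U)) (T t U))) (T t (A U)))"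
      by (intro eqv_sdiff eqv_sscale T_sdiff t Th UH eqv_refl TH)
    also have "eqv \<dots> (sdiff (sscale (of_real (1/h)) (sdiff (T h (T t U)) (T t U))) (T t (A U)))"
      by (intro eqv_sdiff eqv_sscale T_commute t h0 UH eqv_refl TH)
    finally have "N (sdiff (sscale (of_real (1/h)) (sdiff (T h (T t U)) (T t U))) (T t (A U))) = N (T t (sdiff (sscale (of_real (1/h)) (sdiff (T h U) U)) (A U)))"
      by (simp only: eqv_N)
    also have "\<dots> \<le> C * N (sdiff (sscale (of_real (1/h)) (sdiff (T h U) U)) (A U))" by (intro C inH_sdiff d UH)
    finally show ?thesis .
  qed
  have "((\<lambda>h. N (sdiff (sscale (of_real (1/h)) (sdiff (T h (T t U)) (T t U))) (T t (A U)))) \<longlongrightarrow> 0) (at_right 0)"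
  proof (rule tendsto_sandwich[of "\<lambda>_. 0" _ _ "\<lambda>h. C * N (sdiff (sscale (of_real (1/h)) (sdiff (T h U) U)) (A U))"])
    show "((\<lambda>h. C * N (sdiff (sscale (of_real (1/h)) (sdiff (T h U) U)) (A U))) \<longlongrightarrow> 0) (at_right 0)"
      by (rule tendsto_mult_right_zero[OF T_generator[OF U]])
    show "\<forall>\<^sub>F h in at_right 0. N (sdiff (sscale (of_real (1/h)) (sdiff (T h (T t U)) (T t U))) (T t (A U))) \<le> C * N (sdiff (sscale (of_real (1/h)) (sdiff (T h U) U)) (A U))"
      using eventually_at_right_less[of "0::real"] by eventually_elim (rule le)
  qed (auto simp: N_nonneg)
  from T_generator_conv[OF TH this] obtain U' where U': "domA L U'" "N (sdiff (T t U) U') = 0" "N (sdiff (A U') (T t (A U))) = 0" by blast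
  then show ?thesis using TH by (intro exI[of _ U']) (auto simp: eqv_def intro: domA_inH inH_A)
qed

text \<open>On the domain \<open>T h V\<close> is \<open>V + h A V + h R\<close> with
  \<open>R\<close> tending to 0. By \<open>euler_step\<close> the first two terms do not increase
  the squared norm at first order, so its right derivative is at most 0.\<close>

lemma contraction_domA:
  assumes U: "domA L U" and t: "0 \<le> t"
  shows "N (T t U) \<le> N U"
proof -
  have UH: "inH L U" by (rule domA_inH[OF U])
  have "(N (T t U))\<^sup>2 \<le> (N (T 0 U))\<^sup>2"
  proof (rule nonincreasing_of_right_derivative[OF _ _ t])
    show "continuous_on {0..} (\<lambda>t. (N (T t U))\<^sup>2)" by (intro continuous_intros orbit_continuous UH)
    fix s e :: real assume s: "0 \<le> s" and e: "0 < e"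
    obtain V where V: "domA L V" "eqv (T s U) V" using orbit_in_domain[OF U s] by blast
    have VH: "inH L V" "inH L (A V)" using domA_inH[OF V(1)] inH_A[OF V(1)] by auto
    define M where "M = N V + N (A V) + 1"
    have M: "0 \<le> N V" "0 \<le> N (A V)" "1 \<le> M" using N_nonneg by (auto simp: M_def)
    \<comment> \<open>\<open>r\<close> limits the remainder and \<open>d'\<close> the step length;
      the last estimate then splits \<open>e\<close> into \<open>e / 4\<close> and
      \<open>3 * e / 4\<close>.\<close>
    define r where "r = min 1 (e / (4 * M))"
    have r: "0 < r" "r \<le> 1" "r \<le> e / (4 * M)" using e M by (auto simp: r_def)
    have "\<forall>\<^sub>F h in at_right 0. N (sdiff (sscale (of_real (1/h)) (sdiff (T h V) V)) (A V)) < r"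
      by (rule order_tendstoD(2)[OF T_generator[OF V(1)] r(1)])
    then obtain d where d: "0 < d" "\<And>h. 0 < h \<Longrightarrow> h < d \<Longrightarrow> N (sdiff (sscale (of_real (1/h)) (sdiff (T h V) V)) (A V)) < r"
      unfolding eventually_at_right_field by auto
    define d' where "d' = min d (min 1 (e / (4 * (M * M))))"
    have d': "0 < d'" using d e M by (simp add: d'_def)
    have "(N (T (s + h) U))\<^sup>2 \<le> (N (T s U))\<^sup>2 + e * h" if h: "0 < h" "h < d'" for h
    proof -
      have h0: "0 \<le> h" "h < d" "h \<le> 1" "h \<le> e / (4 * (M * M))" using h by (auto simp: d'_def)
      have Th: "inH L (T h V)" by (rule T_inH[OF h0(1) VH(1)])
      have "eqv (T (s + h) U) (T h (T s U))" using T_add[OF h0(1) s UH] by (simp add: add.commute)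
      also have "eqv \<dots> (T h V)" by (rule T_eqv[OF h0(1) V(2)])
      finally have n1: "N (T (s + h) U) = N (T h V)" by (rule eqv_N)
      have n2: "N (T s U) = N V" by (rule eqv_N[OF V(2)])
      define R where "R = sdiff (sscale (of_real (1/h)) (sdiff (T h V) V)) (A V)"
      have RH: "inH L R" unfolding R_def by (intro inH_sdiff inH_sscale Th VH)
      have Nr: "N R < r" unfolding R_def by (rule d(2)[OF h(1) h0(2)])
      have "T h V = lin 1 (lin 1 V (of_real h) (A V)) (of_real h) R"
        using h by (simp add: R_def lin_def sadd_def sdiff_def sscale_def fun_eq_iff field_simps)
      then have "N (T h V) \<le> N (lin 1 V (of_real h) (A V)) + h * N R"
        using lin_le[OF lin_inH[OF VH, of 1 "of_real h"] RH, of 1 "of_real h"] h by simp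
      also have "\<dots> \<le> N (lin 1 V (of_real h) (A V)) + h * r" using Nr h by simp
      finally have n3: "N (T h V) \<le> N (lin 1 V (of_real h) (A V)) + h * r" .
      have n4: "(N (lin 1 V (of_real h) (A V)))\<^sup>2 \<le> (N V)\<^sup>2 + h\<^sup>2 * (N (A V))\<^sup>2" by (rule euler_step[OF V(1) h0(1)])
      have n5: "N (lin 1 V (of_real h) (A V)) \<le> M"
      proof -
        have "N (lin 1 V (of_real h) (A V)) \<le> N V + h * N (A V)" using lin_le[OF VH, of 1 "of_real h"] h by simp
        also have "h * N (A V) \<le> 1 * N (A V)" using h0 M by (intro mult_right_mono) auto
        finally show ?thesis by (simp add: M_def)
      qed
      have "(N (T h V))\<^sup>2 \<le> (N (lin 1 V (of_real h) (A V)) + h * r)\<^sup>2" using n3 N_nonneg by (intro power_mono) auto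
      also have "\<dots> = (N (lin 1 V (of_real h) (A V)))\<^sup>2 + h * (2 * r * N (lin 1 V (of_real h) (A V)) + h * r * r)"
        by (simp add: power2_eq_square algebra_simps)
      also have "\<dots> \<le> ((N V)\<^sup>2 + h\<^sup>2 * (N (A V))\<^sup>2) + h * (2 * r * M + 1 * r * 1)"
        using n4 n5 h h0 r by (intro add_mono mult_left_mono mult_mono) auto
      also have "\<dots> = (N V)\<^sup>2 + h * (h * (N (A V))\<^sup>2 + (2 * M + 1) * r)" by (simp add: power2_eq_square algebra_simps)
      also have "\<dots> \<le> (N V)\<^sup>2 + h * e"
      proof (intro add_left_mono mult_left_mono)
        have "N (A V) * N (A V) \<le> M * M" using M by (intro mult_mono) (auto simp: M_def)
        then have "h * (N (A V))\<^sup>2 \<le> (e / (4 * (M * M))) * (M * M)" unfolding power2_eq_square by (intro mult_mono h0(4)) (use e M in \<open>auto simp: M_def\<close>)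
        also have "\<dots> = e / 4" using M by simp
        finally have 1: "h * (N (A V))\<^sup>2 \<le> e / 4" .
        have "(2 * M + 1) * r \<le> (3 * M) * (e / (4 * M))" using M r e by (intro mult_mono) auto
        also have "\<dots> = 3 * e / 4" using M by simp
        finally show "h * (N (A V))\<^sup>2 + (2 * M + 1) * r \<le> e" using 1 by simp
      qed (use h in simp)
      finally show ?thesis unfolding n1 n2 by (simp add: mult.commute)
    qed
    then show "\<exists>d>0. \<forall>h. 0 < h \<and> h < d \<longrightarrow> (N (T (s + h) U))\<^sup>2 \<le> (N (T s U))\<^sup>2 + e * h" using d' by blast
  qed
  also have "N (T 0 U) = N U" by (rule eqv_N[OF T_0[OF UH]])
  finally show ?thesis by (rule power2_le_imp_le) (rule N_nonneg)
qed

theorem contraction: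
  assumes U: "inH L U" and t: "0 \<le> t"
  shows "N (T t U) \<le> N U"
proof (rule field_le_epsilon)
  fix e :: real assume e: "0 < e"
  obtain C where C: "\<And>U. inH L U \<Longrightarrow> N (T t U) \<le> C * N U" using T_bounded[OF t] by blast
  define r where "r = e / (\<bar>C\<bar> + 1)"
  have r: "0 < r" using e by (simp add: r_def)
  obtain V where V: "domA L V" "N (sdiff U V) < r" using domA_dense[OF U r] by blast
  have VH: "inH L V" by (rule domA_inH[OF V(1)])
  have "N (T t U) \<le> N (sdiff (T t U) (T t V)) + N (T t V)" by (intro N_le_sdiff T_inH t U VH)
  also have "N (sdiff (T t U) (T t V)) = N (T t (sdiff U V))" using eqv_N[OF T_sdiff[OF t U VH]] by simp
  also have "N (T t (sdiff U V)) \<le> \<bar>C\<bar> * N (sdiff U V)"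
    using C[OF inH_sdiff[OF U VH]] mult_right_mono[OF abs_ge_self[of C] N_nonneg[of "sdiff U V"]] by linarith
  also have "\<bar>C\<bar> * N (sdiff U V) \<le> \<bar>C\<bar> * r" using V by (intro mult_left_mono) auto
  also have "N (T t V) \<le> N V" by (rule contraction_domA[OF V(1) t])
  also have "N V \<le> N U + r" using N_le_sdiff[OF VH U] N_sdiff_commute[OF U VH] V(2) by simp
  finally have "N (T t U) \<le> N U + (\<bar>C\<bar> + 1) * r" by (simp add: algebra_simps)
  then show "N (T t U) \<le> N U + e" by (simp add: r_def)
qed

end

section \<open>From the resolvent estimate to exponential decay\<close>

text \<open>The shift theorem for Fourier coefficients; the wrap-around from 0 to
  \<open>m - 1\<close> is consistent because \<open>q ^ m = 1\<close>.\<close>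

lemma sum_cyclic_shift:
  fixes q :: complex and z :: "nat \<Rightarrow> complex"
  assumes m: "0 < m" and q: "q ^ m = 1"
  shows "(\<Sum>j<m. q ^ j * z (if j = 0 then m - 1 else j - 1)) = q * (\<Sum>j<m. q ^ j * z j)"
proof -
  obtain n where n: "m = Suc n" using m by (cases m) auto
  have "(\<Sum>j<m. q ^ j * z (if j = 0 then m - 1 else j - 1)) = z n + (\<Sum>j<n. q ^ Suc j * z j)"
    unfolding n sum.lessThan_Suc_shift by simp
  also have "z n = q ^ Suc n * z n" using q n by simp
  also have "q ^ Suc n * z n + (\<Sum>j<n. q ^ Suc j * z j) = (\<Sum>j<m. q * (q ^ j * z j))"
    unfolding n by (simp add: mult.assoc)
  finally show ?thesis by (simp only: sum_distrib_left)
qed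

text \<open>The backward difference has the favourable sign: on the mode \<open>q\<close> it acts as
  \<open>(1 - q) / h\<close>, whose real part is nonnegative since \<open>q\<close> lies on the unit
  circle. Hence \<open>res_right_half_plane\<close> applies to each mode, and Parseval's identity
  adds the estimates.\<close>

lemma (in bresse) discrete_resolvent:
  fixes m :: nat
  assumes M: "0 < M" "\<And>lam U. domA L U \<Longrightarrow> N U \<le> M * N (res lam U)"
    and m: "0 < m" and h: "0 < h" and w: "\<And>j. j < m \<Longrightarrow> domA L (w j)"
  shows "(\<Sum>j<m. (N (w j))\<^sup>2) \<le> M\<^sup>2 * (\<Sum>j<m. (N (sdiff (sscale (of_real (1/h)) (sdiff (w j) (w (if j = 0 then m - 1 else j - 1)))) (A (w j))))\<^sup>2)"
proof -
  define prev where "prev j = (if j = 0 then m - 1 else j - 1)" for j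
  define g where "g j = sdiff (sscale (of_real (1/h)) (sdiff (w j) (w (prev j)))) (A (w j))" for j
  define e where "e k j = cis (2 * pi * real k * real j / real m)" for k j
  have prev: "prev j < m" if "j < m" for j using that by (auto simp: prev_def)
  have wH: "inH L (w j)" "inH L (A (w j))" if "j < m" for j using domA_inH[OF w[OF that]] inH_A[OF w[OF that]] by auto
  have gH: "inH L (g j)" if "j < m" for j unfolding g_def by (intro inH_sdiff inH_sscale wH that prev)
  have step: "(N (comb m (e k) w))\<^sup>2 \<le> M\<^sup>2 * (N (comb m (e k) g))\<^sup>2" for k
  proof -
    define q where "q = cis (2 * pi * real k / real m)"
    have eq: "e k = (\<lambda>j. q ^ j)" unfolding e_def q_def Complex.DeMoivre by (simp add: mult_ac)
    have q1: "q ^ m = 1"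
    proof -
      have "real m * (2 * pi * real k / real m) = 2 * pi * real k" using m by simp
      then show ?thesis unfolding q_def Complex.DeMoivre by (simp add: cis_multiple_2pi)
    qed
    define mu where "mu = (1 - q) / of_real h"
    have mu: "0 \<le> Re mu" using h by (simp add: mu_def q_def Re_divide_of_real)
    define W where "W = comb m (e k) w"
    have W: "domA L W" unfolding W_def by (rule comb_domA[OF w])
    have "comb m (e k) g i x = sdiff (sscale mu W) (comb m (e k) (\<lambda>j. A (w j))) i x" for i x
    proof -
      have "comb m (e k) g i x = (1 / of_real h) * ((\<Sum>j<m. q ^ j * w j i x) - (\<Sum>j<m. q ^ j * w (prev j) i x)) - (\<Sum>j<m. q ^ j * A (w j) i x)"
        unfolding comb_eq eq g_def
        by (simp add: sdiff_def sscale_def sum_subtractf sum_distrib_left right_diff_distrib mult_ac)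
      also have "(\<Sum>j<m. q ^ j * w (prev j) i x) = q * (\<Sum>j<m. q ^ j * w j i x)"
        unfolding prev_def by (rule sum_cyclic_shift[OF m q1])
      finally show ?thesis using h unfolding W_def sdiff_def sscale_def comb_eq eq mu_def by (simp add: field_simps)
    qed
    then have cg: "comb m (e k) g = sdiff (sscale mu W) (comb m (e k) (\<lambda>j. A (w j)))" by (intro ext)
    have "eqv (sdiff (sscale mu W) (comb m (e k) (\<lambda>j. A (w j)))) (sdiff (sscale mu W) (A W))"
      unfolding W_def by (intro eqv_sdiff eqv_refl inH_sscale eqv_sym[OF A_comb] comb_inH wH w)
    then have "N (comb m (e k) g) = N (sdiff (sscale mu W) (A W))" unfolding cg by (rule eqv_N)
    moreover have "N (res (Im mu) W) \<le> N (sdiff (sscale mu W) (A W))"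
      using res_right_half_plane[OF W mu, of "Im mu"] by (simp only: complex_eq[symmetric])
    moreover have "N W \<le> M * N (res (Im mu) W)" by (rule M(2)[OF W])
    ultimately have "N W \<le> M * N (comb m (e k) g)" using M(1) by (smt (verit) mult_left_mono)
    then show ?thesis unfolding W_def[symmetric] power_mult_distrib[symmetric] using N_nonneg by (intro power_mono) auto
  qed
  have "real m * (\<Sum>j<m. (N (w j))\<^sup>2) = (\<Sum>k<m. (N (comb m (e k) w))\<^sup>2)"
    unfolding e_def by (rule parseval_states[OF m wH(1), symmetric])
  also have "\<dots> \<le> (\<Sum>k<m. M\<^sup>2 * (N (comb m (e k) g))\<^sup>2)" by (intro sum_mono step)
  also have "\<dots> = M\<^sup>2 * (real m * (\<Sum>j<m. (N (g j))\<^sup>2))"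
    unfolding e_def sum_distrib_left[symmetric] using parseval_states[OF m gH] by simp
  finally show ?thesis using m unfolding g_def prev_def by (simp add: mult.left_commute[of _ "real m"])
qed

context bresse_semigroup
begin

lemma N_orbit_le: "eqv (T t U) V \<Longrightarrow> 0 \<le> t \<Longrightarrow> inH L U \<Longrightarrow> N V \<le> N U"
  using contraction[of U t] eqv_N[of "T t U" V] by simp

text \<open>The right side of the weighted difference equation consists of the slope of the tent
  times the orbit, at most \<open>N V0\<close>, and of a consistency error. By contractivity every
  sample is at least as large as \<open>N (T \<tau> V0)\<close>, so the sum of squares on the left
  controls the end state.\<close>

lemma discrete_decay:
  assumes M: "0 < M" "\<And>lam U. domA L U \<Longrightarrow> N U \<le> M * N (res lam U)"
    and V0: "domA L V0" and n: "0 < n" and \<tau>: "0 < \<tau>" and h: "h = \<tau> / (4 * real n)"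
  shows "N (T \<tau> V0) \<le> 6 * M / \<tau> * (\<tau> * N (sdiff (sscale (of_real (1/h)) (sdiff (T h V0) V0)) (T h (A V0))) + N V0)"
proof -
  define m where "m = 4 * n"
  \<comment> \<open>The error of the backward difference quotient at time \<open>h\<close>;
    \<open>defect\<close> transports it along the orbit by contractivity.\<close>
  define B where "B = sdiff (sscale (of_real (1/h)) (sdiff (T h V0) V0)) (T h (A V0))"
  have m: "0 < m" and h0: "0 < h" and hm: "real m * h = \<tau>" using n \<tau> by (auto simp: m_def h)
  have V0H: "inH L V0" "inH L (A V0)" using domA_inH[OF V0] inH_A[OF V0] by auto
  have jh: "0 \<le> real j * h" for j using h0 by simp
  have "\<forall>j. \<exists>v. domA L v \<and> eqv (T (real j * h) V0) v \<and> eqv (A v) (T (real j * h) (A V0))"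
    using orbit_in_domain[OF V0 jh] by blast
  then obtain v where v: "\<And>j. domA L (v j)" "\<And>j. eqv (T (real j * h) V0) (v j)" "\<And>j. eqv (A (v j)) (T (real j * h) (A V0))"
    by metis
  have vH: "inH L (v j)" "inH L (A (v j))" for j using domA_inH[OF v(1)] inH_A[OF v(1)] by auto
  have hH: "0 \<le> h" "inH L (T h V0)" "inH L (T h (A V0))" using h0 V0H by (auto intro: T_inH)
  have BH: "inH L B" unfolding B_def by (intro inH_sdiff inH_sscale hH V0H)
  have defect: "N (sdiff (sscale (of_real (1/h)) (sdiff (v (Suc j)) (v j))) (A (v (Suc j)))) \<le> N B" for j
  proof -
    have s: "T (real (Suc j) * h) U = T (real j * h + h) U" for U by (simp add: algebra_simps)
    have "eqv (T (real j * h) B) (sdiff (T (real j * h) (sscale (of_real (1/h)) (sdiff (T h V0) V0))) (T (real j * h) (T h (A V0))))"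
      unfolding B_def by (intro T_sdiff jh inH_sscale inH_sdiff hH V0H)
    also have "eqv \<dots> (sdiff (sscale (of_real (1/h)) (sdiff (T (real j * h) (T h V0)) (T (real j * h) V0))) (T (real j * h) (T h (A V0))))"
      by (intro eqv_sdiff eqv_refl T_inH jh hH eqv_trans[OF T_sscale eqv_sscale] T_sdiff inH_sdiff V0H)
    also have "eqv \<dots> (sdiff (sscale (of_real (1/h)) (sdiff (v (Suc j)) (v j))) (A (v (Suc j))))"
    proof (intro eqv_sdiff eqv_sscale v(2))
      show "eqv (T (real j * h) (T h V0)) (v (Suc j))"
        using eqv_trans[OF eqv_sym[OF T_add[OF jh hH(1) V0H(1)]] v(2)[of "Suc j", unfolded s]] .
      show "eqv (T (real j * h) (T h (A V0))) (A (v (Suc j)))"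
        using eqv_trans[OF eqv_sym[OF T_add[OF jh hH(1) V0H(2)]] eqv_sym[OF v(3)[of "Suc j", unfolded s]]] .
    qed
    finally show ?thesis by (rule N_orbit_le) (rule jh, rule BH)
  qed
  \<comment> \<open>The tent vanishes at \<open>j = 0\<close> and at \<open>j = m - 1\<close>, the
    cyclic predecessor of 0; this is the reason for \<open>real m - 1 - real j\<close> instead of
    \<open>real m - real j\<close>.\<close>
  define \<eta> where "\<eta> j = h * min (real j) (real m - 1 - real j)" for j
  define w where "w j = sscale (of_real (\<eta> j)) (v j)" for j
  define g where "g j = sdiff (sscale (of_real (1/h)) (sdiff (w j) (w (if j = 0 then m - 1 else j - 1)))) (A (w j))" for j
  have w_lin: "w j = lin (of_real (\<eta> j)) (v j) 0 (v j)" for j by (simp add: w_def lin_def sadd_def sscale_def)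
  have w: "domA L (w j)" for j unfolding w_lin lin_def by (rule domA_lin[OF v(1) v(1)])
  have Aw: "eqv (A (w j)) (sscale (of_real (\<eta> j)) (A (v j)))" for j
  proof -
    have "eqv (A (w j)) (lin (of_real (\<eta> j)) (A (v j)) 0 (A (v j)))" unfolding w_lin by (rule A_lin[OF v(1) v(1)])
    then show ?thesis by (simp add: lin_def sadd_def sscale_def)
  qed
  have wH: "inH L (w j)" for j by (rule domA_inH[OF w])
  have \<eta>_le: "0 \<le> \<eta> j" "\<eta> j \<le> \<tau>" if "j < m" for j
  proof -
    show "0 \<le> \<eta> j" using that h0 by (simp add: \<eta>_def)
    have "h * min (real j) (real m - 1 - real j) \<le> h * real m" using that h0 by (intro mult_left_mono) auto
    then show "\<eta> j \<le> \<tau>" using hm by (simp add: \<eta>_def mult.commute)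
  qed
  define G where "G = \<tau> * N B + N V0"
  have G0: "0 \<le> G" using \<tau> N_nonneg by (simp add: G_def)
  have g_le: "N (g j) \<le> G" if j: "j < m" for j
  proof (cases j)
    case 0
    have "\<eta> 0 = 0" "\<eta> (m - 1) = 0" using m by (auto simp: \<eta>_def)
    then have z: "w 0 = (\<lambda>i x. 0)" "w (m - 1) = (\<lambda>i x. 0)" by (simp_all add: w_def sscale_def)
    have "g j = lin 0 (w 0) (-1) (A (w 0))" unfolding g_def 0 if_P[OF refl] z by (simp add: sdiff_def lin_def sadd_def sscale_def)
    then have "N (g j) \<le> N (A (w 0))" using lin_le[OF wH[of 0] inH_A[OF w[of 0]], of 0 "-1"] by simp
    also have "\<dots> = N (\<lambda>i x. 0)" unfolding z by (rule eqv_N[OF A_zero])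
    also have "\<dots> = 0" using N_self[OF wH[of 0]] unfolding z sdiff_def by simp
    finally show ?thesis using G0 by simp
  next
    case (Suc i)
    define D where "D = sdiff (sscale (of_real (1/h)) (sdiff (v (Suc i)) (v i))) (A (v (Suc i)))"
    have DH: "inH L D" unfolding D_def by (intro inH_sdiff inH_sscale vH)
    have "eqv (g j) (sdiff (sscale (of_real (1/h)) (sdiff (w (Suc i)) (w i))) (sscale (of_real (\<eta> (Suc i))) (A (v (Suc i)))))"
      unfolding g_def Suc by simp (intro eqv_sdiff Aw eqv_refl inH_sscale inH_sdiff wH)
    then have "N (g j) = N (sdiff (sscale (of_real (1/h)) (sdiff (w (Suc i)) (w i))) (sscale (of_real (\<eta> (Suc i))) (A (v (Suc i)))))" by (rule eqv_N)
    \<comment> \<open>Discrete product rule: the tent times the defect, plus the slope of the tent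
      times the previous sample.\<close>
    also have "sdiff (sscale (of_real (1/h)) (sdiff (w (Suc i)) (w i))) (sscale (of_real (\<eta> (Suc i))) (A (v (Suc i))))
      = lin (of_real (\<eta> (Suc i))) D (of_real ((\<eta> (Suc i) - \<eta> i) / h)) (v i)"
      using h0 by (simp add: D_def w_def lin_def sadd_def sdiff_def sscale_def fun_eq_iff field_simps)
    also have "N \<dots> \<le> \<bar>\<eta> (Suc i)\<bar> * N D + \<bar>(\<eta> (Suc i) - \<eta> i) / h\<bar> * N (v i)"
      using lin_le[OF DH vH(1)[of i], of "of_real (\<eta> (Suc i))" "of_real ((\<eta> (Suc i) - \<eta> i) / h)"] by (simp only: norm_of_real)
    also have "\<dots> \<le> \<tau> * N B + 1 * N V0"
    proof (intro add_mono mult_mono)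
      show "\<bar>\<eta> (Suc i)\<bar> \<le> \<tau>" using \<eta>_le[OF j] Suc by simp
      show "N D \<le> N B" unfolding D_def by (rule defect)
      have "(\<eta> (Suc i) - \<eta> i) / h = min (real (Suc i)) (real m - 1 - real (Suc i)) - min (real i) (real m - 1 - real i)"
        using h0 by (simp add: \<eta>_def right_diff_distrib[symmetric])
      then show "\<bar>(\<eta> (Suc i) - \<eta> i) / h\<bar> \<le> 1" by (auto simp: min_def)
      show "N (v i) \<le> N V0" by (rule N_orbit_le[OF v(2) jh V0H(1)])
    qed (use \<tau> N_nonneg in auto)
    finally show ?thesis by (simp add: G_def)
  qed
  have w_ge: "(\<tau> / 4 * N (T \<tau> V0))\<^sup>2 \<le> (N (w j))\<^sup>2" if j: "j \<in> {n..<3*n}" for j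
  proof -
    have jm: "j < m" using j by (auto simp: m_def)
    have t: "0 \<le> \<tau> - real j * h" using jm h0 unfolding hm[symmetric] by (simp add: mult_right_mono)
    have "eqv (T \<tau> V0) (T (\<tau> - real j * h) (T (real j * h) V0))" using T_add[OF t jh[of j] V0H(1)] by simp
    then have "eqv (T \<tau> V0) (T (\<tau> - real j * h) (v j))" by (rule eqv_trans[OF _ T_eqv[OF t v(2)]])
    then have le: "N (T \<tau> V0) \<le> N (v j)" using eqv_N contraction[OF vH(1) t] by simp
    have "h * real n \<le> \<eta> j" unfolding \<eta>_def using j h0 by (intro mult_left_mono) (auto simp: m_def)
    moreover have "h * real n = \<tau> / 4" using n by (simp add: h)
    ultimately have "\<tau> / 4 * N (T \<tau> V0) \<le> \<eta> j * N (v j)" using le \<tau> N_nonneg \<eta>_le[OF jm] by (intro mult_mono) auto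
    also have "\<dots> = N (w j)" using N_sscale[OF vH(1)] \<eta>_le[OF jm] by (simp add: w_def)
    finally show ?thesis using \<tau> N_nonneg by (intro power_mono) auto
  qed
  \<comment> \<open>On the middle half of the samples the tent function is at least \<open>\<tau> / 4\<close>.\<close>
  have "2 * real n * (\<tau> / 4 * N (T \<tau> V0))\<^sup>2 = (\<Sum>j\<in>{n..<3*n}. (\<tau> / 4 * N (T \<tau> V0))\<^sup>2)" by simp
  also have "\<dots> \<le> (\<Sum>j\<in>{n..<3*n}. (N (w j))\<^sup>2)" by (intro sum_mono w_ge)
  also have "\<dots> \<le> (\<Sum>j<m. (N (w j))\<^sup>2)" by (intro sum_mono2) (auto simp: m_def)
  also have "\<dots> \<le> M\<^sup>2 * (\<Sum>j<m. (N (g j))\<^sup>2)" unfolding g_def by (rule discrete_resolvent[OF M m h0 w])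
  also have "\<dots> \<le> M\<^sup>2 * (\<Sum>j<m. G\<^sup>2)" by (intro mult_left_mono sum_mono power_mono g_le N_nonneg) auto
  also have "\<dots> = 2 * real n * (2 * (M * G)\<^sup>2)" by (simp add: m_def power_mult_distrib)
  finally have "(\<tau> / 4 * N (T \<tau> V0))\<^sup>2 \<le> 2 * (M * G)\<^sup>2" using n by simp
  \<comment> \<open>2 is at most the square of 3/2; divided by the factor \<open>\<tau> / 4\<close>
    on the left, 3/2 becomes the 6 in the statement.\<close>
  also have "\<dots> \<le> (3 / 2 * (M * G))\<^sup>2" by (simp add: power_mult_distrib power_divide mult_right_mono)
  finally have "\<tau> / 4 * N (T \<tau> V0) \<le> 3 / 2 * (M * G)" by (rule power2_le_imp_le) (use M G0 in simp)
  then show ?thesis using \<tau> unfolding G_def B_def by (simp add: field_simps)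
qed

text \<open>As the step \<open>h\<close> tends to 0 the consistency error vanishes, because the
  difference quotient of \<open>V\<close> and \<open>T h (A V)\<close> have the same limit
  \<open>A V\<close>. Density and contractivity extend the bound from the domain to all
  states.\<close>

lemma decay:
  assumes M: "0 < M" "\<And>lam U. domA L U \<Longrightarrow> N U \<le> M * N (res lam U)"
    and U: "inH L U" and \<tau>: "0 < \<tau>"
  shows "N (T \<tau> U) \<le> 6 * M / \<tau> * N U"
proof -
  define K where "K = 6 * M / \<tau>"
  have K: "0 < K" using M \<tau> by (simp add: K_def)
  have dom: "N (T \<tau> V) \<le> K * N V" if V: "domA L V" for V
  proof (rule field_le_epsilon)
    fix e :: real assume e: "0 < e"
    define r where "r = e / (2 * K * \<tau>)"
    have r: "0 < r" using e K \<tau> by (simp add: r_def)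
    have VH: "inH L V" "inH L (A V)" using domA_inH[OF V] inH_A[OF V] by auto
    have "\<forall>\<^sub>F h in at_right 0. N (sdiff (sscale (of_real (1/h)) (sdiff (T h V) V)) (A V)) < r \<and> N (sdiff (T h (A V)) (A V)) < r"
      by (intro eventually_conj order_tendstoD(2)[OF T_generator[OF V] r] order_tendstoD(2)[OF T_cont0[OF VH(2)] r])
    then obtain d where d: "0 < d" "\<And>h. 0 < h \<Longrightarrow> h < d \<Longrightarrow> N (sdiff (sscale (of_real (1/h)) (sdiff (T h V) V)) (A V)) < r \<and> N (sdiff (T h (A V)) (A V)) < r"
      unfolding eventually_at_right_field by auto
    obtain n :: nat where n: "\<tau> / d < real n" using reals_Archimedean2 by blast
    have n0: "0 < n" using n \<tau> d by (metis divide_pos_pos less_trans of_nat_0_less_iff)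
    define h where "h = \<tau> / (4 * real n)"
    have h: "0 < h" "h < d"
    proof -
      show "0 < h" using \<tau> n0 by (simp add: h_def)
      have "\<tau> < d * real n" using n d by (simp add: field_simps)
      then show "h < d" using n0 d \<tau> by (simp add: h_def field_simps)
    qed
    have hH: "inH L (sscale (of_real (1/h)) (sdiff (T h V) V))" "inH L (T h (A V))"
      using h VH by (auto intro!: inH_sscale inH_sdiff T_inH)
    have "N (sdiff (sscale (of_real (1/h)) (sdiff (T h V) V)) (T h (A V))) \<le> 2 * r"
      using N_sdiff_triangle[OF hH(1) VH(2) hH(2)] N_sdiff_commute[OF VH(2) hH(2)] d(2)[OF h] by simp
    then have "K * (\<tau> * N (sdiff (sscale (of_real (1/h)) (sdiff (T h V) V)) (T h (A V))) + N V) \<le> K * (\<tau> * (2 * r) + N V)"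
      using K \<tau> by (intro mult_left_mono add_right_mono) auto
    also have "\<dots> = K * N V + e" using K \<tau> by (simp add: r_def field_simps)
    finally show "N (T \<tau> V) \<le> K * N V + e"
      using discrete_decay[OF M V n0 \<tau> h_def] unfolding K_def by linarith
  qed
  have "N (T \<tau> U) \<le> K * N U"
  proof (rule field_le_epsilon)
    fix e :: real assume e: "0 < e"
    define r where "r = e / (1 + K)"
    have r: "0 < r" using e K by (simp add: r_def)
    obtain V where V: "domA L V" "N (sdiff U V) < r" using domA_dense[OF U r] by blast
    have VH: "inH L V" by (rule domA_inH[OF V(1)])
    have \<tau>0: "0 \<le> \<tau>" using \<tau> by simp
    have "N (T \<tau> U) \<le> N (sdiff (T \<tau> U) (T \<tau> V)) + N (T \<tau> V)" by (intro N_le_sdiff T_inH \<tau>0 U VH)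
    also have "N (sdiff (T \<tau> U) (T \<tau> V)) \<le> N (sdiff U V)" by (rule N_orbit_le[OF T_sdiff[OF \<tau>0 U VH] \<tau>0 inH_sdiff[OF U VH]])
    also have "N (T \<tau> V) \<le> K * N V" by (rule dom[OF V(1)])
    also have "K * N V \<le> K * (N U + r)" using N_le_sdiff[OF VH U] N_sdiff_commute[OF U VH] V(2) K by (intro mult_left_mono) auto
    finally have "N (T \<tau> U) \<le> K * N U + (1 + K) * r" using V(2) by (simp add: algebra_simps)
    also have "(1 + K) * r = e" using K by (simp add: r_def)
    finally show "N (T \<tau> U) \<le> K * N U + e" .
  qed
  then show ?thesis by (simp add: K_def)
qed

theorem exponential_stability:
  "\<exists>M \<epsilon>. M \<ge> 1 \<and> \<epsilon> > 0 \<and> (\<forall>U t. inH L U \<and> t \<ge> 0 \<longrightarrow> N (T t U) \<le> M * exp (- \<epsilon> * t) * N U)"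
proof -
  obtain M where M: "0 < M" "\<And>lam U. domA L U \<Longrightarrow> N U \<le> M * N (res lam U)" using resolvent_bound by blast
  define \<tau> where "\<tau> = 12 * M"
  have \<tau>: "0 < \<tau>" using M by (simp add: \<tau>_def)
  have half: "N (T \<tau> U) \<le> 1/2 * N U" if U: "inH L U" for U
    using decay[OF M U \<tau>] M(1) by (simp add: \<tau>_def)
  have iter: "N (T (real n * \<tau>) U) \<le> (1/2) ^ n * N U" if U: "inH L U" for n U
  proof (induction n)
    case 0
    then show ?case using eqv_N[OF T_0[OF U]] by simp
  next
    case (Suc n)
    have n: "0 \<le> real n * \<tau>" using \<tau> by simp
    have "eqv (T (real (Suc n) * \<tau>) U) (T \<tau> (T (real n * \<tau>) U))"
      using T_add[OF less_imp_le[OF \<tau>] n U] by (simp add: algebra_simps)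
    then have "N (T (real (Suc n) * \<tau>) U) = N (T \<tau> (T (real n * \<tau>) U))" by (rule eqv_N)
    also have "\<dots> \<le> 1/2 * N (T (real n * \<tau>) U)" by (rule half[OF T_inH[OF n U]])
    also have "\<dots> \<le> 1/2 * ((1/2) ^ n * N U)" using Suc by simp
    finally show ?case by simp
  qed
  define \<epsilon> where "\<epsilon> = ln 2 / \<tau>"
  have \<epsilon>: "0 < \<epsilon>" using \<tau> by (simp add: \<epsilon>_def)
  have "N (T t U) \<le> 2 * exp (- \<epsilon> * t) * N U" if U: "inH L U" and t: "0 \<le> t" for U t
  proof -
    \<comment> \<open>Complete periods of length \<tau> halve the norm; the incomplete one costs the
      factor 2, which is the constant in front of the exponential.\<close>
    define n where "n = nat \<lfloor>t / \<tau>\<rfloor>"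
    have q: "0 \<le> t / \<tau>" using t \<tau> by simp
    have n: "real n \<le> t / \<tau>" "t / \<tau> < real n + 1" using q by (auto simp: n_def of_nat_nat)
    have n1: "real n * \<tau> \<le> t" "0 \<le> real n * \<tau>" "0 \<le> t - real n * \<tau>" using n(1) \<tau> by (auto simp: field_simps)
    have "eqv (T t U) (T (t - real n * \<tau>) (T (real n * \<tau>) U))" using T_add[OF n1(3,2) U] by simp
    then have "N (T t U) = N (T (t - real n * \<tau>) (T (real n * \<tau>) U))" by (rule eqv_N)
    also have "\<dots> \<le> N (T (real n * \<tau>) U)" by (rule contraction[OF T_inH[OF n1(2) U] n1(3)])
    also have "\<dots> \<le> (1/2) ^ n * N U" by (rule iter[OF U])
    also have "(1/2) ^ n \<le> 2 * exp (- \<epsilon> * t)"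
    proof -
      have "(1/2::real) ^ n = 2 * (1/2) ^ (Suc n)" by simp
      also have "(1/2::real) ^ (Suc n) = exp (real (Suc n) * ln (1/2))" by (subst exp_of_nat_mult) simp
      also have "real (Suc n) * ln (1/2) \<le> - \<epsilon> * t"
      proof -
        have "ln 2 * (t / \<tau>) \<le> ln 2 * (real n + 1)" using n by (intro mult_left_mono) auto
        then show ?thesis by (simp add: \<epsilon>_def ln_div algebra_simps)
      qed
      finally show ?thesis by simp
    qed
    finally show ?thesis using N_nonneg by (simp add: mult_right_mono)
  qed
  then show ?thesis using \<epsilon> by (intro exI[of _ 2] exI[of _ \<epsilon>]) auto
qed

end

theorem theorem4p1:
  fixes \<rho>1 \<rho>2 k1 k2 k3 l L a0 \<beta> :: real
    and T :: "real \<Rightarrow> state \<Rightarrow> state"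
  assumes "\<rho>1 > 0" "\<rho>2 > 0" "k1 > 0" "k2 > 0" "k3 > 0" "l > 0" "L > 0"
    and "0 < \<beta>" "\<beta> < L" "a0 > 0"
    and "k1 / \<rho>1 = k2 / \<rho>2" "k1 = k3"
    and "is_semigroup_of_A \<rho>1 \<rho>2 k1 k2 k3 l L a0 \<beta> T"
  shows "\<exists>M \<epsilon>. M \<ge> 1 \<and> \<epsilon> > 0 \<and>
    (\<forall>U0 t. inH L U0 \<and> t \<ge> 0 \<longrightarrow>
       Hnorm \<rho>1 \<rho>2 k1 k2 k3 l L (T t U0) \<le> M * exp (- \<epsilon> * t) * Hnorm \<rho>1 \<rho>2 k1 k2 k3 l L U0)"
proof -
  interpret bresse_semigroup \<rho>1 \<rho>2 k1 k2 l L a0 \<beta> T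
    by unfold_locales (use assms in simp_all)
  show ?thesis using exponential_stability unfolding N_def \<open>k1 = k3\<close>[symmetric] .
qed

end
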